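(* Let $U\subset\mathbb{R}^2$ be a domain equipped with a smooth Riemannian metric $g$. Let $s\in(\frac12,1)$ and $p\ge\frac2s$, and suppose that $u\in C^1\cap W^{1+s,p}_{loc}(U;\mathbb{R}^3)$ is an isometric embedding of $g$ such that the embedded surface $u(U)$ is the graph of $f:U'\subset\mathbb{R}^2\to\mathbb{R}$, where $u=(\Psi,v)$ with $\Psi:U\to U'$ a ($C^1$) diffeomorphism with inverse $\Phi$, and $f:=v\circ\Phi$. Let $s_0=2(1-s)$ and $p_0=\frac{p}{p-2}$, and suppose that there exists a compact set $S\subset U$ of $(s_0,p_0)$-capacity zero such that $u\in W^{1+\frac23,3}_{loc}(U\setminus S;\mathbb{R}^3)$. Then the Gauss equation $$\operatorname{Det}D^2f=K_g(\Phi)\,(1+|Df|^2)^2\quad\text{in }\mathcal{D}'(U')$$ holds.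
   Context: $K_g$ is the Gaussian curvature of $g$. $u$ isometric means $\partial_iu\cdot\partial_ju=g_{ij}$. For $s\in(0,1)$, $W^{1+s,p}$ consists of $h\in W^{1,p}$ with $Dh\in W^{s,p}$ (finite Gagliardo seminorm). Capacity: for a compact set $K\subset\mathbb{R}^n$, $\sigma\in(0,1)$ and $q\in[1,\infty)$, $$\operatorname{Cap}_{\sigma,q}(K):=\inf\{\|h\|_{W^{\sigma,q}(\mathbb{R}^n)}^q:\ h\in C_c^\infty(\mathbb{R}^n),\ h\ge1\text{ on }K\}.$$ Distributional Hessian determinant: $$\operatorname{Det}D^2f=(f_{x_1}f_{x_2})_{x_1x_2}-\tfrac12(f_{x_1}^2)_{x_2x_2}-\tfrac12(f_{x_2}^2)_{x_1x_1}$$ in the sense of distributions; equivalently, the distributional Jacobian of $Df\in H^{1/2}_{loc}$. *)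

theory Defs
  imports "HOL-Analysis.Analysis"
begin

section \<open>Differentiability classes and test functions\<close>

definition pd :: "'n::finite \<Rightarrow> (real^'n \<Rightarrow> 'b::real_normed_vector) \<Rightarrow> real^'n \<Rightarrow> 'b" where
  "pd i f x = frechet_derivative f (at x) (axis i 1)"

definition grad :: "(real^'n::finite \<Rightarrow> real) \<Rightarrow> real^'n \<Rightarrow> real^'n" where
  "grad f x = (\<chi> i. pd i f x)"

text \<open>The class \<open>C\<^sup>k\<close>; the set \<open>U\<close> is meant to be open, as derivatives are taken in the full space.\<close>

primrec Ck_on :: "nat \<Rightarrow> (real^'n::finite) set \<Rightarrow> (real^'n \<Rightarrow> 'b::real_normed_vector) \<Rightarrow> bool" where
  "Ck_on 0 U f \<longleftrightarrow> continuous_on U f"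
| "Ck_on (Suc k) U f \<longleftrightarrow> (\<forall>x\<in>U. f differentiable (at x)) \<and> (\<forall>i. Ck_on k U (pd i f))"

definition smooth_on :: "(real^'n::finite) set \<Rightarrow> (real^'n \<Rightarrow> 'b::real_normed_vector) \<Rightarrow> bool" where
  "smooth_on U f \<longleftrightarrow> (\<forall>k. Ck_on k U f)"

definition test_functions :: "(real^'n::finite) set \<Rightarrow> (real^'n \<Rightarrow> real) set" where
  "test_functions V =
     {\<phi>. smooth_on UNIV \<phi> \<and> compact (closure {x. \<phi> x \<noteq> 0}) \<and> closure {x. \<phi> x \<noteq> 0} \<subseteq> V}"

text \<open>Both maps are differentiated in the full plane, so both sets are required to be open.\<close>

definition C1_diffeo ::
    "(real^'n::finite) set \<Rightarrow> (real^'n) set \<Rightarrow> (real^'n \<Rightarrow> real^'n) \<Rightarrow> (real^'n \<Rightarrow> real^'n) \<Rightarrow> bool" where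
  "C1_diffeo U U' \<Psi> \<Phi> \<longleftrightarrow>
     open U \<and> open U' \<and> homeomorphism U U' \<Psi> \<Phi> \<and> Ck_on 1 U \<Psi> \<and> Ck_on 1 U' \<Phi>"

section \<open>Fractional Sobolev spaces and capacity\<close>

text \<open>Throughout, \<open>1 \<le> p < \<infinity>\<close> and \<open>0 < s < 1\<close>. The two integrals below are the \<open>p\<close>-th powers
  of the \<open>L\<^sup>p\<close> norm and of the Gagliardo seminorm.\<close>

definition Lp_norm_pow :: "real \<Rightarrow> (real^'n::finite) set \<Rightarrow> (real^'n \<Rightarrow> 'b::euclidean_space) \<Rightarrow> ennreal" where
  "Lp_norm_pow p V h = (\<integral>\<^sup>+x\<in>V. ennreal (norm (h x) powr p) \<partial>lebesgue)"

definition gagliardo_pow ::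
    "real \<Rightarrow> real \<Rightarrow> (real^'n::finite) set \<Rightarrow> (real^'n \<Rightarrow> 'b::euclidean_space) \<Rightarrow> ennreal" where
  "gagliardo_pow s p V h =
     (\<integral>\<^sup>+x\<in>V. (\<integral>\<^sup>+y\<in>V.
        ennreal (norm (h x - h y) powr p / norm (x - y) powr (real CARD('n) + s * p)) \<partial>lebesgue) \<partial>lebesgue)"

definition in_Lp :: "real \<Rightarrow> (real^'n::finite) set \<Rightarrow> (real^'n \<Rightarrow> 'b::euclidean_space) \<Rightarrow> bool" where
  "in_Lp p V h \<longleftrightarrow> h \<in> borel_measurable (lebesgue_on V) \<and> Lp_norm_pow p V h < \<infinity>"

definition in_Wsp :: "real \<Rightarrow> real \<Rightarrow> (real^'n::finite) set \<Rightarrow> (real^'n \<Rightarrow> 'b::euclidean_space) \<Rightarrow> bool" where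
  "in_Wsp s p V h \<longleftrightarrow> in_Lp p V h \<and> gagliardo_pow s p V h < \<infinity>"

definition weak_pd ::
    "(real^'n::finite) set \<Rightarrow> 'n \<Rightarrow> (real^'n \<Rightarrow> 'b::euclidean_space) \<Rightarrow> (real^'n \<Rightarrow> 'b) \<Rightarrow> bool" where
  "weak_pd V i h G \<longleftrightarrow>
     (\<forall>\<phi>\<in>test_functions V.
        (LINT x:V|lebesgue. pd i \<phi> x *\<^sub>R h x) = - (LINT x:V|lebesgue. \<phi> x *\<^sub>R G x))"

text \<open>\<open>W\<^sup>1\<^sup>+\<^sup>s\<^sup>,\<^sup>p(V)\<close>: since \<open>in_Wsp\<close> includes \<open>in_Lp\<close>, membership in \<open>W\<^sup>1\<^sup>,\<^sup>p(V)\<close> is part of this.\<close>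

definition in_W1sp :: "real \<Rightarrow> real \<Rightarrow> (real^'n::finite) set \<Rightarrow> (real^'n \<Rightarrow> 'b::euclidean_space) \<Rightarrow> bool" where
  "in_W1sp s p V h \<longleftrightarrow>
     in_Lp p V h \<and> (\<exists>G. \<forall>i. weak_pd V i h (G i) \<and> in_Wsp s p V (G i))"

definition in_W1sp_loc ::
    "real \<Rightarrow> real \<Rightarrow> (real^'n::finite) set \<Rightarrow> (real^'n \<Rightarrow> 'b::euclidean_space) \<Rightarrow> bool" where
  "in_W1sp_loc s p U h \<longleftrightarrow>
     (\<forall>V. open V \<and> compact (closure V) \<and> closure V \<subseteq> U \<longrightarrow> in_W1sp s p V h)"

text \<open>The norm on \<open>W\<^sup>\<sigma>\<^sup>,\<^sup>q\<close> is normalised by taking its \<open>q\<close>-th power to be the sum of the \<open>q\<close>-th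
  powers of the \<open>L\<^sup>q\<close> norm and the Gagliardo seminorm; other usual choices have the same null sets.\<close>

definition Cap :: "real \<Rightarrow> real \<Rightarrow> (real^'n::finite) set \<Rightarrow> ennreal" where
  "Cap \<sigma> q K =
     (INF h\<in>{h \<in> test_functions UNIV. \<forall>x\<in>K. h x \<ge> 1}. Lp_norm_pow q UNIV h + gagliardo_pow \<sigma> q UNIV h)"

section \<open>Riemannian metrics and Gaussian curvature\<close>

definition riemannian_metric_on :: "(real^2) set \<Rightarrow> (real^2 \<Rightarrow> real^2^2) \<Rightarrow> bool" where
  "riemannian_metric_on U g \<longleftrightarrow>
     smooth_on U g \<and>
     (\<forall>x\<in>U. transpose (g x) = g x \<and> (\<forall>w. w \<noteq> 0 \<longrightarrow> w \<bullet> (g x *v w) > 0))"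

text \<open>\<open>christoffel g k i j\<close> is \<open>\<Gamma>\<^sup>k\<^sub>i\<^sub>j\<close>.\<close>

definition christoffel :: "(real^2 \<Rightarrow> real^2^2) \<Rightarrow> 2 \<Rightarrow> 2 \<Rightarrow> 2 \<Rightarrow> real^2 \<Rightarrow> real" where
  "christoffel g k i j x =
     1/2 * (\<Sum>l\<in>UNIV. matrix_inv (g x) $ k $ l *
       (pd i (\<lambda>y. g y $ j $ l) x + pd j (\<lambda>y. g y $ i $ l) x - pd l (\<lambda>y. g y $ i $ j) x))"

text \<open>\<open>riemann g l i j k\<close> is the \<open>l\<close>-th component of
  \<open>R(\<partial>\<^sub>i, \<partial>\<^sub>j) \<partial>\<^sub>k = \<nabla>\<^sub>i \<nabla>\<^sub>j \<partial>\<^sub>k - \<nabla>\<^sub>j \<nabla>\<^sub>i \<partial>\<^sub>k\<close>.\<close>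

definition riemann :: "(real^2 \<Rightarrow> real^2^2) \<Rightarrow> 2 \<Rightarrow> 2 \<Rightarrow> 2 \<Rightarrow> 2 \<Rightarrow> real^2 \<Rightarrow> real" where
  "riemann g l i j k x =
     pd i (christoffel g l j k) x - pd j (christoffel g l i k) x
     + (\<Sum>m\<in>UNIV. christoffel g l i m x * christoffel g m j k x
                  - christoffel g l j m x * christoffel g m i k x)"

text \<open>\<open>K = g(R(\<partial>\<^sub>1, \<partial>\<^sub>2) \<partial>\<^sub>2, \<partial>\<^sub>1) / det g\<close>, which is positive for the round sphere.\<close>

definition gauss_curvature :: "(real^2 \<Rightarrow> real^2^2) \<Rightarrow> real^2 \<Rightarrow> real" where
  "gauss_curvature g x = (\<Sum>l\<in>UNIV. g x $ 1 $ l * riemann g l 1 2 2 x) / det (g x)"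

text \<open>That \<open>u\<close> is an immersion follows from the metric identity and the positivity of \<open>g\<close>.\<close>

definition isometric_embedding ::
    "(real^2) set \<Rightarrow> (real^2 \<Rightarrow> real^2^2) \<Rightarrow> (real^2 \<Rightarrow> real^3) \<Rightarrow> bool" where
  "isometric_embedding U g u \<longleftrightarrow>
     Ck_on 1 U u \<and>
     (\<forall>x\<in>U. \<forall>i j. pd i u x \<bullet> pd j u x = g x $ i $ j) \<and>
     (\<exists>w. homeomorphism U (u ` U) u w)"

definition graph_over :: "(real^2) set \<Rightarrow> (real^2 \<Rightarrow> real) \<Rightarrow> (real^3) set" where
  "graph_over U' f = (\<lambda>y. vector [y $ 1, y $ 2, f y]) ` U'"

section \<open>Distributions\<close>

text \<open>A distribution on \<open>V\<close> is represented by the functional it induces; only its values on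
  \<open>test_functions V\<close> are meaningful, and equality in \<open>\<D>'(V)\<close> is equality there.\<close>

definition distr_of :: "(real^'n::finite) set \<Rightarrow> (real^'n \<Rightarrow> real) \<Rightarrow> (real^'n \<Rightarrow> real) \<Rightarrow> real" where
  "distr_of V F \<phi> = (LINT x:V|lebesgue. F x * \<phi> x)"

definition distr_pd :: "'n::finite \<Rightarrow> ((real^'n \<Rightarrow> real) \<Rightarrow> real) \<Rightarrow> (real^'n \<Rightarrow> real) \<Rightarrow> real" where
  "distr_pd i T \<phi> = - T (pd i \<phi>)"

definition distr_eq ::
    "(real^'n::finite) set \<Rightarrow> ((real^'n \<Rightarrow> real) \<Rightarrow> real) \<Rightarrow> ((real^'n \<Rightarrow> real) \<Rightarrow> real) \<Rightarrow> bool" where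
  "distr_eq V T1 T2 \<longleftrightarrow> (\<forall>\<phi>\<in>test_functions V. T1 \<phi> = T2 \<phi>)"

text \<open>The distributional Hessian determinant for \<open>f\<close> of class \<open>C\<^sup>1\<close> on the open set \<open>V\<close>, so that
  the first derivatives of \<open>f\<close> are classical:
  \<open>(f\<^sub>1 f\<^sub>2)\<^sub>1\<^sub>2 - 1/2 (f\<^sub>1\<^sup>2)\<^sub>2\<^sub>2 - 1/2 (f\<^sub>2\<^sup>2)\<^sub>1\<^sub>1\<close>.\<close>

definition Det_D2 :: "(real^2) set \<Rightarrow> (real^2 \<Rightarrow> real) \<Rightarrow> (real^2 \<Rightarrow> real) \<Rightarrow> real" where
  "Det_D2 V f \<phi> =
     distr_pd 2 (distr_pd 1 (distr_of V (\<lambda>x. pd 1 f x * pd 2 f x))) \<phi>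
     - 1/2 * distr_pd 2 (distr_pd 2 (distr_of V (\<lambda>x. (pd 1 f x)^2))) \<phi>
     - 1/2 * distr_pd 1 (distr_pd 1 (distr_of V (\<lambda>x. (pd 2 f x)^2))) \<phi>"

end

theory Submission imports Defs
begin

text \<open>Mollify the immersion at scales \<open>2\<^sup>-\<^sup>j\<close>. For a smooth graph with slopes \<open>a\<close>, \<open>b\<close> (the components of
  \<open>Df\<close> in the coordinates of \<open>U\<close>), \<open>Det D\<^sup>2f\<close> pulls back to the two-form \<open>da \<and> db\<close>; integrating by
  parts twice, its pairing with a test function involves \<open>a\<close> and \<open>b\<close> only undifferentiated and so passes to
  the \<open>C\<^sup>1\<close> limit.

  Away from \<open>S\<close> the Gauss equation for the mollified surfaces also passes to the limit: the mollified
  metric differs from \<open>g\<close> by a commutator that is quadratic in the oscillation of \<open>Du\<close>, and the resulting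
  cubic errors are controlled by the \<open>W\<^sup>1\<^sup>+\<^sup>2\<^sup>/\<^sup>3\<^sup>,\<^sup>3\<close> seminorm.

  Near \<open>S\<close> one inserts a weight \<open>\<eta>\<close> that equals one there. The pairing of \<open>\<eta> da \<and> db\<close> is a telescoping sum over
  the scales, each step of which is trilinear in \<open>\<eta>\<close>, \<open>a\<close>, \<open>b\<close> up to exact forms; since \<open>s\<^sub>0 + 2s = 2\<close> and
  \<open>1/p\<^sub>0 + 2/p = 1\<close>, it is controlled by the \<open>(s\<^sub>0, p\<^sub>0)\<close> norm of \<open>\<eta>\<close>, which can be made arbitrarily small as \<open>S\<close>
  has capacity zero.\<close>

section \<open>Partial derivatives and the classes \<open>C\<^sup>k\<close>\<close>

text \<open>The mollification takes place in \<open>U\<close>, not on the graph over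
  \<open>U'\<close>: in the coordinates of \<open>U'\<close> the metric would be merely continuous.
  The obstacle is that the mollified second derivatives can grow like \<open>2^j\<close> times the
  oscillation of \<open>Du\<close>, so neither side of the Gauss equation need converge pointwise.
  The mollified Christoffel symbols of the first kind, being metric quantities, are off by only
  \<open>2^j osc^2\<close>, but this error must not be differentiated; it meets one more factor
  \<open>2^j osc\<close> and leaves \<open>4^j osc^3\<close>. The integral of that is a term of the
  dyadic series of the \<open>W^{2/3,3}\<close> seminorm and tends to 0 because the series
  converges: no power of \<open>2^-j\<close> is left over. Near \<open>S\<close> only the uniform
  bound with exponents \<open>s\<close>, \<open>p\<close> is at hand, and smallness has to come from
  the weight alone. Hence every constant of the trilinear estimate must be independent of the weight
  and of the last scale. The Lipschitz constant of the weight, which the capacity does not control,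
  may enter only away from \<open>S\<close>, where the weight is fixed while \<open>j\<close> tends
  to infinity.\<close>

lemma pd_eqI: "(f has_derivative f') (at x) \<Longrightarrow> pd i f x = f' (axis i 1)"
  unfolding pd_def by (metis frechet_derivative_at)

lemma has_derivative_pd:
  fixes f :: "real^'n::finite \<Rightarrow> 'b::real_normed_vector"
  assumes "f differentiable (at x)"
  shows "(f has_derivative (\<lambda>v. \<Sum>i\<in>UNIV. v $ i *\<^sub>R pd i f x)) (at x)"
proof -
  let ?D = "frechet_derivative f (at x)"
  have D: "(f has_derivative ?D) (at x)"
    using assms by (simp add: frechet_derivative_works)
  then interpret bounded_linear ?D
    by (rule has_derivative_bounded_linear)
  have "?D v = (\<Sum>i\<in>UNIV. v $ i *\<^sub>R pd i f x)" for v
  proof -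
    have "?D v = ?D (\<Sum>i\<in>UNIV. (v $ i) *\<^sub>R axis i 1)"
      using basis_expansion[of v] by (simp add: scalar_mult_eq_scaleR)
    then show ?thesis
      by (simp add: sum scaleR pd_def)
  qed
  with D show ?thesis
    by (metis (no_types, lifting) ext)
qed

lemma has_derivative_grad:
  fixes f :: "real^'n::finite \<Rightarrow> real"
  assumes "f differentiable (at x)"
  shows "(f has_derivative (\<lambda>v. v \<bullet> grad f x)) (at x)"
  using has_derivative_pd[OF assms] by (simp add: grad_def inner_vec_def)

lemma has_derivative_cong_open:
  assumes "open S" "x \<in> S" "\<And>y. y \<in> S \<Longrightarrow> f y = h y"
  shows "(f has_derivative D) (at x) \<longleftrightarrow> (h has_derivative D) (at x)"
  using assms has_derivative_transform_within_open[of f D x UNIV S h]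
    has_derivative_transform_within_open[of h D x UNIV S f] by auto

lemma pd_cong_open:
  assumes "open S" "x \<in> S" "\<And>y. y \<in> S \<Longrightarrow> f y = h y"
  shows "pd i f x = pd i h x"
  unfolding pd_def frechet_derivative_def by (simp add: has_derivative_cong_open[OF assms])

lemma differentiable_cong_open:
  assumes "open S" "x \<in> S" "\<And>y. y \<in> S \<Longrightarrow> f y = h y"
  shows "f differentiable (at x) \<longleftrightarrow> h differentiable (at x)"
  unfolding differentiable_def by (simp add: has_derivative_cong_open[OF assms])

lemma pd_const [simp]: "pd i (\<lambda>x. c) x = 0"
  by (rule pd_eqI[THEN trans]) (auto intro!: derivative_eq_intros)

lemma pd_add:
  assumes "f differentiable (at x)" "h differentiable (at x)"
  shows "pd i (\<lambda>x. f x + h x) x = pd i f x + pd i h x"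
  using pd_eqI[OF has_derivative_add[OF assms[unfolded frechet_derivative_works]], of i]
  by (simp add: pd_def)

lemma pd_diff:
  assumes "f differentiable (at x)" "h differentiable (at x)"
  shows "pd i (\<lambda>x. f x - h x) x = pd i f x - pd i h x"
  using pd_eqI[OF has_derivative_diff[OF assms[unfolded frechet_derivative_works]], of i]
  by (simp add: pd_def)

lemma pd_mult:
  fixes f h :: "real^'n::finite \<Rightarrow> real"
  assumes "f differentiable (at x)" "h differentiable (at x)"
  shows "pd i (\<lambda>x. f x * h x) x = pd i f x * h x + f x * pd i h x"
  using pd_eqI[OF has_derivative_mult[OF assms[unfolded frechet_derivative_works]], of i]
  by (simp add: pd_def)

lemma pd_inverse:
  fixes f :: "real^'n::finite \<Rightarrow> real"
  assumes "f differentiable (at x)" "f x \<noteq> 0"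
  shows "pd i (\<lambda>x. inverse (f x)) x = - (pd i f x * (inverse (f x) * inverse (f x)))"
  using pd_eqI[OF Deriv.has_derivative_inverse[OF assms(2) assms(1)[unfolded frechet_derivative_works]], of i]
  by (simp add: pd_def algebra_simps)

lemma differentiable_nth:
  fixes f :: "real^'n::finite \<Rightarrow> 'b::real_normed_vector^'m::finite"
  assumes "f differentiable (at x)"
  shows "(\<lambda>x. f x $ a) differentiable (at x)"
  using assms by (auto simp: differentiable_def intro: bounded_linear.has_derivative[OF bounded_linear_vec_nth])

lemma pd_nth:
  fixes f :: "real^'n::finite \<Rightarrow> 'b::real_normed_vector^'m::finite"
  assumes "f differentiable (at x)"
  shows "pd i (\<lambda>x. f x $ a) x = pd i f x $ a"
  using pd_eqI[OF bounded_linear.has_derivative[OF bounded_linear_vec_nth assms[unfolded frechet_derivative_works]], of i]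
  by (simp add: pd_def)

lemma Ck_on_cong:
  assumes "open S" "\<And>x. x \<in> S \<Longrightarrow> f x = h x"
  shows "Ck_on k S f \<longleftrightarrow> Ck_on k S h"
  using assms(2)
proof (induction k arbitrary: f h)
  case 0
  then show ?case by (simp cong: continuous_on_cong)
next
  case (Suc k)
  have "Ck_on k S (pd i f) \<longleftrightarrow> Ck_on k S (pd i h)" for i
    by (rule Suc.IH) (rule pd_cong_open[OF assms(1) _ Suc.prems])
  then show ?case
    using differentiable_cong_open[OF assms(1) _ Suc.prems] by auto
qed

lemma Ck_on_SucD: "Ck_on (Suc k) S f \<Longrightarrow> Ck_on k S f"
proof (induction k arbitrary: f)
  case 0
  then show ?case
    by (auto intro!: continuous_at_imp_continuous_on differentiable_imp_continuous_within)
qed auto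

lemma Ck_on_mono: "Ck_on l S f \<Longrightarrow> k \<le> l \<Longrightarrow> Ck_on k S f"
  by (induction l) (auto simp: le_Suc_eq dest: Ck_on_SucD simp del: Ck_on.simps)

lemma Ck_on_subset: "Ck_on k S f \<Longrightarrow> T \<subseteq> S \<Longrightarrow> Ck_on k T f"
  by (induction k arbitrary: f) (auto intro: continuous_on_subset)

lemma Ck_on_imp_continuous: "Ck_on k S f \<Longrightarrow> continuous_on S f"
  using Ck_on_mono[of k S f 0] by simp

lemma Ck_on_pd: "Ck_on (Suc k) S f \<Longrightarrow> Ck_on k S (pd i f)"
  by simp

lemma Ck_on_const [simp]: "Ck_on k S (\<lambda>x. c)"
proof (induction k arbitrary: c)
  case (Suc k)
  have "pd i (\<lambda>x. c) = (\<lambda>x. 0)" for i :: 'a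
    by (rule ext) simp
  with Suc show ?case by simp
qed simp

lemma Ck_on_add:
  assumes "open S"
  shows "Ck_on k S f \<Longrightarrow> Ck_on k S h \<Longrightarrow> Ck_on k S (\<lambda>x. f x + h x)"
proof (induction k arbitrary: f h)
  case (Suc k)
  have "Ck_on k S (pd i (\<lambda>x. f x + h x))" for i
    using Ck_on_cong[OF assms, of "pd i (\<lambda>x. f x + h x)" "\<lambda>x. pd i f x + pd i h x" k]
      Suc pd_add by (simp add: pd_add)
  with Suc.prems show ?case by auto
qed (auto intro: continuous_intros)

lemma Ck_on_mult:
  fixes f h :: "real^'n::finite \<Rightarrow> real"
  assumes "open S"
  shows "Ck_on k S f \<Longrightarrow> Ck_on k S h \<Longrightarrow> Ck_on k S (\<lambda>x. f x * h x)"
proof (induction k arbitrary: f h)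
  case (Suc k)
  have "Ck_on k S (\<lambda>x. pd i f x * h x + f x * pd i h x)" for i
    using Suc Ck_on_SucD[OF Suc.prems(1)] Ck_on_SucD[OF Suc.prems(2)]
    by (intro Ck_on_add assms Suc.IH) auto
  then have "Ck_on k S (pd i (\<lambda>x. f x * h x))" for i
    using Ck_on_cong[OF assms, of "pd i (\<lambda>x. f x * h x)" "\<lambda>x. pd i f x * h x + f x * pd i h x" k]
      Suc.prems by (simp add: pd_mult)
  with Suc.prems show ?case by auto
qed (auto intro: continuous_intros)

lemma Ck_on_minus:
  fixes f :: "real^'n::finite \<Rightarrow> real"
  assumes "open S" "Ck_on k S f"
  shows "Ck_on k S (\<lambda>x. - f x)"
  using Ck_on_mult[OF assms(1) Ck_on_const[of k S "-1"] assms(2)] by simp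

lemma Ck_on_diff:
  fixes f h :: "real^'n::finite \<Rightarrow> real"
  assumes "open S" "Ck_on k S f" "Ck_on k S h"
  shows "Ck_on k S (\<lambda>x. f x - h x)"
  using Ck_on_add[OF assms(1,2) Ck_on_minus[OF assms(1,3)]] by simp

lemma Ck_on_sum:
  assumes "open S" "\<And>i. i \<in> I \<Longrightarrow> Ck_on k S (f i)"
  shows "Ck_on k S (\<lambda>x. \<Sum>i\<in>I. f i x)"
  using assms(2) by (induction I rule: infinite_finite_induct) (auto intro: Ck_on_add[OF assms(1)])

text \<open>The derivative of \<open>1/f\<close> is again built from \<open>1/f\<close> by products,
  and \<open>pd_inverse\<close> is phrased with \<open>inverse\<close> rather than a power so that
  the induction hypothesis applies to it as it stands.\<close>

lemma Ck_on_inverse: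
  fixes f :: "real^'n::finite \<Rightarrow> real"
  assumes "open S" "Ck_on k S f" "\<And>x. x \<in> S \<Longrightarrow> f x \<noteq> 0"
  shows "Ck_on k S (\<lambda>x. inverse (f x))"
  using assms(2)
proof (induction k)
  case 0
  with assms(3) show ?case by (auto intro!: continuous_intros)
next
  case (Suc k)
  have "Ck_on k S (\<lambda>x. - (pd i f x * (inverse (f x) * inverse (f x))))" for i
    using Suc Ck_on_SucD[OF Suc.prems] by (intro Ck_on_minus Ck_on_mult assms(1)) auto
  then have "Ck_on k S (pd i (\<lambda>x. inverse (f x)))" for i
    using Ck_on_cong[OF assms(1), of "pd i (\<lambda>x. inverse (f x))"
        "\<lambda>x. - (pd i f x * (inverse (f x) * inverse (f x)))" k]
      Suc.prems assms(3) by (simp add: pd_inverse)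
  with Suc.prems assms(3) show ?case by auto
qed

lemma Ck_on_divide:
  fixes f h :: "real^'n::finite \<Rightarrow> real"
  assumes "open S" "Ck_on k S f" "Ck_on k S h" "\<And>x. x \<in> S \<Longrightarrow> h x \<noteq> 0"
  shows "Ck_on k S (\<lambda>x. f x / h x)"
  unfolding divide_inverse by (intro Ck_on_mult Ck_on_inverse assms) auto

lemma Ck_on_nth:
  fixes f :: "real^'n::finite \<Rightarrow> 'b::real_normed_vector^'m::finite"
  assumes "open S"
  shows "Ck_on k S f \<Longrightarrow> Ck_on k S (\<lambda>x. f x $ a)"
proof (induction k arbitrary: f)
  case (Suc k)
  have "Ck_on k S (pd i (\<lambda>x. f x $ a))" for i
    using Ck_on_cong[OF assms, of "pd i (\<lambda>x. f x $ a)" "\<lambda>x. pd i f x $ a" k] Suc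
    by (simp add: pd_nth)
  with Suc.prems show ?case by (auto intro: differentiable_nth)
qed (auto intro: continuous_intros)

lemma has_derivative_vec2:
  fixes P Q :: "real^'n::finite \<Rightarrow> real"
  assumes "(P has_derivative P') (at x)" "(Q has_derivative Q') (at x)"
  shows "((\<lambda>x. vector [P x, Q x] :: real^2) has_derivative (\<lambda>v. vector [P' v, Q' v])) (at x)"
proof -
  have e: "(vector [r, s] :: real^2) = r *\<^sub>R axis 1 1 + s *\<^sub>R axis 2 1" for r s
    by (simp add: vec_eq_iff forall_2 axis_def)
  show ?thesis
    unfolding e by (intro derivative_intros assms)
qed

lemma has_derivative_comp_vec2:
  fixes P Q :: "real^'n::finite \<Rightarrow> real" and \<phi> :: "real^2 \<Rightarrow> real"
  assumes "P differentiable (at x)" "Q differentiable (at x)" "\<phi> differentiable (at (vector [P x, Q x]))"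
  shows "((\<lambda>x. \<phi> (vector [P x, Q x])) has_derivative
     (\<lambda>v. frechet_derivative P (at x) v * pd 1 \<phi> (vector [P x, Q x])
        + frechet_derivative Q (at x) v * pd 2 \<phi> (vector [P x, Q x]))) (at x)"
  using has_derivative_compose[OF has_derivative_vec2[OF assms(1,2)[unfolded frechet_derivative_works]]
      has_derivative_pd[OF assms(3)]]
  by (simp add: sum_2)

lemma pd_comp_vec2:
  fixes P Q :: "real^'n::finite \<Rightarrow> real" and \<phi> :: "real^2 \<Rightarrow> real"
  assumes "P differentiable (at x)" "Q differentiable (at x)" "\<phi> differentiable (at (vector [P x, Q x]))"
  shows "pd i (\<lambda>x. \<phi> (vector [P x, Q x])) x =
     pd 1 \<phi> (vector [P x, Q x]) * pd i P x + pd 2 \<phi> (vector [P x, Q x]) * pd i Q x"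
  using pd_eqI[OF has_derivative_comp_vec2[OF assms]] by (simp add: pd_def)

lemma continuous_on_vec2:
  assumes "continuous_on S P" "continuous_on S Q"
  shows "continuous_on S (\<lambda>x. vector [P x, Q x] :: real^2)"
proof -
  have e: "(vector [r, s] :: real^2) = r *\<^sub>R axis 1 1 + s *\<^sub>R axis 2 1" for r s
    by (simp add: vec_eq_iff forall_2 axis_def)
  show ?thesis
    unfolding e by (intro continuous_intros assms)
qed

text \<open>Each derivative brings in first derivatives of \<open>\<phi>\<close> composed with the
  same \<open>P\<close> and \<open>Q\<close>; hence the induction generalises over
  \<open>\<phi>\<close>.\<close>

lemma Ck_on_comp_vec2:
  fixes P Q :: "real^'n::finite \<Rightarrow> real" and \<phi> :: "real^2 \<Rightarrow> real"
  assumes "open S"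
  shows "Ck_on k UNIV \<phi> \<Longrightarrow> Ck_on k S P \<Longrightarrow> Ck_on k S Q \<Longrightarrow> Ck_on k S (\<lambda>x. \<phi> (vector [P x, Q x]))"
proof (induction k arbitrary: \<phi>)
  case 0
  then show ?case
    by (auto intro!: continuous_on_compose2[of UNIV \<phi>] continuous_on_vec2)
next
  case (Suc k)
  let ?v = "\<lambda>x. vector [P x, Q x] :: real^2"
  have "Ck_on k S (\<lambda>x. pd 1 \<phi> (?v x) * pd i P x + pd 2 \<phi> (?v x) * pd i Q x)" for i
    using Suc.prems Ck_on_SucD[OF Suc.prems(2)] Ck_on_SucD[OF Suc.prems(3)]
    by (intro Ck_on_add Ck_on_mult Suc.IH assms) auto
  then have "Ck_on k S (pd i (\<lambda>x. \<phi> (?v x)))" for i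
    using Ck_on_cong[OF assms, of "pd i (\<lambda>x. \<phi> (?v x))"
        "\<lambda>x. pd 1 \<phi> (?v x) * pd i P x + pd 2 \<phi> (?v x) * pd i Q x" k]
      Suc.prems by (simp add: pd_comp_vec2)
  moreover have "(\<lambda>x. \<phi> (?v x)) differentiable (at x)" if "x \<in> S" for x
    using has_derivative_comp_vec2[of P x Q \<phi>] Suc.prems that by (auto simp: differentiable_def)
  ultimately show ?case by simp
qed

lemma has_real_derivative_along_axis:
  fixes f :: "real^'n::finite \<Rightarrow> real"
  assumes "f differentiable (at (x + s *\<^sub>R axis i 1))"
  shows "((\<lambda>s. f (x + s *\<^sub>R axis i 1)) has_real_derivative pd i f (x + s *\<^sub>R axis i 1)) (at s)"
proof -
  have "((\<lambda>s. x + s *\<^sub>R axis i 1) has_derivative (\<lambda>h. h *\<^sub>R axis i 1)) (at s)"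
    by (auto intro!: derivative_eq_intros)
  from has_derivative_compose[OF this assms[unfolded frechet_derivative_works]]
  have "((\<lambda>s. f (x + s *\<^sub>R axis i 1)) has_derivative
      (\<lambda>h. frechet_derivative f (at (x + s *\<^sub>R axis i 1)) (h *\<^sub>R axis i 1))) (at s)" .
  moreover have "frechet_derivative f (at (x + s *\<^sub>R axis i 1)) (h *\<^sub>R axis i 1)
      = pd i f (x + s *\<^sub>R axis i 1) * h" for h
    using linear_scale[OF linear_frechet_derivative[OF assms]] by (simp add: pd_def)
  ultimately show ?thesis
    by (simp add: has_field_derivative_def)
qed

text \<open>Two mean value theorems: one in direction \<open>i\<close> for the difference of
  \<open>f\<close> in direction \<open>j\<close>, then one in direction \<open>j\<close> for
  \<open>pd i f\<close>. The bound \<open>2 * h < r\<close> keeps all points involved in the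
  ball.\<close>

lemma mixed_difference:
  fixes f :: "real^'n::finite \<Rightarrow> real"
  assumes f: "Ck_on 2 (ball x r) f" and h: "0 < h" "2 * h < r"
  obtains \<xi> \<eta> where "0 < \<xi>" "\<xi> < h" "0 < \<eta>" "\<eta> < h"
    "f (x + h *\<^sub>R axis i 1 + h *\<^sub>R axis j 1) - f (x + h *\<^sub>R axis i 1) - f (x + h *\<^sub>R axis j 1) + f x
      = h\<^sup>2 * pd j (pd i f) (x + \<xi> *\<^sub>R axis i 1 + \<eta> *\<^sub>R axis j 1)"
proof -
  have in_ball: "x + s *\<^sub>R axis i 1 + t *\<^sub>R axis j 1 \<in> ball x r"
    if "0 \<le> s" "s \<le> h" "0 \<le> t" "t \<le> h" for s t
  proof -
    have "norm (s *\<^sub>R axis i (1::real) + t *\<^sub>R axis j 1) \<le> s + t"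
      using that by (intro norm_triangle_le) simp
    also have "\<dots> < r" using that h by simp
    finally show ?thesis
      unfolding mem_ball dist_commute[of x] by (simp add: dist_norm add.assoc)
  qed
  have f1: "f differentiable (at y)" "pd i f differentiable (at y)" if "y \<in> ball x r" for y
    using f that by (auto simp: numeral_2_eq_2)
  let ?g = "\<lambda>s. f (x + h *\<^sub>R axis j 1 + s *\<^sub>R axis i 1) - f (x + s *\<^sub>R axis i 1)"
  have "\<exists>\<xi>>0. \<xi> < h \<and> ?g h - ?g 0 =
     (h - 0) * (pd i f (x + h *\<^sub>R axis j 1 + \<xi> *\<^sub>R axis i 1) - pd i f (x + \<xi> *\<^sub>R axis i 1))"
    using h in_ball[of _ h] in_ball[of _ 0]
    by (intro MVT2 DERIV_diff has_real_derivative_along_axis f1) (auto simp: add_ac)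
  then obtain \<xi> where \<xi>: "0 < \<xi>" "\<xi> < h" and g: "?g h - ?g 0 =
     h * (pd i f (x + h *\<^sub>R axis j 1 + \<xi> *\<^sub>R axis i 1) - pd i f (x + \<xi> *\<^sub>R axis i 1))"
    by auto
  let ?k = "\<lambda>t. pd i f (x + \<xi> *\<^sub>R axis i 1 + t *\<^sub>R axis j 1)"
  have "\<exists>\<eta>>0. \<eta> < h \<and> ?k h - ?k 0 = (h - 0) * pd j (pd i f) (x + \<xi> *\<^sub>R axis i 1 + \<eta> *\<^sub>R axis j 1)"
    using h \<xi> in_ball[of \<xi>]
    by (intro MVT2 has_real_derivative_along_axis f1) auto
  then obtain \<eta> where \<eta>: "0 < \<eta>" "\<eta> < h"
    "?k h - ?k 0 = h * pd j (pd i f) (x + \<xi> *\<^sub>R axis i 1 + \<eta> *\<^sub>R axis j 1)"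
    by auto
  show ?thesis
    using \<xi> \<eta> g by (intro that[of \<xi> \<eta>]) (simp_all add: add_ac power2_eq_square)
qed

text \<open>The mixed second difference is symmetric in \<open>i\<close> and \<open>j\<close>.
  Evaluated by \<open>mixed_difference\<close> in both orders it equals \<open>h\<^sup>2\<close>
  times either mixed derivative at points close to \<open>x\<close>, and continuity brings these
  back to \<open>x\<close>.\<close>

lemma pd_commute:
  fixes f :: "real^'n::finite \<Rightarrow> real"
  assumes S: "open S" "x \<in> S" and f: "Ck_on 2 S f"
  shows "pd i (pd j f) x = pd j (pd i f) x"
proof (rule ccontr)
  assume neq: "pd i (pd j f) x \<noteq> pd j (pd i f) x"
  \<comment> \<open>Half the supposed gap: each of the two mixed derivatives moves by less than
    \<open>e\<close>, which together is too little to close it.\<close>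
  define e where "e = \<bar>pd i (pd j f) x - pd j (pd i f) x\<bar> / 2"
  have e: "e > 0" using neq by (simp add: e_def)
  have cont: "continuous_on S (pd a (pd b f))" for a b
    using f by (simp add: numeral_2_eq_2)
  have "\<exists>d>0. \<forall>y. dist y x < d \<longrightarrow> y \<in> S \<and> dist (pd a (pd b f) y) (pd a (pd b f) x) < e" for a b
  proof -
    have "isCont (pd a (pd b f)) x"
      using cont S continuous_on_eq_continuous_at by blast
    then obtain d1 where d1: "d1 > 0" "\<And>y. dist y x < d1 \<Longrightarrow> dist (pd a (pd b f) y) (pd a (pd b f) x) < e"
      using e unfolding continuous_at_eps_delta by blast
    obtain d2 where d2: "d2 > 0" "ball x d2 \<subseteq> S"
      using S openE by blast
    show ?thesis
      using d1 d2 by (intro exI[of _ "min d1 d2"]) (auto simp: dist_commute)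
  qed
  then obtain d where d: "\<And>a b. d a b > 0"
    "\<And>a b y. dist y x < d a b \<Longrightarrow> y \<in> S \<and> dist (pd a (pd b f) y) (pd a (pd b f) x) < e"
    by metis
  define r where "r = min (d i j) (d j i)"
  have r: "r > 0" using d(1) by (simp add: r_def)
  have "ball x r \<subseteq> S"
    using d(2) by (auto simp: r_def dist_commute)
  then have fb: "Ck_on 2 (ball x r) f" using f Ck_on_subset by blast
  define h where "h = r / 3"
  have h: "0 < h" "2 * h < r" using r by (auto simp: h_def)
  have nb: "dist (x + s *\<^sub>R axis a 1 + t *\<^sub>R axis b 1) x < r" if "0 < s" "s < h" "0 < t" "t < h" for s t a b
  proof -
    have "norm (s *\<^sub>R axis a (1::real) + t *\<^sub>R axis b 1) \<le> s + t"
      using that by (intro norm_triangle_le) simp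
    also have "\<dots> < r" using that h by simp
    finally show ?thesis by (simp add: dist_norm add.assoc)
  qed
  obtain \<xi> \<eta> where 1: "0 < \<xi>" "\<xi> < h" "0 < \<eta>" "\<eta> < h"
    "f (x + h *\<^sub>R axis i 1 + h *\<^sub>R axis j 1) - f (x + h *\<^sub>R axis i 1) - f (x + h *\<^sub>R axis j 1) + f x
      = h\<^sup>2 * pd j (pd i f) (x + \<xi> *\<^sub>R axis i 1 + \<eta> *\<^sub>R axis j 1)"
    using mixed_difference[OF fb h, of i j] by metis
  obtain \<xi>' \<eta>' where 2: "0 < \<xi>'" "\<xi>' < h" "0 < \<eta>'" "\<eta>' < h"
    "f (x + h *\<^sub>R axis j 1 + h *\<^sub>R axis i 1) - f (x + h *\<^sub>R axis j 1) - f (x + h *\<^sub>R axis i 1) + f x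
      = h\<^sup>2 * pd i (pd j f) (x + \<xi>' *\<^sub>R axis j 1 + \<eta>' *\<^sub>R axis i 1)"
    using mixed_difference[OF fb h, of j i] by metis
  have "h\<^sup>2 * pd j (pd i f) (x + \<xi> *\<^sub>R axis i 1 + \<eta> *\<^sub>R axis j 1)
      = h\<^sup>2 * pd i (pd j f) (x + \<xi>' *\<^sub>R axis j 1 + \<eta>' *\<^sub>R axis i 1)"
    using 1(5) 2(5) by (simp add: algebra_simps)
  then have "pd j (pd i f) (x + \<xi> *\<^sub>R axis i 1 + \<eta> *\<^sub>R axis j 1)
      = pd i (pd j f) (x + \<xi>' *\<^sub>R axis j 1 + \<eta>' *\<^sub>R axis i 1)"
    using h by simp
  moreover have "dist (pd j (pd i f) (x + \<xi> *\<^sub>R axis i 1 + \<eta> *\<^sub>R axis j 1)) (pd j (pd i f) x) < e"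
    using nb[OF 1(1-4), of i j] d(2)[of _ j i] by (simp add: r_def)
  moreover have "dist (pd i (pd j f) (x + \<xi>' *\<^sub>R axis j 1 + \<eta>' *\<^sub>R axis i 1)) (pd i (pd j f) x) < e"
    using nb[OF 2(1-4), of j i] d(2)[of _ i j] by (simp add: r_def)
  ultimately have "\<bar>pd i (pd j f) x - pd j (pd i f) x\<bar> < 2 * e"
    by (simp add: dist_real_def)
  then show False by (simp add: e_def)
qed

section \<open>Smooth bumps\<close>

text \<open>Multiplying by a polynomial in \<open>1/t\<close> makes the family of flat functions closed under differentiation.\<close>

definition flat :: "real poly \<Rightarrow> real \<Rightarrow> real" where
  "flat q t = (if t > 0 then poly q (1 / t) * exp (- (1 / t)) else 0)"

lemma tendsto_poly_mult_exp: "((\<lambda>x::real. poly q x * exp (- x)) \<longlongrightarrow> 0) at_top"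
proof -
  have "((\<lambda>x::real. \<Sum>i\<le>degree q. coeff q i * (x ^ i / exp x)) \<longlongrightarrow> (\<Sum>i\<le>degree q. coeff q i * 0)) at_top"
    by (intro tendsto_intros tendsto_power_div_exp_0)
  then show ?thesis
    by (simp add: poly_altdef sum_distrib_right exp_minus divide_inverse mult.assoc)
qed

text \<open>Since the derivative of \<open>1/t\<close> is \<open>-1/t\<^sup>2\<close>, the product
  rule turns \<open>q(1/t) exp(-1/t)\<close> into the same expression with the polynomial
  \<open>X\<^sup>2 (q - q')\<close>. At 0 the right difference quotient is again such an expression
  and tends to 0.\<close>

lemma flat_has_derivative:
  "(flat q has_real_derivative flat ([:0, 0, 1:] * (q - pderiv q)) t) (at t)"
proof (cases t "0::real" rule: linorder_cases)
  case less
  have "((\<lambda>t. 0) has_real_derivative flat ([:0, 0, 1:] * (q - pderiv q)) t) (at t)"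
    using less by (simp add: flat_def)
  then show ?thesis
    by (rule has_field_derivative_transform_within_open[where S = "{..<0}"])
      (use less in \<open>auto simp: flat_def\<close>)
next
  case equal
  \<comment> \<open>Dividing by \<open>h\<close> multiplies the polynomial by its variable, which
    gives \<open>pCons 0 q\<close>.\<close>
  have "((\<lambda>h. poly (pCons 0 q) (inverse h) * exp (- inverse h)) \<longlongrightarrow> 0) (at_right 0)"
    using filterlim_compose[OF tendsto_poly_mult_exp filterlim_inverse_at_top_right] .
  then have "((\<lambda>h. (flat q (t + h) - flat q t) / h) \<longlongrightarrow> 0) (at_right 0)"
    by (rule Lim_transform_eventually)
      (auto simp: flat_def equal field_simps eventually_at_filter intro!: always_eventually)
  moreover have "((\<lambda>h. (flat q (t + h) - flat q t) / h) \<longlongrightarrow> 0) (at_left 0)"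
    by (rule Lim_transform_eventually[of "\<lambda>_. 0"])
      (auto simp: flat_def equal eventually_at_filter intro!: always_eventually)
  ultimately have "((\<lambda>h. (flat q (t + h) - flat q t) / h) \<longlongrightarrow> 0) (at 0)"
    by (simp add: filterlim_at_split)
  then show ?thesis
    using equal by (simp add: DERIV_def flat_def)
next
  case greater
  have "((\<lambda>t. poly q (1 / t) * exp (- (1 / t))) has_real_derivative
      flat ([:0, 0, 1:] * (q - pderiv q)) t) (at t)"
    using greater
    by (auto simp: flat_def intro!: derivative_eq_intros DERIV_chain2[OF poly_DERIV])
      (simp add: field_simps power2_eq_square)
  then show ?thesis
    by (rule has_field_derivative_transform_within_open[where S = "{0<..}"])
      (use greater in \<open>auto simp: flat_def\<close>)
qed

lemma flat_affine_has_derivative: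
  fixes x :: "real^'n::finite"
  shows "((\<lambda>x. flat q (c * x $ i + d)) has_derivative
     (\<lambda>v. flat ([:0, 0, 1:] * (q - pderiv q)) (c * x $ i + d) * (c * v $ i))) (at x)"
proof -
  have "((\<lambda>x::real^'n. c * x $ i + d) has_derivative (\<lambda>v. c * v $ i)) (at x)"
    by (auto intro!: derivative_eq_intros bounded_linear.has_derivative[OF bounded_linear_vec_nth])
  from has_derivative_compose[OF this, OF flat_has_derivative[unfolded has_field_derivative_def]]
  show ?thesis .
qed

lemma Ck_on_flat: "Ck_on k UNIV (\<lambda>x::real^'n::finite. flat q (c * x $ i + d))"
proof (induction k arbitrary: q)
  case 0
  have "(\<lambda>x::real^'n. flat q (c * x $ i + d)) differentiable (at x)" for x
    unfolding differentiable_def by (rule exI) (rule flat_affine_has_derivative)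
  then show ?case
    by (auto intro!: continuous_at_imp_continuous_on differentiable_imp_continuous_within)
next
  case (Suc k)
  have "pd m (\<lambda>x::real^'n. flat q (c * x $ i + d)) =
      (\<lambda>x. flat ([:0, 0, 1:] * (q - pderiv q)) (c * x $ i + d) * (c * axis m 1 $ i))" for m
    using pd_eqI[OF flat_affine_has_derivative] by blast
  moreover have "Ck_on k UNIV (\<lambda>x::real^'n. flat ([:0, 0, 1:] * (q - pderiv q)) (c * x $ i + d) * (c * axis m 1 $ i))" for m
    by (intro Ck_on_mult Suc Ck_on_const) auto
  moreover have "(\<lambda>x::real^'n. flat q (c * x $ i + d)) differentiable (at x)" for x
    unfolding differentiable_def by (rule exI) (rule flat_affine_has_derivative)
  ultimately show ?case
    by simp
qed

lemma flat_1_pos_iff: "flat 1 t > 0 \<longleftrightarrow> t > 0" and flat_1_nonneg: "flat 1 t \<ge> 0"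
  and flat_1_le_1: "flat 1 t \<le> 1"
  by (auto simp: flat_def)

text \<open>The box \<open>(a, b)\<close> is where the function is positive for every
  \<open>n > 0\<close>; the parameter only steepens the flanks, so that the bumps tend to the
  indicator of the box as \<open>n\<close> grows. The arguments of \<open>flat\<close> are spelled
  as \<open>c * x $ i + d\<close> to match \<open>Ck_on_flat\<close>.\<close>

definition bump :: "real \<Rightarrow> real^'n::finite \<Rightarrow> real^'n \<Rightarrow> real^'n \<Rightarrow> real" where
  "bump n a b x = (\<Prod>i\<in>UNIV. flat 1 (n * x $ i + - n * a $ i) * flat 1 (- n * x $ i + n * b $ i))"

lemma Ck_on_prod:
  fixes f :: "'i \<Rightarrow> real^'n::finite \<Rightarrow> real"
  assumes "open S" "\<And>i. i \<in> I \<Longrightarrow> Ck_on k S (f i)"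
  shows "Ck_on k S (\<lambda>x. \<Prod>i\<in>I. f i x)"
  using assms(2) by (induction I rule: infinite_finite_induct) (auto intro: Ck_on_mult[OF assms(1)])

lemma Ck_on_bump: "Ck_on k UNIV (bump n a b)"
  unfolding bump_def by (intro Ck_on_prod Ck_on_mult Ck_on_flat) auto

lemma bump_nonneg: "bump n a b x \<ge> 0" and bump_le_1: "bump n a b x \<le> 1"
  unfolding bump_def by (auto intro!: prod_nonneg prod_le_1 mult_le_one simp: flat_1_nonneg flat_1_le_1)

lemma bump_pos_iff:
  assumes "n > 0"
  shows "bump n a b x > 0 \<longleftrightarrow> x \<in> box a b"
proof -
  have *: "n * x $ i + - n * a $ i > 0 \<longleftrightarrow> a $ i < x $ i" "- n * x $ i + n * b $ i > 0 \<longleftrightarrow> x $ i < b $ i" for i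
    using assms by (simp_all add: zero_less_mult_iff flip: right_diff_distrib)
  have "bump n a b x > 0 \<longleftrightarrow> bump n a b x \<noteq> 0"
    using bump_nonneg[of n a b x] by linarith
  also have "\<dots> \<longleftrightarrow> (\<forall>i. flat 1 (n * x $ i + - n * a $ i) \<noteq> 0 \<and> flat 1 (- n * x $ i + n * b $ i) \<noteq> 0)"
    by (simp add: bump_def)
  also have "\<dots> \<longleftrightarrow> (\<forall>i. flat 1 (n * x $ i + - n * a $ i) > 0 \<and> flat 1 (- n * x $ i + n * b $ i) > 0)"
    using flat_1_nonneg by (metis less_le)
  finally show ?thesis
    unfolding flat_1_pos_iff * by (simp add: mem_box_cart)
qed

lemma bump_eq_0: "n > 0 \<Longrightarrow> x \<notin> box a b \<Longrightarrow> bump n a b x = 0"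
  using bump_pos_iff[of n a b x] bump_nonneg[of n a b x] by linarith

lemma bump_tendsto_1:
  fixes x :: "real^'n::finite"
  assumes "x \<in> box a b"
  shows "((\<lambda>n. bump n a b x) \<longlongrightarrow> 1) at_top"
proof -
  have *: "((\<lambda>n. flat 1 (n * t)) \<longlongrightarrow> 1) at_top" if "t > 0" for t
  proof -
    have "((\<lambda>n. exp (- (1 / (n * t)))) \<longlongrightarrow> exp (- 0)) at_top"
      using that by real_asymp
    then have "((\<lambda>n. exp (- (1 / (n * t)))) \<longlongrightarrow> 1) at_top" by simp
    then show ?thesis
      by (rule Lim_transform_eventually)
        (use that in \<open>auto simp: flat_def intro: eventually_mono[OF eventually_gt_at_top[of 0]]\<close>)
  qed
  have "((\<lambda>n. \<Prod>i\<in>UNIV. flat 1 (n * (x $ i - a $ i)) * flat 1 (n * (b $ i - x $ i))) \<longlongrightarrow> (\<Prod>i\<in>(UNIV::'n set). 1 * 1)) at_top"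
    using assms by (intro tendsto_prod tendsto_mult *) (auto simp: mem_box_cart)
  then show ?thesis
    by (simp add: bump_def algebra_simps)
qed

section \<open>Integrals of compactly supported functions\<close>

lemma set_integrable_compact:
  fixes f :: "'a::euclidean_space \<Rightarrow> 'b::{banach, second_countable_topology}"
  assumes "compact K" "continuous_on K f"
  shows "set_integrable lborel K f"
  using borel_integrable_compact[OF assms] by (simp add: set_integrable_def)

lemma cbox_support_integral:
  fixes f :: "'a::euclidean_space \<Rightarrow> real"
  assumes "continuous_on UNIV f" "\<And>x. x \<notin> cbox a b \<Longrightarrow> f x = 0"
  shows "integrable lborel f" "(LINT x|lborel. f x) = integral (cbox a b) f"
proof -
  have "(\<lambda>x. indicator (cbox a b) x *\<^sub>R f x) = f"
    using assms(2) by (auto simp: fun_eq_iff indicator_def)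
  then show i: "integrable lborel f"
    using borel_integrable_compact[of "cbox a b" f] assms(1) continuous_on_subset by fastforce
  have "(LINT x|lborel. f x) = integral UNIV f"
    using integral_lborel[OF i] by simp
  also have "\<dots> = integral UNIV (\<lambda>x. if x \<in> cbox a b then f x else 0)"
    using assms(2) by (intro arg_cong[of _ _ "integral UNIV"]) auto
  also have "\<dots> = integral (cbox a b) f"
    by (rule integral_restrict_UNIV)
  finally show "(LINT x|lborel. f x) = integral (cbox a b) f" .
qed

lemma nn_integral_lborel_affine:
  fixes f :: "'a::euclidean_space \<Rightarrow> ennreal"
  assumes [measurable]: "f \<in> borel_measurable borel" and c: "c \<noteq> 0"
  shows "(\<integral>\<^sup>+x. f x \<partial>lborel) = ennreal (\<bar>c\<bar> ^ DIM('a)) * (\<integral>\<^sup>+x. f (t + c *\<^sub>R x) \<partial>lborel)"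
  by (subst lborel_affine[OF c, of t])
    (simp add: nn_integral_density nn_integral_distr nn_integral_cmult)

lemma integral_lborel_affine:
  fixes f :: "'a::euclidean_space \<Rightarrow> real"
  assumes [measurable]: "f \<in> borel_measurable borel" and c: "c \<noteq> 0"
  shows "(LINT x|lborel. f x) = \<bar>c\<bar> ^ DIM('a) * (LINT x|lborel. f (t + c *\<^sub>R x))"
  by (subst lborel_affine[OF c, of t])
    (simp add: integral_density integral_distr)

lemma mem_cbox_cart_around:
  fixes x c :: "real^'n::finite"
  assumes "\<And>i. \<bar>x $ i - c $ i\<bar> \<le> r"
  shows "x \<in> cbox (c - (\<chi> i. r)) (c + (\<chi> i. r))"
  unfolding mem_box_cart using assms by (auto simp: abs_le_iff algebra_simps)

text \<open>No iterated integrals: by translation invariance the integral of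
  \<open>F (x + s e)\<close> over a fixed large box does not depend on \<open>s\<close>, and
  differentiating under the integral at \<open>s = 0\<close> yields the claim.\<close>

lemma integral_pd_eq_0:
  fixes F :: "real^'n::finite \<Rightarrow> real"
  assumes F: "Ck_on 1 UNIV F" and supp: "\<And>x. x \<notin> cbox a b \<Longrightarrow> F x = 0"
  shows "(LINT x|lborel. pd i F x) = 0"
proof -
  \<comment> \<open>Enlarged by 1 on every side, so that all translates by \<open>s\<close> in
    \<open>[-1, 1]\<close> keep their support inside.\<close>
  define B where "B = cbox (a - 1) (b + 1)"
  define e where "e = (axis i 1 :: real^'n)"
  have diff: "F differentiable (at x)" and cont: "continuous_on UNIV F" "continuous_on UNIV (pd i F)" for x
    using F Ck_on_imp_continuous[OF F] by auto
  have shift: "x + s *\<^sub>R e \<notin> cbox a b" if "x \<notin> B" "s \<in> {-1..1}" for x s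
  proof
    assume *: "x + s *\<^sub>R e \<in> cbox a b"
    have "\<bar>(s *\<^sub>R e) $ j\<bar> \<le> 1" for j
      using that by (auto simp: e_def axis_def)
    then have "a $ j - 1 \<le> x $ j \<and> x $ j \<le> b $ j + 1" for j
      using *[unfolded mem_box_cart, rule_format, of j] abs_le_D1[of "(s *\<^sub>R e) $ j" 1]
        abs_le_D2[of "(s *\<^sub>R e) $ j" 1] unfolding vector_add_component by fastforce
    then have "x \<in> B"
      unfolding B_def mem_box_cart by simp
    with that show False by simp
  qed
  have "integral B (\<lambda>x. F (x + s *\<^sub>R e)) = (LINT x|lborel. F x)" if "s \<in> {-1..1}" for s
  proof -
    have "integral B (\<lambda>x. F (x + s *\<^sub>R e)) = (LINT x|lborel. F (x + s *\<^sub>R e))"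
      unfolding B_def
      by (rule cbox_support_integral(2)[symmetric])
        (use shift[of _ s] supp that in \<open>auto simp: B_def intro!: continuous_intros continuous_on_compose2[OF cont(1)]\<close>)
    also have "\<dots> = (LINT x|lborel. F x)"
      using integral_lborel_affine[of F 1 "s *\<^sub>R e"] cont(1)
      by (simp add: borel_measurable_continuous_onI add.commute)
    finally show ?thesis .
  qed
  then have "((\<lambda>s. integral B (\<lambda>x. F (x + s *\<^sub>R e))) has_field_derivative 0) (at 0 within {-1..1})"
    by (intro has_field_derivative_transform_within[OF DERIV_const[of "LINT x|lborel. F x"], of 1]) auto
  moreover have "((\<lambda>s. integral B (\<lambda>x. F (x + s *\<^sub>R e))) has_field_derivative
      integral B (\<lambda>x. pd i F (x + 0 *\<^sub>R e))) (at 0 within {-1..1})"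
    unfolding B_def
  proof (rule leibniz_rule_field_derivative)
    fix s x
    show "((\<lambda>s. F (x + s *\<^sub>R e)) has_field_derivative pd i F (x + s *\<^sub>R e)) (at s within {-1..1})"
      unfolding e_def by (rule has_field_derivative_at_within) (rule has_real_derivative_along_axis[OF diff])
    show "(\<lambda>x. F (x + s *\<^sub>R e)) integrable_on cbox (a - 1) (b + 1)"
      by (intro integrable_continuous continuous_on_compose2[OF cont(1)] continuous_intros) auto
    show "continuous_on ({-1..1} \<times> cbox (a - 1) (b + 1)) (\<lambda>(s, x). pd i F (x + s *\<^sub>R e))"
      unfolding split_beta by (intro continuous_on_compose2[OF cont(2)] continuous_intros) auto
  qed auto
  ultimately have "integral B (pd i F) = 0"
    using DERIV_unique at_within_Icc_at[of "-1" "0::real" 1] by fastforce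
  moreover have "pd i F x = 0" if "x \<notin> B" for x
  proof -
    have "F y = 0" if "y \<in> - cbox a b" for y using supp that by simp
    moreover have "x \<in> - cbox a b" using shift[OF that, of 0] by simp
    ultimately show ?thesis
      using pd_cong_open[of "- cbox a b" x F "\<lambda>_. 0" i] by (simp add: open_Compl closed_cbox)
  qed
  ultimately show ?thesis
    using cbox_support_integral(2)[OF cont(2), of "a - 1" "b + 1"] by (simp add: B_def)
qed

lemma Ck_on_Un:
  assumes "open S" "open T" "Ck_on k S f" "Ck_on k T f"
  shows "Ck_on k (S \<union> T) f"
  using assms(3,4)
  by (induction k arbitrary: f) (auto intro: continuous_on_open_Un assms)

text \<open>The open sets \<open>W\<close> and \<open>- K\<close> cover the space; the extension
  agrees with \<open>F\<close> on the first, by the vanishing on \<open>W - K\<close>, and with 0 on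
  the second.\<close>

lemma Ck_on_extend_0:
  assumes "open W" "compact K" "K \<subseteq> W" "Ck_on k W F" "\<And>x. x \<in> W - K \<Longrightarrow> F x = 0"
  shows "Ck_on k UNIV (\<lambda>x. if x \<in> K then F x else 0)"
proof -
  let ?F = "\<lambda>x. if x \<in> K then F x else 0"
  have o: "open (- K)" using assms(2) by (simp add: compact_imp_closed open_Compl)
  have "Ck_on k W ?F"
    using Ck_on_cong[OF assms(1), of ?F F] assms(4,5) by auto
  moreover have "Ck_on k (- K) ?F"
    using Ck_on_cong[OF o, of ?F "\<lambda>_. 0"] by auto
  ultimately have "Ck_on k (W \<union> - K) ?F"
    using assms(1) o Ck_on_Un by blast
  moreover have "W \<union> - K = UNIV" using assms(3) by auto
  ultimately show ?thesis by simp
qed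

lemma set_integral_pd_eq_0:
  fixes F :: "real^'n::finite \<Rightarrow> real"
  assumes "open W" "compact K" "K \<subseteq> W" "Ck_on 1 W F" "\<And>x. x \<in> W - K \<Longrightarrow> F x = 0"
  shows "(LINT x:K|lborel. pd i F x) = 0"
proof -
  let ?F = "\<lambda>x. if x \<in> K then F x else 0"
  obtain a b where ab: "K \<subseteq> cbox a b"
    using assms(2) bounded_subset_cbox_symmetric compact_imp_bounded by metis
  have "(LINT x|lborel. pd i ?F x) = 0"
    using ab by (intro integral_pd_eq_0[OF Ck_on_extend_0[OF assms]]) auto
  moreover have "pd i ?F x = indicator K x *\<^sub>R pd i F x" for x
  proof (cases "x \<in> K")
    case True
    then show ?thesis
      using pd_cong_open[OF assms(1), of x ?F F] assms(3,5) by auto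
  next
    case False
    then show ?thesis
      using pd_cong_open[of "- K" x ?F "\<lambda>_. 0"] assms(2) by (simp add: compact_imp_closed open_Compl)
  qed
  ultimately show ?thesis
    by (simp add: set_lebesgue_integral_def)
qed

text \<open>The graph of a convex power lies above its tangent at \<open>c\<close>. The point
  \<open>d = 0\<close> is separate because convexity is invoked on the open half line.\<close>

lemma powr_tangent_le:
  fixes c d q :: real
  assumes "c > 0" "d \<ge> 0" "q \<ge> 1"
  shows "c powr q + q * c powr (q - 1) * (d - c) \<le> d powr q"
proof (cases "d = 0")
  case True
  have "c powr (q - 1) * c = c powr q"
    using assms by (simp add: powr_diff)
  then have "c powr q + q * c powr (q - 1) * (d - c) = (1 - q) * c powr q"
    using True by (simp add: algebra_simps)
  also have "\<dots> \<le> 0" using assms by (simp add: mult_nonpos_nonneg)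
  finally show ?thesis using True by simp
next
  case False
  have "convex_on {0<..} (\<lambda>x. x powr q)"
    using assms by (intro f''_ge0_imp_convex[where f' = "\<lambda>x. q * x powr (q - 1)"
          and f'' = "\<lambda>x. q * ((q - 1) * x powr (q - 1 - 1))"])
      (auto intro!: derivative_eq_intros)
  moreover have "((\<lambda>x. x powr q) has_real_derivative q * c powr (q - 1)) (at c within {0<..})"
    using assms by (auto intro!: derivative_eq_intros)
  ultimately have "q * c powr (q - 1) * (d - c) \<le> d powr q - c powr q"
    using assms False convex_on_imp_above_tangent[of "{0<..}" "\<lambda>x. x powr q" c d] by (auto simp: interior_open)
  then show ?thesis by simp
qed

text \<open>Jensen's inequality: integrate the tangent inequality at the mean value
  \<open>c = I / V\<close>, where the linear term integrates to 0. The tangent requires a positive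
  mean, so a vanishing integral is treated apart.\<close>

lemma integral_powr_le:
  fixes \<delta> :: "'a::euclidean_space \<Rightarrow> real"
  assumes cont: "continuous_on (cbox a b) \<delta>" and nonneg: "\<And>y. y \<in> cbox a b \<Longrightarrow> \<delta> y \<ge> 0"
    and q: "q \<ge> 1" and V: "measure lborel (cbox a b) = V" "V > 0"
  shows "(integral (cbox a b) \<delta>) powr q \<le> V powr (q - 1) * integral (cbox a b) (\<lambda>y. \<delta> y powr q)"
proof -
  have contp: "continuous_on (cbox a b) (\<lambda>y. \<delta> y powr q)"
    using nonneg q by (intro continuous_on_powr' cont continuous_intros) auto
  show ?thesis
proof (cases "integral (cbox a b) \<delta> > 0")
  case False
  moreover have "integral (cbox a b) \<delta> \<ge> 0"
    using nonneg integral_nonneg[OF integrable_continuous[OF cont]] by blast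
  moreover have "integral (cbox a b) (\<lambda>y. \<delta> y powr q) \<ge> 0"
    by (intro integral_nonneg integrable_continuous contp) auto
  ultimately show ?thesis using q by simp
next
  case True
  define I where "I = integral (cbox a b) \<delta>"
  define c where "c = I / V"
  have c: "c > 0" using True V by (simp add: c_def I_def)
  have int: "\<delta> integrable_on cbox a b"
    by (rule integrable_continuous[OF cont])
  have "integral (cbox a b) (\<lambda>y. c powr q + q * c powr (q - 1) * (\<delta> y - c)) \<le> integral (cbox a b) (\<lambda>y. \<delta> y powr q)"
    by (intro integral_le integrable_continuous continuous_intros cont contp powr_tangent_le)
      (use q c nonneg in auto)
  also have "integral (cbox a b) (\<lambda>y. c powr q + q * c powr (q - 1) * (\<delta> y - c)) =
      V * c powr q + q * c powr (q - 1) * (I - V * c)"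
  proof (rule integral_unique)
    have const: "((\<lambda>y. r) has_integral V * r) (cbox a b)" for r :: real
      using has_integral_const[of r a b] V by simp
    show "((\<lambda>y. c powr q + q * c powr (q - 1) * (\<delta> y - c)) has_integral
        V * c powr q + q * c powr (q - 1) * (I - V * c)) (cbox a b)"
      unfolding I_def
      by (intro has_integral_add has_integral_mult_right has_integral_diff const integrable_integral int)
  qed
  also have "\<dots> = V * c powr q" using V by (simp add: c_def)
  finally have "V * c powr q \<le> integral (cbox a b) (\<lambda>y. \<delta> y powr q)" .
  moreover have "I powr q = V powr (q - 1) * (V * c powr q)"
  proof -
    have "I = V * c" using V by (simp add: c_def)
    then have "I powr q = V powr q * c powr q"
      using V c by (simp add: powr_mult)
    also have "V powr q = V powr (q - 1) * V" using V by (simp add: powr_diff)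
    finally show ?thesis by simp
  qed
  ultimately show ?thesis
    unfolding I_def by (simp add: mult_left_mono)
qed
qed

section \<open>Mollification\<close>

abbreviation unit_cube :: "(real^'n::finite) set" where
  "unit_cube \<equiv> cbox (- 1) 1"

abbreviation cube_supported :: "(real^'n::finite \<Rightarrow> real) \<Rightarrow> bool" where
  "cube_supported \<kappa> \<equiv> \<forall>y. y \<notin> unit_cube \<longrightarrow> \<kappa> y = 0"

text \<open>The kernel is a parameter because a derivative may be let fall on it: the result is
  again a \<open>mol\<close>, with kernel \<open>pd i \<kappa>\<close>. Integrating over a fixed
  cube keeps \<open>t\<close> out of the domain of integration.\<close>

definition mol :: "(real^'n::finite \<Rightarrow> real) \<Rightarrow> real \<Rightarrow> (real^'n \<Rightarrow> real) \<Rightarrow> real^'n \<Rightarrow> real" where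
  "mol \<kappa> t F x = integral unit_cube (\<lambda>y. \<kappa> y * F (x - t *\<^sub>R y))"

text \<open>Up to the factor \<open>cube_vol\<close>, the mean of the \<open>q\<close>-th power of
  the increment of \<open>F\<close> over the cube of half side \<open>t\<close> around
  \<open>x\<close>. Integrated in \<open>x\<close>, weighted by \<open>2^(j s q)\<close> and summed
  over \<open>t = 2^-j\<close>, it plays the part of the Gagliardo seminorm.\<close>

definition osc :: "real \<Rightarrow> real \<Rightarrow> (real^'n::finite \<Rightarrow> real) \<Rightarrow> real^'n \<Rightarrow> real" where
  "osc q t F x = integral unit_cube (\<lambda>y. \<bar>F (x - t *\<^sub>R y) - F x\<bar> powr q)"

lemma continuous_on_affine_shift:
  fixes F :: "real^'n::finite \<Rightarrow> 'b::topological_space"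
  assumes "continuous_on UNIV F"
  shows "continuous_on S (\<lambda>y. F (x - t *\<^sub>R y))"
  by (intro continuous_on_compose2[OF assms] continuous_intros) auto

lemma mol_integrable:
  fixes \<kappa> F :: "real^'n::finite \<Rightarrow> real"
  assumes "continuous_on unit_cube \<kappa>" "continuous_on UNIV F"
  shows "(\<lambda>y. \<kappa> y * F (x - t *\<^sub>R y)) integrable_on unit_cube"
  by (intro integrable_continuous continuous_intros continuous_on_affine_shift assms)

lemma mol_cong:
  fixes \<kappa> F G :: "real^'n::finite \<Rightarrow> real"
  assumes "\<And>y. y \<in> unit_cube \<Longrightarrow> F (x - t *\<^sub>R y) = G (x - t *\<^sub>R y)"
  shows "mol \<kappa> t F x = mol \<kappa> t G x"
  unfolding mol_def by (rule integral_cong) (simp add: assms)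

lemma mol_add:
  fixes \<kappa> F G :: "real^'n::finite \<Rightarrow> real"
  assumes "continuous_on unit_cube \<kappa>" "continuous_on UNIV F" "continuous_on UNIV G"
  shows "mol \<kappa> t (\<lambda>x. F x + G x) x = mol \<kappa> t F x + mol \<kappa> t G x"
  using integral_add[OF mol_integrable[OF assms(1,2)] mol_integrable[OF assms(1,3)], of x t x t]
  by (simp add: mol_def distrib_left)

lemma continuous_on_mol:
  fixes \<kappa> F :: "real^'n::finite \<Rightarrow> real"
  assumes "continuous_on UNIV \<kappa>" "continuous_on UNIV F"
  shows "continuous_on S (mol \<kappa> t F)"
proof -
  have "continuous_on UNIV (\<lambda>x. integral unit_cube (\<lambda>y. \<kappa> y * F (x - t *\<^sub>R y)))"
    by (rule integral_continuous_on_param)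
      (auto simp: split_beta intro!: continuous_intros continuous_on_compose2[OF assms(1)]
        continuous_on_compose2[OF assms(2)])
  then show ?thesis
    unfolding mol_def[abs_def] using continuous_on_subset by blast
qed

lemma continuous_on_osc:
  fixes F :: "real^'n::finite \<Rightarrow> real"
  assumes "continuous_on UNIV F" "q > 0"
  shows "continuous_on S (osc q t F)"
proof -
  have "continuous_on UNIV (\<lambda>x. integral unit_cube (\<lambda>y. \<bar>F (x - t *\<^sub>R y) - F x\<bar> powr q))"
    using assms(2)
    by (intro integral_continuous_on_param)
      (auto simp: split_beta intro!: continuous_intros continuous_on_powr'
        continuous_on_compose2[OF assms(1)])
  then show ?thesis
    unfolding osc_def[abs_def] using continuous_on_subset by blast
qed

lemma continuous_on_grad:
  fixes F :: "real^'n::finite \<Rightarrow> real"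
  assumes "\<And>i. continuous_on S (pd i F)"
  shows "continuous_on S (grad F)"
  unfolding grad_def by (intro continuous_on_vec_lambda assms)

lemma mol_has_derivative_inner:
  fixes \<kappa> F :: "real^'n::finite \<Rightarrow> real"
  assumes \<kappa>: "continuous_on UNIV \<kappa>" and F: "Ck_on 1 UNIV F"
  shows "(mol \<kappa> t F has_derivative (\<lambda>v. integral unit_cube (\<lambda>y. \<kappa> y * (v \<bullet> grad F (x - t *\<^sub>R y))))) (at x)"
proof -
  have diff: "F differentiable (at z)" and cont: "continuous_on UNIV F" "continuous_on UNIV (grad F)" for z
    using F Ck_on_imp_continuous[OF F] by (auto intro: continuous_on_grad)
  define fx where "fx x y = \<kappa> y *\<^sub>R blinfun_inner_left (grad F (x - t *\<^sub>R y))" for x y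
  have cont_fx: "continuous_on (UNIV \<times> unit_cube) (\<lambda>(x, y). fx x y)"
    unfolding fx_def split_beta
    by (intro continuous_intros continuous_on_compose2[OF \<kappa>] continuous_on_compose2[OF cont(2)]
        bounded_linear.continuous_on[OF bounded_linear_blinfun_inner_left]) auto
  have "((\<lambda>x. integral unit_cube (\<lambda>y. \<kappa> y * F (x - t *\<^sub>R y))) has_derivative
      blinfun_apply (integral unit_cube (fx x))) (at x within UNIV)"
  proof (rule leibniz_rule[OF _ _ cont_fx])
    fix x y :: "real^'n"
    have "((\<lambda>x. x - t *\<^sub>R y) has_derivative (\<lambda>v. v)) (at x)"
      by (auto intro!: derivative_eq_intros)
    from has_derivative_compose[OF this has_derivative_grad[OF diff]]
    show "((\<lambda>x. \<kappa> y * F (x - t *\<^sub>R y)) has_derivative blinfun_apply (fx x y)) (at x within UNIV)"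
      by (rule has_derivative_eq_rhs[OF has_derivative_mult_right], auto simp: fx_def blinfun.scaleR_left)
    show "(\<lambda>y. \<kappa> y * F (x - t *\<^sub>R y)) integrable_on unit_cube"
      by (intro mol_integrable cont continuous_on_subset[OF \<kappa>]) auto
  qed auto
  moreover have "blinfun_apply (integral unit_cube (fx x)) =
      (\<lambda>v. integral unit_cube (\<lambda>y. \<kappa> y * (v \<bullet> grad F (x - t *\<^sub>R y))))"
  proof
    fix v
    have "fx x integrable_on unit_cube"
      unfolding fx_def
      by (intro integrable_continuous continuous_intros continuous_on_subset[OF \<kappa>] 
          bounded_linear.continuous_on[OF bounded_linear_blinfun_inner_left]
          continuous_on_affine_shift[OF cont(2)]) auto
    from blinfun_apply_integral[OF this, of v]
    show "blinfun_apply (integral unit_cube (fx x)) v =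
        integral unit_cube (\<lambda>y. \<kappa> y * (v \<bullet> grad F (x - t *\<^sub>R y)))"
      by (simp add: fx_def blinfun.scaleR_left)
  qed
  ultimately show ?thesis
    unfolding mol_def[abs_def] by simp
qed

lemma inner_axis_grad: "axis i 1 \<bullet> grad F x = pd i F x"
  by (simp add: grad_def inner_axis' )

text \<open>The derivative may fall on \<open>F\<close>, with bounds uniform in \<open>t\<close>, or
  on the kernel as in \<open>pd_mol_kernel\<close>, at the cost of \<open>1 / t\<close>. First
  derivatives of the mollified surface are treated in the former way, second derivatives in the
  latter.\<close>

lemma pd_mol:
  fixes \<kappa> F :: "real^'n::finite \<Rightarrow> real"
  assumes "continuous_on UNIV \<kappa>" "Ck_on 1 UNIV F"
  shows "pd i (mol \<kappa> t F) x = mol \<kappa> t (pd i F) x"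
  unfolding pd_eqI[OF mol_has_derivative_inner[OF assms]] mol_def inner_axis_grad ..

text \<open>The substitution \<open>y = (x - z) / t\<close> moves the dependence on \<open>x\<close> from \<open>F\<close> to the kernel.\<close>

lemma mol_conv_eq:
  fixes x x0 :: "real^'n::finite"
  assumes \<kappa>: "continuous_on UNIV \<kappa>" "cube_supported \<kappa>"
    and F: "continuous_on UNIV F" and t: "t > 0" and x: "x \<in> ball x0 1"
  shows "mol \<kappa> t F x = (1 / t) ^ CARD('n) *
    integral (cbox (x0 - (\<chi> i. 1 + t)) (x0 + (\<chi> i. 1 + t))) (\<lambda>z. \<kappa> ((1 / t) *\<^sub>R x - (1 / t) *\<^sub>R z) * F z)"
proof -
  let ?g = "\<lambda>y. \<kappa> y * F (x - t *\<^sub>R y)"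
  have cg: "continuous_on UNIV ?g"
    by (intro continuous_intros \<kappa> continuous_on_affine_shift F)
  have "mol \<kappa> t F x = (LINT y|lborel. ?g y)"
    unfolding mol_def by (rule cbox_support_integral(2)[symmetric, OF cg]) (simp add: \<kappa>(2))
  also have "\<dots> = (1 / t) ^ CARD('n) * (LINT z|lborel. ?g ((1 / t) *\<^sub>R x + (- 1 / t) *\<^sub>R z))"
    using integral_lborel_affine[OF borel_measurable_continuous_onI[OF cg], of "- 1 / t" "(1 / t) *\<^sub>R x"] t
    by simp
  also have "(LINT z|lborel. ?g ((1 / t) *\<^sub>R x + (- 1 / t) *\<^sub>R z)) =
     (LINT z|lborel. \<kappa> ((1 / t) *\<^sub>R x - (1 / t) *\<^sub>R z) * F z)"
    using t by (simp add: algebra_simps)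
  also have "\<dots> = integral (cbox (x0 - (\<chi> i. 1 + t)) (x0 + (\<chi> i. 1 + t)))
      (\<lambda>z. \<kappa> ((1 / t) *\<^sub>R x - (1 / t) *\<^sub>R z) * F z)"
  proof (rule cbox_support_integral(2))
    show "continuous_on UNIV (\<lambda>z. \<kappa> ((1 / t) *\<^sub>R x - (1 / t) *\<^sub>R z) * F z)"
      by (intro continuous_intros continuous_on_compose2[OF \<kappa>(1)] F) auto
    fix z assume z: "z \<notin> cbox (x0 - (\<chi> i. 1 + t)) (x0 + (\<chi> i. 1 + t))"
    have "(1 / t) *\<^sub>R x - (1 / t) *\<^sub>R z \<notin> unit_cube"
    proof
      assume a: "(1 / t) *\<^sub>R x - (1 / t) *\<^sub>R z \<in> unit_cube"
      have "\<bar>z $ i - x0 $ i\<bar> \<le> 1 + t" for i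
      proof -
        have "- 1 \<le> (x $ i - z $ i) / t" "(x $ i - z $ i) / t \<le> 1"
          using a unfolding mem_box_cart by (simp_all add: diff_divide_distrib)
        then have "\<bar>x $ i - z $ i\<bar> \<le> t"
          using t by (simp add: field_simps abs_le_iff)
        moreover have "\<bar>x $ i - x0 $ i\<bar> \<le> 1"
          using x component_le_norm_cart[of "x - x0" i] by (simp add: dist_norm norm_minus_commute)
        ultimately show ?thesis by linarith
      qed
      then show False using z mem_cbox_cart_around[of z x0 "1 + t"] by simp
    qed
    then show "\<kappa> ((1 / t) *\<^sub>R x - (1 / t) *\<^sub>R z) * F z = 0"
      using \<kappa>(2) by simp
  qed
  finally show ?thesis .
qed

lemma cube_supported_pd:
  assumes "cube_supported \<kappa>"
  shows "cube_supported (pd i \<kappa>)"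
  using pd_cong_open[of "- unit_cube" _ \<kappa> "\<lambda>_. 0" i] assms by (simp add: closed_cbox open_Compl)

text \<open>Here \<open>F\<close> is merely continuous: after \<open>mol_conv_eq\<close> the point
  \<open>x\<close> sits in the kernel alone, so the derivative falls on \<open>\<kappa>\<close> at
  the price of a factor \<open>1 / t\<close>.\<close>

lemma mol_kernel_has_derivative:
  fixes x :: "real^'n::finite"
  assumes \<kappa>: "Ck_on 1 UNIV \<kappa>" "cube_supported \<kappa>"
    and F: "continuous_on UNIV F" and t: "t > 0"
  shows "\<exists>D. (mol \<kappa> t F has_derivative D) (at x) \<and> (\<forall>i. D (axis i 1) = (1 / t) * mol (pd i \<kappa>) t F x)"
proof -
  let ?B = "cbox (x - (\<chi> i. 1 + t)) (x + (\<chi> i. 1 + t))"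
  let ?c = "(1 / t) ^ CARD('n)"
  let ?s = "\<lambda>x z. (1 / t) *\<^sub>R x - (1 / t) *\<^sub>R z :: real^'n"
  have diff: "\<kappa> differentiable (at z)" and cont: "continuous_on UNIV \<kappa>" "continuous_on UNIV (pd i \<kappa>)"
    "continuous_on UNIV (grad \<kappa>)" for z i
    using \<kappa>(1) Ck_on_imp_continuous[OF \<kappa>(1)] by (auto intro: continuous_on_grad)
  define fx where "fx x z = (F z * (1 / t)) *\<^sub>R blinfun_inner_left (grad \<kappa> (?s x z))" for x z
  have cont_fx: "continuous_on (ball x 1 \<times> ?B) (\<lambda>(x, z). fx x z)"
    unfolding fx_def split_beta
    by (intro continuous_intros continuous_on_compose2[OF F] continuous_on_compose2[OF cont(3)]
        bounded_linear.continuous_on[OF bounded_linear_blinfun_inner_left]) auto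
  \<comment> \<open>The domain of integration is frozen and contains the support of the shifted
    kernel for points within distance 1 of \<open>x\<close>; hence the restriction to a
    ball.\<close>
  have "((\<lambda>x. integral ?B (\<lambda>z. \<kappa> (?s x z) * F z)) has_derivative
      blinfun_apply (integral ?B (fx x))) (at x within ball x 1)"
  proof (rule leibniz_rule[OF _ _ cont_fx])
    fix w z :: "real^'n"
    have "((\<lambda>w. ?s w z) has_derivative (\<lambda>v. (1 / t) *\<^sub>R v)) (at w)"
      by (auto intro!: derivative_eq_intros)
    from has_derivative_compose[OF this has_derivative_grad[OF diff]]
    have "((\<lambda>w. \<kappa> (?s w z)) has_derivative (\<lambda>v. ((1 / t) *\<^sub>R v) \<bullet> grad \<kappa> (?s w z))) (at w)" .
    from has_derivative_mult_left[OF this, of "F z"]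
    have "((\<lambda>w. \<kappa> (?s w z) * F z) has_derivative blinfun_apply (fx w z)) (at w)"
      by (rule has_derivative_eq_rhs) (auto simp: fx_def blinfun.scaleR_left)
    then show "((\<lambda>w. \<kappa> (?s w z) * F z) has_derivative blinfun_apply (fx w z)) (at w within ball x 1)"
      by (rule has_derivative_at_withinI)
    show "(\<lambda>z. \<kappa> (?s w z) * F z) integrable_on ?B"
      by (intro integrable_continuous continuous_intros continuous_on_compose2[OF cont(1)]
          continuous_on_subset[OF F]) auto
  qed (simp_all add: convex_ball)
  then have "((\<lambda>x. integral ?B (\<lambda>z. \<kappa> (?s x z) * F z)) has_derivative
      blinfun_apply (integral ?B (fx x))) (at x)"
    by (simp only: at_within_open[OF centre_in_ball[THEN iffD2, OF zero_less_one] open_ball])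
  from has_derivative_mult_right[OF this, of ?c]
  have "(mol \<kappa> t F has_derivative (\<lambda>v. ?c * blinfun_apply (integral ?B (fx x)) v)) (at x)"
    by (rule has_derivative_transform_within_open[of _ _ _ _ "ball x 1"])
      (simp_all add: mol_conv_eq[OF cont(1) \<kappa>(2) F t, of _ x])
  moreover have "?c * blinfun_apply (integral ?B (fx x)) (axis i 1) = (1 / t) * mol (pd i \<kappa>) t F x" for i
  proof -
    have "fx x integrable_on ?B"
      unfolding fx_def
      by (intro integrable_continuous continuous_intros continuous_on_subset[OF F]
          bounded_linear.continuous_on[OF bounded_linear_blinfun_inner_left]
          continuous_on_compose2[OF cont(3)]) auto
    from blinfun_apply_integral[OF this, of "axis i 1"]
    have "blinfun_apply (integral ?B (fx x)) (axis i 1) = integral ?B (\<lambda>z. (1 / t) * (pd i \<kappa> (?s x z) * F z))"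
      by (simp add: fx_def blinfun.scaleR_left inner_axis_grad mult_ac)
    then show ?thesis
      using mol_conv_eq[OF cont(2)[of i] cube_supported_pd[OF \<kappa>(2), of i] F t, of x x] by simp
  qed
  ultimately show ?thesis by blast
qed

lemma mol_kernel_differentiable:
  fixes x :: "real^'n::finite"
  assumes "Ck_on 1 UNIV \<kappa>" "cube_supported \<kappa>" "continuous_on UNIV F" "t > 0"
  shows "mol \<kappa> t F differentiable (at x)"
  using mol_kernel_has_derivative[OF assms, of x] by (auto simp: differentiable_def)

lemma pd_mol_kernel:
  fixes x :: "real^'n::finite"
  assumes "Ck_on 1 UNIV \<kappa>" "cube_supported \<kappa>" "continuous_on UNIV F" "t > 0"
  shows "pd i (mol \<kappa> t F) x = (1 / t) * mol (pd i \<kappa>) t F x"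
  using mol_kernel_has_derivative[OF assms, of x] by (auto simp: pd_eqI)

lemma Ck_on_mol:
  fixes \<kappa> F :: "real^'n::finite \<Rightarrow> real"
  assumes "Ck_on k UNIV \<kappa>" "cube_supported \<kappa>" "continuous_on UNIV F" "t > 0"
  shows "Ck_on k UNIV (mol \<kappa> t F)"
  using assms(1,2)
proof (induction k arbitrary: \<kappa>)
  case 0
  then show ?case using continuous_on_mol[of \<kappa> F UNIV] assms(3) by simp
next
  case (Suc k)
  have \<kappa>1: "Ck_on 1 UNIV \<kappa>" by (rule Ck_on_mono[OF Suc.prems(1)]) simp
  have "pd i (mol \<kappa> t F) = (\<lambda>x. (1 / t) * mol (pd i \<kappa>) t F x)" for i
    using pd_mol_kernel[OF \<kappa>1 Suc.prems(2) assms(3,4)] by blast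
  moreover have "Ck_on k UNIV (\<lambda>x. (1 / t) * mol (pd i \<kappa>) t F x)" for i
    using Suc cube_supported_pd[OF Suc.prems(2)] by (intro Ck_on_mult Ck_on_const Suc.IH) auto
  ultimately show ?case
    using mol_kernel_differentiable[OF \<kappa>1 Suc.prems(2) assms(3,4)] by simp
qed

text \<open>A kernel of mean zero allows \<open>F x\<close> to be subtracted under the integral.
  This is why derivatives of mollifications see oscillations only.\<close>

lemma integral_pd_kernel:
  fixes \<kappa> :: "real^'n::finite \<Rightarrow> real"
  assumes "Ck_on 1 UNIV \<kappa>" "cube_supported \<kappa>"
  shows "integral unit_cube (pd i \<kappa>) = 0"
proof -
  have "continuous_on UNIV (pd i \<kappa>)" using assms(1) by simp
  then have "integral unit_cube (pd i \<kappa>) = (LINT x|lborel. pd i \<kappa> x)"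
    using cube_supported_pd[OF assms(2), of i] by (intro cbox_support_integral(2)[symmetric]) auto
  also have "\<dots> = 0"
    by (rule integral_pd_eq_0[OF assms(1), of "- 1" 1]) (use assms(2) in auto)
  finally show ?thesis .
qed

section \<open>The standard mollifier and its estimates\<close>

definition cube_vol :: "'n::finite itself \<Rightarrow> real" where
  "cube_vol _ = measure lborel (unit_cube :: (real^'n) set)"

lemma measure_unit_cube: "measure lborel (unit_cube :: (real^'n::finite) set) = cube_vol TYPE('n)"
  by (simp add: cube_vol_def)

lemma cube_vol_pos: "cube_vol TYPE('n::finite) > 0"
  unfolding cube_vol_def by (subst content_pos_lt_eq) (auto simp: Basis_vec_def inner_axis)

definition rho :: "real^'n::finite \<Rightarrow> real" where
  "rho x = bump 1 (- 1) 1 x / integral unit_cube (bump 1 (- 1) (1 :: real^'n))"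

lemma integral_bump_pos: "integral unit_cube (bump 1 (- 1) (1 :: real^'n::finite)) > 0"
proof -
  let ?b = "bump 1 (- 1) (1 :: real^'n)"
  have cont: "continuous_on unit_cube ?b"
    using Ck_on_imp_continuous[OF Ck_on_bump] continuous_on_subset by blast
  have box0: "(0 :: real^'n) \<in> box (- 1) 1"
    by (simp add: mem_box_cart)
  have "integral unit_cube ?b \<ge> 0"
    by (intro integral_nonneg integrable_continuous cont) (simp add: bump_nonneg)
  moreover have "integral unit_cube ?b \<noteq> 0"
  proof
    assume "integral unit_cube ?b = 0"
    then have "(?b has_integral 0) unit_cube"
      using integrable_integral[OF integrable_continuous[OF cont]] by simp
    then have "?b 0 = 0"
      by (rule has_integral_0_cbox_imp_0[OF cont bump_nonneg])
        (use box0 box_subset_cbox in \<open>auto simp del: box_eq_empty\<close>)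
    then show False using bump_pos_iff[of 1 "- 1" 1 "0 :: real^'n"] box0 by simp
  qed
  ultimately show ?thesis by linarith
qed

lemma Ck_on_rho: "Ck_on k UNIV rho"
  unfolding rho_def divide_inverse by (intro Ck_on_mult Ck_on_bump Ck_on_const) auto

lemma continuous_on_rho: "continuous_on S rho" "continuous_on S (pd i rho)"
  using Ck_on_imp_continuous[OF Ck_on_rho[of 0]] Ck_on_imp_continuous[OF Ck_on_pd[OF Ck_on_rho[of "Suc 0"]]]
    continuous_on_subset by blast+

lemma cube_supported_rho: "cube_supported rho"
  using bump_eq_0[of 1 _ "- 1" 1] box_subset_cbox by (auto simp: rho_def)

lemma rho_nonneg: "rho x \<ge> 0"
  using bump_nonneg[of 1 "- 1" 1 x] by (simp add: rho_def integral_bump_pos less_imp_le)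

lemma integral_rho: "integral unit_cube (rho :: real^'n::finite \<Rightarrow> real) = 1"
proof -
  have "integral unit_cube (rho :: real^'n \<Rightarrow> real)
      = integral unit_cube (\<lambda>x :: real^'n. bump 1 (- 1) 1 x * inverse (integral unit_cube (bump 1 (- 1) (1 :: real^'n))))"
    by (simp add: rho_def[abs_def] divide_inverse)
  also have "\<dots> = 1"
    unfolding integral_mult_left using integral_bump_pos[where 'n='n] by simp
  finally show ?thesis .
qed

text \<open>One constant per dimension for the kernel and all its first derivatives, fixed by choice
  so that later bounds can name it instead of quantifying over it.\<close>

definition rho_bound :: "'n::finite itself \<Rightarrow> real" where
  "rho_bound _ = (SOME C. C > 0 \<and> (\<forall>y :: real^'n. \<forall>i. \<bar>rho y\<bar> \<le> C \<and> \<bar>pd i rho y\<bar> \<le> C))"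

lemma rho_bound:
  fixes y :: "real^'n::finite"
  shows "rho_bound TYPE('n) > 0" "\<bar>rho y\<bar> \<le> rho_bound TYPE('n)" "\<bar>pd i rho y\<bar> \<le> rho_bound TYPE('n)"
proof -
  have bd: "\<exists>C. \<forall>y. \<bar>f y\<bar> \<le> C" if "continuous_on UNIV f" "cube_supported f" for f :: "real^'n \<Rightarrow> real"
  proof -
    have "bounded (f ` unit_cube)"
      using that(1) by (intro compact_imp_bounded compact_continuous_image)
        (auto intro: continuous_on_subset)
    then obtain C where "\<And>y. y \<in> unit_cube \<Longrightarrow> \<bar>f y\<bar> \<le> C"
      by (auto simp: bounded_iff)
    then have "\<bar>f y\<bar> \<le> max C 0" for y
      using that(2) by (cases "y \<in> unit_cube") (auto simp: le_max_iff_disj)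
    then show ?thesis by blast
  qed
  obtain C0 where C0: "\<And>y :: real^'n. \<bar>rho y\<bar> \<le> C0"
    using bd[OF continuous_on_rho(1) cube_supported_rho] by blast
  have "\<exists>C. \<forall>y :: real^'n. \<bar>pd i rho y\<bar> \<le> C" for i
    by (rule bd[OF continuous_on_rho(2) cube_supported_pd[OF cube_supported_rho]])
  then obtain C1 where C1: "\<And>i (y :: real^'n). \<bar>pd i rho y\<bar> \<le> C1 i" by metis
  define C where "C = \<bar>C0\<bar> + (\<Sum>i\<in>UNIV. \<bar>C1 i\<bar>) + 1"
  have le: "\<bar>C1 i\<bar> \<le> (\<Sum>i\<in>UNIV. \<bar>C1 i\<bar>)" for i
    by (rule member_le_sum) auto
  have nn: "(\<Sum>i\<in>UNIV. \<bar>C1 i\<bar>) \<ge> 0" by (simp add: sum_nonneg)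
  then have "C > 0" unfolding C_def by linarith
  moreover have "\<bar>rho y\<bar> \<le> C" for y :: "real^'n"
    using C0[of y] nn unfolding C_def by linarith
  moreover have "\<bar>pd i rho y\<bar> \<le> C" for i and y :: "real^'n"
    using C1[of i y] le[of i] unfolding C_def by linarith
  ultimately have "\<exists>C. C > 0 \<and> (\<forall>y :: real^'n. \<forall>i. \<bar>rho y\<bar> \<le> C \<and> \<bar>pd i rho y\<bar> \<le> C)"
    by blast
  from someI_ex[OF this]
  show "rho_bound TYPE('n) > 0" "\<bar>rho y\<bar> \<le> rho_bound TYPE('n)" "\<bar>pd i rho y\<bar> \<le> rho_bound TYPE('n)"
    unfolding rho_bound_def by blast+
qed

abbreviation reg :: "real \<Rightarrow> (real^'n::finite \<Rightarrow> real) \<Rightarrow> real^'n \<Rightarrow> real" where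
  "reg \<equiv> mol rho"

lemma continuous_on_shift_diff:
  fixes F :: "real^'n::finite \<Rightarrow> real"
  assumes "continuous_on UNIV F"
  shows "continuous_on S (\<lambda>y. \<bar>F (x - t *\<^sub>R y) - F x\<bar>)"
  by (intro continuous_intros continuous_on_affine_shift assms)

lemma continuous_on_shift_diff_powr:
  fixes F :: "real^'n::finite \<Rightarrow> real"
  assumes "continuous_on UNIV F" "q > 0"
  shows "continuous_on S (\<lambda>y. \<bar>F (x - t *\<^sub>R y) - F x\<bar> powr q)"
  by (intro continuous_on_powr' continuous_on_shift_diff assms continuous_on_const) (use assms in auto)

lemma osc_integrable:
  fixes F :: "real^'n::finite \<Rightarrow> real"
  assumes "continuous_on UNIV F" "q > 0"
  shows "(\<lambda>y. \<bar>F (x - t *\<^sub>R y) - F x\<bar> powr q) integrable_on unit_cube"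
  by (intro integrable_continuous continuous_on_shift_diff_powr assms)

lemma osc_nonneg:
  assumes "continuous_on UNIV F" "q > 0"
  shows "osc q t F x \<ge> 0"
  unfolding osc_def by (rule integral_nonneg[OF osc_integrable[OF assms]]) simp

lemma osc_le:
  fixes F :: "real^'n::finite \<Rightarrow> real"
  assumes "continuous_on UNIV F" "\<And>y. y \<in> unit_cube \<Longrightarrow> \<bar>F (x - t *\<^sub>R y) - F x\<bar> \<le> M"
  shows "osc 1 t F x \<le> cube_vol TYPE('n) * M"
proof -
  have "osc 1 t F x \<le> integral unit_cube (\<lambda>y :: real^'n. M)"
    unfolding osc_def using assms by (intro integral_le osc_integrable integrable_const) auto
  then show ?thesis by (simp add: measure_unit_cube)
qed

lemma osc_1_powr_le:
  fixes F :: "real^'n::finite \<Rightarrow> real"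
  assumes "continuous_on UNIV F" "q \<ge> 1"
  shows "osc 1 t F x powr q \<le> cube_vol TYPE('n) powr (q - 1) * osc q t F x"
  unfolding osc_def
  by (simp, rule integral_powr_le[OF continuous_on_shift_diff[OF assms(1)] abs_ge_zero assms(2) measure_unit_cube cube_vol_pos])

text \<open>Jensen with exponent 3/2 for the squared increments: the passage from the quadratic
  commutator error to the cubic oscillation that the \<open>W^{2/3,3}\<close> seminorm
  controls.\<close>

lemma osc_2_powr_le:
  fixes F :: "real^'n::finite \<Rightarrow> real"
  assumes "continuous_on UNIV F"
  shows "osc 2 t F x powr (3/2) \<le> cube_vol TYPE('n) powr (1/2) * osc 3 t F x"
proof -
  have "(\<bar>r\<bar> powr 2) powr (3/2) = \<bar>r\<bar> powr 3" for r :: real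
    by (simp add: powr_powr del: powr_numeral)
  moreover have "osc 2 t F x powr (3/2) \<le> cube_vol TYPE('n) powr (3/2 - 1)
      * integral unit_cube (\<lambda>y. (\<bar>F (x - t *\<^sub>R y) - F x\<bar> powr 2) powr (3/2))"
    unfolding osc_def
    by (rule integral_powr_le[OF continuous_on_shift_diff_powr[OF assms] powr_ge_zero _ measure_unit_cube cube_vol_pos]) auto
  ultimately show ?thesis
    by (simp add: osc_def del: powr_numeral)
qed

lemma kernel_integral_diff:
  fixes F :: "real^'n::finite \<Rightarrow> real"
  assumes "continuous_on unit_cube \<kappa>" "continuous_on UNIV F"
  shows "integral unit_cube (\<lambda>y. \<kappa> y * (F (x - t *\<^sub>R y) - c)) = mol \<kappa> t F x - c * integral unit_cube \<kappa>"
  using integral_diff[OF mol_integrable[OF assms] integrable_on_mult_right[OF integrable_continuous[OF assms(1)]], of x t c]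
  by (simp add: mol_def algebra_simps)

lemma abs_kernel_integral_le:
  fixes F :: "real^'n::finite \<Rightarrow> real"
  assumes "continuous_on unit_cube \<kappa>" "continuous_on UNIV F" "\<And>y. \<bar>\<kappa> y\<bar> \<le> C"
  shows "\<bar>integral unit_cube (\<lambda>y. \<kappa> y * (F (x - t *\<^sub>R y) - F x))\<bar> \<le> C * osc 1 t F x"
proof -
  have "norm (integral unit_cube (\<lambda>y. \<kappa> y * (F (x - t *\<^sub>R y) - F x)))
      \<le> integral unit_cube (\<lambda>y. C * \<bar>F (x - t *\<^sub>R y) - F x\<bar> powr 1)"
    by (rule integral_norm_bound_integral)
      (use assms in \<open>auto intro!: integrable_continuous continuous_intros continuous_on_affine_shift mult_right_mono simp: abs_mult\<close>)
  then show ?thesis by (simp add: osc_def)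
qed

lemma reg_minus_le:
  fixes F :: "real^'n::finite \<Rightarrow> real"
  assumes "continuous_on UNIV F"
  shows "\<bar>reg t F x - F x\<bar> \<le> rho_bound TYPE('n) * osc 1 t F x"
  using abs_kernel_integral_le[OF continuous_on_rho(1) assms rho_bound(2), of x t]
    kernel_integral_diff[OF continuous_on_rho(1) assms, of x t "F x"] by (simp add: integral_rho)

lemma pd_reg_eq:
  fixes F :: "real^'n::finite \<Rightarrow> real"
  assumes "continuous_on UNIV F" "t > 0"
  shows "pd i (reg t F) x = (1 / t) * mol (pd i rho) t F x"
  by (rule pd_mol_kernel[OF Ck_on_rho cube_supported_rho assms])

text \<open>One derivative costs \<open>1 / t\<close>, but because \<open>pd i rho\<close> has mean
  zero it multiplies the oscillation of \<open>F\<close> and not its size.\<close>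

lemma pd_reg_le:
  fixes F :: "real^'n::finite \<Rightarrow> real"
  assumes "continuous_on UNIV F" "t > 0"
  shows "\<bar>pd i (reg t F) x\<bar> \<le> rho_bound TYPE('n) / t * osc 1 t F x"
proof -
  have "\<bar>integral unit_cube (\<lambda>y. pd i rho y * (F (x - t *\<^sub>R y) - F x))\<bar> \<le> rho_bound TYPE('n) * osc 1 t F x"
    by (rule abs_kernel_integral_le[OF continuous_on_rho(2) assms(1) rho_bound(3)])
  moreover have "integral unit_cube (\<lambda>y. pd i rho y * (F (x - t *\<^sub>R y) - F x)) = mol (pd i rho) t F x"
    by (simp add: kernel_integral_diff[OF continuous_on_rho(2) assms(1)]
        integral_pd_kernel[OF Ck_on_rho cube_supported_rho])
  ultimately have "\<bar>mol (pd i rho) t F x\<bar> \<le> rho_bound TYPE('n) * osc 1 t F x"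
    by simp
  then show ?thesis
    using assms(2) by (simp add: pd_reg_eq[OF assms] abs_mult divide_right_mono)
qed

lemma Ck_on_reg:
  fixes F :: "real^'n::finite \<Rightarrow> real"
  assumes "continuous_on UNIV F" "t > 0"
  shows "Ck_on k UNIV (reg t F)"
  by (rule Ck_on_mol[OF Ck_on_rho cube_supported_rho assms])

lemma reg_abs_le:
  fixes F :: "real^'n::finite \<Rightarrow> real"
  assumes "continuous_on UNIV F" "\<And>y. y \<in> unit_cube \<Longrightarrow> \<bar>F (x - t *\<^sub>R y)\<bar> \<le> M"
  shows "\<bar>reg t F x\<bar> \<le> M"
proof -
  have "norm (reg t F x) \<le> integral unit_cube (\<lambda>y :: real^'n. rho y * M)"
    unfolding mol_def
    by (rule integral_norm_bound_integral)
      (use assms rho_nonneg in \<open>auto intro!: mol_integrable integrable_continuous continuous_intros continuous_on_rho continuous_on_affine_shift mult_mono simp: abs_mult\<close>)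
  then show ?thesis by (simp add: integral_rho)
qed

lemma osc_1_mult_le:
  fixes A B :: "real^'n::finite \<Rightarrow> real"
  assumes "continuous_on UNIV A" "continuous_on UNIV B"
  shows "osc 1 t A x * osc 1 t B x \<le> cube_vol TYPE('n) * (osc 2 t A x + osc 2 t B x)"
proof -
  have "osc 1 t F x ^ 2 \<le> cube_vol TYPE('n) * osc 2 t F x" if "continuous_on UNIV F" for F :: "real^'n \<Rightarrow> real"
    using osc_1_powr_le[OF that, of 2 t x] osc_nonneg[OF that, of 1 t x] cube_vol_pos[where 'n='n] by simp
  from this[OF assms(1)] this[OF assms(2)]
  show ?thesis
    using sum_squares_bound[of "osc 1 t A x" "osc 1 t B x"]
      mult_nonneg_nonneg[OF osc_nonneg[OF assms(1), of 1 t x] osc_nonneg[OF assms(2), of 1 t x]]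
    unfolding distrib_left by linarith
qed

text \<open>The commutator estimate behind the Gauss equation below \<open>C\<^sup>2\<close>: products and mollification commute
  up to a quadratic expression in the oscillation.\<close>

lemma pd_reg_commutator_le:
  fixes A B :: "real^'n::finite \<Rightarrow> real"
  assumes A: "continuous_on UNIV A" and B: "continuous_on UNIV B" and t: "t > 0"
  defines "R \<equiv> rho_bound TYPE('n)"
  shows "\<bar>pd i (\<lambda>x. reg t A x * reg t B x) x - pd i (reg t (\<lambda>z. A z * B z)) x\<bar>
     \<le> (2 * R\<^sup>2 * cube_vol TYPE('n) + R) / t * (osc 2 t A x + osc 2 t B x)"
proof -
  let ?k = "pd i (rho :: real^'n \<Rightarrow> real)"
  let ?I = "integral unit_cube (\<lambda>y. ?k y * ((A (x - t *\<^sub>R y) - A x) * (B (x - t *\<^sub>R y) - B x)))"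
  have R: "R > 0" by (simp add: R_def rho_bound)
  have AB: "continuous_on UNIV (\<lambda>z. A z * B z)" by (intro continuous_intros A B)
  have diff: "reg t F differentiable (at x)" if "continuous_on UNIV F" for F :: "real^'n \<Rightarrow> real"
    using Ck_on_reg[OF that t, of "Suc 0"] by simp
  \<comment> \<open>Expansion of the product of increments; the term with \<open>A x * B x\<close>
    disappears because the kernel has mean zero.\<close>
  have I: "?I = mol ?k t (\<lambda>z. A z * B z) x - A x * mol ?k t B x - B x * mol ?k t A x"
  proof -
    have "?I = integral unit_cube (\<lambda>y. ?k y * (A (x - t *\<^sub>R y) * B (x - t *\<^sub>R y)) - A x * (?k y * B (x - t *\<^sub>R y))
        - B x * (?k y * A (x - t *\<^sub>R y)) + A x * B x * ?k y)"
      by (simp add: algebra_simps)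
    also have "\<dots> = mol ?k t (\<lambda>z. A z * B z) x - A x * mol ?k t B x - B x * mol ?k t A x + A x * B x * integral unit_cube ?k"
      unfolding mol_def
      by (intro integral_unique has_integral_add has_integral_diff has_integral_mult_right integrable_integral
          mol_integrable[OF continuous_on_rho(2) AB] mol_integrable[OF continuous_on_rho(2) A]
          mol_integrable[OF continuous_on_rho(2) B] integrable_continuous continuous_on_rho)
    finally show ?thesis
      by (simp add: integral_pd_kernel[OF Ck_on_rho cube_supported_rho])
  qed
  have I_le: "\<bar>?I\<bar> \<le> R * (osc 2 t A x + osc 2 t B x)"
  proof -
    have "norm ?I \<le> integral unit_cube (\<lambda>y. R * (\<bar>A (x - t *\<^sub>R y) - A x\<bar> powr 2 + \<bar>B (x - t *\<^sub>R y) - B x\<bar> powr 2))"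
    proof (rule integral_norm_bound_integral)
      show "(\<lambda>y. ?k y * ((A (x - t *\<^sub>R y) - A x) * (B (x - t *\<^sub>R y) - B x))) integrable_on unit_cube"
        by (intro integrable_continuous continuous_intros continuous_on_affine_shift A B continuous_on_rho)
      show "(\<lambda>y. R * (\<bar>A (x - t *\<^sub>R y) - A x\<bar> powr 2 + \<bar>B (x - t *\<^sub>R y) - B x\<bar> powr 2)) integrable_on unit_cube"
        by (intro integrable_on_mult_right integrable_add osc_integrable A B) auto
      fix y :: "real^'n"
      have "\<bar>a * b\<bar> \<le> \<bar>a\<bar> powr 2 + \<bar>b\<bar> powr 2" for a b :: real
        using sum_squares_bound[of "\<bar>a\<bar>" "\<bar>b\<bar>"] mult_nonneg_nonneg[OF abs_ge_zero[of a] abs_ge_zero[of b]]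
        unfolding abs_mult powr_numeral[OF abs_ge_zero] by linarith
      then show "norm (?k y * ((A (x - t *\<^sub>R y) - A x) * (B (x - t *\<^sub>R y) - B x)))
          \<le> R * (\<bar>A (x - t *\<^sub>R y) - A x\<bar> powr 2 + \<bar>B (x - t *\<^sub>R y) - B x\<bar> powr 2)"
        using rho_bound(3)[of i y] R unfolding R_def real_norm_def abs_mult[of "?k y"]
        by (intro mult_mono) auto
    qed
    also have "\<dots> = R * (osc 2 t A x + osc 2 t B x)"
      using integral_add[OF osc_integrable[OF A, of 2 x t] osc_integrable[OF B, of 2 x t]] by (simp add: osc_def)
    finally show ?thesis by simp
  qed
  \<comment> \<open>The commutator identity of Constantin, E and Titi in differentiated form: terms
    linear in an increment cancel, and each remaining term is a product of two increments.\<close>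
  have eq: "pd i (\<lambda>x. reg t A x * reg t B x) x - pd i (reg t (\<lambda>z. A z * B z)) x
      = (reg t A x - A x) * pd i (reg t B) x + (reg t B x - B x) * pd i (reg t A) x - (1 / t) * ?I"
    unfolding I using t
    by (simp add: pd_mult[OF diff[OF A] diff[OF B]] pd_reg_eq[OF _ t] A B AB field_simps)
  have "\<bar>pd i (\<lambda>x. reg t A x * reg t B x) x - pd i (reg t (\<lambda>z. A z * B z)) x\<bar> \<le> \<bar>(reg t A x - A x) * pd i (reg t B) x\<bar> + \<bar>(reg t B x - B x) * pd i (reg t A) x\<bar> + \<bar>(1 / t) * ?I\<bar>"
    unfolding eq by linarith
  also have "\<dots> \<le> R\<^sup>2 * cube_vol TYPE('n) / t * (osc 2 t A x + osc 2 t B x)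
      + R\<^sup>2 * cube_vol TYPE('n) / t * (osc 2 t A x + osc 2 t B x) + R / t * (osc 2 t A x + osc 2 t B x)"
  proof (intro add_mono)
    have *: "\<bar>(reg t F x - F x) * pd i (reg t G) x\<bar> \<le> R\<^sup>2 * cube_vol TYPE('n) / t * (osc 2 t F x + osc 2 t G x)"
      if "continuous_on UNIV F" "continuous_on UNIV G" for F G :: "real^'n \<Rightarrow> real"
    proof -
      have "\<bar>(reg t F x - F x) * pd i (reg t G) x\<bar> \<le> (R * osc 1 t F x) * (R / t * osc 1 t G x)"
        unfolding abs_mult R_def using osc_nonneg[OF that(1), of 1 t x] rho_bound(1)[where 'n='n]
        by (intro mult_mono reg_minus_le pd_reg_le that t) auto
      also have "\<dots> = R\<^sup>2 / t * (osc 1 t F x * osc 1 t G x)"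
        by (simp add: power2_eq_square)
      also have "\<dots> \<le> R\<^sup>2 / t * (cube_vol TYPE('n) * (osc 2 t F x + osc 2 t G x))"
        using t by (intro mult_left_mono osc_1_mult_le that) auto
      finally show ?thesis by simp
    qed
    show "\<bar>(reg t A x - A x) * pd i (reg t B) x\<bar> \<le> R\<^sup>2 * cube_vol TYPE('n) / t * (osc 2 t A x + osc 2 t B x)"
      by (rule *[OF A B])
    show "\<bar>(reg t B x - B x) * pd i (reg t A) x\<bar> \<le> R\<^sup>2 * cube_vol TYPE('n) / t * (osc 2 t A x + osc 2 t B x)"
      using *[OF B A] by (simp add: add.commute)
    show "\<bar>(1 / t) * ?I\<bar> \<le> R / t * (osc 2 t A x + osc 2 t B x)"
      using I_le t by (simp add: abs_mult divide_right_mono)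
  qed
  also have "\<dots> = (2 * R\<^sup>2 * cube_vol TYPE('n) + R) / t * (osc 2 t A x + osc 2 t B x)"
    by (simp add: add_divide_distrib algebra_simps)
  finally show ?thesis .
qed

lemma unit_cube_norm_le:
  fixes y :: "real^'n::finite"
  assumes "y \<in> unit_cube"
  shows "norm y \<le> CARD('n)"
proof -
  have "\<bar>y $ i\<bar> \<le> 1" for i
    using assms unfolding mem_box_cart by (simp add: abs_le_iff minus_le_iff)
  then have "(\<Sum>i\<in>UNIV. \<bar>y $ i\<bar>) \<le> (\<Sum>i\<in>(UNIV :: 'n set). 1)"
    by (intro sum_mono) auto
  then show ?thesis
    using norm_le_l1_cart[of y] by simp
qed

lemma osc_uniformly_small:
  fixes F :: "real^'n::finite \<Rightarrow> real"
  assumes F: "continuous_on UNIV F" and K: "compact K" and e: "e > 0"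
  shows "\<exists>d>0. \<forall>t x. 0 < t \<and> t < d \<and> x \<in> K \<longrightarrow> osc 1 t F x \<le> e"
proof -
  let ?V = "cube_vol TYPE('n)"
  let ?n = "real CARD('n)"
  obtain B where B: "\<And>x. x \<in> K \<Longrightarrow> norm x \<le> B"
    using compact_imp_bounded[OF K] by (auto simp: bounded_iff)
  have n: "?n \<ge> 1" by (simp add: Suc_leI)
  have "uniformly_continuous_on (cball 0 (B + 1)) F"
    by (rule compact_uniformly_continuous[OF continuous_on_subset[OF F]]) auto
  moreover have eV: "e / ?V > 0" using e cube_vol_pos[where 'n='n] by simp
  ultimately obtain d where d: "d > 0" "\<And>x y. x \<in> cball 0 (B + 1) \<Longrightarrow> y \<in> cball 0 (B + 1) \<Longrightarrow> dist y x < d \<Longrightarrow> dist (F y) (F x) < e / ?V"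
    unfolding uniformly_continuous_on_def by meson
  \<comment> \<open>Points of the unit cube have norm at most \<open>?n\<close>, hence the division;
    the cap at 1 keeps the shifted points in the ball of radius \<open>B + 1\<close>, on which
    \<open>F\<close> is uniformly continuous.\<close>
  show ?thesis
  proof (intro exI[of _ "min d 1 / ?n"] conjI allI impI)
    show "min d 1 / ?n > 0" using d n by auto
    fix t x assume tx: "0 < t \<and> t < min d 1 / ?n \<and> x \<in> K"
    then have tn: "t * ?n < d" "t * ?n < 1"
      using n by (auto simp: pos_less_divide_eq)
    have "\<bar>F (x - t *\<^sub>R y) - F x\<bar> \<le> e / ?V" if "y \<in> unit_cube" for y
    proof -
      have "norm (t *\<^sub>R y) \<le> t * ?n"
        using unit_cube_norm_le[OF that] tx by (simp add: mult_left_mono)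
      then have "norm (t *\<^sub>R y) < d" "norm (t *\<^sub>R y) \<le> 1" using tn by auto
      moreover have "norm x \<le> B" using B tx by auto
      ultimately show ?thesis
        using d(2)[of x "x - t *\<^sub>R y"] norm_triangle_ineq4[of x "t *\<^sub>R y"]
        by (simp add: dist_norm norm_minus_commute del: norm_scaleR)
    qed
    from osc_le[OF F this] show "osc 1 t F x \<le> e"
      using cube_vol_pos[where 'n='n] by simp
  qed
qed

lemma reg_uniformly_close:
  fixes F :: "real^'n::finite \<Rightarrow> real"
  assumes F: "continuous_on UNIV F" and K: "compact K" and e: "e > 0"
  shows "\<exists>d>0. \<forall>t x. 0 < t \<and> t < d \<and> x \<in> K \<longrightarrow> \<bar>reg t F x - F x\<bar> \<le> e"
proof -
  let ?R = "rho_bound TYPE('n)"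
  have R: "?R > 0" by (rule rho_bound)
  obtain d where d: "d > 0" "\<And>t x. 0 < t \<Longrightarrow> t < d \<Longrightarrow> x \<in> K \<Longrightarrow> osc 1 t F x \<le> e / ?R"
    using osc_uniformly_small[OF F K, of "e / ?R"] e R by auto
  have "\<bar>reg t F x - F x\<bar> \<le> e" if "0 < t" "t < d" "x \<in> K" for t x
    using reg_minus_le[OF F, of t x] mult_left_mono[OF d(2)[OF that], of ?R] R by simp
  with d(1) show ?thesis by blast
qed

lemma reg_tendsto:
  fixes F :: "real^'n::finite \<Rightarrow> real"
  assumes F: "continuous_on UNIV F" and t: "\<And>j. t j > 0" "t \<longlonglongrightarrow> 0"
  shows "(\<lambda>j. reg (t j) F x) \<longlonglongrightarrow> F x"
proof (rule tendstoI)
  fix e :: real assume "e > 0"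
  then obtain d where d: "d > 0" "\<And>t. 0 < t \<Longrightarrow> t < d \<Longrightarrow> \<bar>reg t F x - F x\<bar> \<le> e / 2"
    using reg_uniformly_close[OF F, of "{x}" "e / 2"] by auto
  have "\<forall>\<^sub>F j in sequentially. t j < d"
    using t(2) d(1) by (auto intro: order_tendstoD)
  then show "\<forall>\<^sub>F j in sequentially. dist (reg (t j) F x) (F x) < e"
    by eventually_elim (use d(2) t(1) \<open>e > 0\<close> in \<open>force simp: dist_real_def\<close>)
qed

lemma reg_minus_le_Lipschitz:
  fixes F :: "real^'n::finite \<Rightarrow> real"
  assumes F: "continuous_on UNIV F" and L: "\<And>y. \<bar>F (x - y) - F x\<bar> \<le> L * norm y" and t: "t > 0"
  shows "\<bar>reg t F x - F x\<bar> \<le> rho_bound TYPE('n) * cube_vol TYPE('n) * (L * CARD('n)) * t"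
proof -
  have "L \<ge> 0" using order_trans[OF abs_ge_zero L[of "axis undefined 1"]] by simp
  have "osc 1 t F x \<le> cube_vol TYPE('n) * (L * CARD('n) * t)"
  proof (rule osc_le[OF F])
    fix y :: "real^'n" assume "y \<in> unit_cube"
    from unit_cube_norm_le[OF this] t have "norm (t *\<^sub>R y) \<le> CARD('n) * t"
      by (simp add: mult.commute)
    from mult_left_mono[OF this \<open>L \<ge> 0\<close>] L[of "t *\<^sub>R y"]
    show "\<bar>F (x - t *\<^sub>R y) - F x\<bar> \<le> L * CARD('n) * t" by (simp add: mult.assoc)
  qed
  from mult_left_mono[OF this, of "rho_bound TYPE('n)"] rho_bound(1)[where 'n='n]
  have "rho_bound TYPE('n) * osc 1 t F x \<le> rho_bound TYPE('n) * (cube_vol TYPE('n) * (L * CARD('n) * t))"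
    by simp
  with reg_minus_le[OF F, of t x] show ?thesis by (simp add: mult_ac)
qed

section \<open>Dyadic form of the Gagliardo seminorm\<close>

lemma nn_integral_compact_eq:
  fixes f :: "'a::euclidean_space \<Rightarrow> real"
  assumes K: "compact K" and f: "continuous_on K f" and nonneg: "\<And>x. x \<in> K \<Longrightarrow> f x \<ge> 0"
  shows "(\<integral>\<^sup>+x. ennreal (indicator K x * f x) \<partial>lborel) = ennreal (LINT x:K|lborel. f x)"
proof -
  have "integrable lborel (\<lambda>x. indicator K x *\<^sub>R f x)"
    using set_integrable_compact[OF K f] by (simp add: set_integrable_def)
  from nn_integral_eq_integral[OF this] nonneg show ?thesis
    by (simp add: set_lebesgue_integral_def indicator_def)
qed

lemma nn_integral_cbox_eq:
  fixes f :: "'a::euclidean_space \<Rightarrow> real"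
  assumes f: "continuous_on (cbox a b) f" and nonneg: "\<And>x. x \<in> cbox a b \<Longrightarrow> f x \<ge> 0"
  shows "(\<integral>\<^sup>+x. ennreal (indicator (cbox a b) x * f x) \<partial>lborel) = ennreal (integral (cbox a b) f)"
  using nn_integral_compact_eq[OF compact_cbox f nonneg]
    set_borel_integral_eq_integral(2)[OF set_integrable_compact[OF compact_cbox f]] by simp

text \<open>A geometric sum with ratio \<open>2 powr \<beta> \<ge> 2\<close> is at most twice its
  last term, and the last term that counts has \<open>2 ^ j \<le> R\<close>.\<close>

lemma sum_dyadic_powr_le:
  fixes \<beta> R :: real
  assumes "\<beta> \<ge> 1" "R > 0"
  shows "(\<Sum>j<N. if 2 ^ j \<le> R then (2 ^ j) powr \<beta> else 0) \<le> 2 * R powr \<beta>"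
proof (induction N)
  case 0
  then show ?case by simp
next
  case (Suc N)
  show ?case
  proof (cases "2 ^ N \<le> R")
    case False
    with Suc show ?thesis by simp
  next
    case True
    have geo: "(\<Sum>j<Suc n. (2 ^ j) powr \<beta>) \<le> 2 * (2 ^ n) powr \<beta>" for n
    proof (induction n)
      case (Suc n)
      have "2 * (2 ^ n) powr \<beta> \<le> 2 powr \<beta> * (2 ^ n :: real) powr \<beta>"
        using powr_mono[OF assms(1), of 2] by (intro mult_right_mono) auto
      also have "\<dots> = (2 ^ Suc n) powr \<beta>" by (simp add: powr_mult)
      finally show ?case using Suc by simp
    qed simp
    have "(\<Sum>j<Suc N. if 2 ^ j \<le> R then (2 ^ j) powr \<beta> else 0) \<le> (\<Sum>j<Suc N. (2 ^ j) powr \<beta>)"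
      by (rule sum_mono) simp
    also have "\<dots> \<le> 2 * (2 ^ N) powr \<beta>" by (rule geo)
    also have "\<dots> \<le> 2 * R powr \<beta>"
      using True assms by (intro mult_left_mono powr_mono2) auto
    finally show ?thesis .
  qed
qed

lemma gagliardo_pow_lborel:
  "gagliardo_pow s q V F =
     (\<integral>\<^sup>+x. (\<integral>\<^sup>+y. ennreal (norm (F x - F y) powr q / norm (x - y) powr (real CARD('n) + s * q)) * indicator V y \<partial>lborel)
        * indicator V (x :: real^'n::finite) \<partial>lborel)"
  by (simp add: gagliardo_pow_def nn_integral_completion)

text \<open>Substituting \<open>z = x - t y\<close> turns the term at scale \<open>j\<close> into an
  integral over pairs with \<open>norm (x - z) \<le> n / 2^j\<close>. For a fixed pair the weights
  form a geometric series over the admissible scales, whose sum is bounded by a multiple of the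
  singular kernel of the seminorm.\<close>

lemma osc_dyadic_sum_le:
  fixes F :: "real^'n::finite \<Rightarrow> real"
  assumes F: "continuous_on UNIV F" and q: "q \<ge> 1" and s: "s > 0"
    and K: "compact K" and V: "V \<in> sets borel"
    and KV: "\<And>x y j. x \<in> K \<Longrightarrow> y \<in> unit_cube \<Longrightarrow> j \<ge> j0 \<Longrightarrow> x - (1 / 2 ^ j) *\<^sub>R y \<in> V" and KV0: "K \<subseteq> V"
    and fin: "gagliardo_pow s q V F < \<infinity>"
  shows "(\<Sum>j\<in>{j0..<N}. (2 ^ j) powr (s * q) * (LINT x:K|lborel. osc q (1 / 2 ^ j) F x))
     \<le> 2 * real CARD('n) powr (real CARD('n) + s * q) * enn2real (gagliardo_pow s q V F)"
proof -
  let ?n = "real CARD('n)"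
  define \<beta> where "\<beta> = ?n + s * q"
  have n: "?n \<ge> 1" by (simp add: Suc_leI)
  have \<beta>: "\<beta> \<ge> 1" using n q s by (simp add: \<beta>_def add_increasing2)
  have [measurable]: "V \<in> sets borel" "K \<in> sets borel" "F \<in> borel_measurable borel"
    using V K F by (auto intro: borel_measurable_continuous_onI simp: compact_imp_closed borel_closed)
  let ?A = "\<lambda>j x z. ennreal ((if norm (x - z) \<le> ?n / 2 ^ j then (2 ^ j) powr \<beta> * \<bar>F x - F z\<bar> powr q else 0) * indicator V z * indicator K x)"
  have step: "ennreal ((2 ^ j) powr (s * q) * (LINT x:K|lborel. osc q (1 / 2 ^ j) F x))
      \<le> (\<integral>\<^sup>+x. (\<integral>\<^sup>+z. ?A j x z \<partial>lborel) \<partial>lborel)" if j: "j \<ge> j0" for j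
  proof -
    define t :: real where "t = 1 / 2 ^ j"
    have t: "t > 0" by (simp add: t_def)
    have "ennreal ((2 ^ j) powr (s * q) * (LINT x:K|lborel. osc q t F x))
        = ennreal ((2 ^ j) powr (s * q)) * (\<integral>\<^sup>+x. ennreal (indicator K x * osc q t F x) \<partial>lborel)"
      using nn_integral_compact_eq[OF K continuous_on_osc[OF F, of q]] q osc_nonneg[OF F, of q]
      by (simp add: ennreal_mult')
    also have "\<dots> = (\<integral>\<^sup>+x. ennreal ((2 ^ j) powr (s * q)) * ennreal (indicator K x * osc q t F x) \<partial>lborel)"
      using continuous_on_osc[OF F, of q UNIV t] q
      by (intro nn_integral_cmult[symmetric]) (auto dest: borel_measurable_continuous_onI)
    also have "\<dots> \<le> (\<integral>\<^sup>+x. (\<integral>\<^sup>+z. ?A j x z \<partial>lborel) \<partial>lborel)"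
    proof (rule nn_integral_mono)
      fix x
      show "ennreal ((2 ^ j) powr (s * q)) * ennreal (indicator K x * osc q t F x) \<le> (\<integral>\<^sup>+z. ?A j x z \<partial>lborel)"
      proof (cases "x \<in> K")
        case True
        let ?g = "\<lambda>z. ennreal (indicator unit_cube ((1 / t) *\<^sub>R (x - z)) * \<bar>F z - F x\<bar> powr q)"
        have "ennreal (osc q t F x) = (\<integral>\<^sup>+y. ennreal (indicator unit_cube y * \<bar>F (x - t *\<^sub>R y) - F x\<bar> powr q) \<partial>lborel)"
          unfolding osc_def
          by (rule nn_integral_cbox_eq[symmetric]) (use q in \<open>auto intro!: continuous_on_shift_diff_powr F\<close>)
        also have "\<dots> = (\<integral>\<^sup>+y. ?g (x + (- t) *\<^sub>R y) \<partial>lborel)"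
          using t by simp
        finally have osc: "ennreal (t ^ CARD('n)) * ennreal (osc q t F x) = (\<integral>\<^sup>+z. ?g z \<partial>lborel)"
          using nn_integral_lborel_affine[of ?g "- t" x] t by simp
        \<comment> \<open>The Jacobian \<open>t^n\<close> of the substitution raises the exponent
          from \<open>s * q\<close> to \<open>\<beta> = n + s * q\<close>.\<close>
        have pw: "(2 ^ j) powr (s * q) = (2 ^ j) powr \<beta> * t ^ CARD('n)"
          by (simp add: \<beta>_def powr_add t_def powr_realpow power_divide)
        have "ennreal ((2 ^ j) powr (s * q)) * ennreal (indicator K x * osc q t F x)
            = ennreal ((2 ^ j) powr \<beta>) * (ennreal (t ^ CARD('n)) * ennreal (osc q t F x))"
          unfolding pw using True t by (simp add: ennreal_mult mult.assoc)
        also have "\<dots> = (\<integral>\<^sup>+z. ennreal ((2 ^ j) powr \<beta>) * ?g z \<partial>lborel)"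
          unfolding osc by (rule nn_integral_cmult[symmetric]) measurable
        also have "\<dots> \<le> (\<integral>\<^sup>+z. ?A j x z \<partial>lborel)"
        proof (rule nn_integral_mono)
          fix z
          show "ennreal ((2 ^ j) powr \<beta>) * ?g z \<le> ?A j x z"
          proof (cases "(1 / t) *\<^sub>R (x - z) \<in> unit_cube")
            case in_cube: True
            have "norm ((1 / t) *\<^sub>R (x - z)) \<le> ?n"
              by (rule unit_cube_norm_le[OF in_cube])
            then have "norm (x - z) \<le> ?n / 2 ^ j"
              using t by (simp add: t_def pos_le_divide_eq mult.commute)
            moreover have "z \<in> V"
              using KV[OF True in_cube j] t by (simp add: t_def)
            ultimately show ?thesis
              using in_cube True by (simp add: ennreal_mult' abs_minus_commute)
          qed simp
        qed
        finally show ?thesis .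
      qed simp
    qed
    finally show ?thesis by (simp add: t_def)
  qed
  have meas: "(\<lambda>x. \<integral>\<^sup>+z. ?A j x z \<partial>lborel) \<in> borel_measurable lborel" for j
    by measurable
  have "ennreal (\<Sum>j\<in>{j0..<N}. (2 ^ j) powr (s * q) * (LINT x:K|lborel. osc q (1 / 2 ^ j) F x))
      = (\<Sum>j\<in>{j0..<N}. ennreal ((2 ^ j) powr (s * q) * (LINT x:K|lborel. osc q (1 / 2 ^ j) F x)))"
    using osc_nonneg[OF F, of q] q
    by (intro sum_ennreal[symmetric]) (auto simp: set_lebesgue_integral_def intro!: integral_nonneg_AE mult_nonneg_nonneg)
  also have "\<dots> \<le> (\<Sum>j\<in>{j0..<N}. \<integral>\<^sup>+x. (\<integral>\<^sup>+z. ?A j x z \<partial>lborel) \<partial>lborel)"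
    by (intro sum_mono step) simp
  also have "\<dots> = (\<integral>\<^sup>+x. (\<Sum>j\<in>{j0..<N}. \<integral>\<^sup>+z. ?A j x z \<partial>lborel) \<partial>lborel)"
    by (rule nn_integral_sum[symmetric]) (rule meas)
  also have "\<dots> = (\<integral>\<^sup>+x. (\<integral>\<^sup>+z. (\<Sum>j\<in>{j0..<N}. ?A j x z) \<partial>lborel) \<partial>lborel)"
    by (intro nn_integral_cong nn_integral_sum[symmetric]) measurable
  also have "\<dots> \<le> (\<integral>\<^sup>+x. ennreal (2 * ?n powr \<beta>) * ((\<integral>\<^sup>+z. ennreal (norm (F x - F z) powr q / norm (x - z) powr \<beta>) * indicator V z \<partial>lborel) * indicator V x) \<partial>lborel)"
  proof (rule nn_integral_mono)
    fix x
    have "(\<integral>\<^sup>+z. (\<Sum>j\<in>{j0..<N}. ?A j x z) \<partial>lborel)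
        \<le> (\<integral>\<^sup>+z. ennreal (2 * ?n powr \<beta>) * (ennreal (norm (F x - F z) powr q / norm (x - z) powr \<beta>) * indicator V z * indicator V x) \<partial>lborel)"
    proof (rule nn_integral_mono)
      fix z
      show "(\<Sum>j\<in>{j0..<N}. ?A j x z) \<le> ennreal (2 * ?n powr \<beta>) * (ennreal (norm (F x - F z) powr q / norm (x - z) powr \<beta>) * indicator V z * indicator V x)"
      proof (cases "x \<in> K \<and> z \<in> V")
        case True
        define r where "r = norm (x - z)"
        show ?thesis
        proof (cases "r = 0")
          case True
          then show ?thesis by (simp add: r_def)
        next
          case False
          then have r: "r > 0" by (simp add: r_def)
          \<comment> \<open>For the pair \<open>x\<close>, \<open>z\<close> only the scales with
            \<open>2 ^ j \<le> n / r\<close> contribute; this is where the geometric series is cut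
            off.\<close>
          have le_iff: "r \<le> ?n / 2 ^ j \<longleftrightarrow> 2 ^ j \<le> ?n / r" for j
            using r by (simp add: field_simps)
          let ?a = "\<lambda>j. if 2 ^ j \<le> ?n / r then (2 ^ j) powr \<beta> * \<bar>F x - F z\<bar> powr q else 0"
          have "(\<Sum>j\<in>{j0..<N}. ?a j) \<le> (\<Sum>j<N. ?a j)"
            by (rule sum_mono2) auto
          also have "\<dots> = (\<Sum>j<N. (if 2 ^ j \<le> ?n / r then (2 ^ j) powr \<beta> else 0)) * \<bar>F x - F z\<bar> powr q"
            unfolding sum_distrib_right by (rule sum.cong) auto
          also have "\<dots> \<le> (2 * (?n / r) powr \<beta>) * \<bar>F x - F z\<bar> powr q"
            using sum_dyadic_powr_le[OF \<beta>, of "?n / r" N] r n by (intro mult_right_mono) auto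
          also have "\<dots> = (2 * ?n powr \<beta>) * (norm (F x - F z) powr q / norm (x - z) powr \<beta>)"
            using r by (simp add: powr_divide r_def)
          finally have le: "(\<Sum>j\<in>{j0..<N}. ?a j) \<le> (2 * ?n powr \<beta>) * (norm (F x - F z) powr q / norm (x - z) powr \<beta>)" .
          have "(\<Sum>j\<in>{j0..<N}. ?A j x z) = (\<Sum>j\<in>{j0..<N}. ennreal (?a j))"
            using True by (intro sum.cong) (auto simp: le_iff simp flip: r_def)
          then have "(\<Sum>j\<in>{j0..<N}. ?A j x z) = ennreal (\<Sum>j\<in>{j0..<N}. ?a j)"
            by (simp add: sum_ennreal)
          also have "\<dots> \<le> ennreal ((2 * ?n powr \<beta>) * (norm (F x - F z) powr q / norm (x - z) powr \<beta>))"
            by (rule ennreal_leI[OF le])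
          also have "\<dots> = ennreal (2 * ?n powr \<beta>) * ennreal (norm (F x - F z) powr q / norm (x - z) powr \<beta>)"
            by (rule ennreal_mult') simp
          finally show ?thesis
            using True subsetD[OF KV0, of x] by simp
        qed
      qed (auto simp: indicator_def)
    qed
    also have "\<dots> = ennreal (2 * ?n powr \<beta>) * ((\<integral>\<^sup>+z. ennreal (norm (F x - F z) powr q / norm (x - z) powr \<beta>) * indicator V z \<partial>lborel) * indicator V x)"
      by (simp add: nn_integral_cmult nn_integral_multc)
    finally show "(\<integral>\<^sup>+z. (\<Sum>j\<in>{j0..<N}. ?A j x z) \<partial>lborel) \<le> \<dots>" .
  qed
  also have "\<dots> = ennreal (2 * ?n powr \<beta>) * gagliardo_pow s q V F"
    unfolding gagliardo_pow_lborel \<beta>_def by (rule nn_integral_cmult) measurable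
  also have "\<dots> = ennreal (2 * ?n powr \<beta> * enn2real (gagliardo_pow s q V F))"
    using fin by (simp add: ennreal_mult')
  finally show ?thesis
    by (simp add: \<beta>_def ennreal_le_iff mult_nonneg_nonneg)
qed

section \<open>Weak derivatives of \<open>C\<^sup>1\<close> functions and cutoffs\<close>

lemma test_functions_bump:
  fixes a b :: "real^'n::finite"
  assumes "cbox a b \<subseteq> V" "n > 0"
  shows "bump n a b \<in> test_functions V"
proof -
  have "{x. bump n a b x \<noteq> 0} \<subseteq> cbox a b"
    using bump_eq_0[OF assms(2)] box_subset_cbox by blast
  then have cl: "closure {x. bump n a b x \<noteq> 0} \<subseteq> cbox a b"
    by (rule closure_minimal) (rule closed_cbox)
  then have "compact (closure {x. bump n a b x \<noteq> 0})"
    by (meson bounded_cbox bounded_subset closed_closure compact_eq_bounded_closed)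
  with cl assms(1) show ?thesis
    by (auto simp: test_functions_def smooth_on_def Ck_on_bump)
qed

lemma set_integral_lebesgue_eq:
  fixes f :: "'a::euclidean_space \<Rightarrow> real"
  assumes "compact K" "continuous_on K f"
  shows "set_integrable lebesgue K f" "(LINT x:K|lebesgue. f x) = (LINT x:K|lborel. f x)"
proof -
  have m: "(\<lambda>x. indicator K x *\<^sub>R f x) \<in> borel_measurable lborel"
    using set_integrable_compact[OF assms] by (auto simp: set_integrable_def dest: borel_measurable_integrable)
  show "set_integrable lebesgue K f"
    using set_integrable_compact[OF assms] integrable_completion[OF m] by (simp add: set_integrable_def)
  show "(LINT x:K|lebesgue. f x) = (LINT x:K|lborel. f x)"
    using integral_completion[OF m] by (simp add: set_lebesgue_integral_def)
qed

lemma set_integral_eq_subset: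
  assumes "K \<subseteq> V" "\<And>x. x \<in> V - K \<Longrightarrow> f x = 0"
  shows "(LINT x:V|M. f x) = (LINT x:K|M. f x)"
proof -
  have "(\<lambda>x. indicator V x *\<^sub>R f x) = (\<lambda>x. indicator K x *\<^sub>R f x)"
    using assms by (fastforce simp: fun_eq_iff indicator_def)
  then show ?thesis by (simp add: set_lebesgue_integral_def)
qed

text \<open>Weak and classical integration by parts against the same bump show that
  \<open>G - pd i h\<close> is orthogonal to every bump of the box; as these tend to its indicator,
  the integral over the box vanishes.\<close>

lemma weak_pd_cbox_integral_eq_0:
  fixes h G :: "real^'n::finite \<Rightarrow> real"
  assumes V: "open V" and h: "Ck_on 1 V h" and w: "weak_pd V i h G"
    and G: "set_integrable lebesgue (cbox a b) G" and ab: "cbox a b \<subseteq> V"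
  shows "(LINT x:cbox a b|lebesgue. G x - pd i h x) = 0"
proof -
  let ?B = "cbox a b"
  let ?D = "\<lambda>x. G x - pd i h x"
  have cont: "continuous_on V h" "continuous_on V (pd i h)" and dh: "h differentiable (at x)" if "x \<in> V" for x
    using h that Ck_on_imp_continuous[OF h] by auto
  have conth: "continuous_on ?B h" "continuous_on ?B (pd i h)"
    using h Ck_on_imp_continuous[OF h] ab by (auto intro: continuous_on_subset)
  have D: "set_integrable lebesgue ?B ?D"
    by (intro set_integral_diff G set_integral_lebesgue_eq conth compact_cbox)
  have zero: "(LINT x:?B|lebesgue. bump n a b x * ?D x) = 0" if n: "n > 0" for n
  proof -
    let ?\<phi> = "bump n a b"
    have \<phi>: "Ck_on 1 UNIV ?\<phi>" by (rule Ck_on_bump)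
    then have c\<phi>: "continuous_on S ?\<phi>" "continuous_on S (pd i ?\<phi>)" and d\<phi>: "?\<phi> differentiable (at x)" for x S
      using Ck_on_imp_continuous[OF \<phi>] continuous_on_subset[OF _ subset_UNIV] by (auto intro: continuous_on_subset)
    have \<phi>0: "?\<phi> x = 0" if "x \<notin> ?B" for x
      using bump_eq_0[OF n, of x a b] that box_subset_cbox by blast
    have pd0: "pd i ?\<phi> x = 0" if "x \<notin> ?B" for x
      using pd_cong_open[of "- ?B" x ?\<phi> "\<lambda>_. 0" i] \<phi>0 that by (simp add: open_Compl closed_cbox)
    have "(LINT x:V|lebesgue. pd i ?\<phi> x *\<^sub>R h x) = - (LINT x:V|lebesgue. ?\<phi> x *\<^sub>R G x)"
      using w test_functions_bump[OF ab n] by (simp add: weak_pd_def)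
    then have 1: "(LINT x:?B|lebesgue. pd i ?\<phi> x * h x) = - (LINT x:?B|lebesgue. ?\<phi> x * G x)"
      using set_integral_eq_subset[OF ab, of "\<lambda>x. pd i ?\<phi> x * h x" lebesgue]
        set_integral_eq_subset[OF ab, of "\<lambda>x. ?\<phi> x * G x" lebesgue] \<phi>0 pd0 by simp
    have "(LINT x:?B|lborel. pd i (\<lambda>x. ?\<phi> x * h x) x) = 0"
      using \<phi>0 by (intro set_integral_pd_eq_0[OF V compact_cbox ab] Ck_on_mult V h Ck_on_subset[OF \<phi>]) auto
    moreover have "(LINT x:?B|lborel. pd i (\<lambda>x. ?\<phi> x * h x) x) = (LINT x:?B|lborel. pd i ?\<phi> x * h x + ?\<phi> x * pd i h x)"
      by (rule set_lebesgue_integral_cong) (use ab dh d\<phi> in \<open>auto simp: pd_mult\<close>)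
    moreover have "(LINT x:?B|lborel. pd i ?\<phi> x * h x + ?\<phi> x * pd i h x)
        = (LINT x:?B|lebesgue. pd i ?\<phi> x * h x) + (LINT x:?B|lebesgue. ?\<phi> x * pd i h x)"
      by (subst set_integral_add(2))
        (auto intro!: set_integrable_compact continuous_intros conth c\<phi> simp: set_integral_lebesgue_eq(2)
          conth c\<phi> continuous_on_mult)
    ultimately have 2: "(LINT x:?B|lebesgue. ?\<phi> x * G x) = (LINT x:?B|lebesgue. ?\<phi> x * pd i h x)"
      using 1 by simp
    have iG: "set_integrable lebesgue ?B (\<lambda>x. ?\<phi> x * G x)"
      unfolding set_integrable_def
    proof (rule Bochner_Integration.integrable_bound[OF G[unfolded set_integrable_def]])
      have "(\<lambda>x. indicator ?B x *\<^sub>R G x) \<in> borel_measurable lebesgue"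
        using G by (auto simp: set_integrable_def dest: borel_measurable_integrable)
      moreover have "?\<phi> \<in> borel_measurable lebesgue"
        using borel_measurable_continuous_onI[OF c\<phi>(1)] by (simp add: measurable_completion)
      ultimately have "(\<lambda>x. ?\<phi> x * (indicator ?B x *\<^sub>R G x)) \<in> borel_measurable lebesgue"
        by measurable
      then show "(\<lambda>x. indicator ?B x *\<^sub>R (?\<phi> x * G x)) \<in> borel_measurable lebesgue"
        by (simp add: mult_ac)
      show "AE x in lebesgue. norm (indicator ?B x *\<^sub>R (?\<phi> x * G x)) \<le> norm (indicator ?B x *\<^sub>R G x)"
        using bump_nonneg[of n a b] bump_le_1[of n a b]
        by (auto simp: abs_mult indicator_def intro!: mult_left_le_one_le)
    qed
    have "(LINT x:?B|lebesgue. ?\<phi> x * ?D x) = (LINT x:?B|lebesgue. ?\<phi> x * G x - ?\<phi> x * pd i h x)"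
      by (simp add: right_diff_distrib)
    also have "\<dots> = (LINT x:?B|lebesgue. ?\<phi> x * G x) - (LINT x:?B|lebesgue. ?\<phi> x * pd i h x)"
      by (rule set_integral_diff[OF iG]) (intro set_integral_lebesgue_eq compact_cbox continuous_intros conth c\<phi>)
    finally show ?thesis using 2 by simp
  qed
  have mD: "(\<lambda>x. indicator ?B x *\<^sub>R ?D x) \<in> borel_measurable lebesgue"
    using D by (auto simp: set_integrable_def dest: borel_measurable_integrable)
  have "(\<lambda>n. LINT x|lebesgue. indicator ?B x *\<^sub>R (bump (real (Suc n)) a b x * ?D x))
      \<longlonglongrightarrow> (LINT x|lebesgue. indicator ?B x *\<^sub>R ?D x)"
  proof (rule integral_dominated_convergence[where w = "\<lambda>x. norm (indicator ?B x *\<^sub>R ?D x)"])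
    show "integrable lebesgue (\<lambda>x. norm (indicator ?B x *\<^sub>R ?D x))"
      using D by (simp add: set_integrable_def integrable_norm)
    show "(\<lambda>x. indicator ?B x *\<^sub>R ?D x) \<in> borel_measurable lebesgue" by (rule mD)
    fix n :: nat
    have "continuous_on UNIV (bump (real (Suc n)) a b)"
      by (rule Ck_on_imp_continuous[OF Ck_on_bump])
    then have "bump (real (Suc n)) a b \<in> borel_measurable lebesgue"
      by (simp add: borel_measurable_continuous_onI measurable_completion)
    with mD have "(\<lambda>x. bump (real (Suc n)) a b x * (indicator ?B x *\<^sub>R ?D x)) \<in> borel_measurable lebesgue"
      by measurable
    then show "(\<lambda>x. indicator ?B x *\<^sub>R (bump (real (Suc n)) a b x * ?D x)) \<in> borel_measurable lebesgue"
      by (simp add: mult_ac)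
    show "AE x in lebesgue. norm (indicator ?B x *\<^sub>R (bump (real (Suc n)) a b x * ?D x)) \<le> norm (indicator ?B x *\<^sub>R ?D x)"
      using bump_nonneg[of "real (Suc n)" a b] bump_le_1[of "real (Suc n)" a b]
      by (auto simp: abs_mult indicator_def intro!: mult_left_le_one_le)
  next
    \<comment> \<open>On the boundary of the box the bumps stay 0, but that set is
      negligible.\<close>
    have "negligible (?B - box a b)"
      using negligible_frontier_interval[of a b] by simp
    then have "AE x in lebesgue. x \<notin> ?B - box a b"
      unfolding negligible_iff_null_sets by (rule AE_not_in)
    then show "AE x in lebesgue. (\<lambda>n. indicator ?B x *\<^sub>R (bump (real (Suc n)) a b x * ?D x)) \<longlonglongrightarrow> indicator ?B x *\<^sub>R ?D x"
    proof eventually_elim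
      case (elim x)
      show ?case
      proof (cases "x \<in> box a b")
        case True
        have "(\<lambda>n. bump (real (Suc n)) a b x) \<longlonglongrightarrow> 1"
          using filterlim_compose[OF bump_tendsto_1[OF True] filterlim_compose[OF filterlim_real_sequentially filterlim_Suc]] .
        from tendsto_mult[OF this tendsto_const[of "?D x"]]
        show ?thesis
          by (intro tendsto_scaleR tendsto_const) simp
      next
        case False
        with elim show ?thesis by (simp add: indicator_def)
      qed
    qed
  qed
  moreover have "(LINT x|lebesgue. indicator ?B x *\<^sub>R (bump (real (Suc n)) a b x * ?D x)) = 0" for n
    using zero[of "real (Suc n)"] by (simp add: set_lebesgue_integral_def)
  ultimately have "(LINT x|lebesgue. indicator ?B x *\<^sub>R ?D x) = 0"
    by (simp add: LIMSEQ_const_iff)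
  then show ?thesis by (simp add: set_lebesgue_integral_def)
qed

text \<open>Vanishing integrals over all boxes determine the function by Lebesgue differentiation;
  countably many closed boxes exhaust \<open>V\<close>, so the exceptional sets together remain
  null.\<close>

lemma weak_pd_AE_eq:
  fixes h G :: "real^'n::finite \<Rightarrow> real"
  assumes V: "open V" and h: "Ck_on 1 V h" and w: "weak_pd V i h G"
    and G: "\<And>a b. cbox a b \<subseteq> V \<Longrightarrow> set_integrable lebesgue (cbox a b) G"
  shows "AE x in lebesgue. x \<in> V \<longrightarrow> G x = pd i h x"
proof -
  have loc: "AE x in lebesgue. x \<in> cbox a b \<longrightarrow> G x = pd i h x" if ab: "cbox a b \<subseteq> V" for a b
  proof -
    let ?D = "\<lambda>x. G x - pd i h x"
    define f where "f = (\<lambda>x. if x \<in> cbox a b then ?D x else 0)"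
    have "continuous_on (cbox a b) (pd i h)"
      using h ab by (auto intro: continuous_on_subset)
    then have D: "set_integrable lebesgue (cbox a b) ?D"
      by (intro set_integral_diff G ab set_integral_lebesgue_eq compact_cbox)
    have "f integrable_on cbox c d" for c d
    proof -
      have "set_integrable lebesgue (cbox a b \<inter> cbox c d) ?D"
        by (rule set_integrable_subset[OF D]) (auto simp del: Int_interval)
      then have "?D integrable_on (cbox a b \<inter> cbox c d)"
        by (rule set_lebesgue_integral_eq_integral(1))
      then show ?thesis
        unfolding f_def by (simp add: integrable_restrict_Int)
    qed
    then obtain N where N: "negligible N" "\<And>x e. \<lbrakk>x \<notin> N; 0 < e\<rbrakk> \<Longrightarrow>
        \<exists>d>0. \<forall>h. 0 < h \<and> h < d \<longrightarrow> norm (integral (cbox x (x + h *\<^sub>R One)) f /\<^sub>R h ^ DIM(real^'n) - f x) < e"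
      using integrable_ccontinuous_explicit[of f] by metis
    have zero: "f x = 0" if x: "x \<in> box a b" "x \<notin> N" for x
    proof (rule ccontr)
      assume "f x \<noteq> 0"
      then obtain d where d: "d > 0" "\<And>h. 0 < h \<Longrightarrow> h < d \<Longrightarrow>
          norm (integral (cbox x (x + h *\<^sub>R One)) f /\<^sub>R h ^ DIM(real^'n) - f x) < \<bar>f x\<bar>"
        using N(2)[OF x(2), of "\<bar>f x\<bar>"] by auto
      obtain r where r: "r > 0" "cball x r \<subseteq> box a b"
        using x(1) open_box open_contains_cball by blast
      \<comment> \<open>Small enough for the differentiation theorem, and for the cube with lower
        corner \<open>x\<close> and side \<open>k\<close> to stay within the box.\<close>
      define k where "k = min (d / 2) (r / norm (One :: real^'n))"
      have One: "norm (One :: real^'n) > 0"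
        by (metis One_non_0 zero_less_norm_iff)
      have k: "0 < k" "k < d" using d(1) r(1) One by (auto simp: k_def min_less_iff_disj)
      have kr: "k * norm (One :: real^'n) \<le> r"
        using One by (simp add: k_def min_le_iff_disj flip: pos_le_divide_eq)
      have sub: "cbox x (x + k *\<^sub>R One) \<subseteq> cbox a b"
      proof
        fix y assume y: "y \<in> cbox x (x + k *\<^sub>R One)"
        have "norm (y - x) \<le> norm (k *\<^sub>R (One :: real^'n))"
        proof (rule norm_le_componentwise)
          fix b :: "real^'n" assume b: "b \<in> Basis"
          have "x \<bullet> b \<le> y \<bullet> b" "y \<bullet> b \<le> x \<bullet> b + k * (One \<bullet> b)"
            using y b by (auto simp: mem_box inner_add_left)
          then show "\<bar>(y - x) \<bullet> b\<bar> \<le> \<bar>(k *\<^sub>R One) \<bullet> b\<bar>"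
            by (simp add: inner_diff_left)
        qed
        then have "y \<in> cball x r" using kr k by (simp add: dist_norm norm_minus_commute)
        then show "y \<in> cbox a b" using r(2) box_subset_cbox by blast
      qed
      have "integral (cbox x (x + k *\<^sub>R One)) f = integral (cbox x (x + k *\<^sub>R One)) ?D"
        by (rule integral_cong) (use sub in \<open>auto simp: f_def\<close>)
      also have "\<dots> = (LINT y:cbox x (x + k *\<^sub>R One)|lebesgue. ?D y)"
        by (rule set_lebesgue_integral_eq_integral(2)[symmetric]) (rule set_integrable_subset[OF D _ sub], simp)
      also have "\<dots> = 0"
        by (rule weak_pd_cbox_integral_eq_0[OF V h w]) (use sub ab G in auto)
      finally show False using d(2)[OF k] by simp
    qed
    have "negligible (N \<union> (cbox a b - box a b))"
      using N(1) negligible_frontier_interval[of a b] by (intro negligible_Un) auto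
    then have "AE x in lebesgue. x \<notin> N \<union> (cbox a b - box a b)"
      unfolding negligible_iff_null_sets by (rule AE_not_in)
    then show ?thesis
    proof eventually_elim
      case (elim x)
      show ?case
      proof
        assume x: "x \<in> cbox a b"
        with elim have "f x = 0" by (intro zero) auto
        with x show "G x = pd i h x" by (simp add: f_def)
      qed
    qed
  qed
  obtain \<D> where D: "countable \<D>" "\<And>X. X \<in> \<D> \<Longrightarrow> \<exists>a b. X = cbox a b" "\<Union>\<D> = V"
    using open_countable_Union_open_cbox[OF V] by metis
  have "AE x in lebesgue. \<forall>X\<in>\<D>. x \<in> X \<longrightarrow> G x = pd i h x"
    unfolding AE_ball_countable[OF D(1)]
  proof
    fix X assume X: "X \<in> \<D>"
    then obtain a b where "X = cbox a b" using D(2) by blast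
    moreover have "X \<subseteq> V" using D(3) X by blast
    ultimately show "AE x in lebesgue. x \<in> X \<longrightarrow> G x = pd i h x" using loc by blast
  qed
  then show ?thesis
    by eventually_elim (use D(3) in auto)
qed

text \<open>Taking components commutes with the integral of an integrable function; otherwise the
  vector integral is 0 by convention, while a component may still have a nonzero integral. Hence the
  two integrability assumptions.\<close>

lemma weak_pd_nth:
  fixes h G :: "real^'n::finite \<Rightarrow> real^'m::finite"
  assumes w: "weak_pd V i h G"
    and h: "\<And>\<phi>. \<phi> \<in> test_functions V \<Longrightarrow> set_integrable lebesgue V (\<lambda>x. pd i \<phi> x *\<^sub>R h x)"
    and G: "\<And>\<phi>. \<phi> \<in> test_functions V \<Longrightarrow> set_integrable lebesgue V (\<lambda>x. \<phi> x *\<^sub>R G x)"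
  shows "weak_pd V i (\<lambda>x. h x $ a) (\<lambda>x. G x $ a)"
  unfolding weak_pd_def
proof
  fix \<phi> assume \<phi>: "\<phi> \<in> test_functions V"
  have c: "(LINT x:V|lebesgue. f x) $ a = (LINT x:V|lebesgue. f x $ a)"
    if "set_integrable lebesgue V f" for f :: "real^'n \<Rightarrow> real^'m"
    using integral_bounded_linear[OF bounded_linear_vec_nth that[unfolded set_integrable_def], of a]
    by (simp add: set_lebesgue_integral_def)
  have "(LINT x:V|lebesgue. pd i \<phi> x *\<^sub>R h x) = - (LINT x:V|lebesgue. \<phi> x *\<^sub>R G x)"
    using w \<phi> by (simp add: weak_pd_def)
  then have "(LINT x:V|lebesgue. pd i \<phi> x *\<^sub>R h x) $ a = - (LINT x:V|lebesgue. \<phi> x *\<^sub>R G x) $ a"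
    by simp
  then show "(LINT x:V|lebesgue. pd i \<phi> x *\<^sub>R h x $ a) = - (LINT x:V|lebesgue. \<phi> x *\<^sub>R G x $ a)"
    unfolding c[OF h[OF \<phi>]] c[OF G[OF \<phi>]] by simp
qed

text \<open>On a set of finite measure \<open>L^p\<close> embeds into \<open>L^1\<close>, by
  \<open>t \<le> 1 + t powr p\<close>.\<close>

lemma in_Lp_set_integrable:
  fixes G :: "real^'n::finite \<Rightarrow> 'b::euclidean_space"
  assumes "in_Lp p V G" "p \<ge> 1" and V: "V \<in> sets lebesgue" "emeasure lebesgue V < \<infinity>"
  shows "set_integrable lebesgue V G"
proof -
  have G: "G \<in> borel_measurable (lebesgue_on V)" and fin: "Lp_norm_pow p V G < \<infinity>"
    using assms(1) by (auto simp: in_Lp_def)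
  have m: "(\<lambda>x. indicator V x *\<^sub>R G x) \<in> borel_measurable lebesgue"
    using borel_measurable_restrict_space_iff[of V lebesgue G] V(1) G by simp
  have le: "ennreal (norm (indicator V x *\<^sub>R G x))
      \<le> indicator V x + ennreal (norm (G x) powr p) * indicator V x" for x
  proof (cases "x \<in> V")
    case True
    have "norm (G x) \<le> 1 + norm (G x) powr p"
    proof (cases "norm (G x) \<le> 1")
      case False
      then have "norm (G x) powr 1 \<le> norm (G x) powr p"
        using assms(2) by (intro powr_mono) auto
      then show ?thesis using False by simp
    qed (simp add: add_increasing2)
    then have "ennreal (norm (G x)) \<le> ennreal (1 + norm (G x) powr p)"
      by (rule ennreal_leI)
    then show ?thesis using True by simp
  qed simp
  have "(\<integral>\<^sup>+x. ennreal (norm (indicator V x *\<^sub>R G x)) \<partial>lebesgue)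
      \<le> (\<integral>\<^sup>+x. indicator V x + ennreal (norm (G x) powr p) * indicator V x \<partial>lebesgue)"
    by (rule nn_integral_mono) (rule le)
  also have "\<dots> = emeasure lebesgue V + Lp_norm_pow p V G"
  proof -
    have "(\<lambda>x. ennreal (norm (indicator V x *\<^sub>R G x) powr p)) \<in> borel_measurable lebesgue"
      using m by measurable
    then have "(\<lambda>x. ennreal (norm (indicator V x *\<^sub>R G x) powr p) * indicator V x) \<in> borel_measurable lebesgue"
      using V(1) by measurable
    moreover have "(\<lambda>x. ennreal (norm (indicator V x *\<^sub>R G x) powr p) * indicator V x)
        = (\<lambda>x. ennreal (norm (G x) powr p) * indicator V x)"
      by (auto simp: fun_eq_iff indicator_def)
    ultimately show ?thesis
      using V(1) by (subst nn_integral_add) (auto simp: Lp_norm_pow_def)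
  qed
  also have "\<dots> < \<infinity>" using V(2) fin by simp
  finally show ?thesis
    using m by (simp add: set_integrable_def integrable_iff_bounded)
qed

lemma test_functionsD:
  assumes "\<phi> \<in> test_functions V"
  shows "Ck_on k UNIV \<phi>" "compact (closure {x. \<phi> x \<noteq> 0})" "closure {x. \<phi> x \<noteq> 0} \<subseteq> V"
    "x \<notin> closure {x. \<phi> x \<noteq> 0} \<Longrightarrow> \<phi> x = 0" "x \<notin> closure {x. \<phi> x \<noteq> 0} \<Longrightarrow> pd i \<phi> x = 0"
proof -
  let ?K = "closure {x. \<phi> x \<noteq> 0}"
  show "Ck_on k UNIV \<phi>" "compact ?K" "?K \<subseteq> V"
    using assms by (auto simp: test_functions_def smooth_on_def)
  have 0: "\<phi> y = 0" if "y \<notin> ?K" for y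
    using that closure_subset[of "{x. \<phi> x \<noteq> 0}"] by blast
  then show "x \<notin> ?K \<Longrightarrow> \<phi> x = 0" .
  assume "x \<notin> ?K"
  then have "pd i \<phi> x = pd i (\<lambda>_. 0) x"
    using pd_cong_open[of "- ?K" x \<phi> "\<lambda>_. 0" i] 0 by (metis ComplD ComplI closed_closure open_Compl)
  then show "pd i \<phi> x = 0" by simp
qed

lemma test_function_bounded:
  assumes "\<phi> \<in> test_functions V"
  obtains B where "\<And>x. \<bar>\<phi> x\<bar> \<le> B"
proof -
  let ?K = "closure {x. \<phi> x \<noteq> 0}"
  have "bounded (\<phi> ` ?K)"
    using test_functionsD(1)[OF assms, of 0] test_functionsD(2)[OF assms]
    by (intro compact_imp_bounded compact_continuous_image) (auto intro: continuous_on_subset)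
  then obtain B where "\<And>x. x \<in> ?K \<Longrightarrow> \<bar>\<phi> x\<bar> \<le> B"
    by (auto simp: bounded_iff)
  then have "\<bar>\<phi> x\<bar> \<le> max B 0" for x
    using test_functionsD(4)[OF assms, of x] by (cases "x \<in> ?K") (auto simp: le_max_iff_disj)
  with that show ?thesis by blast
qed

lemma gagliardo_pow_cong_AE:
  assumes "AE x in lebesgue. x \<in> V \<longrightarrow> F x = H x"
  shows "gagliardo_pow s p V F = gagliardo_pow s p V H"
  unfolding gagliardo_pow_def
proof (rule nn_integral_cong_AE)
  show "AE x in lebesgue.
      (\<integral>\<^sup>+y\<in>V. ennreal (norm (F x - F y) powr p / norm (x - y) powr (real CARD('a) + s * p)) \<partial>lebesgue) * indicator V x
    = (\<integral>\<^sup>+y\<in>V. ennreal (norm (H x - H y) powr p / norm (x - y) powr (real CARD('a) + s * p)) \<partial>lebesgue) * indicator V x"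
    using assms
  proof eventually_elim
    case (elim x)
    show ?case
    proof (cases "x \<in> V")
      case True
      have "AE y in lebesgue.
          ennreal (norm (F x - F y) powr p / norm (x - y) powr (real CARD('a) + s * p)) * indicator V y
        = ennreal (norm (H x - H y) powr p / norm (x - y) powr (real CARD('a) + s * p)) * indicator V y"
        using assms by eventually_elim (use elim True in \<open>auto simp: indicator_def\<close>)
      from nn_integral_cong_AE[OF this] show ?thesis by simp
    qed simp
  qed
qed

lemma gagliardo_pow_cong: "(\<And>x. x \<in> V \<Longrightarrow> F x = H x) \<Longrightarrow> gagliardo_pow s p V F = gagliardo_pow s p V H"
  by (rule gagliardo_pow_cong_AE, rule AE_I2) simp

lemma gagliardo_pow_mono:
  assumes "\<And>x y. x \<in> V \<Longrightarrow> y \<in> V \<Longrightarrow> norm (F x - F y) \<le> norm (H x - H y)" "p \<ge> 0"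
  shows "gagliardo_pow s p V F \<le> gagliardo_pow s p V H"
proof -
  have "ennreal (norm (F x - F y) powr p / norm (x - y) powr (real CARD('a) + s * p)) * indicator V y
      \<le> ennreal (norm (H x - H y) powr p / norm (x - y) powr (real CARD('a) + s * p)) * indicator V y"
    if "x \<in> V" for x y
    using assms(1)[OF that, of y] assms(2)
    by (cases "y \<in> V") (simp_all add: ennreal_leI divide_right_mono powr_mono2)
  from nn_integral_mono[OF this]
  have "(\<integral>\<^sup>+y\<in>V. ennreal (norm (F x - F y) powr p / norm (x - y) powr (real CARD('a) + s * p)) \<partial>lebesgue) * indicator V x
      \<le> (\<integral>\<^sup>+y\<in>V. ennreal (norm (H x - H y) powr p / norm (x - y) powr (real CARD('a) + s * p)) \<partial>lebesgue) * indicator V x" for x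
    by (cases "x \<in> V") simp_all
  from nn_integral_mono[OF this] show ?thesis
    unfolding gagliardo_pow_def .
qed

text \<open>The bridge from the Sobolev hypotheses to the estimates. The weak gradient is some
  function, determined up to null sets; for a \<open>C^1\<close> map it agrees almost everywhere
  with the classical gradient, which thus inherits the finite seminorm componentwise.\<close>

theorem in_W1sp_gagliardo_pd:
  fixes h :: "real^'n::finite \<Rightarrow> real^'m::finite"
  assumes W: "in_W1sp s p V h" and V: "open V" "bounded V" and h: "Ck_on 1 V h" and p: "p \<ge> 1"
  shows "gagliardo_pow s p V (\<lambda>x. pd i (\<lambda>x. h x $ a) x) < \<infinity>"
proof -
  obtain G where G: "weak_pd V i h (G i)" "in_Wsp s p V (G i)"
    using W by (auto simp: in_W1sp_def)
  have Vm: "V \<in> sets lebesgue" "emeasure lebesgue V < \<infinity>"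
    using V emeasure_bounded_finite[OF V(2)] by auto
  have intG: "set_integrable lebesgue V (G i)"
    using G(2) p Vm by (intro in_Lp_set_integrable) (auto simp: in_Wsp_def)
  have cont: "continuous_on V h" by (rule Ck_on_imp_continuous[OF h])
  have "weak_pd V i (\<lambda>x. h x $ a) (\<lambda>x. G i x $ a)"
  proof (rule weak_pd_nth[OF G(1)])
    fix \<phi> :: "real^'n \<Rightarrow> real" assume \<phi>: "\<phi> \<in> test_functions V"
    note t = test_functionsD[OF \<phi>]
    let ?K = "closure {x. \<phi> x \<noteq> 0}"
    have c: "continuous_on UNIV \<phi>" "continuous_on UNIV (pd i \<phi>)"
      using t(1)[of 0] t(1)[of 1] by auto
    have "set_integrable lborel ?K (\<lambda>x. pd i \<phi> x *\<^sub>R h x)"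
      using t(2,3) c by (intro set_integrable_compact continuous_intros) (auto intro: continuous_on_subset cont)
    moreover have "(\<lambda>x. indicator ?K x *\<^sub>R (pd i \<phi> x *\<^sub>R h x)) = (\<lambda>x. indicator V x *\<^sub>R (pd i \<phi> x *\<^sub>R h x))"
      using t(3,5) by (fastforce simp: indicator_def fun_eq_iff)
    ultimately show "set_integrable lebesgue V (\<lambda>x. pd i \<phi> x *\<^sub>R h x)"
      by (auto simp: set_integrable_def integrable_completion dest: borel_measurable_integrable)
    obtain B where B: "\<And>x. \<bar>\<phi> x\<bar> \<le> B" using test_function_bounded[OF \<phi>] by blast
    have \<phi>m: "\<phi> \<in> borel_measurable lebesgue"
      using c(1) by (simp add: borel_measurable_continuous_onI measurable_completion)
    show "set_integrable lebesgue V (\<lambda>x. \<phi> x *\<^sub>R G i x)"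
      unfolding set_integrable_def
    proof (rule Bochner_Integration.integrable_bound)
      show "integrable lebesgue (\<lambda>x. B *\<^sub>R (indicator V x *\<^sub>R G i x))"
        by (rule integrable_scaleR_right) (rule intG[unfolded set_integrable_def])
      have "(\<lambda>x. \<phi> x *\<^sub>R (indicator V x *\<^sub>R G i x)) \<in> borel_measurable lebesgue"
        by (rule borel_measurable_scaleR[OF \<phi>m borel_measurable_integrable[OF intG[unfolded set_integrable_def]]])
      then show "(\<lambda>x. indicator V x *\<^sub>R \<phi> x *\<^sub>R G i x) \<in> borel_measurable lebesgue"
        by (simp add: mult.commute)
      show "AE x in lebesgue. norm (indicator V x *\<^sub>R \<phi> x *\<^sub>R G i x) \<le> norm (B *\<^sub>R (indicator V x *\<^sub>R G i x))"
        using order_trans[OF B abs_ge_self] by (auto simp: indicator_def intro!: mult_right_mono)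
    qed
  qed
  moreover have "set_integrable lebesgue (cbox c d) (\<lambda>x. G i x $ a)" if "cbox c d \<subseteq> V" for c d
  proof -
    have "set_integrable lebesgue (cbox c d) (G i)"
      by (rule set_integrable_subset[OF intG _ that]) simp
    from integrable_bounded_linear[OF bounded_linear_vec_nth this[unfolded set_integrable_def], of a]
    show ?thesis by (simp add: set_integrable_def)
  qed
  ultimately have "AE x in lebesgue. x \<in> V \<longrightarrow> G i x $ a = pd i (\<lambda>x. h x $ a) x"
    by (rule weak_pd_AE_eq[OF V(1) Ck_on_nth[OF V(1) h]])
  from gagliardo_pow_cong_AE[OF this]
  have "gagliardo_pow s p V (\<lambda>x. pd i (\<lambda>x. h x $ a) x) = gagliardo_pow s p V (\<lambda>x. G i x $ a)"
    by simp
  also have "\<dots> \<le> gagliardo_pow s p V (G i)"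
    using p by (intro gagliardo_pow_mono) (auto simp flip: vector_minus_component intro: component_le_norm_cart)
  also have "\<dots> < \<infinity>" using G(2) by (simp add: in_Wsp_def)
  finally show ?thesis .
qed

text \<open>A mollified truncated linear function of the distance to \<open>K\<close>. The cutoff
  equals 1 on an open neighbourhood of \<open>K\<close>, so that multiplying by it leaves all
  derivatives there unchanged.\<close>

lemma smooth_cutoff:
  fixes U :: "(real^'n::finite) set"
  assumes "compact K" "open U" "K \<subseteq> U"
  obtains \<zeta> V K' where "\<And>k. Ck_on k UNIV \<zeta>" "open V" "K \<subseteq> V" "V \<subseteq> K'" "compact K'" "K' \<subseteq> U"
    "\<And>x. x \<in> V \<Longrightarrow> \<zeta> x = 1" "\<And>x. x \<notin> K' \<Longrightarrow> \<zeta> x = (0 :: real)"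
proof (cases "K = {}")
  case True
  show ?thesis
    by (rule that[of "\<lambda>_. 0" "{}" "{}"]) (auto simp: True)
next
  case False
  obtain e where e: "e > 0" "{x. infdist x K \<le> e} \<subseteq> U"
    using compact_in_open_separated[OF False assms(1,2,3)] by blast
  define r where "r = e / 4"
  have r: "r > 0" using e by (simp add: r_def)
  \<comment> \<open>Equal to 1 up to distance \<open>2 r\<close> and to 0 beyond \<open>3 r\<close>.
    Mollifying changes the distance by at most \<open>r\<close>, which leaves 1 at distances below
    \<open>r\<close> and 0 beyond \<open>4 r = e\<close>.\<close>
  define f where "f x = max 0 (min 1 (3 - infdist x K / r))" for x
  have contf: "continuous_on UNIV f"
    unfolding f_def using r by (intro continuous_intros continuous_on_infdist) auto
  define t where "t = r / CARD('n)"
  have t: "t > 0" using r by (simp add: t_def)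
  have near: "\<bar>infdist (x - t *\<^sub>R y) K - infdist x K\<bar> \<le> r" if "y \<in> unit_cube" for x y
  proof -
    have "dist (x - t *\<^sub>R y) x \<le> r"
      using mult_left_mono[OF unit_cube_norm_le[OF that], of t] t r by (simp add: dist_norm) (simp add: t_def pos_divide_le_eq)
    moreover have "\<bar>infdist (x - t *\<^sub>R y) K - infdist x K\<bar> \<le> dist (x - t *\<^sub>R y) x"
      by (rule infdist_triangle_abs)
    ultimately show ?thesis by linarith
  qed
  show ?thesis
  proof (rule that[of "reg t f" "{x. infdist x K < r}" "{x. infdist x K \<le> e}"])
    show "Ck_on k UNIV (reg t f)" for k by (rule Ck_on_reg[OF contf t])
    show "open {x. infdist x K < r}"
      by (intro open_Collect_less continuous_intros continuous_on_infdist)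
    show "K \<subseteq> {x. infdist x K < r}" using r by auto
    show "{x. infdist x K < r} \<subseteq> {x. infdist x K \<le> e}" using r by (auto simp: r_def)
    show "compact {x. infdist x K \<le> e}" using assms(1) False using e(1) by (intro compact_infdist_le)
    show "{x. infdist x K \<le> e} \<subseteq> U" by (rule e)
    fix x
    show "reg t f x = 1" if "x \<in> {x. infdist x K < r}"
    proof -
      have "f (x - t *\<^sub>R y) = 1" if "y \<in> unit_cube" for y
      proof -
        have "infdist (x - t *\<^sub>R y) K / r \<le> 2"
          using near[OF that, of x] \<open>x \<in> _\<close> r by (simp add: pos_divide_le_eq)
        then show ?thesis by (simp add: f_def)
      qed
      then have "reg t f x = reg t (\<lambda>_. 1) x" by (intro mol_cong) simp
      then show ?thesis by (simp add: mol_def integral_rho)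
    qed
    show "reg t f x = 0" if "x \<notin> {x. infdist x K \<le> e}"
    proof -
      have "f (x - t *\<^sub>R y) = 0" if "y \<in> unit_cube" for y
      proof -
        have "infdist (x - t *\<^sub>R y) K / r \<ge> 3"
          using abs_le_D2[OF near[OF that, of x]] \<open>x \<notin> _\<close> r by (simp add: pos_le_divide_eq r_def)
        then show ?thesis by (simp add: f_def)
      qed
      then have "reg t f x = reg t (\<lambda>_. 0) x" by (intro mol_cong) simp
      then show ?thesis by (simp add: mol_def)
    qed
  qed
qed

lemma Ck_on_cutoff:
  fixes F \<zeta> :: "real^'n::finite \<Rightarrow> real"
  assumes "Ck_on k UNIV \<zeta>" "open U" "compact K'" "K' \<subseteq> U" "\<And>x. x \<notin> K' \<Longrightarrow> \<zeta> x = 0" "Ck_on k U F"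
  shows "Ck_on k UNIV (\<lambda>x. \<zeta> x * F x)"
proof -
  have "Ck_on k UNIV (\<lambda>x. if x \<in> K' then \<zeta> x * F x else 0)"
    using assms(5) by (intro Ck_on_extend_0[OF assms(2-4)] Ck_on_mult Ck_on_subset[OF assms(1)] assms) auto
  moreover have "(\<lambda>x. if x \<in> K' then \<zeta> x * F x else 0) = (\<lambda>x. \<zeta> x * F x)"
    using assms(5) by auto
  ultimately show ?thesis by simp
qed

section \<open>Exact forms and the Gauss equation for smooth graphs\<close>

text \<open>The coefficient of \<open>dF \<and> dG\<close> with respect to
  \<open>dx\<^sub>1 \<and> dx\<^sub>2\<close>.\<close>

definition wed :: "(real^2 \<Rightarrow> real) \<Rightarrow> (real^2 \<Rightarrow> real) \<Rightarrow> real^2 \<Rightarrow> real" where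
  "wed F G x = pd 1 F x * pd 2 G x - pd 2 F x * pd 1 G x"

lemma Ck_on_wed:
  assumes "open W" "Ck_on (Suc k) W F" "Ck_on (Suc k) W G"
  shows "Ck_on k W (wed F G)"
  unfolding wed_def[abs_def] by (intro Ck_on_diff Ck_on_mult Ck_on_pd assms)

lemma wed_mult_left:
  assumes "F differentiable (at x)" "H differentiable (at x)"
  shows "wed (\<lambda>x. F x * H x) G x = F x * wed H G x + H x * wed F G x"
  by (simp add: wed_def pd_mult[OF assms] algebra_simps)

lemma wed_swap: "wed G F x = - wed F G x"
  by (simp add: wed_def)

text \<open>\<open>dF \<and> dG\<close> is \<open>d(F dG)\<close>, and \<open>F dG\<close> vanishes
  outside \<open>K\<close>. The two derivatives of \<open>G\<close> enter through the symmetry of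
  its Hessian, that is \<open>d(dG) = 0\<close>.\<close>

lemma set_integral_wed_eq_0:
  assumes W: "open W" "compact K" "K \<subseteq> W" and F: "Ck_on 1 W F" "\<And>x. x \<in> W - K \<Longrightarrow> F x = 0"
    and G: "Ck_on 2 W G"
  shows "set_integrable lborel K (wed F G)" "(LINT x:K|lborel. wed F G x) = 0"
proof -
  have G1: "Ck_on 1 W (pd i G)" for i using G by (simp add: numeral_2_eq_2)
  have FG: "Ck_on 1 W (\<lambda>x. F x * pd i G x)" for i by (intro Ck_on_mult W F G1)
  have c: "continuous_on K (pd j (\<lambda>x. F x * pd i G x))" for i j
    by (rule continuous_on_subset[OF Ck_on_imp_continuous[OF Ck_on_pd[OF FG[unfolded One_nat_def]]] W(3)])
  have eq: "wed F G x = pd 1 (\<lambda>x. F x * pd 2 G x) x - pd 2 (\<lambda>x. F x * pd 1 G x) x" if "x \<in> K" for x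
  proof -
    have "F differentiable (at x)" "pd i G differentiable (at x)" for i
      using F(1) G1[of i] that W(3) by auto
    moreover have "pd 1 (pd 2 G) x = pd 2 (pd 1 G) x"
      by (rule pd_commute[OF W(1) _ G]) (use that W(3) in auto)
    ultimately show ?thesis by (simp add: wed_def pd_mult)
  qed
  have z: "(LINT x:K|lborel. pd j (\<lambda>x. F x * pd i G x) x) = 0" for i j
    using F(2) by (intro set_integral_pd_eq_0[OF W FG]) auto
  have i: "set_integrable lborel K (pd j (\<lambda>x. F x * pd i G x))" for i j
    by (rule set_integrable_compact[OF W(2) c])
  show "set_integrable lborel K (wed F G)"
    using set_integral_diff(1)[OF i[of 1 2] i[of 2 1]] eq by (simp cong: set_integrable_cong)
  have "(LINT x:K|lborel. wed F G x) = (LINT x:K|lborel. pd 1 (\<lambda>x. F x * pd 2 G x) x - pd 2 (\<lambda>x. F x * pd 1 G x) x)"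
    using eq W(2) by (intro set_lebesgue_integral_cong) (auto simp: compact_imp_closed)
  also have "\<dots> = 0"
    using set_integral_diff(2)[OF i[of 1 2] i[of 2 1]] by (simp add: z)
  finally show "(LINT x:K|lborel. wed F G x) = 0" .
qed

text \<open>The surface \<open>(z 1, z 2, z 3)\<close> is the graph of a function over the \<open>(z 1, z 2)\<close> plane with gradient
  \<open>(slope z 3 2, slope z 1 3)\<close>, by Cramer's rule for \<open>dz\<^sub>3 = a dz\<^sub>1 + b dz\<^sub>2\<close>.\<close>

definition slope :: "(3 \<Rightarrow> real^2 \<Rightarrow> real) \<Rightarrow> 3 \<Rightarrow> 3 \<Rightarrow> real^2 \<Rightarrow> real" where
  "slope z m n x = wed (z m) (z n) x / wed (z 1) (z 2) x"

definition proj :: "(3 \<Rightarrow> real^2 \<Rightarrow> real) \<Rightarrow> real^2 \<Rightarrow> real^2" where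
  "proj z x = vector [z 1 x, z 2 x]"

text \<open>The integrand of \<open>Det D\<^sup>2f\<close> tested with \<open>\<phi>\<close>, pulled
  back by \<open>proj z\<close>. The Jacobian is taken with its sign, which makes this the
  coefficient of a two-form; on a connected \<open>U\<close> the sign is constant and cancels in the
  end.\<close>

definition hess_form :: "(real^2 \<Rightarrow> real) \<Rightarrow> (3 \<Rightarrow> real^2 \<Rightarrow> real) \<Rightarrow> real^2 \<Rightarrow> real" where
  "hess_form \<phi> z x = (slope z 3 2 x * slope z 1 3 x * pd 1 (pd 2 \<phi>) (proj z x)
     - 1/2 * (slope z 3 2 x)\<^sup>2 * pd 2 (pd 2 \<phi>) (proj z x)
     - 1/2 * (slope z 1 3 x)\<^sup>2 * pd 1 (pd 1 \<phi>) (proj z x)) * wed (z 1) (z 2) x"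

lemma Ck_on_slope:
  assumes "open W" "\<And>a. Ck_on (Suc k) W (z a)" "\<And>x. x \<in> W \<Longrightarrow> wed (z 1) (z 2) x \<noteq> 0"
  shows "Ck_on k W (slope z m n)"
  unfolding slope_def[abs_def] by (intro Ck_on_divide Ck_on_wed assms) auto

lemma pd_z3_eq:
  assumes "wed (z 1) (z 2) x \<noteq> 0"
  shows "pd i (z 3) x = slope z 3 2 x * pd i (z 1) x + slope z 1 3 x * pd i (z 2) x"
proof -
  have "i = 1 \<or> i = 2" using exhaust_2 by blast
  then show ?thesis
    using assms by (auto simp: slope_def wed_def divide_simps) (simp_all add: algebra_simps)
qed

text \<open>\<open>dz\<^sub>3 = a dz\<^sub>1 + b dz\<^sub>2\<close> is differentiated once more. The
  right-hand side is the second fundamental form with respect to the unnormalised normal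
  \<open>(-a, -b, 1)\<close>.\<close>

lemma pd_slope_eq:
  assumes W: "open W" "x \<in> W" and z: "\<And>a. Ck_on 2 W (z a)" and nd: "\<And>x. x \<in> W \<Longrightarrow> wed (z 1) (z 2) x \<noteq> 0"
  shows "pd j (slope z 3 2) x * pd i (z 1) x + pd j (slope z 1 3) x * pd i (z 2) x
    = pd j (pd i (z 3)) x - slope z 3 2 x * pd j (pd i (z 1)) x - slope z 1 3 x * pd j (pd i (z 2)) x"
proof -
  have s: "slope z m n differentiable (at x)" for m n
    using Ck_on_slope[of W "Suc 0" z m n] W z nd by (simp add: numeral_2_eq_2)
  have d: "pd i (z a) differentiable (at x)" for a i
    using z[of a] W by (simp add: numeral_2_eq_2)
  have "pd j (pd i (z 3)) x = pd j (\<lambda>x. slope z 3 2 x * pd i (z 1) x + slope z 1 3 x * pd i (z 2) x) x"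
    by (rule pd_cong_open[OF W]) (rule pd_z3_eq[OF nd])
  also have "\<dots> = pd j (\<lambda>x. slope z 3 2 x * pd i (z 1) x) x + pd j (\<lambda>x. slope z 1 3 x * pd i (z 2) x) x"
    by (intro pd_add differentiable_mult s d)
  finally show ?thesis
    by (simp add: pd_mult s d)
qed

text \<open>The exterior derivative of \<open>dz\<^sub>3 = a dz\<^sub>1 + b dz\<^sub>2\<close>, in
  which the Hessians of the coordinates drop out by symmetry.\<close>

lemma slope_closed:
  assumes W: "open W" "x \<in> W" and z: "\<And>a. Ck_on 2 W (z a)" and nd: "\<And>x. x \<in> W \<Longrightarrow> wed (z 1) (z 2) x \<noteq> 0"
  shows "wed (slope z 3 2) (z 1) x + wed (slope z 1 3) (z 2) x = 0"
proof -
  have "pd 1 (pd 2 (z a)) x = pd 2 (pd 1 (z a)) x" for a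
    by (rule pd_commute[OF W z])
  then show ?thesis
    using pd_slope_eq[OF W z nd, of 1 2] pd_slope_eq[OF W z nd, of 2 1] by (simp add: wed_def)
qed

text \<open>All derivatives of the slopes are removed at once by a pointwise identity: the two
  integrands differ by a combination of exact forms whose primitives vanish outside
  \<open>K\<close>.\<close>

lemma integral_wed_slope_eq:
  fixes z :: "3 \<Rightarrow> real^2 \<Rightarrow> real"
  assumes W: "open W" "compact K" "K \<subseteq> W" and z: "\<And>a. Ck_on 3 W (z a)"
    and nd: "\<And>x. x \<in> W \<Longrightarrow> wed (z 1) (z 2) x \<noteq> 0" and \<phi>: "\<phi> \<in> test_functions V"
    and supp: "\<And>x. x \<in> W - K \<Longrightarrow> proj z x \<notin> closure {y. \<phi> y \<noteq> 0}"
  shows "(LINT x:K|lborel. \<phi> (proj z x) * wed (slope z 3 2) (slope z 1 3) x)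
    = (LINT x:K|lborel. hess_form \<phi> z x)"
proof -
  define a where "a = slope z 3 2"
  define b where "b = slope z 1 3"
  define P where "P = z 1"
  define Q where "Q = z 2"
  define \<psi> where "\<psi> x = \<phi> (proj z x)" for x
  define \<phi>1 where "\<phi>1 x = pd 1 \<phi> (proj z x)" for x
  define \<phi>2 where "\<phi>2 x = pd 2 \<phi> (proj z x)" for x
  have z2: "Ck_on 2 W (z c)" and z1: "Ck_on 1 W (z c)" for c
    by (rule Ck_on_mono[OF z], simp)+
  have z3: "Ck_on (Suc 2) W (z c)" for c using z by (simp del: Ck_on.simps)
  have ab: "Ck_on 2 W a" "Ck_on 2 W b"
    unfolding a_def b_def by (intro Ck_on_slope W z3 nd; assumption)+
  have ab1: "Ck_on 1 W a" "Ck_on 1 W b"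
    by (rule Ck_on_mono[OF ab(1)], simp) (rule Ck_on_mono[OF ab(2)], simp)
  have comp: "Ck_on 1 W (\<lambda>x. F (proj z x))" if "Ck_on 1 UNIV F" for F :: "real^2 \<Rightarrow> real"
    unfolding proj_def by (rule Ck_on_comp_vec2[OF W(1) that z1 z1])
  have \<phi>C: "Ck_on 1 UNIV \<phi>" "Ck_on 1 UNIV (pd i \<phi>)" for i
    using test_functionsD(1)[OF \<phi>, of 1] test_functionsD(1)[OF \<phi>, of "Suc 1"] by auto
  have C1: "Ck_on 1 W \<psi>" "Ck_on 1 W \<phi>1" "Ck_on 1 W \<phi>2"
    unfolding \<psi>_def[abs_def] \<phi>1_def[abs_def] \<phi>2_def[abs_def] by (rule comp[OF \<phi>C(1)], rule comp[OF \<phi>C(2)], rule comp[OF \<phi>C(2)])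
  have supp0: "\<psi> x = 0" "\<phi>1 x = 0" "\<phi>2 x = 0" if "x \<in> W - K" for x
    unfolding \<psi>_def \<phi>1_def \<phi>2_def
    by (rule test_functionsD(4)[OF \<phi> supp[OF that]] test_functionsD(5)[OF \<phi> supp[OF that]])+
  have PQ: "Ck_on 2 W P" "Ck_on 2 W Q" by (simp_all add: P_def Q_def z2)
  note wz = set_integral_wed_eq_0[OF W]
  have F1: "Ck_on 1 W (\<lambda>x. b x * \<psi> x)" "Ck_on 1 W (\<lambda>x. \<phi>1 x * (b x * b x))"
     "Ck_on 1 W (\<lambda>x. \<phi>2 x * (a x * b x))" "Ck_on 1 W (\<lambda>x. \<phi>2 x * (a x * a x))"
    by (intro Ck_on_mult W ab1 C1)+
  have i: "set_integrable lborel K (wed (\<lambda>x. b x * \<psi> x) a)" "set_integrable lborel K (wed (\<lambda>x. \<phi>1 x * (b x * b x)) Q)"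
     "set_integrable lborel K (wed (\<lambda>x. \<phi>2 x * (a x * b x)) Q)" "set_integrable lborel K (wed (\<lambda>x. \<phi>2 x * (a x * a x)) P)"
    by (intro wz F1 ab PQ; simp add: supp0)+
  have z0: "(LINT x:K|lborel. wed (\<lambda>x. b x * \<psi> x) a x) = 0" "(LINT x:K|lborel. wed (\<lambda>x. \<phi>1 x * (b x * b x)) Q x) = 0"
     "(LINT x:K|lborel. wed (\<lambda>x. \<phi>2 x * (a x * b x)) Q x) = 0" "(LINT x:K|lborel. wed (\<lambda>x. \<phi>2 x * (a x * a x)) P x) = 0"
    by (intro wz F1 ab PQ; simp add: supp0)+
  \<comment> \<open>Origin of the terms: \<open>d\<close> is moved off \<open>b\<close>, which gives
    \<open>wed (b \<psi>) a\<close>; the chain rule for \<open>\<psi>\<close> and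
    \<open>slope_closed\<close> leave \<open>b db \<and> dQ\<close>, \<open>d(ab) \<and> dQ\<close>
    and \<open>a da \<and> dP\<close>, from which \<open>d\<close> is moved onto
    \<open>\<phi>1\<close> and \<open>\<phi>2\<close>.\<close>
  let ?E = "\<lambda>x. 1/2 * wed (\<lambda>x. \<phi>1 x * (b x * b x)) Q x - wed (\<lambda>x. b x * \<psi> x) a x
       - wed (\<lambda>x. \<phi>2 x * (a x * b x)) Q x - 1/2 * wed (\<lambda>x. \<phi>2 x * (a x * a x)) P x"
  have key: "\<psi> x * wed a b x - hess_form \<phi> z x = ?E x" if "x \<in> K" for x
  proof -
    have xW: "x \<in> W" using that W(3) by auto
    have d: "a differentiable (at x)" "b differentiable (at x)" "\<psi> differentiable (at x)"
      "\<phi>1 differentiable (at x)" "\<phi>2 differentiable (at x)" "P differentiable (at x)" "Q differentiable (at x)"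
      using ab1 C1 PQ xW by (auto simp: numeral_2_eq_2)
    have cl: "wed a P x + wed b Q x = 0"
      unfolding a_def b_def P_def Q_def by (rule slope_closed[OF W(1) xW z2 nd])
    have dpP: "z 1 differentiable (at x)" "z 2 differentiable (at x)" using d by (auto simp: P_def Q_def)
    have chain: "pd i (\<lambda>x. F (proj z x)) x = pd 1 F (proj z x) * pd i P x + pd 2 F (proj z x) * pd i Q x"
      if "Ck_on 1 UNIV F" for F :: "real^2 \<Rightarrow> real" and i
      unfolding proj_def P_def Q_def using that by (intro pd_comp_vec2 dpP) auto
    have \<psi>i: "pd i \<psi> x = \<phi>1 x * pd i P x + \<phi>2 x * pd i Q x" for i
      unfolding \<psi>_def \<phi>1_def \<phi>2_def by (rule chain[OF \<phi>C(1)])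
    have \<phi>i: "pd i \<phi>1 x = pd 1 (pd 1 \<phi>) (proj z x) * pd i P x + pd 2 (pd 1 \<phi>) (proj z x) * pd i Q x"
      "pd i \<phi>2 x = pd 1 (pd 2 \<phi>) (proj z x) * pd i P x + pd 2 (pd 2 \<phi>) (proj z x) * pd i Q x" for i
      unfolding \<phi>1_def \<phi>2_def by (rule chain[OF \<phi>C(2)])+
    have m: "wed (\<lambda>x. b x * \<psi> x) a x = b x * wed \<psi> a x + \<psi> x * wed b a x"
      "wed (\<lambda>x. \<phi>1 x * (b x * b x)) Q x = \<phi>1 x * (2 * b x * wed b Q x) + (b x * b x) * wed \<phi>1 Q x"
      "wed (\<lambda>x. \<phi>2 x * (a x * b x)) Q x = \<phi>2 x * (a x * wed b Q x + b x * wed a Q x) + (a x * b x) * wed \<phi>2 Q x"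
      "wed (\<lambda>x. \<phi>2 x * (a x * a x)) P x = \<phi>2 x * (2 * a x * wed a P x) + (a x * a x) * wed \<phi>2 P x"
      by (simp_all add: wed_mult_left d)
    have w1: "wed \<psi> a x = - \<phi>1 x * wed a P x - \<phi>2 x * wed a Q x"
      by (simp add: wed_def \<psi>i algebra_simps)
    have w2: "wed \<phi>1 Q x = pd 1 (pd 1 \<phi>) (proj z x) * wed P Q x" "wed \<phi>2 Q x = pd 1 (pd 2 \<phi>) (proj z x) * wed P Q x"
      "wed \<phi>2 P x = - pd 2 (pd 2 \<phi>) (proj z x) * wed P Q x"
      by (simp_all add: wed_def \<phi>i algebra_simps)
    have w3: "wed b Q x = - wed a P x" using cl by simp
    have h: "hess_form \<phi> z x = (a x * b x * pd 1 (pd 2 \<phi>) (proj z x) - 1/2 * (a x)\<^sup>2 * pd 2 (pd 2 \<phi>) (proj z x)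
        - 1/2 * (b x)\<^sup>2 * pd 1 (pd 1 \<phi>) (proj z x)) * wed P Q x"
      by (simp add: hess_form_def a_def b_def P_def Q_def)
    show ?thesis
      unfolding m w1 w2 w3 h wed_swap[of a b] by (simp add: power2_eq_square algebra_simps)
  qed
  have cK: "continuous_on K (\<lambda>x. \<psi> x * wed a b x)"
  proof -
    have "Ck_on 0 W (\<lambda>x. \<psi> x * wed a b x)"
      by (intro Ck_on_mult Ck_on_wed W) (use C1 ab1 Ck_on_mono[of 1 W \<psi> 0] in auto)
    then show ?thesis using W(3) continuous_on_subset by auto
  qed
  have iE: "set_integrable lborel K ?E"
    by (intro set_integral_diff set_integrable_mult_right i)
  have E0: "(LINT x:K|lborel. ?E x) = 0"
    using i z0 by (simp add: set_integral_diff set_integrable_mult_right)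
  have key': "hess_form \<phi> z x = \<psi> x * wed a b x - ?E x" if "x \<in> K" for x
    using key[OF that] by linarith
  have "(LINT x:K|lborel. hess_form \<phi> z x) = (LINT x:K|lborel. \<psi> x * wed a b x - ?E x)"
    by (rule set_lebesgue_integral_cong) (use key' W(2) in \<open>simp_all add: compact_imp_closed borel_closed\<close>)
  also have "\<dots> = (LINT x:K|lborel. \<psi> x * wed a b x) - (LINT x:K|lborel. ?E x)"
    by (rule set_integral_diff(2)[OF set_integrable_compact[OF W(2) cK] iE])
  finally show ?thesis
    unfolding E0 by (simp add: \<psi>_def a_def b_def)
qed

section \<open>Metric, Christoffel symbols and the Gauss equation of a smooth graph\<close>

definition met :: "(3 \<Rightarrow> real^2 \<Rightarrow> real) \<Rightarrow> 2 \<Rightarrow> 2 \<Rightarrow> real^2 \<Rightarrow> real" where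
  "met z i j x = (\<Sum>a\<in>UNIV. pd i (z a) x * pd j (z a) x)"

text \<open>The Christoffel symbols of the first kind, read off from the immersion;
  \<open>christ\<close> obtains the same symbols from the metric alone.\<close>

definition chr :: "(3 \<Rightarrow> real^2 \<Rightarrow> real) \<Rightarrow> 2 \<Rightarrow> 2 \<Rightarrow> 2 \<Rightarrow> real^2 \<Rightarrow> real" where
  "chr z k i j x = (\<Sum>a\<in>UNIV. pd k (z a) x * pd i (pd j (z a)) x)"

text \<open>\<open>christ G k i j\<close> is the Christoffel symbol of the first kind \<open>\<Gamma>\<^sub>k\<^sub>,\<^sub>i\<^sub>j\<close>;
  \<open>quad\<close> is \<open>det g\<close> times \<open>g\<^sup>k\<^sup>l (\<Gamma>\<^sub>k\<^sub>,\<^sub>1\<^sub>1 \<Gamma>\<^sub>l\<^sub>,\<^sub>2\<^sub>2 - \<Gamma>\<^sub>k\<^sub>,\<^sub>1\<^sub>2 \<Gamma>\<^sub>l\<^sub>,\<^sub>1\<^sub>2)\<close>.\<close>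

definition christ :: "(2 \<Rightarrow> 2 \<Rightarrow> real^2 \<Rightarrow> real) \<Rightarrow> 2 \<Rightarrow> 2 \<Rightarrow> 2 \<Rightarrow> real^2 \<Rightarrow> real" where
  "christ G k i j x = 1/2 * (pd i (G j k) x + pd j (G i k) x - pd k (G i j) x)"

definition quad :: "(2 \<Rightarrow> 2 \<Rightarrow> real) \<Rightarrow> (2 \<Rightarrow> 2 \<Rightarrow> 2 \<Rightarrow> real) \<Rightarrow> real" where
  "quad m c = m 2 2 * (c 1 1 1 * c 1 2 2 - (c 1 1 2)\<^sup>2)
     - m 1 2 * (c 1 1 1 * c 2 2 2 + c 2 1 1 * c 1 2 2 - 2 * c 1 1 2 * c 2 1 2)
     + m 1 1 * (c 2 1 1 * c 2 2 2 - (c 2 1 2)\<^sup>2)"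

definition det_met :: "(2 \<Rightarrow> 2 \<Rightarrow> real) \<Rightarrow> real" where
  "det_met m = m 1 1 * m 2 2 - (m 1 2)\<^sup>2"

text \<open>With \<open>e\<^sub>1 = (p1, q1, r1)\<close> and \<open>e\<^sub>2 = (p2, q2, r2)\<close>
  the left-hand side is \<open>det (e\<^sub>1, e\<^sub>2, x) * det (e\<^sub>1, e\<^sub>2,
  y)\<close>, and the right-hand side is the corresponding Gram determinant, expanded.\<close>

lemma gram_identity:
  fixes p1 q1 r1 p2 q2 r2 x1 x2 x3 y1 y2 y3 :: real
  shows "((q1 * r2 - r1 * q2) * x1 + (r1 * p2 - p1 * r2) * x2 + (p1 * q2 - q1 * p2) * x3)
    * ((q1 * r2 - r1 * q2) * y1 + (r1 * p2 - p1 * r2) * y2 + (p1 * q2 - q1 * p2) * y3)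
   = ((p1 * p1 + q1 * q1 + r1 * r1) * (p2 * p2 + q2 * q2 + r2 * r2) - (p1 * p2 + q1 * q2 + r1 * r2)\<^sup>2)
      * (x1 * y1 + x2 * y2 + x3 * y3)
     - ((p2 * p2 + q2 * q2 + r2 * r2) * ((p1 * x1 + q1 * x2 + r1 * x3) * (p1 * y1 + q1 * y2 + r1 * y3))
      - (p1 * p2 + q1 * q2 + r1 * r2) * ((p1 * x1 + q1 * x2 + r1 * x3) * (p2 * y1 + q2 * y2 + r2 * y3)
          + (p2 * x1 + q2 * x2 + r2 * x3) * (p1 * y1 + q1 * y2 + r1 * y3))
      + (p1 * p1 + q1 * q1 + r1 * r1) * ((p2 * x1 + q2 * x2 + r2 * x3) * (p2 * y1 + q2 * y2 + r2 * y3)))"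
  by algebra

lemma pd_sum:
  fixes f :: "'i \<Rightarrow> real^'n::finite \<Rightarrow> real"
  assumes "\<And>i. i \<in> I \<Longrightarrow> f i differentiable (at x)"
  shows "pd k (\<lambda>x. \<Sum>i\<in>I. f i x) x = (\<Sum>i\<in>I. pd k (f i) x)"
  using assms
proof (induction I rule: infinite_finite_induct)
  case (insert i I)
  then show ?case by (simp add: pd_add)
qed auto

lemma det_met_eq:
  "det_met (\<lambda>i j. met z i j x) = (wed (z 2) (z 3) x)\<^sup>2 + (wed (z 3) (z 1) x)\<^sup>2 + (wed (z 1) (z 2) x)\<^sup>2"
  unfolding det_met_def met_def sum_3 wed_def by algebra

lemma chr_eq_christ:
  assumes W: "open W" "x \<in> W" and z: "\<And>a. Ck_on 2 W (z a)"
  shows "chr z k i j x = christ (met z) k i j x"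
proof -
  have d: "pd i (z a) differentiable (at x)" for a i
    using z[of a] W by (simp add: numeral_2_eq_2)
  have c: "pd i (pd j (z a)) x = pd j (pd i (z a)) x" for i j a
    by (rule pd_commute[OF W z])
  have m: "pd i (met z j k) x = (\<Sum>a\<in>UNIV. pd i (pd j (z a)) x * pd k (z a) x + pd j (z a) x * pd i (pd k (z a)) x)" for i j k
    unfolding met_def[abs_def] by (simp add: pd_sum d pd_mult)
  show ?thesis
    unfolding christ_def m chr_def sum_3 c[of i k] c[of j k] c[of j i] by (simp add: algebra_simps)
qed

lemma Ck_on_chr:
  assumes "open W" "\<And>a. Ck_on (Suc (Suc k)) W (z a)"
  shows "Ck_on k W (chr z l i j)"
  unfolding chr_def[abs_def]
  by (intro Ck_on_sum Ck_on_mult assms(1) Ck_on_pd[OF Ck_on_SucD[OF assms(2)]] Ck_on_pd[OF Ck_on_pd[OF assms(2)]])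

text \<open>The third derivatives cancel, which leaves an expression quadratic in the Hessian of the
  immersion.\<close>

lemma curl_chr_eq:
  assumes W: "open W" "x \<in> W" and z: "\<And>a. Ck_on 3 W (z a)"
  shows "pd 1 (chr z 1 2 2) x - pd 2 (chr z 1 1 2) x
    = (\<Sum>a\<in>UNIV. pd 1 (pd 1 (z a)) x * pd 2 (pd 2 (z a)) x - pd 1 (pd 2 (z a)) x * pd 1 (pd 2 (z a)) x)"
proof -
  have z2: "Ck_on 2 W (pd i (z a))" "Ck_on 2 W (z a)" for a i
    using z[of a] Ck_on_mono[OF z[of a], of 2] by (simp_all add: numeral_3_eq_3 numeral_2_eq_2)
  have d: "pd i (z a) differentiable (at x)" "pd i (pd j (z a)) differentiable (at x)" for a i j
    using z[of a] W by (simp_all add: numeral_3_eq_3)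
  have c: "pd 1 (pd 2 (pd 2 (z a))) x = pd 2 (pd 1 (pd 2 (z a))) x" "pd 2 (pd 1 (z a)) x = pd 1 (pd 2 (z a)) x" for a
    by (rule pd_commute[OF W z2(1)], rule pd_commute[OF W z2(2)])
  show ?thesis
    unfolding chr_def[abs_def] by (simp add: pd_sum d pd_mult c sum_subtractf[symmetric])
qed

text \<open>The theorema egregium for graphs. The determinant of the second fundamental form along
  the cross product of the tangent vectors is, by \<open>gram_identity\<close>, the full quadratic
  expression in the Hessian minus its tangential part. By \<open>chr_eq_christ\<close> the
  right-hand side is determined by the metric.\<close>

lemma gauss_smooth:
  assumes W: "open W" "x \<in> W" and z: "\<And>a. Ck_on 3 W (z a)" and nd: "\<And>x. x \<in> W \<Longrightarrow> wed (z 1) (z 2) x \<noteq> 0"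
  shows "(wed (z 1) (z 2) x) ^ 3 * wed (slope z 3 2) (slope z 1 3) x
    = det_met (\<lambda>i j. met z i j x) * (pd 1 (chr z 1 2 2) x - pd 2 (chr z 1 1 2) x)
      - quad (\<lambda>i j. met z i j x) (\<lambda>k i j. chr z k i j x)"
proof -
  have z2: "Ck_on 2 W (z a)" for a by (rule Ck_on_mono[OF z]) simp
  have c: "pd 2 (pd 1 (z a)) x = pd 1 (pd 2 (z a)) x" for a
    by (rule pd_commute[OF W z2])
  define D where "D = wed (z 1) (z 2) x"
  have D: "D \<noteq> 0" unfolding D_def by (rule nd[OF W(2)])
  define e where "e i a = pd i (z a) x" for i a
  define h where "h i j a = pd i (pd j (z a)) x" for i j a
  have h21: "h 2 1 a = h 1 2 a" for a by (simp add: h_def c)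
  define a where "a = slope z 3 2"
  define b where "b = slope z 1 3"
  \<comment> \<open>The Hessian of the immersion tested with the cross product of the two tangent
    vectors: the second fundamental form times the length of that normal.\<close>
  define N where "N i j = (e 1 2 * e 2 3 - e 1 3 * e 2 2) * h i j 1 + (e 1 3 * e 2 1 - e 1 1 * e 2 3) * h i j 2
      + (e 1 1 * e 2 2 - e 1 2 * e 2 1) * h i j 3" for i j
  have aD: "D * a x = e 1 3 * e 2 2 - e 2 3 * e 1 2" "D * b x = e 1 1 * e 2 3 - e 2 1 * e 1 3"
    using D by (simp_all add: a_def b_def slope_def D_def wed_def e_def)
  have De: "D = e 1 1 * e 2 2 - e 2 1 * e 1 2" by (simp add: D_def wed_def e_def)
  have step: "D * (pd j a x * e i 1 + pd j b x * e i 2) = N j i" for i j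
  proof -
    have "D * (pd j a x * e i 1 + pd j b x * e i 2) = D * (h j i 3 - a x * h j i 1 - b x * h j i 2)"
      using pd_slope_eq[OF W z2 nd, of j i] by (simp add: a_def b_def e_def h_def)
    also have "\<dots> = D * h j i 3 - (D * a x) * h j i 1 - (D * b x) * h j i 2"
      by (simp add: algebra_simps)
    also have "\<dots> = N j i" unfolding aD by (simp add: N_def De algebra_simps)
    finally show ?thesis .
  qed
  \<comment> \<open>Of the three factors \<open>D\<close>, one is the determinant of the matrix of
    \<open>dz\<^sub>1\<close>, \<open>dz\<^sub>2\<close>, by which the matrix of \<open>da\<close>,
    \<open>db\<close> is multiplied; the other two convert the products into entries of
    \<open>N\<close> through \<open>step\<close>.\<close>
  have "D ^ 3 * wed a b x = D * (pd 1 a x * e 1 1 + pd 1 b x * e 1 2) * (D * (pd 2 a x * e 2 1 + pd 2 b x * e 2 2))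
      - D * (pd 2 a x * e 1 1 + pd 2 b x * e 1 2) * (D * (pd 1 a x * e 2 1 + pd 1 b x * e 2 2))"
    unfolding wed_def power3_eq_cube by (subst (3) De) (simp add: algebra_simps)
  also have "\<dots> = N 1 1 * N 2 2 - N 2 1 * N 1 2" unfolding step ..
  also have "\<dots> = N 1 1 * N 2 2 - N 1 2 * N 1 2" by (simp add: N_def h21)
  also have "\<dots> = det_met (\<lambda>i j. met z i j x) * (pd 1 (chr z 1 2 2) x - pd 2 (chr z 1 1 2) x)
      - quad (\<lambda>i j. met z i j x) (\<lambda>k i j. chr z k i j x)"
    unfolding curl_chr_eq[OF W z] N_def gram_identity det_met_def quad_def met_def chr_def sum_3
      e_def[symmetric] h_def[symmetric]
    by algebra
  finally show ?thesis by (simp add: D_def a_def b_def)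
qed

section \<open>Bounds up to a uniform constant\<close>

text \<open>A big-O with one constant for all of \<open>I\<close>. Scale, point and later also the
  weight are part of the index, which is how uniformity in them is expressed.\<close>

definition bnd :: "'z set \<Rightarrow> ('z \<Rightarrow> real) \<Rightarrow> ('z \<Rightarrow> real) \<Rightarrow> bool" where
  "bnd I f g \<longleftrightarrow> (\<exists>C. \<forall>z\<in>I. \<bar>f z\<bar> \<le> C * g z)"

lemma bndI: "(\<And>z. z \<in> I \<Longrightarrow> \<bar>f z\<bar> \<le> C * g z) \<Longrightarrow> bnd I f g"
  unfolding bnd_def by blast

lemma bndE:
  assumes "bnd I f g"
  obtains C where "C \<ge> 0" "\<And>z. z \<in> I \<Longrightarrow> \<bar>f z\<bar> \<le> C * \<bar>g z\<bar>"
proof -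
  obtain C where C: "\<And>z. z \<in> I \<Longrightarrow> \<bar>f z\<bar> \<le> C * g z" using assms by (auto simp: bnd_def)
  have "\<bar>f z\<bar> \<le> \<bar>C\<bar> * \<bar>g z\<bar>" if "z \<in> I" for z
    using C[OF that] by (metis abs_ge_self abs_mult order_trans)
  then show ?thesis using that[of "\<bar>C\<bar>"] by simp
qed

lemma bnd_trans:
  assumes "bnd I f g" "bnd I g h"
  shows "bnd I f h"
proof -
  obtain C where C: "C \<ge> 0" "\<And>z. z \<in> I \<Longrightarrow> \<bar>f z\<bar> \<le> C * \<bar>g z\<bar>" using bndE[OF assms(1)] by metis
  obtain D where D: "\<And>z. z \<in> I \<Longrightarrow> \<bar>g z\<bar> \<le> D * h z" using assms(2) by (auto simp: bnd_def)
  have "\<bar>f z\<bar> \<le> (C * D) * h z" if "z \<in> I" for z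
    using C(2)[OF that] mult_left_mono[OF D[OF that] C(1)] by (simp add: mult.assoc)
  then show ?thesis by (rule bndI)
qed

lemma bnd_add:
  assumes "bnd I f h" "bnd I g h"
  shows "bnd I (\<lambda>z. f z + g z) h"
proof -
  obtain C where C: "\<And>z. z \<in> I \<Longrightarrow> \<bar>f z\<bar> \<le> C * h z" using assms(1) by (auto simp: bnd_def)
  obtain D where D: "\<And>z. z \<in> I \<Longrightarrow> \<bar>g z\<bar> \<le> D * h z" using assms(2) by (auto simp: bnd_def)
  have "\<bar>f z + g z\<bar> \<le> (C + D) * h z" if "z \<in> I" for z
    using C[OF that] D[OF that] abs_triangle_ineq[of "f z" "g z"] by (simp add: distrib_right)
  then show ?thesis by (rule bndI)
qed

lemma bnd_minus: "bnd I f h \<Longrightarrow> bnd I (\<lambda>z. - f z) h"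
  by (simp add: bnd_def)

lemma bnd_diff: "bnd I f h \<Longrightarrow> bnd I g h \<Longrightarrow> bnd I (\<lambda>z. f z - g z) h"
  using bnd_add[OF _ bnd_minus, of I f h g] by simp

lemma bnd_mult:
  assumes "bnd I f F" "bnd I g G"
  shows "bnd I (\<lambda>z. f z * g z) (\<lambda>z. F z * G z)"
proof -
  obtain C where C: "\<And>z. z \<in> I \<Longrightarrow> \<bar>f z\<bar> \<le> C * F z" using assms(1) by (auto simp: bnd_def)
  obtain D where D: "\<And>z. z \<in> I \<Longrightarrow> \<bar>g z\<bar> \<le> D * G z" using assms(2) by (auto simp: bnd_def)
  have "\<bar>f z * g z\<bar> \<le> (C * D) * (F z * G z)" if "z \<in> I" for z
    using mult_mono[OF C[OF that] D[OF that]] order_trans[OF abs_ge_zero C[OF that]]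
    by (simp add: abs_mult mult_ac)
  then show ?thesis by (rule bndI)
qed

lemma bnd_mult_1l: "bnd I f (\<lambda>_. 1) \<Longrightarrow> bnd I g G \<Longrightarrow> bnd I (\<lambda>z. f z * g z) G"
  using bnd_mult[of I f "\<lambda>_. 1" g G] by simp

lemma bnd_mult_1r: "bnd I f F \<Longrightarrow> bnd I g (\<lambda>_. 1) \<Longrightarrow> bnd I (\<lambda>z. f z * g z) F"
  using bnd_mult[of I f F g "\<lambda>_. 1"] by simp

lemma bnd_sum:
  assumes "\<And>i. i \<in> A \<Longrightarrow> bnd I (f i) h" "\<And>z. z \<in> I \<Longrightarrow> h z \<ge> 0"
  shows "bnd I (\<lambda>z. \<Sum>i\<in>A. f i z) h"
  using assms(1)
proof (induction A rule: infinite_finite_induct)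
  case (insert x A)
  then show ?case by (simp add: bnd_add)
qed (auto intro!: bndI[of _ _ 1] assms(2))

lemma bnd_mono: "(\<And>z. z \<in> I \<Longrightarrow> \<bar>f z\<bar> \<le> g z) \<Longrightarrow> bnd I f g"
  by (rule bndI[of _ _ 1]) simp

lemma bnd_le:
  assumes "bnd I f g" "\<And>z. z \<in> I \<Longrightarrow> 0 \<le> g z" "\<And>z. z \<in> I \<Longrightarrow> g z \<le> h z"
  shows "bnd I f h"
  by (rule bnd_trans[OF assms(1)]) (rule bnd_mono, simp add: assms(2,3))

lemma bnd_const: "bnd I (\<lambda>_. c) (\<lambda>_. 1)"
  by (rule bndI[of _ _ "\<bar>c\<bar>"]) simp

lemma bnd_cmult: "bnd I f g \<Longrightarrow> bnd I (\<lambda>z. c * f z) g"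
  by (rule bnd_mult_1l[OF bnd_const])

lemma bnd_cong: "(\<And>z. z \<in> I \<Longrightarrow> f z = f' z) \<Longrightarrow> bnd I f g \<longleftrightarrow> bnd I f' g"
  by (simp add: bnd_def)

lemma bnd_subset: "bnd I f g \<Longrightarrow> J \<subseteq> I \<Longrightarrow> bnd J f g"
  unfolding bnd_def by blast

lemma bnd_comp:
  assumes "bnd I f g" "\<And>z. z \<in> J \<Longrightarrow> \<pi> z \<in> I"
  shows "bnd J (\<lambda>z. f (\<pi> z)) (\<lambda>z. g (\<pi> z))"
  using assms unfolding bnd_def by blast

lemma bnd_mult_diff:
  assumes "bnd I (\<lambda>z. f' z - f z) M" "bnd I (\<lambda>z. g' z - g z) M" "bnd I f (\<lambda>_. 1)" "bnd I g' (\<lambda>_. 1)"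
  shows "bnd I (\<lambda>z. f' z * g' z - f z * g z) M"
proof -
  have "bnd I (\<lambda>z. (f' z - f z) * g' z + f z * (g' z - g z)) M"
    by (intro bnd_add bnd_mult_1r[OF assms(1,4)] bnd_mult_1l[OF assms(3,2)])
  then show ?thesis by (simp add: algebra_simps)
qed

lemma compact_integral_tendsto:
  fixes f :: "nat \<Rightarrow> 'a::euclidean_space \<Rightarrow> real"
  assumes K: "compact K" and c: "\<And>j. j \<ge> j0 \<Longrightarrow> continuous_on K (f j)" "continuous_on K g"
    and C: "\<And>j x. j \<ge> j0 \<Longrightarrow> x \<in> K \<Longrightarrow> \<bar>f j x\<bar> \<le> C"
    and lim: "\<And>x. x \<in> K \<Longrightarrow> (\<lambda>j. f j x) \<longlonglongrightarrow> g x"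
  shows "(\<lambda>j. LINT x:K|lborel. f j x) \<longlonglongrightarrow> (LINT x:K|lborel. g x)"
proof -
  have "(\<lambda>j. LINT x|lborel. indicator K x *\<^sub>R f (j + j0) x) \<longlonglongrightarrow> (LINT x|lborel. indicator K x *\<^sub>R g x)"
  proof (rule integral_dominated_convergence[where w = "\<lambda>x. indicator K x *\<^sub>R C"])
    show "(\<lambda>x. indicator K x *\<^sub>R g x) \<in> borel_measurable lborel"
      using set_integrable_compact[OF K c(2)] by (auto simp: set_integrable_def dest: borel_measurable_integrable)
    show "(\<lambda>x. indicator K x *\<^sub>R f (j + j0) x) \<in> borel_measurable lborel" for j
      using set_integrable_compact[OF K c(1)[of "j + j0"]] by (auto simp: set_integrable_def dest: borel_measurable_integrable)
    show "integrable lborel (\<lambda>x. indicator K x *\<^sub>R C)"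
      using borel_integrable_compact[OF K continuous_on_const[of K C]] by simp
    show "AE x in lborel. (\<lambda>j. indicator K x *\<^sub>R f (j + j0) x) \<longlonglongrightarrow> indicator K x *\<^sub>R g x"
    proof (rule AE_I2)
      fix x
      show "(\<lambda>j. indicator K x *\<^sub>R f (j + j0) x) \<longlonglongrightarrow> indicator K x *\<^sub>R g x"
        using LIMSEQ_ignore_initial_segment[OF lim, of x j0] by (cases "x \<in> K") simp_all
    qed
    show "AE x in lborel. norm (indicator K x *\<^sub>R f (j + j0) x) \<le> indicator K x *\<^sub>R C" for j
      using C[of "j + j0"] by (auto simp: indicator_def)
  qed
  then have "(\<lambda>j. LINT x:K|lborel. f (j + j0) x) \<longlonglongrightarrow> (LINT x:K|lborel. g x)"
    by (simp add: set_lebesgue_integral_def)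
  then show ?thesis by (rule LIMSEQ_offset)
qed

section \<open>Mollified graphs\<close>

definition dyadic :: "nat \<Rightarrow> real" where
  "dyadic j = 1 / 2 ^ j"

lemma dyadic_pos: "dyadic j > 0" and dyadic_le_1: "dyadic j \<le> 1"
  by (auto simp: dyadic_def)

lemma dyadic_tendsto_0: "dyadic \<longlonglongrightarrow> 0"
  unfolding dyadic_def[abs_def] by real_asymp

lemma dyadic_Suc: "dyadic (Suc j) = dyadic j / 2"
  by (simp add: dyadic_def)

text \<open>\<open>w\<close> is the immersion after a cutoff, hence defined on the whole plane. On
  \<open>W\<close> the Jacobian of the projected mollified surfaces is bounded below uniformly in
  \<open>j \<ge> j0\<close>, and \<open>K\<close> is meant to contain the supports of the pulled
  back test functions.\<close>

locale mollified_graph =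
  fixes w :: "3 \<Rightarrow> real^2 \<Rightarrow> real" and W K :: "(real^2) set" and c B :: real and j0 :: nat
  assumes w: "Ck_on 1 UNIV (w a)"
    and w_le: "\<bar>w a x\<bar> \<le> B" and pd_w_le: "\<bar>pd i (w a) x\<bar> \<le> B"
    and W: "open W" and K: "compact K" "K \<subseteq> W"
    and c: "c > 0"
    and nd_u: "j \<ge> j0 \<Longrightarrow> x \<in> W \<Longrightarrow> c \<le> \<bar>wed (reg (dyadic j) (w 1)) (reg (dyadic j) (w 2)) x\<bar>"
    and nd_w: "x \<in> W \<Longrightarrow> c \<le> \<bar>wed (w 1) (w 2) x\<bar>"
begin

definition u :: "nat \<Rightarrow> 3 \<Rightarrow> real^2 \<Rightarrow> real" where
  "u j a = reg (dyadic j) (w a)"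

definition Osc :: "real \<Rightarrow> real \<Rightarrow> real^2 \<Rightarrow> real" where
  "Osc q t x = (\<Sum>i\<in>UNIV. \<Sum>a\<in>UNIV. osc q t (pd i (w a)) x)"

definition I :: "(nat \<times> (real^2)) set" where
  "I = {j0..} \<times> W"

definition O1 :: "nat \<times> (real^2) \<Rightarrow> real" where
  "O1 z = Osc 1 (dyadic (fst z)) (snd z)"

text \<open>Two neighbouring scales, because a telescoping step compares \<open>j\<close> with
  \<open>Suc j\<close>.\<close>

definition O12 :: "nat \<times> (real^2) \<Rightarrow> real" where
  "O12 z = Osc 1 (dyadic (fst z)) (snd z) + Osc 1 (dyadic (Suc (fst z))) (snd z)"

lemma cont_w: "continuous_on S (w a)" "continuous_on S (pd i (w a))"
  using w[of a] Ck_on_imp_continuous[OF w[of a]] continuous_on_subset[OF _ subset_UNIV] by auto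

lemma Ck_on_u: "Ck_on k S (u j a)"
  unfolding u_def by (rule Ck_on_subset[OF Ck_on_reg[OF cont_w(1) dyadic_pos] subset_UNIV])

lemma u_diff: "u j a differentiable (at x)" "pd i (u j a) differentiable (at x)"
  using Ck_on_u[of "Suc (Suc 0)" UNIV j a] by auto

lemma wed_u_nz: "j \<ge> j0 \<Longrightarrow> x \<in> W \<Longrightarrow> wed (u j 1) (u j 2) x \<noteq> 0"
  using nd_u[of j x] c unfolding u_def by auto

lemma wed_w_nz: "x \<in> W \<Longrightarrow> wed (w 1) (w 2) x \<noteq> 0"
  using nd_w[of x] c by auto

lemma pd_u: "pd i (u j a) = reg (dyadic j) (pd i (w a))"
  unfolding u_def by (rule ext) (rule pd_mol[OF continuous_on_rho(1) w])

lemma Osc_nonneg: "q > 0 \<Longrightarrow> Osc q t x \<ge> 0"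
  unfolding Osc_def by (intro sum_nonneg osc_nonneg cont_w)

lemma osc_le_Osc: "q > 0 \<Longrightarrow> osc q t (pd i (w a)) x \<le> Osc q t x"
proof -
  assume q: "q > 0"
  have "osc q t (pd i (w a)) x \<le> (\<Sum>a\<in>UNIV. osc q t (pd i (w a)) x)"
    by (rule member_le_sum) (auto intro: osc_nonneg cont_w q)
  also have "\<dots> \<le> Osc q t x"
    unfolding Osc_def by (rule member_le_sum) (auto intro!: sum_nonneg osc_nonneg cont_w q)
  finally show ?thesis .
qed

lemma O1_nonneg: "O1 z \<ge> 0" and O12_nonneg: "O12 z \<ge> 0" and O1_le_O12: "O1 z \<le> O12 z"
  using Osc_nonneg[of 1] by (auto simp: O1_def O12_def)

lemma u_tendsto: "(\<lambda>j. u j a x) \<longlonglongrightarrow> w a x" "(\<lambda>j. pd i (u j a) x) \<longlonglongrightarrow> pd i (w a) x"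
  unfolding pd_u unfolding u_def by (intro reg_tendsto cont_w dyadic_pos dyadic_tendsto_0)+

lemma wed_tendsto: "(\<lambda>j. wed (u j a) (u j b) x) \<longlonglongrightarrow> wed (w a) (w b) x"
  unfolding wed_def by (intro tendsto_intros u_tendsto)

lemma slope_tendsto: "x \<in> W \<Longrightarrow> (\<lambda>j. slope (u j) a b x) \<longlonglongrightarrow> slope w a b x"
  unfolding slope_def by (intro tendsto_intros wed_tendsto wed_w_nz)

lemma cont_wed_w: "continuous_on S (wed (w a) (w b))"
  unfolding wed_def[abs_def] by (intro continuous_intros cont_w)

lemma cont_slope_w: "continuous_on W (slope w a b)"
  unfolding slope_def[abs_def] by (intro continuous_intros cont_wed_w) (auto simp: wed_w_nz)

lemma bnd_pd_u: "bnd I (\<lambda>z. pd i (u (fst z) a) (snd z)) (\<lambda>_. 1)"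
  unfolding pd_u by (rule bndI[of _ _ B]) (simp add: reg_abs_le cont_w pd_w_le)

text \<open>Second derivatives of the mollified maps may be unbounded in \<open>j\<close>, but at
  most at the rate of \<open>2 ^ j\<close> times the oscillation of \<open>Du\<close>; the later
  estimates count such factors.\<close>

lemma bnd_pd2_u: "bnd I (\<lambda>z. pd k (pd i (u (fst z) a)) (snd z)) (\<lambda>z. 2 ^ fst z * O1 z)"
proof (rule bndI[of _ _ "rho_bound TYPE(2)"])
  fix z
  have "\<bar>pd k (pd i (u (fst z) a)) (snd z)\<bar> \<le> rho_bound TYPE(2) / dyadic (fst z) * osc 1 (dyadic (fst z)) (pd i (w a)) (snd z)"
    unfolding pd_u by (rule pd_reg_le[OF cont_w(2) dyadic_pos])
  also have "\<dots> \<le> rho_bound TYPE(2) / dyadic (fst z) * O1 z"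
    unfolding O1_def using rho_bound(1)[where 'n=2] dyadic_pos[of "fst z"] by (intro mult_left_mono osc_le_Osc) auto
  finally show "\<bar>pd k (pd i (u (fst z) a)) (snd z)\<bar> \<le> rho_bound TYPE(2) * (2 ^ fst z * O1 z)"
    by (simp add: dyadic_def)
qed

lemma bnd_pd_u_diff: "bnd I (\<lambda>z. pd i (u (Suc (fst z)) a) (snd z) - pd i (u (fst z) a) (snd z)) O12"
proof (rule bndI[of _ _ "rho_bound TYPE(2)"])
  fix z
  have *: "\<bar>pd i (u j a) x - pd i (w a) x\<bar> \<le> rho_bound TYPE(2) * Osc 1 (dyadic j) x" for j x
  proof -
    have "\<bar>pd i (u j a) x - pd i (w a) x\<bar> \<le> rho_bound TYPE(2) * osc 1 (dyadic j) (pd i (w a)) x"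
      unfolding pd_u by (rule reg_minus_le[OF cont_w(2)])
    also have "\<dots> \<le> rho_bound TYPE(2) * Osc 1 (dyadic j) x"
      using rho_bound(1)[where 'n=2] by (intro mult_left_mono osc_le_Osc) auto
    finally show ?thesis .
  qed
  show "\<bar>pd i (u (Suc (fst z)) a) (snd z) - pd i (u (fst z) a) (snd z)\<bar> \<le> rho_bound TYPE(2) * O12 z"
    using *[of "fst z" "snd z"] *[of "Suc (fst z)" "snd z"] by (simp add: O12_def distrib_left)
qed

lemma bnd_Suc:
  assumes "bnd I (\<lambda>z. f (fst z) (snd z)) (\<lambda>_. 1)"
  shows "bnd I (\<lambda>z. f (Suc (fst z)) (snd z)) (\<lambda>_. 1)"
  using bnd_comp[OF assms, of I "\<lambda>z. (Suc (fst z), snd z)"] by (auto simp: I_def)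

lemma bnd_wed_u: "bnd I (\<lambda>z. wed (u (fst z) a) (u (fst z) b) (snd z)) (\<lambda>_. 1)"
  unfolding wed_def by (intro bnd_diff bnd_mult_1l bnd_pd_u)

lemma bnd_inverse_wed: "bnd I (\<lambda>z. inverse (wed (u (fst z) 1) (u (fst z) 2) (snd z))) (\<lambda>_. 1)"
proof (rule bndI[of _ _ "inverse c"])
  fix z assume "z \<in> I"
  then have "c \<le> \<bar>wed (u (fst z) 1) (u (fst z) 2) (snd z)\<bar>"
    using nd_u[of "fst z" "snd z"] by (auto simp: I_def u_def)
  then show "\<bar>inverse (wed (u (fst z) 1) (u (fst z) 2) (snd z))\<bar> \<le> inverse c * 1"
    using c by (simp add: le_imp_inverse_le)
qed

lemma bnd_slope: "bnd I (\<lambda>z. slope (u (fst z)) a b (snd z)) (\<lambda>_. 1)"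
  unfolding slope_def divide_inverse by (intro bnd_mult_1l bnd_wed_u bnd_inverse_wed)

lemma bnd_wed_u_diff:
  "bnd I (\<lambda>z. wed (u (Suc (fst z)) a) (u (Suc (fst z)) b) (snd z) - wed (u (fst z) a) (u (fst z) b) (snd z)) O12"
proof -
  have m: "bnd I (\<lambda>z. pd i (u (Suc (fst z)) a) (snd z) * pd k (u (Suc (fst z)) b) (snd z)
      - pd i (u (fst z) a) (snd z) * pd k (u (fst z) b) (snd z)) O12" for i k
    by (rule bnd_mult_diff[OF bnd_pd_u_diff bnd_pd_u_diff bnd_pd_u bnd_Suc[OF bnd_pd_u]])
  from bnd_diff[OF m[of 1 2] m[of 2 1]] show ?thesis
    by (simp add: wed_def algebra_simps)
qed

lemma bnd_slope_diff: "bnd I (\<lambda>z. slope (u (Suc (fst z))) a b (snd z) - slope (u (fst z)) a b (snd z)) O12"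
proof -
  let ?D = "\<lambda>j x. wed (u j 1) (u j 2) x"
  have b: "bnd I (\<lambda>z. - ((inverse (?D (Suc (fst z)) (snd z)) * inverse (?D (fst z) (snd z)))
      * (?D (Suc (fst z)) (snd z) - ?D (fst z) (snd z)))) O12"
    by (intro bnd_minus bnd_mult_1l[OF bnd_mult_1l[OF bnd_Suc[OF bnd_inverse_wed] bnd_inverse_wed] bnd_wed_u_diff])
  have eq: "inverse (?D (Suc (fst z)) (snd z)) - inverse (?D (fst z) (snd z))
      = - ((inverse (?D (Suc (fst z)) (snd z)) * inverse (?D (fst z) (snd z)))
      * (?D (Suc (fst z)) (snd z) - ?D (fst z) (snd z)))"
    if "z \<in> I" for z
    using wed_u_nz[of "fst z" "snd z"] wed_u_nz[of "Suc (fst z)" "snd z"] that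
    by (auto simp: I_def field_simps)
  have inv: "bnd I (\<lambda>z. inverse (?D (Suc (fst z)) (snd z)) - inverse (?D (fst z) (snd z))) O12"
    by (subst bnd_cong[OF eq]) (auto intro: b)
  show ?thesis
    unfolding slope_def divide_inverse
    by (rule bnd_mult_diff[OF bnd_wed_u_diff inv bnd_wed_u bnd_Suc[OF bnd_inverse_wed]])
qed

lemma bnd_pd_wed: "bnd I (\<lambda>z. pd k (wed (u (fst z) a) (u (fst z) b)) (snd z)) (\<lambda>z. 2 ^ fst z * O1 z)"
proof -
  have eq: "pd k (wed (u j a) (u j b)) x =
     (pd k (pd 1 (u j a)) x * pd 2 (u j b) x + pd 1 (u j a) x * pd k (pd 2 (u j b)) x)
     - (pd k (pd 2 (u j a)) x * pd 1 (u j b) x + pd 2 (u j a) x * pd k (pd 1 (u j b)) x)" for j x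
    unfolding wed_def[abs_def] by (simp add: pd_diff pd_mult u_diff)
  show ?thesis
    unfolding eq by (intro bnd_diff bnd_add bnd_mult_1l[OF bnd_pd_u bnd_pd2_u] bnd_mult_1r[OF bnd_pd2_u bnd_pd_u])
qed

lemma bnd_pd_inverse_wed:
  "bnd I (\<lambda>z. pd k (\<lambda>x. inverse (wed (u (fst z) 1) (u (fst z) 2) x)) (snd z)) (\<lambda>z. 2 ^ fst z * O1 z)"
proof -
  have "wed (u j a) (u j b) differentiable (at x)" for j a b x
    using Ck_on_wed[OF open_UNIV Ck_on_u Ck_on_u, of "Suc 0"] by simp
  then have eq: "pd k (\<lambda>x. inverse (wed (u (fst z) 1) (u (fst z) 2) x)) (snd z) =
     - (pd k (wed (u (fst z) 1) (u (fst z) 2)) (snd z) * (inverse (wed (u (fst z) 1) (u (fst z) 2) (snd z)) * inverse (wed (u (fst z) 1) (u (fst z) 2) (snd z))))"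
    if "z \<in> I" for z
    using wed_u_nz[of "fst z" "snd z"] that by (subst pd_inverse) (auto simp: I_def)
  show ?thesis
    by (subst bnd_cong[OF eq]) (auto intro!: bnd_minus bnd_mult_1r[OF bnd_pd_wed bnd_mult_1l] bnd_inverse_wed)
qed

lemma wed_u_differentiable: "wed (u j a) (u j b) differentiable (at x)"
  using Ck_on_wed[OF open_UNIV Ck_on_u Ck_on_u, of "Suc 0"] by simp

lemma inverse_wed_differentiable:
  assumes "j \<ge> j0" "x \<in> W"
  shows "(\<lambda>x. inverse (wed (u j 1) (u j 2) x)) differentiable (at x)"
  by (intro differentiable_inverse wed_u_differentiable wed_u_nz assms)

lemma bnd_pd_slope: "bnd I (\<lambda>z. pd k (slope (u (fst z)) a b) (snd z)) (\<lambda>z. 2 ^ fst z * O1 z)"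
proof -
  have eq: "pd k (slope (u (fst z)) a b) (snd z) =
     pd k (wed (u (fst z) a) (u (fst z) b)) (snd z) * inverse (wed (u (fst z) 1) (u (fst z) 2) (snd z))
     + wed (u (fst z) a) (u (fst z) b) (snd z) * pd k (\<lambda>x. inverse (wed (u (fst z) 1) (u (fst z) 2) x)) (snd z)"
    if "z \<in> I" for z
    unfolding slope_def[abs_def] divide_inverse
    by (rule pd_mult) (use that in \<open>auto simp: I_def intro: wed_u_differentiable inverse_wed_differentiable\<close>)
  show ?thesis
    by (subst bnd_cong[OF eq])
      (auto intro!: bnd_add bnd_mult_1r[OF bnd_pd_wed bnd_inverse_wed] bnd_mult_1l[OF bnd_wed_u bnd_pd_inverse_wed])
qed

lemma Ck_on_slope_u: "j \<ge> j0 \<Longrightarrow> Ck_on k W (slope (u j) a b)"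
  by (rule Ck_on_slope[OF W Ck_on_u wed_u_nz])

lemma proj_tendsto: "(\<lambda>j. proj (u j) x) \<longlonglongrightarrow> proj w x"
  unfolding proj_def
proof (rule vec_tendstoI)
  fix i :: 2
  have "i = 1 \<or> i = 2" using exhaust_2 by blast
  then show "(\<lambda>j. (vector [u j 1 x, u j 2 x] :: real^2) $ i) \<longlonglongrightarrow> (vector [w 1 x, w 2 x] :: real^2) $ i"
    using u_tendsto(1) by auto
qed

lemma cont_proj: "continuous_on S (proj (u j))" "continuous_on S (proj w)"
  unfolding proj_def[abs_def]
  by (intro continuous_on_vec2 cont_w Ck_on_imp_continuous[OF Ck_on_u])+

lemma hess_form_integral_tendsto:
  assumes \<phi>: "\<phi> \<in> test_functions V"
    and supp: "\<And>j x. j \<ge> j0 \<Longrightarrow> x \<in> W - K \<Longrightarrow> proj (u j) x \<notin> closure {y. \<phi> y \<noteq> 0}"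
  shows "(\<lambda>j. LINT x:K|lborel. \<phi> (proj (u j) x) * wed (slope (u j) 3 2) (slope (u j) 1 3) x)
    \<longlonglongrightarrow> (LINT x:K|lborel. hess_form \<phi> w x)"
proof -
  have \<phi>2: "continuous_on UNIV (pd i (pd k \<phi>))" for i k
    using test_functionsD(1)[OF \<phi>, of "Suc (Suc 0)"] by simp
  have \<phi>2b: "\<exists>C. \<forall>y. \<bar>pd i (pd k \<phi>) y\<bar> \<le> C" for i k
  proof -
    let ?S = "closure {y. \<phi> y \<noteq> 0}"
    have "bounded (pd i (pd k \<phi>) ` ?S)"
      using test_functionsD(2)[OF \<phi>] \<phi>2
      by (intro compact_imp_bounded compact_continuous_image) (auto intro: continuous_on_subset)
    then obtain C where C: "\<And>y. y \<in> ?S \<Longrightarrow> \<bar>pd i (pd k \<phi>) y\<bar> \<le> C"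
      by (auto simp: bounded_iff)
    have "pd i (pd k \<phi>) y = 0" if "y \<notin> ?S" for y
    proof -
      have "pd i (pd k \<phi>) y = pd i (\<lambda>_. 0) y"
        by (rule pd_cong_open[of "- ?S"]) (use that test_functionsD(5)[OF \<phi>] in auto)
      then show ?thesis by simp
    qed
    then have "\<bar>pd i (pd k \<phi>) y\<bar> \<le> max C 0" for y
      using C[of y] by (cases "y \<in> ?S") (auto simp: le_max_iff_disj)
    then show ?thesis by blast
  qed
  have b\<phi>: "bnd I (\<lambda>z. pd i (pd k \<phi>) (proj (u (fst z)) (snd z))) (\<lambda>_. 1)" for i k
    using \<phi>2b[of i k] unfolding bnd_def by auto
  have "bnd I (\<lambda>z. hess_form \<phi> (u (fst z)) (snd z)) (\<lambda>_. 1)"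
    unfolding hess_form_def power2_eq_square
    by (intro bnd_mult_1l bnd_diff bnd_slope bnd_wed_u b\<phi> bnd_const)
  then obtain C where C: "\<And>z. z \<in> I \<Longrightarrow> \<bar>hess_form \<phi> (u (fst z)) (snd z)\<bar> \<le> C * \<bar>1\<bar>"
    by (rule bndE) blast
  have cs: "continuous_on K (slope w a b)" for a b
    by (rule continuous_on_subset[OF cont_slope_w K(2)])
  have csu: "continuous_on K (slope (u j) a b)" if "j \<ge> j0" for a b j
    by (rule continuous_on_subset[OF Ck_on_imp_continuous[OF Ck_on_slope_u[OF that]] K(2)])
  have cwu: "continuous_on K (wed (u j a) (u j b))" for j a b
    by (rule Ck_on_imp_continuous[of 0]) (rule Ck_on_subset[OF Ck_on_wed[OF open_UNIV Ck_on_u Ck_on_u]], simp)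
  have "(\<lambda>j. LINT x:K|lborel. hess_form \<phi> (u j) x) \<longlonglongrightarrow> (LINT x:K|lborel. hess_form \<phi> w x)"
  proof (rule compact_integral_tendsto[OF K(1)])
    show "continuous_on K (hess_form \<phi> (u j))" if "j \<ge> j0" for j
      unfolding hess_form_def[abs_def]
      by (intro continuous_intros csu[OF that] cwu continuous_on_compose2[OF \<phi>2 cont_proj(1)]) auto
    show "continuous_on K (hess_form \<phi> w)"
      unfolding hess_form_def[abs_def]
      by (intro continuous_intros cs cont_wed_w continuous_on_compose2[OF \<phi>2 cont_proj(2)]) auto
    show "\<bar>hess_form \<phi> (u j) x\<bar> \<le> C" if "j \<ge> j0" "x \<in> K" for j x
      using C[of "(j, x)"] that K(2) by (auto simp: I_def)
    fix x assume "x \<in> K"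
    then have xW: "x \<in> W" using K(2) by auto
    have "isCont (pd i (pd k \<phi>)) (proj w x)" for i k
      using \<phi>2[of i k] by (simp add: continuous_on_eq_continuous_at)
    from isCont_tendsto_compose[OF this proj_tendsto]
    have l: "(\<lambda>j. pd i (pd k \<phi>) (proj (u j) x)) \<longlonglongrightarrow> pd i (pd k \<phi>) (proj w x)" for i k .
    show "(\<lambda>j. hess_form \<phi> (u j) x) \<longlonglongrightarrow> hess_form \<phi> w x"
      unfolding hess_form_def by (intro tendsto_intros slope_tendsto[OF xW] wed_tendsto l)
  qed
  moreover have "\<forall>\<^sub>F j in sequentially. (LINT x:K|lborel. hess_form \<phi> (u j) x)
      = (LINT x:K|lborel. \<phi> (proj (u j) x) * wed (slope (u j) 3 2) (slope (u j) 1 3) x)"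
    using eventually_ge_at_top[of j0]
  proof eventually_elim
    case (elim j)
    show ?case
      by (rule integral_wed_slope_eq[OF W K Ck_on_u wed_u_nz[OF elim] \<phi> supp[OF elim], symmetric])
  qed
  ultimately show ?thesis
    by (rule Lim_transform_eventually)
qed

end

text \<open>The product is \<open>t + M + M^2 / t + M^3 / t^2\<close>, and each middle term is
  dominated by one of the outer ones, according to whether \<open>M \<le> t\<close>. Here
  \<open>t\<close> stands for the scale and \<open>M\<close> for the cubic mean of the
  oscillation.\<close>

lemma cubic_error_le:
  fixes t M :: real
  assumes "t > 0" "M \<ge> 0"
  shows "(t + M\<^sup>2 / t) * (1 + M / t) \<le> 4 * (t + M ^ 3 / t\<^sup>2)"
proof -
  have e: "(t + M\<^sup>2 / t) * (1 + M / t) = t + M + M\<^sup>2 / t + M ^ 3 / t\<^sup>2"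
    using assms(1) by (simp add: field_simps power2_eq_square power3_eq_cube)
  have nn: "M ^ 3 / t\<^sup>2 \<ge> 0" using assms by simp
  have 1: "M \<le> t + M ^ 3 / t\<^sup>2"
  proof (cases "M \<le> t")
    case False
    then have "M * t\<^sup>2 \<le> M * M\<^sup>2" using assms by (intro mult_left_mono power_mono) auto
    then have "M \<le> M ^ 3 / t\<^sup>2"
      using assms(1) by (simp add: pos_le_divide_eq power3_eq_cube power2_eq_square mult.assoc)
    then show ?thesis using assms(1) by simp
  qed (use nn in simp)
  have 2: "M\<^sup>2 / t \<le> t + M ^ 3 / t\<^sup>2"
  proof (cases "M \<le> t")
    case True
    then have "M\<^sup>2 \<le> t\<^sup>2" using assms by (intro power_mono) auto
    then have "M\<^sup>2 / t \<le> t" using assms(1) by (simp add: pos_divide_le_eq power2_eq_square)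
    then show ?thesis using nn by simp
  next
    case False
    then have "M\<^sup>2 * t \<le> M\<^sup>2 * M" using assms by (intro mult_left_mono) auto
    then have "M\<^sup>2 / t \<le> M ^ 3 / t\<^sup>2"
      using assms(1) by (simp add: field_simps power2_eq_square power3_eq_cube)
    then show ?thesis using assms(1) by simp
  qed
  show ?thesis unfolding e using 1 2 nn assms(1) by simp
qed

section \<open>Weights of controlled gradient and the cubic error\<close>

context mollified_graph
begin

definition IK :: "(nat \<times> (real^2)) set" where
  "IK = {j0..} \<times> K"

lemma IK_subset: "IK \<subseteq> I"
  using K(2) by (auto simp: IK_def I_def)

text \<open>A class closed under sums and products that holds the pulled back test functions and the
  coefficients made from first derivatives of \<open>u j\<close>. The gradient may grow like a
  second derivative of \<open>u j\<close>; the summand 1 admits weights of bounded gradient.\<close>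

definition tame :: "(nat \<Rightarrow> real^2 \<Rightarrow> real) \<Rightarrow> bool" where
  "tame f \<longleftrightarrow> (\<forall>j\<ge>j0. Ck_on 1 W (f j)) \<and> bnd I (\<lambda>z. f (fst z) (snd z)) (\<lambda>_. 1)
     \<and> (\<forall>k. bnd I (\<lambda>z. pd k (f (fst z)) (snd z)) (\<lambda>z. 1 + 2 ^ fst z * O1 z))"

lemma tameD:
  assumes "tame f"
  shows "j \<ge> j0 \<Longrightarrow> Ck_on 1 W (f j)" "bnd I (\<lambda>z. f (fst z) (snd z)) (\<lambda>_. 1)"
    "bnd I (\<lambda>z. pd k (f (fst z)) (snd z)) (\<lambda>z. 1 + 2 ^ fst z * O1 z)"
    "j \<ge> j0 \<Longrightarrow> x \<in> W \<Longrightarrow> f j differentiable (at x)"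
  using assms unfolding tame_def by auto

lemma tame_mult:
  assumes "tame f" "tame g"
  shows "tame (\<lambda>j x. f j x * g j x)"
  unfolding tame_def
proof (intro conjI allI impI)
  show "Ck_on 1 W (\<lambda>x. f j x * g j x)" if "j \<ge> j0" for j
    by (intro Ck_on_mult W tameD(1)[OF assms(1)] tameD(1)[OF assms(2)] that)
  show "bnd I (\<lambda>z. f (fst z) (snd z) * g (fst z) (snd z)) (\<lambda>_. 1)"
    by (rule bnd_mult_1l[OF tameD(2)[OF assms(1)] tameD(2)[OF assms(2)]])
  fix k
  have eq: "pd k (\<lambda>x. f (fst z) x * g (fst z) x) (snd z)
      = pd k (f (fst z)) (snd z) * g (fst z) (snd z) + f (fst z) (snd z) * pd k (g (fst z)) (snd z)" if "z \<in> I" for z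
    using that by (intro pd_mult tameD(4)[OF assms(1)] tameD(4)[OF assms(2)]) (auto simp: I_def)
  show "bnd I (\<lambda>z. pd k (\<lambda>x. f (fst z) x * g (fst z) x) (snd z)) (\<lambda>z. 1 + 2 ^ fst z * O1 z)"
    by (subst bnd_cong[OF eq], assumption)
      (intro bnd_add bnd_mult_1r[OF tameD(3)[OF assms(1)] tameD(2)[OF assms(2)]]
        bnd_mult_1l[OF tameD(2)[OF assms(1)] tameD(3)[OF assms(2)]])
qed

lemma tame_add:
  assumes "tame f" "tame g"
  shows "tame (\<lambda>j x. f j x + g j x)"
  unfolding tame_def
proof (intro conjI allI impI)
  show "Ck_on 1 W (\<lambda>x. f j x + g j x)" if "j \<ge> j0" for j
    by (intro Ck_on_add W tameD(1)[OF assms(1)] tameD(1)[OF assms(2)] that)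
  show "bnd I (\<lambda>z. f (fst z) (snd z) + g (fst z) (snd z)) (\<lambda>_. 1)"
    by (rule bnd_add[OF tameD(2)[OF assms(1)] tameD(2)[OF assms(2)]])
  fix k
  have eq: "pd k (\<lambda>x. f (fst z) x + g (fst z) x) (snd z)
      = pd k (f (fst z)) (snd z) + pd k (g (fst z)) (snd z)" if "z \<in> I" for z
    using that by (intro pd_add tameD(4)[OF assms(1)] tameD(4)[OF assms(2)]) (auto simp: I_def)
  show "bnd I (\<lambda>z. pd k (\<lambda>x. f (fst z) x + g (fst z) x) (snd z)) (\<lambda>z. 1 + 2 ^ fst z * O1 z)"
    by (subst bnd_cong[OF eq], assumption) (intro bnd_add tameD(3)[OF assms(1)] tameD(3)[OF assms(2)])
qed

lemma bnd_1_plus: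
  assumes "bnd I f (\<lambda>z. 2 ^ fst z * O1 z)"
  shows "bnd I f (\<lambda>z. 1 + 2 ^ fst z * O1 z)"
  by (rule bnd_le[OF assms]) (simp_all add: O1_nonneg)

lemma tame_wed: "tame (\<lambda>j. wed (u j a) (u j b))"
  unfolding tame_def
  by (intro conjI allI impI bnd_wed_u bnd_1_plus[OF bnd_pd_wed] Ck_on_wed[OF W] Ck_on_u)

lemma tame_inverse_wed: "tame (\<lambda>j x. inverse (wed (u j 1) (u j 2) x))"
  unfolding tame_def
  by (intro conjI allI impI bnd_inverse_wed bnd_1_plus[OF bnd_pd_inverse_wed] Ck_on_inverse W Ck_on_wed[OF W] Ck_on_u wed_u_nz)

text \<open>The size of the error in the first derivatives of the mollified metric:
  \<open>dyadic\<close> comes from mollifying a smooth metric, the other term from the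
  commutator.\<close>

definition E2 :: "nat \<times> (real^2) \<Rightarrow> real" where
  "E2 z = dyadic (fst z) + 2 ^ fst z * Osc 2 (dyadic (fst z)) (snd z)"

text \<open>The size of the error after multiplication by one more derivative. The integral of the
  second term is a dyadic term of the \<open>W^{2/3,3}\<close> seminorm, since
  \<open>2/3 * 3 = 2\<close>.\<close>

definition E3 :: "nat \<times> (real^2) \<Rightarrow> real" where
  "E3 z = dyadic (fst z) + (2 ^ fst z)\<^sup>2 * Osc 3 (dyadic (fst z)) (snd z)"

lemma E3_nonneg: "E3 z \<ge> 0"
  using Osc_nonneg[of 3] dyadic_pos by (simp add: E3_def less_imp_le)

lemma bnd_O1_Osc3: "bnd I O1 (\<lambda>z. Osc 3 (dyadic (fst z)) (snd z) powr (1/3))"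
  unfolding O1_def Osc_def[of 1]
proof (intro bnd_sum)
  fix i a
  let ?V = "cube_vol TYPE(2)"
  show "bnd I (\<lambda>z. osc 1 (dyadic (fst z)) (pd i (w a)) (snd z)) (\<lambda>z. Osc 3 (dyadic (fst z)) (snd z) powr (1/3))"
  proof (rule bndI[of _ _ "(?V powr 2) powr (1/3)"])
    fix z
    let ?o = "\<lambda>q. osc q (dyadic (fst z)) (pd i (w a)) (snd z)"
    have "?o 1 = (?o 1 powr 3) powr (1/3)"
      using osc_nonneg[OF cont_w(2), of 1] by (simp add: powr_powr del: powr_numeral)
    also have "\<dots> \<le> (?V powr 2 * Osc 3 (dyadic (fst z)) (snd z)) powr (1/3)"
    proof (rule powr_mono2)
      have "?o 1 powr 3 \<le> ?V powr 2 * ?o 3"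
        using osc_1_powr_le[OF cont_w(2), of 3] by simp
      also have "\<dots> \<le> ?V powr 2 * Osc 3 (dyadic (fst z)) (snd z)"
        by (intro mult_left_mono osc_le_Osc) auto
      finally show "?o 1 powr 3 \<le> ?V powr 2 * Osc 3 (dyadic (fst z)) (snd z)" .
    qed auto
    also have "\<dots> = (?V powr 2) powr (1/3) * Osc 3 (dyadic (fst z)) (snd z) powr (1/3)"
      using Osc_nonneg[of 3] by (simp add: powr_mult)
    finally show "\<bar>?o 1\<bar> \<le> (?V powr 2) powr (1/3) * Osc 3 (dyadic (fst z)) (snd z) powr (1/3)"
      using osc_nonneg[OF cont_w(2), of 1] by simp
  qed
qed auto

lemma bnd_Osc2_Osc3: "bnd I (\<lambda>z. Osc 2 (dyadic (fst z)) (snd z)) (\<lambda>z. (Osc 3 (dyadic (fst z)) (snd z) powr (1/3))\<^sup>2)"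
  unfolding Osc_def[of 2]
proof (intro bnd_sum)
  fix i a
  let ?V = "cube_vol TYPE(2)"
  show "bnd I (\<lambda>z. osc 2 (dyadic (fst z)) (pd i (w a)) (snd z)) (\<lambda>z. (Osc 3 (dyadic (fst z)) (snd z) powr (1/3))\<^sup>2)"
  proof (rule bndI[of _ _ "(?V powr (1/2)) powr (2/3)"])
    fix z
    let ?o = "\<lambda>q. osc q (dyadic (fst z)) (pd i (w a)) (snd z)"
    have "?o 2 = (?o 2 powr (3/2)) powr (2/3)"
      using osc_nonneg[OF cont_w(2), of 2] by (simp add: powr_powr)
    also have "\<dots> \<le> (?V powr (1/2) * Osc 3 (dyadic (fst z)) (snd z)) powr (2/3)"
    proof (rule powr_mono2)
      have "?o 2 powr (3/2) \<le> ?V powr (1/2) * ?o 3"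
        by (rule osc_2_powr_le[OF cont_w(2)])
      also have "\<dots> \<le> ?V powr (1/2) * Osc 3 (dyadic (fst z)) (snd z)"
        by (intro mult_left_mono osc_le_Osc) auto
      finally show "?o 2 powr (3/2) \<le> ?V powr (1/2) * Osc 3 (dyadic (fst z)) (snd z)" .
    qed auto
    also have "\<dots> = (?V powr (1/2)) powr (2/3) * Osc 3 (dyadic (fst z)) (snd z) powr (2/3)"
      using Osc_nonneg[of 3] by (simp add: powr_mult)
    also have "Osc 3 (dyadic (fst z)) (snd z) powr (2/3) = (Osc 3 (dyadic (fst z)) (snd z) powr (1/3))\<^sup>2"
      by (simp add: power2_eq_square flip: powr_add)
    finally show "\<bar>?o 2\<bar> \<le> (?V powr (1/2)) powr (2/3) * (Osc 3 (dyadic (fst z)) (snd z) powr (1/3))\<^sup>2"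
      using osc_nonneg[OF cont_w(2), of 2] by simp
  qed
qed auto

text \<open>All oscillations are first expressed by the cube root of \<open>Osc 3\<close>, so that
  \<open>cubic_error_le\<close> applies at each scale with \<open>t = 2^-j\<close>.\<close>

lemma bnd_E3:
  assumes "bnd I f E2" "bnd I g (\<lambda>z. 1 + 2 ^ fst z * O1 z)"
  shows "bnd I (\<lambda>z. f z * g z) E3"
proof -
  let ?M = "\<lambda>z. Osc 3 (dyadic (fst z)) (snd z) powr (1/3)"
  let ?A = "\<lambda>z. dyadic (fst z) + (?M z)\<^sup>2 / dyadic (fst z)"
  let ?B = "\<lambda>z. 1 + ?M z / dyadic (fst z)"
  have sc: "2 ^ j = 1 / dyadic j" for j by (simp add: dyadic_def)
  have "bnd I E2 ?A"
    unfolding E2_def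
  proof (rule bnd_add)
    show "bnd I (\<lambda>z. dyadic (fst z)) ?A"
      by (rule bnd_mono) (simp add: dyadic_pos less_imp_le)
    have "bnd I (\<lambda>z. 2 ^ fst z * Osc 2 (dyadic (fst z)) (snd z)) (\<lambda>z. 2 ^ fst z * (?M z)\<^sup>2)"
      by (intro bnd_mult bnd_Osc2_Osc3 bnd_mono) auto
    then show "bnd I (\<lambda>z. 2 ^ fst z * Osc 2 (dyadic (fst z)) (snd z)) ?A"
      by (rule bnd_le) (simp_all add: sc dyadic_pos less_imp_le)
  qed
  then have f: "bnd I f ?A" by (rule bnd_trans[OF assms(1)])
  have "bnd I (\<lambda>z. 1 + 2 ^ fst z * O1 z) ?B"
  proof (rule bnd_add)
    show "bnd I (\<lambda>z. 1) ?B"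
      by (rule bnd_mono) (simp add: dyadic_pos less_imp_le)
    have "bnd I (\<lambda>z. 2 ^ fst z * O1 z) (\<lambda>z. 2 ^ fst z * ?M z)"
      by (intro bnd_mult bnd_O1_Osc3 bnd_mono) auto
    then show "bnd I (\<lambda>z. 2 ^ fst z * O1 z) ?B"
      by (rule bnd_le) (simp_all add: sc dyadic_pos less_imp_le)
  qed
  then have g: "bnd I g ?B" by (rule bnd_trans[OF assms(2)])
  have "bnd I (\<lambda>z. ?A z * ?B z) E3"
  proof (rule bndI[of _ _ 4])
    fix z
    have M: "?M z ^ 3 = Osc 3 (dyadic (fst z)) (snd z)"
      using Osc_nonneg[of 3 "dyadic (fst z)" "snd z"] by (simp add: powr_powr flip: powr_numeral)
    have "?A z * ?B z \<ge> 0"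
      using dyadic_pos[of "fst z"] by (intro mult_nonneg_nonneg add_nonneg_nonneg divide_nonneg_pos) auto
    then show "\<bar>?A z * ?B z\<bar> \<le> 4 * E3 z"
      using cubic_error_le[OF dyadic_pos[of "fst z"], of "?M z"] unfolding M
      by (simp add: E3_def sc power_divide)
  qed
  then show ?thesis by (rule bnd_trans[OF bnd_mult[OF f g]])
qed

lemma bnd_E2_imp_E3: "bnd I f E2 \<Longrightarrow> bnd I f E3"
  using bnd_E3[of f "\<lambda>_. 1"] bnd_mono[of I "\<lambda>_. 1" "\<lambda>z. 1 + 2 ^ fst z * O1 z"] by (simp add: O1_nonneg)

lemma continuous_on_Osc: "q > 0 \<Longrightarrow> continuous_on S (Osc q t)"
  unfolding Osc_def[abs_def] by (intro continuous_intros continuous_on_osc cont_w)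

text \<open>The exponents leave no spare power of \<open>2^-j\<close>: the cubic term tends to 0 by
  the hypothesis \<open>gag\<close>, not by a rate.\<close>

lemma E3_integral_tendsto_0:
  assumes f: "bnd IK (\<lambda>z. f (fst z) (snd z)) E3" and cf: "\<And>j. j \<ge> j0 \<Longrightarrow> continuous_on K (f j)"
    and gag: "(\<lambda>j. (2 ^ j)\<^sup>2 * (LINT x:K|lborel. Osc 3 (dyadic j) x)) \<longlonglongrightarrow> 0"
  shows "(\<lambda>j. LINT x:K|lborel. f j x) \<longlonglongrightarrow> 0"
proof -
  obtain C where C0: "C \<ge> 0" "\<And>z. z \<in> IK \<Longrightarrow> \<bar>f (fst z) (snd z)\<bar> \<le> C * \<bar>E3 z\<bar>"
    by (rule bndE[OF f]) blast
  have C: "\<bar>f j x\<bar> \<le> C * E3 (j, x)" if "j \<ge> j0" "x \<in> K" for j x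
    using C0(2)[of "(j, x)"] that E3_nonneg[of "(j, x)"] by (simp add: IK_def)
  have c3: "continuous_on K (\<lambda>x. E3 (j, x))" for j
    unfolding E3_def fst_conv snd_conv by (intro continuous_intros continuous_on_Osc) auto
  have le: "norm (LINT x:K|lborel. f j x) \<le> C * (dyadic j * measure lborel K + (2 ^ j)\<^sup>2 * (LINT x:K|lborel. Osc 3 (dyadic j) x))"
    if j: "j \<ge> j0" for j
  proof -
    have "norm (LINT x:K|lborel. f j x) \<le> (LINT x:K|lborel. norm (f j x))"
      by (rule set_integral_norm_bound[OF set_integrable_compact[OF K(1) cf[OF j]]])
    also have "\<dots> \<le> (LINT x:K|lborel. C * E3 (j, x))"
      using C[OF j] by (intro set_integral_mono set_integrable_compact K(1) continuous_intros cf[OF j] c3) auto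
    also have "\<dots> = C * (LINT x:K|lborel. E3 (j, x))" by simp
    also have "(LINT x:K|lborel. E3 (j, x)) = (LINT x:K|lborel. dyadic j) + (LINT x:K|lborel. (2 ^ j)\<^sup>2 * Osc 3 (dyadic j) x)"
      unfolding E3_def fst_conv snd_conv
      by (intro set_integral_add(2) set_integrable_compact K(1) continuous_intros continuous_on_Osc) auto
    also have "(LINT x:K|lborel. dyadic j) = dyadic j * measure lborel K"
      by (simp add: set_lebesgue_integral_def)
    finally show ?thesis by simp
  qed
  have "(\<lambda>j. C * (dyadic j * measure lborel K + (2 ^ j)\<^sup>2 * (LINT x:K|lborel. Osc 3 (dyadic j) x))) \<longlonglongrightarrow> C * (0 * measure lborel K + 0)"
    by (intro tendsto_intros gag dyadic_tendsto_0)
  then have "(\<lambda>j. C * (dyadic j * measure lborel K + (2 ^ j)\<^sup>2 * (LINT x:K|lborel. Osc 3 (dyadic j) x))) \<longlonglongrightarrow> 0" by simp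
  then show ?thesis
    by (rule Lim_null_comparison[rotated]) (use le in \<open>auto intro!: eventually_sequentiallyI[of j0]\<close>)
qed

end

lemma Lipschitz_of_bounded_pd:
  fixes F :: "real^'n::finite \<Rightarrow> real" and M :: real
  assumes F: "Ck_on 1 UNIV F" and M: "\<And>i x. \<bar>pd i F x\<bar> \<le> M"
  shows "\<bar>F (x - y) - F x\<bar> \<le> (CARD('n) * M) * norm y"
proof -
  have M0: "M \<ge> 0" using order_trans[OF abs_ge_zero M] .
  have "norm (F (x - y) - F x) \<le> (CARD('n) * M) * norm ((x - y) - x)"
  proof (rule differentiable_bound[of UNIV])
    fix x
    have "F differentiable (at x)" using F by auto
    then show "(F has_derivative (\<lambda>v. v \<bullet> grad F x)) (at x within UNIV)"
      by (rule has_derivative_grad)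
    have "norm (grad F x) \<le> (\<Sum>i\<in>UNIV. \<bar>grad F x $ i\<bar>)" by (rule norm_le_l1_cart)
    also have "\<dots> \<le> (\<Sum>i\<in>(UNIV :: 'n set). M)" by (intro sum_mono) (simp add: grad_def M)
    finally have g: "norm (grad F x) \<le> CARD('n) * M" by simp
    show "onorm (\<lambda>v. v \<bullet> grad F x) \<le> CARD('n) * M"
    proof (rule onorm_le)
      fix v
      have "norm (v \<bullet> grad F x) \<le> norm v * norm (grad F x)"
        using Cauchy_Schwarz_ineq2[of v "grad F x"] by simp
      also have "\<dots> \<le> norm v * (CARD('n) * M)" by (intro mult_left_mono g) auto
      finally show "norm (v \<bullet> grad F x) \<le> CARD('n) * M * norm v" by (simp add: mult.commute)
    qed
  qed auto
  then show ?thesis by simp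
qed

section \<open>Passage to the limit in the Gauss equation\<close>

context mollified_graph
begin

lemma bnd_met: "bnd I (\<lambda>z. met (u (fst z)) i j (snd z)) (\<lambda>_. 1)"
  unfolding met_def by (intro bnd_sum bnd_mult_1l bnd_pd_u) auto

lemma bnd_chr: "bnd I (\<lambda>z. chr (u (fst z)) k i j (snd z)) (\<lambda>z. 2 ^ fst z * O1 z)"
  unfolding chr_def by (intro bnd_sum bnd_mult_1l bnd_pd_u bnd_pd2_u) (simp add: O1_nonneg)

lemma met_tendsto: "(\<lambda>n. met (u n) i j x) \<longlonglongrightarrow> met w i j x"
  unfolding met_def by (intro tendsto_intros u_tendsto)

lemma mol_sum3:
  assumes "\<And>a. continuous_on UNIV (f a)"
  shows "reg t (\<lambda>z. \<Sum>a\<in>(UNIV :: 3 set). f a z) x = (\<Sum>a\<in>UNIV. reg t (f a) x)"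
proof -
  have c: "continuous_on UNIV (\<lambda>z. f 1 z + f 2 z)" by (intro continuous_intros assms)
  show ?thesis
    unfolding sum_3 by (simp add: mol_add[OF continuous_on_rho(1) c assms] mol_add[OF continuous_on_rho(1) assms assms])
qed

end

text \<open>The right-hand side of \<open>gauss_smooth\<close> divided by the cube of the Jacobian,
  with the Christoffel symbols computed from a separate metric \<open>G\<close>. Of \<open>w\<close>
  it contains first derivatives only, so it is meaningful for the limit surface.\<close>

definition gauss_density :: "(3 \<Rightarrow> real^2 \<Rightarrow> real) \<Rightarrow> (2 \<Rightarrow> 2 \<Rightarrow> real^2 \<Rightarrow> real) \<Rightarrow> real^2 \<Rightarrow> real" where
  "gauss_density w G x = (det_met (\<lambda>i k. met w i k x) * (pd 1 (christ G 1 2 2) x - pd 2 (christ G 1 1 2) x)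
     - quad (\<lambda>i k. met w i k x) (\<lambda>k i l. christ G k i l x)) / (wed (w 1) (w 2) x) ^ 3"

text \<open>The metric identity is required on \<open>V\<close> and not only on \<open>W\<close>,
  since mollifying at a point of \<open>W\<close> uses values at shifted points. \<open>G\<close> is
  a metric extended to the whole plane by a cutoff.\<close>

locale mollified_metric = mollified_graph +
  fixes G :: "2 \<Rightarrow> 2 \<Rightarrow> real^2 \<Rightarrow> real" and L :: real and V :: "(real^2) set"
  assumes G: "Ck_on 2 UNIV (G i k)"
    and G_Lip: "\<bar>pd m (pd l (G i k)) x\<bar> \<le> L"
    and near: "j \<ge> j0 \<Longrightarrow> x \<in> W \<Longrightarrow> y \<in> unit_cube \<Longrightarrow> x - dyadic j *\<^sub>R y \<in> V"
    and metric: "x \<in> V \<Longrightarrow> met w i k x = G i k x"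
    and gag: "(\<lambda>j. (2 ^ j)\<^sup>2 * (LINT x:K|lborel. Osc 3 (dyadic j) x)) \<longlonglongrightarrow> 0"
begin

lemma G_C: "continuous_on S (G i k)" "Ck_on 1 UNIV (G i k)" "Ck_on 1 UNIV (pd l (G i k))" "continuous_on S (pd l (G i k))"
proof -
  show 1: "Ck_on 1 UNIV (G i k)" by (rule Ck_on_mono[OF G]) simp
  show 2: "Ck_on 1 UNIV (pd l (G i k))" using G[of i k] by (simp add: numeral_2_eq_2)
  show "continuous_on S (G i k)" "continuous_on S (pd l (G i k))"
    using Ck_on_imp_continuous[OF 1] Ck_on_imp_continuous[OF 2] continuous_on_subset by blast+
qed

text \<open>Two comparisons: the derivative of the metric of \<open>u j\<close> with that of the
  mollified \<open>G\<close>, which is the commutator, and the latter with the derivative of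
  \<open>G\<close>, which is the mollification error of a Lipschitz function.\<close>

lemma bnd_pd_met: "bnd I (\<lambda>z. pd m (met (u (fst z)) i k) (snd z) - pd m (G i k) (snd z)) E2"
proof -
  let ?R = "rho_bound TYPE(2)"
  let ?C1 = "2 * ?R\<^sup>2 * cube_vol TYPE(2) + ?R"
  let ?C2 = "?R * cube_vol TYPE(2) * ((CARD(2) * L) * CARD(2))"
  have C1: "?C1 \<ge> 0" using rho_bound(1)[where 'n=2] cube_vol_pos[where 'n=2] by simp
  have cp: "continuous_on UNIV (\<lambda>y. pd i (w a) y * pd k (w a) y)" for a
    by (intro continuous_intros cont_w)
  \<comment> \<open>The factor 6 counts three components of the immersion and two oscillations for
    each.\<close>
  have main: "\<bar>pd m (met (u j) i k) x - pd m (G i k) x\<bar> \<le> (6 * ?C1 + \<bar>?C2\<bar>) * E2 (j, x)" if j: "j \<ge> j0" and x: "x \<in> W" for j x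
  proof -
    let ?t = "dyadic j"
    have d: "reg ?t F differentiable (at y)" if "continuous_on UNIV F" for F :: "real^2 \<Rightarrow> real" and y
      using Ck_on_reg[OF that dyadic_pos, of "Suc 0" j] by simp
    have eqG: "pd m (reg ?t (G i k)) x = (\<Sum>a\<in>UNIV. pd m (reg ?t (\<lambda>y. pd i (w a) y * pd k (w a) y)) x)"
    proof -
      have "reg ?t (G i k) y = (\<Sum>a\<in>UNIV. reg ?t (\<lambda>y. pd i (w a) y * pd k (w a) y) y)" if "y \<in> W" for y
      proof -
        have "reg ?t (G i k) y = reg ?t (\<lambda>y. \<Sum>a\<in>UNIV. pd i (w a) y * pd k (w a) y) y"
          by (rule mol_cong) (use metric near[OF j that] in \<open>simp add: met_def\<close>)
        then show ?thesis by (simp add: mol_sum3 cp)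
      qed
      then have "pd m (reg ?t (G i k)) x = pd m (\<lambda>y. \<Sum>a\<in>UNIV. reg ?t (\<lambda>y. pd i (w a) y * pd k (w a) y) y) x"
        by (rule pd_cong_open[OF W x])
      then show ?thesis by (simp add: pd_sum d cp)
    qed
    have eqM: "pd m (met (u j) i k) x = (\<Sum>a\<in>UNIV. pd m (\<lambda>x. reg ?t (pd i (w a)) x * reg ?t (pd k (w a)) x) x)"
      unfolding met_def[abs_def] pd_u by (rule pd_sum) (intro differentiable_mult d cont_w)
    have each: "\<bar>pd m (\<lambda>x. reg ?t (pd i (w a)) x * reg ?t (pd k (w a)) x) x
        - pd m (reg ?t (\<lambda>y. pd i (w a) y * pd k (w a) y)) x\<bar> \<le> 2 * ?C1 * E2 (j, x)" for a
    proof -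
      have "\<bar>pd m (\<lambda>x. reg ?t (pd i (w a)) x * reg ?t (pd k (w a)) x) x
          - pd m (reg ?t (\<lambda>y. pd i (w a) y * pd k (w a) y)) x\<bar>
          \<le> ?C1 / ?t * (osc 2 ?t (pd i (w a)) x + osc 2 ?t (pd k (w a)) x)"
        by (rule pd_reg_commutator_le[OF cont_w(2) cont_w(2) dyadic_pos])
      also have "\<dots> \<le> ?C1 / ?t * (2 * Osc 2 ?t x)"
        using osc_le_Osc[of 2 ?t i a x] osc_le_Osc[of 2 ?t k a x] C1 dyadic_pos[of j]
        by (intro mult_left_mono divide_nonneg_pos) auto
      also have "\<dots> = 2 * ?C1 * (2 ^ j * Osc 2 ?t x)" by (simp add: dyadic_def)
      also have "\<dots> \<le> 2 * ?C1 * E2 (j, x)"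
        using C1 dyadic_pos[of j] by (intro mult_left_mono) (auto simp: E2_def)
      finally show ?thesis .
    qed
    have "\<bar>(\<Sum>a\<in>UNIV. pd m (\<lambda>x. reg ?t (pd i (w a)) x * reg ?t (pd k (w a)) x) x
        - pd m (reg ?t (\<lambda>y. pd i (w a) y * pd k (w a) y)) x)\<bar> \<le> 3 * (2 * ?C1 * E2 (j, x))"
      using each[of 1] each[of 2] each[of 3] unfolding sum_3 by linarith
    then have 1: "\<bar>pd m (met (u j) i k) x - pd m (reg ?t (G i k)) x\<bar> \<le> 6 * ?C1 * E2 (j, x)"
      unfolding eqM eqG sum_subtractf[symmetric] by linarith
    have "pd m (reg ?t (G i k)) x = reg ?t (pd m (G i k)) x"
      by (rule pd_mol[OF continuous_on_rho(1) G_C(2)])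
    moreover have "\<bar>reg ?t (pd m (G i k)) x - pd m (G i k) x\<bar> \<le> ?C2 * ?t"
      by (rule reg_minus_le_Lipschitz[OF G_C(4) _ dyadic_pos])
        (rule Lipschitz_of_bounded_pd[OF G_C(3) G_Lip])
    moreover have "?C2 * ?t \<le> \<bar>?C2\<bar> * E2 (j, x)"
      using dyadic_pos[of j] Osc_nonneg[of 2 ?t x] by (intro mult_mono) (auto simp: E2_def)
    ultimately show ?thesis using 1 unfolding distrib_right by linarith
  qed
  show ?thesis
    by (rule bndI[of _ _ "6 * ?C1 + \<bar>?C2\<bar>"]) (use main in \<open>auto simp: I_def\<close>)
qed

lemma chr_u_eq: "x \<in> W \<Longrightarrow> chr (u j) k i l x = christ (met (u j)) k i l x"
  by (rule chr_eq_christ[OF W _ Ck_on_u])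

lemma bnd_chr_diff: "bnd I (\<lambda>z. chr (u (fst z)) k i l (snd z) - christ G k i l (snd z)) E2"
proof -
  have eq: "chr (u (fst z)) k i l (snd z) - christ G k i l (snd z)
      = 1/2 * ((pd i (met (u (fst z)) l k) (snd z) - pd i (G l k) (snd z))
        + (pd l (met (u (fst z)) i k) (snd z) - pd l (G i k) (snd z))
        - (pd k (met (u (fst z)) i l) (snd z) - pd k (G i l) (snd z)))" if "z \<in> I" for z
  proof -
    have "chr (u (fst z)) k i l (snd z) = christ (met (u (fst z))) k i l (snd z)"
      using that by (intro chr_u_eq) (simp add: I_def mem_Times_iff)
    then show ?thesis unfolding christ_def by (simp add: field_simps)
  qed
  show ?thesis
    by (subst bnd_cong[OF eq], assumption) (intro bnd_cmult bnd_add bnd_diff bnd_pd_met)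
qed

lemma Ck_on_christ: "Ck_on 1 UNIV (christ G k i l)"
  unfolding christ_def[abs_def] by (intro Ck_on_mult Ck_on_add Ck_on_diff Ck_on_const G_C open_UNIV)

lemma cont_christ: "continuous_on S (christ G k i l)" "continuous_on S (pd m (christ G k i l))"
  using Ck_on_christ[of k i l] Ck_on_imp_continuous[OF Ck_on_christ[of k i l]] continuous_on_subset[OF _ subset_UNIV]
  by auto

lemma bnd_christ: "bnd IK (\<lambda>z. christ G k i l (snd z)) (\<lambda>_. 1)"
proof -
  have "bounded (christ G k i l ` K)"
    by (intro compact_imp_bounded compact_continuous_image cont_christ K)
  then obtain C where "\<And>x. x \<in> K \<Longrightarrow> \<bar>christ G k i l x\<bar> \<le> C" by (auto simp: bounded_iff)
  then show ?thesis by (intro bndI[of _ _ C]) (auto simp: IK_def)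
qed

text \<open>\<open>ab - a'b' = (a - a') b + a' (b - b')\<close> with \<open>a\<close>,
  \<open>b\<close> mollified: the factor \<open>b\<close> may grow like \<open>2 ^ j * O1\<close>,
  which makes the error cubic, while \<open>a'\<close> is bounded on \<open>K\<close>.\<close>

lemma bnd_chr_mult_diff:
  "bnd IK (\<lambda>z. chr (u (fst z)) k i l (snd z) * chr (u (fst z)) k' i' l' (snd z)
     - christ G k i l (snd z) * christ G k' i' l' (snd z)) E3"
proof -
  have 1: "bnd I (\<lambda>z. (chr (u (fst z)) k i l (snd z) - christ G k i l (snd z)) * chr (u (fst z)) k' i' l' (snd z)) E3"
    by (rule bnd_E3[OF bnd_chr_diff bnd_1_plus[OF bnd_chr]])
  have 2: "bnd IK (\<lambda>z. christ G k i l (snd z) * (chr (u (fst z)) k' i' l' (snd z) - christ G k' i' l' (snd z))) E3"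
    by (rule bnd_mult_1l[OF bnd_christ bnd_subset[OF bnd_E2_imp_E3[OF bnd_chr_diff] IK_subset]])
  from bnd_add[OF bnd_subset[OF 1 IK_subset] 2] show ?thesis by (simp add: algebra_simps)
qed

lemma bnd_quad_diff:
  "bnd IK (\<lambda>z. quad (\<lambda>i k. met (u (fst z)) i k (snd z)) (\<lambda>k i l. chr (u (fst z)) k i l (snd z))
     - quad (\<lambda>i k. met (u (fst z)) i k (snd z)) (\<lambda>k i l. christ G k i l (snd z))) E3"
proof -
  let ?d = "\<lambda>k i l k' i' l' z. chr (u (fst z)) k i l (snd z) * chr (u (fst z)) k' i' l' (snd z)
     - christ G k i l (snd z) * christ G k' i' l' (snd z)"
  let ?m = "\<lambda>i k z. met (u (fst z)) i k (snd z)"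
  have "bnd IK (\<lambda>z. ?m 2 2 z * (?d 1 1 1 1 2 2 z - ?d 1 1 2 1 1 2 z)
      - ?m 1 2 z * (?d 1 1 1 2 2 2 z + ?d 2 1 1 1 2 2 z - 2 * ?d 1 1 2 2 1 2 z)
      + ?m 1 1 z * (?d 2 1 1 2 2 2 z - ?d 2 1 2 2 1 2 z)) E3"
    by (intro bnd_add bnd_diff bnd_mult_1l[OF bnd_subset[OF bnd_met IK_subset]] bnd_cmult bnd_chr_mult_diff)
  moreover have "?m 2 2 z * (?d 1 1 1 1 2 2 z - ?d 1 1 2 1 1 2 z)
      - ?m 1 2 z * (?d 1 1 1 2 2 2 z + ?d 2 1 1 1 2 2 z - 2 * ?d 1 1 2 2 1 2 z)
      + ?m 1 1 z * (?d 2 1 1 2 2 2 z - ?d 2 1 2 2 1 2 z)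
    = quad (\<lambda>i k. met (u (fst z)) i k (snd z)) (\<lambda>k i l. chr (u (fst z)) k i l (snd z))
     - quad (\<lambda>i k. met (u (fst z)) i k (snd z)) (\<lambda>k i l. christ G k i l (snd z))" for z
    unfolding quad_def power2_eq_square by (simp add: algebra_simps)
  ultimately show ?thesis by simp
qed

lemma cont_gauss_density: "continuous_on W (gauss_density w G)"
proof -
  have "continuous_on W (met w i k)" for i k
    unfolding met_def[abs_def] by (intro continuous_intros cont_w)
  then show ?thesis
    unfolding gauss_density_def[abs_def] det_met_def quad_def
    using wed_w_nz by (intro continuous_intros cont_christ cont_wed_w) auto
qed

text \<open>\<open>bnd_chr_diff\<close> controls the error in the Christoffel symbols but not in
  their derivatives. So the derivative is moved onto the weight, the symbols are replaced by those
  of \<open>G\<close>, and the derivative is moved back; then the integrands converge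
  pointwise.\<close>

theorem gauss_limit:
  assumes \<psi>: "tame \<psi>" "\<And>j x. j \<ge> j0 \<Longrightarrow> x \<in> W - K \<Longrightarrow> \<psi> j x = 0"
    and lim: "\<And>x. x \<in> K \<Longrightarrow> (\<lambda>j. \<psi> j x) \<longlonglongrightarrow> \<psi>0 x" and c0: "continuous_on K \<psi>0"
  shows "(\<lambda>j. LINT x:K|lborel. \<psi> j x * wed (slope (u j) 3 2) (slope (u j) 1 3) x)
     \<longlonglongrightarrow> (LINT x:K|lborel. \<psi>0 x * gauss_density w G x)"
proof -
  \<comment> \<open>The coefficients of \<open>gauss_smooth\<close> after division by the cube of
    the Jacobian: \<open>q\<close> is \<open>\<psi>\<close> over that cube, and \<open>s\<close> is
    \<open>q\<close> times the determinant of the mollified metric. Both are tame.\<close>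
  define iD where "iD j x = inverse (wed (u j 1) (u j 2) x)" for j x
  define q where "q j x = \<psi> j x * (iD j x * (iD j x * iD j x))" for j x
  define dm where "dm j x = wed (u j 2) (u j 3) x * wed (u j 2) (u j 3) x + wed (u j 3) (u j 1) x * wed (u j 3) (u j 1) x
      + wed (u j 1) (u j 2) x * wed (u j 1) (u j 2) x" for j x
  define s where "s j x = q j x * dm j x" for j x
  have iD: "tame iD" unfolding iD_def[abs_def] by (rule tame_inverse_wed)
  have tq: "tame q" unfolding q_def[abs_def] by (intro tame_mult \<psi> iD)
  have ts: "tame s"
    unfolding s_def[abs_def] dm_def[abs_def] by (intro tame_mult tame_add tq tame_wed)
  have dm_eq: "dm j x = det_met (\<lambda>i k. met (u j) i k x)" for j x
    unfolding det_met_eq by (simp add: dm_def power2_eq_square)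
  have s0: "s j x = 0" if "j \<ge> j0" "x \<in> W - K" for j x
    using \<psi>(2)[OF that] by (simp add: s_def q_def)
  define ch where "ch j k i l = chr (u j) k i l" for j k i l
  have ch1: "Ck_on 1 W (ch j k i l)" for j k i l
    unfolding ch_def by (rule Ck_on_chr[OF W Ck_on_u])
  define Q where "Q j c x = quad (\<lambda>i k. met (u j) i k x) (\<lambda>k i l. c k i l x)" for j and c :: "2 \<Rightarrow> 2 \<Rightarrow> 2 \<Rightarrow> real^2 \<Rightarrow> real" and x
  have cK: "continuous_on K F" if "Ck_on 1 W F" for F :: "real^2 \<Rightarrow> real"
    by (rule continuous_on_subset[OF Ck_on_imp_continuous[OF that] K(2)])
  have cpK: "continuous_on K (pd i F)" if "Ck_on 1 W F" for F :: "real^2 \<Rightarrow> real" and i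
    by (rule continuous_on_subset[OF Ck_on_imp_continuous[OF Ck_on_pd[OF that[unfolded One_nat_def]]] K(2)])
  have cmet: "continuous_on K (met (u j) i k)" for j i k
    unfolding met_def[abs_def] pd_u by (intro continuous_intros continuous_on_mol continuous_on_rho cont_w)
  have cQ: "continuous_on K (Q j c)" if "\<And>k i l. continuous_on K (c k i l)" for j and c :: "2 \<Rightarrow> 2 \<Rightarrow> 2 \<Rightarrow> real^2 \<Rightarrow> real"
    unfolding Q_def[abs_def] quad_def by (intro continuous_intros cmet that)
  note si = set_integrable_compact[OF K(1)]
  note ts1 = tameD(1)[OF ts] and tq1 = tameD(1)[OF tq]

  text \<open>Integration by parts, valid for both the mollified and the limiting Christoffel symbols.\<close>
  have parts: "(LINT x:K|lborel. s j x * (pd 1 A x - pd 2 B x) - q j x * Q j c x)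
      = (LINT x:K|lborel. (pd 2 (s j) x * B x - pd 1 (s j) x * A x) - q j x * Q j c x)"
    if j: "j \<ge> j0" and A: "Ck_on 1 W A" and B: "Ck_on 1 W B" and cc: "\<And>k i l. continuous_on K (c k i l)" for j A B c
  proof -
    have sA: "Ck_on 1 W (\<lambda>x. s j x * A x)" and sB: "Ck_on 1 W (\<lambda>x. s j x * B x)"
      by (intro Ck_on_mult W ts1 j A B)+
    have z: "(LINT x:K|lborel. pd 1 (\<lambda>x. s j x * A x) x) = 0" "(LINT x:K|lborel. pd 2 (\<lambda>x. s j x * B x) x) = 0"
      using s0[OF j] by (auto intro!: set_integral_pd_eq_0[OF W K] sA sB)
    have i2: "set_integrable lborel K (\<lambda>x. (pd 2 (s j) x * B x - pd 1 (s j) x * A x) - q j x * Q j c x)"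
      by (intro si continuous_intros cpK[OF ts1[OF j]] cK[OF A] cK[OF B] cK[OF tq1[OF j]] cQ cc)
    have i1: "set_integrable lborel K (\<lambda>x. pd 1 (\<lambda>x. s j x * A x) x - pd 2 (\<lambda>x. s j x * B x) x)"
      by (intro si continuous_intros cpK sA sB)
    have eq: "s j x * (pd 1 A x - pd 2 B x) - q j x * Q j c x
        = (pd 1 (\<lambda>x. s j x * A x) x - pd 2 (\<lambda>x. s j x * B x) x) + ((pd 2 (s j) x * B x - pd 1 (s j) x * A x) - q j x * Q j c x)"
      if "x \<in> K" for x
    proof -
      have "s j differentiable (at x)" "A differentiable (at x)" "B differentiable (at x)"
        using tameD(4)[OF ts j] A B that K(2) by auto
      then show ?thesis by (simp add: pd_mult algebra_simps)
    qed
    have "(LINT x:K|lborel. s j x * (pd 1 A x - pd 2 B x) - q j x * Q j c x)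
        = (LINT x:K|lborel. (pd 1 (\<lambda>x. s j x * A x) x - pd 2 (\<lambda>x. s j x * B x) x)
            + ((pd 2 (s j) x * B x - pd 1 (s j) x * A x) - q j x * Q j c x))"
      by (rule set_lebesgue_integral_cong) (use eq K(1) in \<open>simp_all add: compact_imp_closed borel_closed\<close>)
    also have "\<dots> = (LINT x:K|lborel. pd 1 (\<lambda>x. s j x * A x) x - pd 2 (\<lambda>x. s j x * B x) x)
        + (LINT x:K|lborel. (pd 2 (s j) x * B x - pd 1 (s j) x * A x) - q j x * Q j c x)"
      by (rule set_integral_add(2)[OF i1 i2])
    also have "(LINT x:K|lborel. pd 1 (\<lambda>x. s j x * A x) x - pd 2 (\<lambda>x. s j x * B x) x) = 0"
      using set_integral_diff(2)[OF si[OF cpK[OF sA]] si[OF cpK[OF sB]]] z by simp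
    finally show ?thesis by simp
  qed
  have C1G: "Ck_on 1 W (christ G k i l)" for k i l
    by (rule Ck_on_subset[OF Ck_on_christ subset_UNIV])

  \<comment> \<open>\<open>R1\<close> carries the mollified symbols and \<open>R2\<close> those of
    \<open>G\<close>, both with the derivative on the weight; \<open>R3\<close> is \<open>R2\<close>
    with the derivative returned to the symbols.\<close>
  define R1 where "R1 j x = (pd 2 (s j) x * ch j 1 1 2 x - pd 1 (s j) x * ch j 1 2 2 x) - q j x * Q j (ch j) x" for j x
  define R2 where "R2 j x = (pd 2 (s j) x * christ G 1 1 2 x - pd 1 (s j) x * christ G 1 2 2 x) - q j x * Q j (christ G) x" for j x
  define R3 where "R3 j x = s j x * (pd 1 (christ G 1 2 2) x - pd 2 (christ G 1 1 2) x) - q j x * Q j (christ G) x" for j x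
  have cR: "continuous_on K (R1 j)" "continuous_on K (R2 j)" if "j \<ge> j0" for j
    unfolding R1_def[abs_def] R2_def[abs_def]
    by (intro continuous_intros cpK[OF ts1[OF that]] cK[OF tq1[OF that]] cK[OF ch1] cQ cont_christ)+
  have step1: "(LINT x:K|lborel. \<psi> j x * wed (slope (u j) 3 2) (slope (u j) 1 3) x) = (LINT x:K|lborel. R1 j x)" if j: "j \<ge> j0" for j
  proof -
    have "\<psi> j x * wed (slope (u j) 3 2) (slope (u j) 1 3) x
        = s j x * (pd 1 (ch j 1 2 2) x - pd 2 (ch j 1 1 2) x) - q j x * Q j (ch j) x" if x: "x \<in> K" for x
    proof -
      have xW: "x \<in> W" using x K(2) by auto
      define D where "D = wed (u j 1) (u j 2) x"
      have D: "D \<noteq> 0" unfolding D_def by (rule wed_u_nz[OF j xW])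
      have "D ^ 3 * wed (slope (u j) 3 2) (slope (u j) 1 3) x
          = dm j x * (pd 1 (ch j 1 2 2) x - pd 2 (ch j 1 1 2) x) - Q j (ch j) x"
        unfolding dm_eq Q_def ch_def D_def by (rule gauss_smooth[OF W xW Ck_on_u wed_u_nz[OF j]])
      then have eq: "wed (slope (u j) 3 2) (slope (u j) 1 3) x
          = (inverse D * (inverse D * inverse D)) * (dm j x * (pd 1 (ch j 1 2 2) x - pd 2 (ch j 1 1 2) x) - Q j (ch j) x)"
        using D by (simp add: field_simps power3_eq_cube)
      show ?thesis
        unfolding eq by (simp add: s_def q_def iD_def D_def algebra_simps)
    qed
    then have "(LINT x:K|lborel. \<psi> j x * wed (slope (u j) 3 2) (slope (u j) 1 3) x)
        = (LINT x:K|lborel. s j x * (pd 1 (ch j 1 2 2) x - pd 2 (ch j 1 1 2) x) - q j x * Q j (ch j) x)"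
      by (intro set_lebesgue_integral_cong) (simp_all add: K(1) compact_imp_closed borel_closed)
    also have "\<dots> = (LINT x:K|lborel. R1 j x)"
      unfolding R1_def by (rule parts[OF j ch1 ch1 cK[OF ch1]])
    finally show ?thesis .
  qed
  have step3: "(LINT x:K|lborel. R2 j x) = (LINT x:K|lborel. R3 j x)" if j: "j \<ge> j0" for j
    unfolding R2_def R3_def by (rule parts[OF j C1G C1G cont_christ(1), symmetric])
  have small: "(\<lambda>j. LINT x:K|lborel. R1 j x - R2 j x) \<longlonglongrightarrow> 0"
  proof (rule E3_integral_tendsto_0[OF _ _ gag])
    show "continuous_on K (\<lambda>x. R1 j x - R2 j x)" if "j \<ge> j0" for j
      by (intro continuous_intros cR that)
    \<comment> \<open>An error of size \<open>E2\<close> times a tame gradient: the case for which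
      \<open>bnd_E3\<close> and the cubic oscillation are made.\<close>
    have t: "bnd IK (\<lambda>z. pd k (s (fst z)) (snd z) * (ch (fst z) 1 i l (snd z) - christ G 1 i l (snd z))) E3" for k i l
      using bnd_subset[OF bnd_E3[OF bnd_chr_diff tameD(3)[OF ts]] IK_subset] by (simp add: mult.commute ch_def)
    have qd: "bnd IK (\<lambda>z. q (fst z) (snd z) * (Q (fst z) (ch (fst z)) (snd z) - Q (fst z) (christ G) (snd z))) E3"
      unfolding Q_def ch_def by (rule bnd_mult_1l[OF bnd_subset[OF tameD(2)[OF tq] IK_subset] bnd_quad_diff])
    from bnd_diff[OF bnd_diff[OF t[of 2 1 2] t[of 1 2 2]] qd]
    show "bnd IK (\<lambda>z. R1 (fst z) (snd z) - R2 (fst z) (snd z)) E3"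
      by (simp add: R1_def R2_def algebra_simps)
  qed
  have bK: "bnd IK (\<lambda>z. F (snd z)) (\<lambda>_. 1)" if "continuous_on K F" for F :: "real^2 \<Rightarrow> real"
  proof -
    have "bounded (F ` K)" by (intro compact_imp_bounded compact_continuous_image that K)
    then obtain C where "\<And>x. x \<in> K \<Longrightarrow> \<bar>F x\<bar> \<le> C" by (auto simp: bounded_iff)
    then show ?thesis by (intro bndI[of _ _ C]) (auto simp: IK_def)
  qed
  have lim3: "(\<lambda>j. LINT x:K|lborel. R3 j x) \<longlonglongrightarrow> (LINT x:K|lborel. \<psi>0 x * gauss_density w G x)"
  proof -
    have b: "bnd IK (\<lambda>z. R3 (fst z) (snd z)) (\<lambda>_. 1)"
      unfolding R3_def Q_def quad_def power2_eq_square
      by (intro bnd_add bnd_diff bnd_mult_1l bnd_subset[OF tameD(2)[OF ts] IK_subset]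
          bnd_subset[OF tameD(2)[OF tq] IK_subset] bnd_subset[OF bnd_met IK_subset] bnd_christ bK cont_christ bnd_const)
    obtain C where C: "\<And>z. z \<in> IK \<Longrightarrow> \<bar>R3 (fst z) (snd z)\<bar> \<le> C * \<bar>1\<bar>"
      by (rule bndE[OF b]) blast
    show ?thesis
    proof (rule compact_integral_tendsto[OF K(1)])
      show "continuous_on K (R3 j)" if "j \<ge> j0" for j
        unfolding R3_def[abs_def]
        by (intro continuous_intros cK[OF ts1[OF that]] cK[OF tq1[OF that]] cQ cont_christ)
      show "continuous_on K (\<lambda>x. \<psi>0 x * gauss_density w G x)"
        by (intro continuous_intros c0 continuous_on_subset[OF cont_gauss_density K(2)])
      show "\<bar>R3 j x\<bar> \<le> C" if "j \<ge> j0" "x \<in> K" for j x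
        using C[of "(j, x)"] that by (auto simp: IK_def)
      fix x assume x: "x \<in> K"
      then have xW: "x \<in> W" using K(2) by auto
      define D where "D = wed (w 1) (w 2) x"
      have D: "D \<noteq> 0" unfolding D_def by (rule wed_w_nz[OF xW])
      have liD: "(\<lambda>j. iD j x) \<longlonglongrightarrow> inverse D"
        unfolding iD_def D_def by (intro tendsto_inverse wed_tendsto wed_w_nz xW)
      have lq: "(\<lambda>j. q j x) \<longlonglongrightarrow> \<psi>0 x * (inverse D * (inverse D * inverse D))"
        unfolding q_def by (intro tendsto_mult lim x liD)
      have ls: "(\<lambda>j. s j x) \<longlonglongrightarrow> \<psi>0 x * (inverse D * (inverse D * inverse D)) * det_met (\<lambda>i k. met w i k x)"
        unfolding s_def dm_eq unfolding det_met_def by (intro tendsto_intros lq met_tendsto)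
      have lQ: "(\<lambda>j. Q j (christ G) x) \<longlonglongrightarrow> quad (\<lambda>i k. met w i k x) (\<lambda>k i l. christ G k i l x)"
        unfolding Q_def quad_def by (intro tendsto_intros met_tendsto)
      have "(\<lambda>j. R3 j x) \<longlonglongrightarrow> \<psi>0 x * (inverse D * (inverse D * inverse D)) * det_met (\<lambda>i k. met w i k x)
          * (pd 1 (christ G 1 2 2) x - pd 2 (christ G 1 1 2) x)
          - \<psi>0 x * (inverse D * (inverse D * inverse D)) * quad (\<lambda>i k. met w i k x) (\<lambda>k i l. christ G k i l x)"
        unfolding R3_def by (intro tendsto_intros ls lq lQ)
      moreover have "\<psi>0 x * (inverse D * (inverse D * inverse D)) * det_met (\<lambda>i k. met w i k x)
          * (pd 1 (christ G 1 2 2) x - pd 2 (christ G 1 1 2) x)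
          - \<psi>0 x * (inverse D * (inverse D * inverse D)) * quad (\<lambda>i k. met w i k x) (\<lambda>k i l. christ G k i l x)
          = \<psi>0 x * gauss_density w G x"
        unfolding gauss_density_def D_def[symmetric] using D by (simp add: field_simps power3_eq_cube)
      ultimately show "(\<lambda>j. R3 j x) \<longlonglongrightarrow> \<psi>0 x * gauss_density w G x" by simp
    qed
  qed
  have "(\<lambda>j. (LINT x:K|lborel. R1 j x - R2 j x) + (LINT x:K|lborel. R3 j x)) \<longlonglongrightarrow> 0 + (LINT x:K|lborel. \<psi>0 x * gauss_density w G x)"
    by (rule tendsto_add[OF small lim3])
  moreover have "\<forall>\<^sub>F j in sequentially. (LINT x:K|lborel. R1 j x - R2 j x) + (LINT x:K|lborel. R3 j x)
      = (LINT x:K|lborel. \<psi> j x * wed (slope (u j) 3 2) (slope (u j) 1 3) x)"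
    using eventually_ge_at_top[of j0]
  proof eventually_elim
    case (elim j)
    have "(LINT x:K|lborel. R1 j x - R2 j x) = (LINT x:K|lborel. R1 j x) - (LINT x:K|lborel. R2 j x)"
      by (rule set_integral_diff(2)[OF si[OF cR(1)[OF elim]] si[OF cR(2)[OF elim]]])
    then show ?case by (simp add: step1[OF elim] step3[OF elim])
  qed
  ultimately show ?thesis
    by (simp add: Lim_transform_eventually)
qed

end

section \<open>The trilinear estimate\<close>

lemma powr_sum_le:
  fixes f :: "'i \<Rightarrow> real"
  assumes "finite A" "\<And>i. i \<in> A \<Longrightarrow> f i \<ge> 0" "q > 0"
  shows "(\<Sum>i\<in>A. f i) powr q \<le> real (card A) powr q * (\<Sum>i\<in>A. f i powr q)"
proof (cases "A = {}")
  case False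
  define m where "m = Max (f ` A)"
  have fin: "finite (f ` A)" "f ` A \<noteq> {}" using assms(1) False by auto
  have "m \<in> f ` A" unfolding m_def by (rule Max_in[OF fin])
  then obtain k where k: "k \<in> A" "m = f k" by auto
  have m0: "m \<ge> 0" using k assms(2) by simp
  have le: "f i \<le> m" if "i \<in> A" for i unfolding m_def using that fin(1) by simp
  have "(\<Sum>i\<in>A. f i) \<le> real (card A) * m"
    using sum_bounded_above[of A f m] le by simp
  then have "(\<Sum>i\<in>A. f i) powr q \<le> (real (card A) * m) powr q"
    using assms by (intro powr_mono2 sum_nonneg) auto
  also have "\<dots> = real (card A) powr q * f k powr q" using m0 k by (simp add: powr_mult)
  also have "\<dots> \<le> real (card A) powr q * (\<Sum>i\<in>A. f i powr q)"
    using k assms(1) by (intro mult_left_mono member_le_sum) auto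
  finally show ?thesis .
qed simp

lemma powr_add_le:
  fixes a b q :: real
  assumes "a \<ge> 0" "b \<ge> 0" "q > 0"
  shows "(a + b) powr q \<le> 2 powr q * (a powr q + b powr q)"
  using powr_sum_le[of "UNIV :: bool set" "\<lambda>x. if x then a else b" q] assms
  by (simp add: UNIV_bool add.commute)

text \<open>Young's inequality for the conjugate exponents \<open>p / 2\<close> and
  \<open>p / (p - 2)\<close>, with no attention to the best constant: whichever term on the right is
  the larger dominates the product.\<close>

lemma young_conjugate:
  fixes x y p :: real
  assumes "x \<ge> 0" "y \<ge> 0" "p > 2"
  shows "x\<^sup>2 * y \<le> x powr p + y powr (p / (p - 2))"
proof (cases "x = 0 \<or> y = 0")
  case False
  then have xy: "x > 0" "y > 0" using assms by auto
  show ?thesis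
  proof (cases "y \<le> x powr (p - 2)")
    case True
    have "x\<^sup>2 * y \<le> x powr 2 * x powr (p - 2)"
      using True xy by (simp add: mult_left_mono)
    also have "\<dots> = x powr p" by (simp flip: powr_add)
    finally show ?thesis by (simp add: add_increasing2)
  next
    case False
    have "x = (x powr (p - 2)) powr (1 / (p - 2))" using assms xy by (simp add: powr_powr)
    also have "\<dots> \<le> y powr (1 / (p - 2))" using False assms by (intro powr_mono2) auto
    finally have "x powr 2 \<le> (y powr (1 / (p - 2))) powr 2" using xy by (intro powr_mono2) auto
    then have "x\<^sup>2 * y \<le> y powr (2 / (p - 2)) * y powr 1"
      using xy by (simp add: powr_powr mult_right_mono)
    also have "\<dots> = y powr (2 / (p - 2) + 1)" by (rule powr_add[symmetric])
    also have "2 / (p - 2) + 1 = p / (p - 2)" using assms by (simp add: field_simps)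
    finally show ?thesis by (simp add: add_increasing)
  qed
qed (use assms in auto)

text \<open>Replacing \<open>x\<close> by \<open>\<mu> x\<close> and \<open>y\<close> by
  \<open>\<mu>^(-2) y\<close> leaves the product unchanged and shifts weight between the two
  terms.\<close>

lemma young_weighted:
  fixes x y p \<mu> :: real
  assumes "x \<ge> 0" "y \<ge> 0" "p > 2" "\<mu> > 0"
  shows "x\<^sup>2 * y \<le> \<mu> powr p * x powr p + (\<mu> powr (-2 * (p / (p - 2)))) * y powr (p / (p - 2))"
proof -
  have "x\<^sup>2 * y = (\<mu> * x)\<^sup>2 * (\<mu> powr (-2) * y)"
    using assms by (simp add: powr_minus power2_eq_square field_simps)
  also have "\<dots> \<le> (\<mu> * x) powr p + (\<mu> powr (-2) * y) powr (p / (p - 2))"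
    using assms by (intro young_conjugate) auto
  also have "\<dots> = \<mu> powr p * x powr p + (\<mu> powr (-2 * (p / (p - 2)))) * y powr (p / (p - 2))"
    using assms by (simp add: powr_mult powr_powr)
  finally show ?thesis .
qed

lemma sum_atLeastLessThan_Suc_shift_le:
  fixes f :: "nat \<Rightarrow> real"
  assumes "\<And>j. f j \<ge> 0"
  shows "(\<Sum>j\<in>{m..<n}. f (Suc j)) \<le> (\<Sum>j\<in>{m..<Suc n}. f j)"
proof -
  have "(\<Sum>j\<in>{m..<n}. f (Suc j)) = (\<Sum>j\<in>{Suc m..<Suc n}. f j)"
    by (rule sum.shift_bounds_Suc_ivl[symmetric])
  also have "\<dots> \<le> (\<Sum>j\<in>{m..<Suc n}. f j)"
    using assms by (intro sum_mono2) auto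
  finally show ?thesis .
qed

lemma sum_geometric_le:
  fixes r :: real
  assumes "0 \<le> r" "r < 1"
  shows "(\<Sum>j\<in>{m..<n}. r ^ j) \<le> 1 / (1 - r)"
proof -
  have "(\<Sum>j\<in>{m..<n}. r ^ j) \<le> (\<Sum>j. r ^ j)"
    using assms by (intro sum_le_suminf summable_geometric) auto
  also have "\<dots> = 1 / (1 - r)" using assms by (simp add: suminf_geometric)
  finally show ?thesis .
qed

section \<open>Weighted pairings and their increments between scales\<close>

context mollified_graph
begin

text \<open>\<open>w\<close> is Lipschitz, so undifferentiated quantities settle at the rate
  \<open>2^-j\<close>.\<close>

lemma u_diff_le: "bnd I (\<lambda>z. u (Suc (fst z)) a (snd z) - u (fst z) a (snd z)) (\<lambda>z. dyadic (fst z))"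
proof -
  let ?C = "rho_bound TYPE(2) * cube_vol TYPE(2) * ((CARD(2) * B) * CARD(2))"
  have *: "\<bar>u j a x - w a x\<bar> \<le> ?C * dyadic j" for j x
    unfolding u_def
    by (rule reg_minus_le_Lipschitz[OF cont_w(1) Lipschitz_of_bounded_pd[OF w pd_w_le] dyadic_pos])
  have "\<bar>u (Suc j) a x - u j a x\<bar> \<le> (3 / 2 * ?C) * dyadic j" for j x
    using *[of j x] *[of "Suc j" x] unfolding dyadic_Suc by linarith
  then show ?thesis by (intro bndI) blast
qed

text \<open>The test function is composed with the projection of the mollified surface, not with
  that of the limit, so that \<open>integral_wed_slope_eq\<close> holds exactly at each
  scale.\<close>

definition \<theta> :: "(real^2 \<Rightarrow> real) \<Rightarrow> nat \<Rightarrow> real^2 \<Rightarrow> real" where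
  "\<theta> \<phi> j x = \<phi> (proj (u j) x)"

lemma test_function_pd_bounded:
  assumes "\<phi> \<in> test_functions V"
  obtains C where "\<And>x. \<bar>pd i \<phi> x\<bar> \<le> C"
proof -
  let ?S = "closure {x. \<phi> x \<noteq> 0}"
  have "bounded (pd i \<phi> ` ?S)"
    using test_functionsD(1)[OF assms, of "Suc 0"] test_functionsD(2)[OF assms]
    by (intro compact_imp_bounded compact_continuous_image) (auto intro: continuous_on_subset)
  then obtain C where "\<And>x. x \<in> ?S \<Longrightarrow> \<bar>pd i \<phi> x\<bar> \<le> C" by (auto simp: bounded_iff)
  then have "\<bar>pd i \<phi> x\<bar> \<le> max C 0" for x
    using test_functionsD(5)[OF assms, of x i] by (cases "x \<in> ?S") (auto simp: le_max_iff_disj)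
  with that show ?thesis by blast
qed

lemma Ck_on_\<theta>: "\<phi> \<in> test_functions V \<Longrightarrow> Ck_on k S (\<theta> \<phi> j)"
  unfolding \<theta>_def[abs_def] proj_def
  by (rule Ck_on_subset[OF Ck_on_comp_vec2[OF open_UNIV test_functionsD(1) Ck_on_u Ck_on_u] subset_UNIV])

lemma bnd_\<theta>:
  assumes "\<phi> \<in> test_functions V"
  shows "bnd I (\<lambda>z. \<theta> \<phi> (fst z) (snd z)) (\<lambda>_. 1)"
proof -
  obtain C where "\<And>x. \<bar>\<phi> x\<bar> \<le> C" using test_function_bounded[OF assms] by blast
  then show ?thesis by (intro bndI[of _ _ C]) (simp add: \<theta>_def)
qed

lemma bnd_pd_\<theta>:
  assumes \<phi>: "\<phi> \<in> test_functions V"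
  shows "bnd I (\<lambda>z. pd k (\<theta> \<phi> (fst z)) (snd z)) (\<lambda>_. 1)"
proof -
  have d: "\<phi> differentiable (at x)" for x using test_functionsD(1)[OF \<phi>, of "Suc 0"] by simp
  have eq: "pd k (\<theta> \<phi> j) x = pd 1 \<phi> (proj (u j) x) * pd k (u j 1) x + pd 2 \<phi> (proj (u j) x) * pd k (u j 2) x" for j x
    unfolding \<theta>_def[abs_def] proj_def by (rule pd_comp_vec2[OF u_diff(1) u_diff(1) d])
  have b: "bnd I (\<lambda>z. pd i \<phi> (proj (u (fst z)) (snd z))) (\<lambda>_. 1)" for i
    by (rule test_function_pd_bounded[OF \<phi>, of i]) (auto simp: bnd_def)
  show ?thesis
    unfolding eq by (intro bnd_add bnd_mult_1l b bnd_pd_u)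
qed

lemma bnd_\<theta>_diff:
  assumes \<phi>: "\<phi> \<in> test_functions V"
  shows "bnd I (\<lambda>z. \<theta> \<phi> (Suc (fst z)) (snd z) - \<theta> \<phi> (fst z) (snd z)) (\<lambda>z. dyadic (fst z))"
proof -
  obtain C1 where C1: "\<And>x. \<bar>pd 1 \<phi> x\<bar> \<le> C1" using test_function_pd_bounded[OF \<phi>] by blast
  obtain C2 where C2: "\<And>x. \<bar>pd 2 \<phi> x\<bar> \<le> C2" using test_function_pd_bounded[OF \<phi>] by blast
  let ?M = "max C1 C2"
  have M: "\<bar>pd i \<phi> x\<bar> \<le> ?M" for i x
    using C1[of x] C2[of x] exhaust_2[of i] by (auto simp: le_max_iff_disj)
  have Lip: "\<bar>\<phi> y - \<phi> x\<bar> \<le> (2 * ?M) * norm (x - y)" for x y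
    using Lipschitz_of_bounded_pd[OF test_functionsD(1)[OF \<phi>] M, of x "x - y"] by simp
  have M0: "?M \<ge> 0" using order_trans[OF abs_ge_zero M] .
  have n: "norm (proj (u j) x - proj (u (Suc j)) x) \<le> \<bar>u (Suc j) 1 x - u j 1 x\<bar> + \<bar>u (Suc j) 2 x - u j 2 x\<bar>" for j x
    using norm_le_l1_cart[of "proj (u j) x - proj (u (Suc j)) x"]
    by (simp add: sum_2 proj_def abs_minus_commute)
  have le: "\<bar>\<theta> \<phi> (Suc j) x - \<theta> \<phi> j x\<bar> \<le> (2 * ?M) * (\<bar>u (Suc j) 1 x - u j 1 x\<bar> + \<bar>u (Suc j) 2 x - u j 2 x\<bar>)" for j x
    unfolding \<theta>_def
    by (rule order_trans[OF Lip mult_left_mono[OF n]]) (use M0 in simp)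
  have "bnd I (\<lambda>z. (2 * ?M) * (\<bar>u (Suc (fst z)) 1 (snd z) - u (fst z) 1 (snd z)\<bar> + \<bar>u (Suc (fst z)) 2 (snd z) - u (fst z) 2 (snd z)\<bar>)) (\<lambda>z. dyadic (fst z))"
    using u_diff_le[of 1] u_diff_le[of 2] by (intro bnd_cmult bnd_add) (simp_all add: bnd_def)
  then show ?thesis by (rule bnd_trans[rotated]) (rule bnd_mono, rule le)
qed

text \<open>The weight functions may vary with the index, so they become part of it.\<close>

definition J :: "((real^2 \<Rightarrow> real) \<times> nat \<times> (real^2)) set" where
  "J = {\<eta>. continuous_on UNIV \<eta>} \<times> {j0..} \<times> K"

definition nosc :: "(real^2 \<Rightarrow> real) \<times> nat \<times> (real^2) \<Rightarrow> real" where
  "nosc z = osc 1 (dyadic (fst (snd z))) (fst z) (snd (snd z)) + osc 1 (dyadic (Suc (fst (snd z)))) (fst z) (snd (snd z))"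

text \<open>The size of the change of the weight in one step: the oscillation of
  \<open>\<eta>\<close>, and \<open>\<eta>\<close> itself times the change of
  \<open>\<theta>\<close>, which is of order \<open>2^-j\<close>. Multiplied by \<open>2 ^ j\<close>
  it also bounds the weight and its gradient.\<close>

definition A :: "(real^2 \<Rightarrow> real) \<times> nat \<times> (real^2) \<Rightarrow> real" where
  "A z = nosc z + dyadic (fst (snd z)) * \<bar>fst z (snd (snd z))\<bar>"

lemma osc_J: "z \<in> J \<Longrightarrow> osc 1 t (fst z) x \<ge> 0"
  by (rule osc_nonneg) (auto simp: J_def)

lemma nosc_nonneg: "z \<in> J \<Longrightarrow> nosc z \<ge> 0" and A_nonneg: "z \<in> J \<Longrightarrow> A z \<ge> 0" and nosc_le_A: "z \<in> J \<Longrightarrow> nosc z \<le> A z"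
  using osc_J dyadic_pos[of "fst (snd z)"] by (simp_all add: nosc_def A_def less_imp_le)

lemma bnd_lift:
  assumes "bnd I f g"
  shows "bnd J (\<lambda>z. f (snd z)) (\<lambda>z. g (snd z))"
  by (rule bnd_comp[OF assms]) (use K(2) in \<open>auto simp: J_def I_def\<close>)

lemma bnd_reg_\<eta>:
  "bnd J (\<lambda>z. reg (dyadic (Suc (fst (snd z)))) (fst z) (snd (snd z)) - reg (dyadic (fst (snd z))) (fst z) (snd (snd z))) nosc"
  "bnd J (\<lambda>z. pd k (reg (dyadic (fst (snd z))) (fst z)) (snd (snd z))) (\<lambda>z. 2 ^ fst (snd z) * nosc z)"
  "bnd J (\<lambda>z. reg (dyadic (fst (snd z))) (fst z) (snd (snd z))) (\<lambda>z. nosc z + \<bar>fst z (snd (snd z))\<bar>)"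
proof -
  let ?R = "rho_bound TYPE(2)"
  have R: "?R > 0" by (rule rho_bound)
  have c: "continuous_on UNIV (fst z)" if "z \<in> J" for z using that by (auto simp: J_def)
  have d: "\<bar>reg t (fst z) x - fst z x\<bar> \<le> ?R * osc 1 t (fst z) x" if "z \<in> J" for z t x
    by (rule reg_minus_le[OF c[OF that]])
  show "bnd J (\<lambda>z. reg (dyadic (Suc (fst (snd z)))) (fst z) (snd (snd z)) - reg (dyadic (fst (snd z))) (fst z) (snd (snd z))) nosc"
  proof (rule bndI[of _ _ ?R])
    fix z assume "z \<in> J"
    from d[OF this, of "dyadic (Suc (fst (snd z)))" "snd (snd z)"] d[OF this, of "dyadic (fst (snd z))" "snd (snd z)"]
    show "\<bar>reg (dyadic (Suc (fst (snd z)))) (fst z) (snd (snd z)) - reg (dyadic (fst (snd z))) (fst z) (snd (snd z))\<bar> \<le> ?R * nosc z"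
      unfolding nosc_def distrib_left by linarith
  qed
  show "bnd J (\<lambda>z. pd k (reg (dyadic (fst (snd z))) (fst z)) (snd (snd z))) (\<lambda>z. 2 ^ fst (snd z) * nosc z)"
  proof (rule bndI[of _ _ ?R])
    fix z assume z: "z \<in> J"
    have "\<bar>pd k (reg (dyadic (fst (snd z))) (fst z)) (snd (snd z))\<bar> \<le> ?R / dyadic (fst (snd z)) * osc 1 (dyadic (fst (snd z))) (fst z) (snd (snd z))"
      by (rule pd_reg_le[OF c[OF z] dyadic_pos])
    also have "\<dots> \<le> ?R / dyadic (fst (snd z)) * nosc z"
      using osc_J[OF z] R dyadic_pos[of "fst (snd z)"] by (intro mult_left_mono) (auto simp: nosc_def)
    finally show "\<bar>pd k (reg (dyadic (fst (snd z))) (fst z)) (snd (snd z))\<bar> \<le> ?R * (2 ^ fst (snd z) * nosc z)"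
      by (simp add: dyadic_def)
  qed
  show "bnd J (\<lambda>z. reg (dyadic (fst (snd z))) (fst z) (snd (snd z))) (\<lambda>z. nosc z + \<bar>fst z (snd (snd z))\<bar>)"
  proof (rule bndI[of _ _ "?R + 1"])
    fix z assume z: "z \<in> J"
    have "?R * osc 1 (dyadic (fst (snd z))) (fst z) (snd (snd z)) \<le> ?R * nosc z"
      using osc_J[OF z] R by (intro mult_left_mono) (auto simp: nosc_def)
    then show "\<bar>reg (dyadic (fst (snd z))) (fst z) (snd (snd z))\<bar> \<le> (?R + 1) * (nosc z + \<bar>fst z (snd (snd z))\<bar>)"
      using d[OF z, of "dyadic (fst (snd z))" "snd (snd z)"] nosc_nonneg[OF z]
        mult_nonneg_nonneg[OF less_imp_le[OF R] abs_ge_zero[of "fst z (snd (snd z))"]]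
      unfolding distrib_left distrib_right by linarith
  qed
qed

definition \<psi> :: "(real^2 \<Rightarrow> real) \<Rightarrow> (real^2 \<Rightarrow> real) \<Rightarrow> nat \<Rightarrow> real^2 \<Rightarrow> real" where
  "\<psi> \<phi> \<eta> j x = reg (dyadic j) \<eta> x * \<theta> \<phi> j x"

lemma two_power_dyadic: "2 ^ j * dyadic j = 1" and two_power_ge_1: "(2::real) ^ j \<ge> 1"
  by (simp_all add: dyadic_def)

lemma Ck_on_\<psi>: "\<phi> \<in> test_functions V \<Longrightarrow> continuous_on UNIV \<eta> \<Longrightarrow> Ck_on k W (\<psi> \<phi> \<eta> j)"
  unfolding \<psi>_def[abs_def]
  by (intro Ck_on_mult W Ck_on_\<theta> Ck_on_subset[OF Ck_on_reg[OF _ dyadic_pos] subset_UNIV])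

lemma bnd_\<psi>:
  assumes \<phi>: "\<phi> \<in> test_functions V"
  shows "bnd J (\<lambda>z. \<psi> \<phi> (fst z) (fst (snd z)) (snd (snd z))) (\<lambda>z. 2 ^ fst (snd z) * A z)"
    "bnd J (\<lambda>z. \<psi> \<phi> (fst z) (Suc (fst (snd z))) (snd (snd z)) - \<psi> \<phi> (fst z) (fst (snd z)) (snd (snd z))) A"
    "bnd J (\<lambda>z. pd k (\<psi> \<phi> (fst z) (fst (snd z))) (snd (snd z))) (\<lambda>z. 2 ^ fst (snd z) * A z)"
proof -
  note t = bnd_lift[OF bnd_\<theta>[OF \<phi>]] and t' = bnd_lift[OF bnd_Suc[OF bnd_\<theta>[OF \<phi>]]]
    and pt = bnd_lift[OF bnd_pd_\<theta>[OF \<phi>]] and dt = bnd_lift[OF bnd_\<theta>_diff[OF \<phi>]]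
  have pA: "2 ^ j * (n + dyadic j * x) = 2 ^ j * n + x" for j and n x :: real
    using two_power_dyadic[of j] by (simp add: distrib_left flip: mult.assoc)
  have r: "bnd J (\<lambda>z. reg (dyadic (fst (snd z))) (fst z) (snd (snd z))) (\<lambda>z. 2 ^ fst (snd z) * A z)"
  proof (rule bnd_le[OF bnd_reg_\<eta>(3)])
    fix z assume z: "z \<in> J"
    show "0 \<le> nosc z + \<bar>fst z (snd (snd z))\<bar>" using nosc_nonneg[OF z] by simp
    show "nosc z + \<bar>fst z (snd (snd z))\<bar> \<le> 2 ^ fst (snd z) * A z"
      unfolding A_def pA using nosc_nonneg[OF z] two_power_ge_1[of "fst (snd z)"]
      by (simp add: mult_le_cancel_right1 mult_right_mono[of 1, simplified])
  qed
  show "bnd J (\<lambda>z. \<psi> \<phi> (fst z) (fst (snd z)) (snd (snd z))) (\<lambda>z. 2 ^ fst (snd z) * A z)"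
    unfolding \<psi>_def by (rule bnd_mult_1r[OF r t])
  have "bnd J (\<lambda>z. (reg (dyadic (Suc (fst (snd z)))) (fst z) (snd (snd z)) - reg (dyadic (fst (snd z))) (fst z) (snd (snd z)))
      * \<theta> \<phi> (Suc (fst (snd z))) (snd (snd z))
      + reg (dyadic (fst (snd z))) (fst z) (snd (snd z)) * (\<theta> \<phi> (Suc (fst (snd z))) (snd (snd z)) - \<theta> \<phi> (fst (snd z)) (snd (snd z)))) A"
  proof (rule bnd_add)
    show "bnd J (\<lambda>z. (reg (dyadic (Suc (fst (snd z)))) (fst z) (snd (snd z)) - reg (dyadic (fst (snd z))) (fst z) (snd (snd z)))
      * \<theta> \<phi> (Suc (fst (snd z))) (snd (snd z))) A"
      by (rule bnd_le[OF bnd_mult_1r[OF bnd_reg_\<eta>(1) t'] nosc_nonneg nosc_le_A])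
    show "bnd J (\<lambda>z. reg (dyadic (fst (snd z))) (fst z) (snd (snd z)) * (\<theta> \<phi> (Suc (fst (snd z))) (snd (snd z)) - \<theta> \<phi> (fst (snd z)) (snd (snd z)))) A"
    proof (rule bnd_trans[OF bnd_mult[OF r dt]], rule bnd_mono)
      fix z assume z: "z \<in> J"
      have "2 ^ fst (snd z) * A z * dyadic (fst (snd z)) = A z"
        using two_power_dyadic[of "fst (snd z)"] by (simp add: mult.assoc mult.left_commute)
      then show "\<bar>2 ^ fst (snd z) * A z * dyadic (fst (snd z))\<bar> \<le> A z"
        using abs_of_nonneg[OF A_nonneg[OF z]] by (metis order_refl)
    qed
  qed
  then show "bnd J (\<lambda>z. \<psi> \<phi> (fst z) (Suc (fst (snd z))) (snd (snd z)) - \<psi> \<phi> (fst z) (fst (snd z)) (snd (snd z))) A"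
    by (simp add: \<psi>_def algebra_simps)
  have eq: "pd k (\<psi> \<phi> (fst z) (fst (snd z))) (snd (snd z)) =
      pd k (reg (dyadic (fst (snd z))) (fst z)) (snd (snd z)) * \<theta> \<phi> (fst (snd z)) (snd (snd z))
      + reg (dyadic (fst (snd z))) (fst z) (snd (snd z)) * pd k (\<theta> \<phi> (fst (snd z))) (snd (snd z))" if "z \<in> J" for z
  proof -
    have "reg (dyadic (fst (snd z))) (fst z) differentiable (at (snd (snd z)))"
      using Ck_on_reg[of "fst z" "dyadic (fst (snd z))" "Suc 0"] that dyadic_pos by (simp add: J_def mem_Times_iff)
    moreover have "\<theta> \<phi> (fst (snd z)) differentiable (at (snd (snd z)))"
      using Ck_on_\<theta>[OF \<phi>, of "Suc 0" UNIV] by simp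
    ultimately show ?thesis unfolding \<psi>_def[abs_def] by (rule pd_mult)
  qed
  have n2: "bnd J (\<lambda>z. pd k (reg (dyadic (fst (snd z))) (fst z)) (snd (snd z))) (\<lambda>z. 2 ^ fst (snd z) * A z)"
    by (rule bnd_le[OF bnd_reg_\<eta>(2)]) (simp_all add: nosc_nonneg nosc_le_A)
  show "bnd J (\<lambda>z. pd k (\<psi> \<phi> (fst z) (fst (snd z))) (snd (snd z))) (\<lambda>z. 2 ^ fst (snd z) * A z)"
    by (subst bnd_cong[OF eq], assumption) (intro bnd_add bnd_mult_1r[OF n2 t] bnd_mult_1r[OF r pt])
qed

text \<open>The common size of all terms of a step. One of the three functions is differenced and
  the other two are differentiated; each derivative costs \<open>2 ^ j\<close>, and the result is
  the same whichever function is differenced.\<close>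

definition integrand_bound :: "(real^2 \<Rightarrow> real) \<times> nat \<times> (real^2) \<Rightarrow> real" where
  "integrand_bound z = (2 ^ fst (snd z) * O12 (snd z))\<^sup>2 * A z"

lemma integrand_bound_nonneg: "z \<in> J \<Longrightarrow> integrand_bound z \<ge> 0"
  by (simp add: integrand_bound_def A_nonneg)

lemma bnd_pd_slope_12:
  "bnd I (\<lambda>z. pd k (slope (u (fst z)) a b) (snd z)) (\<lambda>z. 2 ^ fst z * O12 z)"
  "bnd I (\<lambda>z. pd k (slope (u (Suc (fst z))) a b) (snd z)) (\<lambda>z. 2 ^ fst z * O12 z)"
proof -
  show "bnd I (\<lambda>z. pd k (slope (u (fst z)) a b) (snd z)) (\<lambda>z. 2 ^ fst z * O12 z)"
    by (rule bnd_le[OF bnd_pd_slope]) (simp_all add: O1_nonneg O1_le_O12)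
  have "bnd I (\<lambda>z. pd k (slope (u (Suc (fst z))) a b) (snd z)) (\<lambda>z. 2 ^ Suc (fst z) * O1 (Suc (fst z), snd z))"
    using bnd_comp[OF bnd_pd_slope, of I "\<lambda>z. (Suc (fst z), snd z)" k a b] by (auto simp: I_def)
  moreover have "bnd I (\<lambda>z. 2 ^ Suc (fst z) * O1 (Suc (fst z), snd z)) (\<lambda>z. 2 ^ fst z * O12 z)"
    by (rule bndI[of _ _ 2]) (use Osc_nonneg[of 1] in \<open>simp add: O1_def O12_def abs_mult\<close>)
  ultimately show "bnd I (\<lambda>z. pd k (slope (u (Suc (fst z))) a b) (snd z)) (\<lambda>z. 2 ^ fst z * O12 z)"
    by (rule bnd_trans)
qed

definition pairing :: "(real^2 \<Rightarrow> real) \<Rightarrow> (real^2 \<Rightarrow> real) \<Rightarrow> nat \<Rightarrow> real" where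
  "pairing \<phi> \<eta> j = (LINT x:K|lborel. \<psi> \<phi> \<eta> j x * wed (slope (u j) 3 2) (slope (u j) 1 3) x)"

text \<open>The increment of \<open>\<psi> da \<and> db\<close> from \<open>j\<close> to
  \<open>Suc j\<close>, with one factor changed at a time. In the last two terms the derivative of
  the increment of a slope has been moved onto \<open>\<psi>\<close>.\<close>

definition step_form :: "(real^2 \<Rightarrow> real) \<Rightarrow> (real^2 \<Rightarrow> real) \<times> nat \<times> (real^2) \<Rightarrow> real" where
  "step_form \<phi> z = (case z of (\<eta>, j, x) \<Rightarrow>
     (\<psi> \<phi> \<eta> (Suc j) x - \<psi> \<phi> \<eta> j x) * wed (slope (u (Suc j)) 3 2) (slope (u (Suc j)) 1 3) x
     - (slope (u (Suc j)) 3 2 x - slope (u j) 3 2 x) * wed (\<psi> \<phi> \<eta> j) (slope (u (Suc j)) 1 3) x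
     + (slope (u (Suc j)) 1 3 x - slope (u j) 1 3 x) * wed (\<psi> \<phi> \<eta> j) (slope (u j) 3 2) x)"

lemma bnd_step_form:
  assumes \<phi>: "\<phi> \<in> test_functions V"
  shows "bnd J (step_form \<phi>) integrand_bound"
proof -
  let ?S = "\<lambda>z. slope (u (Suc (fst (snd z))))"
  let ?s = "\<lambda>z. slope (u (fst (snd z)))"
  let ?h = "\<lambda>z. 2 ^ fst (snd z) * O12 (snd z)"
  let ?\<psi> = "\<lambda>z. \<psi> \<phi> (fst z) (fst (snd z))"
  have pS: "bnd J (\<lambda>z. pd k (?S z a b) (snd (snd z))) ?h" "bnd J (\<lambda>z. pd k (?s z a b) (snd (snd z))) ?h" for k a b
    using bnd_lift[OF bnd_pd_slope_12(2)] bnd_lift[OF bnd_pd_slope_12(1)] .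
  have dS: "bnd J (\<lambda>z. ?S z a b (snd (snd z)) - ?s z a b (snd (snd z))) (\<lambda>z. O12 (snd z))" for a b
    using bnd_lift[OF bnd_slope_diff] .
  have 1: "bnd J (\<lambda>z. (\<psi> \<phi> (fst z) (Suc (fst (snd z))) (snd (snd z)) - ?\<psi> z (snd (snd z)))
      * wed (?S z 3 2) (?S z 1 3) (snd (snd z))) (\<lambda>z. A z * (?h z * ?h z))"
    unfolding wed_def by (intro bnd_mult bnd_\<psi>[OF \<phi>] bnd_diff pS)
  have 2: "bnd J (\<lambda>z. (?S z a b (snd (snd z)) - ?s z a b (snd (snd z))) * wed (?\<psi> z) (F z) (snd (snd z)))
      (\<lambda>z. O12 (snd z) * ((2 ^ fst (snd z) * A z) * ?h z))"
    if "\<And>k. bnd J (\<lambda>z. pd k (F z) (snd (snd z))) ?h" for a b F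
    unfolding wed_def by (intro bnd_mult dS bnd_diff bnd_\<psi>[OF \<phi>] that)
  have 3: "bnd J (\<lambda>z. (\<psi> \<phi> (fst z) (Suc (fst (snd z))) (snd (snd z)) - ?\<psi> z (snd (snd z)))
      * wed (?S z 3 2) (?S z 1 3) (snd (snd z))) integrand_bound"
    by (rule bnd_trans[OF 1], rule bnd_mono)
      (auto simp: integrand_bound_def power2_eq_square A_nonneg O12_nonneg mult_ac)
  have 4: "bnd J (\<lambda>z. (?S z a b (snd (snd z)) - ?s z a b (snd (snd z))) * wed (?\<psi> z) (F z) (snd (snd z))) integrand_bound"
    if "\<And>k. bnd J (\<lambda>z. pd k (F z) (snd (snd z))) ?h" for a b F
    by (rule bnd_trans[OF 2[OF that]], rule bnd_mono)
      (auto simp: integrand_bound_def power2_eq_square A_nonneg O12_nonneg mult_ac)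
  from bnd_add[OF bnd_diff[OF 3 4[OF pS(1)[of _ 1 3], of 3 2]] 4[OF pS(2)[of _ 3 2], of 1 3]]
  show ?thesis by (simp add: step_form_def[abs_def] case_prod_beta)
qed

end

context mollified_graph
begin

lemma cont_K_Ck: "Ck_on k W F \<Longrightarrow> continuous_on K F"
  by (rule continuous_on_subset[OF Ck_on_imp_continuous K(2)])

lemma cont_K_wed:
  assumes "Ck_on 1 W F" "Ck_on 1 W H"
  shows "continuous_on K (wed F H)"
  by (rule cont_K_Ck[of 0]) (rule Ck_on_wed[OF W assms[unfolded One_nat_def]])

lemma \<psi>_support:
  assumes "\<phi> \<in> test_functions V" "proj (u j) x \<notin> closure {y. \<phi> y \<noteq> 0}"
  shows "\<psi> \<phi> \<eta> j x = 0"
  using test_functionsD(4)[OF assms] by (simp add: \<psi>_def \<theta>_def)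

text \<open>The discarded terms are \<open>d(\<psi> (a' - a)) \<and> db'\<close> and
  \<open>d(\<psi> (b' - b)) \<and> da\<close>, exact with primitives supported in \<open>K\<close>.
  Once they are removed, no increment of a slope is differentiated.\<close>

lemma pairing_step:
  assumes \<phi>: "\<phi> \<in> test_functions V"
    and supp: "\<And>j x. j \<ge> j0 \<Longrightarrow> x \<in> W - K \<Longrightarrow> proj (u j) x \<notin> closure {y. \<phi> y \<noteq> 0}"
    and \<eta>: "continuous_on UNIV \<eta>" and j: "j \<ge> j0"
  shows "continuous_on K (\<lambda>x. step_form \<phi> (\<eta>, j, x))"
    "pairing \<phi> \<eta> (Suc j) - pairing \<phi> \<eta> j = (LINT x:K|lborel. step_form \<phi> (\<eta>, j, x))"
proof -
  let ?p = "\<psi> \<phi> \<eta> j" and ?p' = "\<psi> \<phi> \<eta> (Suc j)"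
  define a b a' b' where "a = slope (u j) 3 2" and "b = slope (u j) 1 3"
    and "a' = slope (u (Suc j)) 3 2" and "b' = slope (u (Suc j)) 1 3"
  have j': "Suc j \<ge> j0" using j by simp
  have C: "Ck_on k W a" "Ck_on k W b" "Ck_on k W a'" "Ck_on k W b'" for k
    unfolding a_def b_def a'_def b'_def using Ck_on_slope_u j j' by blast+
  have Cp: "Ck_on k W (\<psi> \<phi> \<eta> i)" for k i by (rule Ck_on_\<psi>[OF \<phi> \<eta>])
  have p0: "?p x = 0" if "x \<in> W - K" for x
    by (rule \<psi>_support[OF \<phi> supp[OF j that]])
  define F where "F x = ?p x * (a' x - a x)" for x
  define H where "H x = ?p x * (b' x - b x)" for x
  have CF: "Ck_on k W F" and CH: "Ck_on k W H" for k
    unfolding F_def[abs_def] H_def[abs_def] by (intro Ck_on_mult Ck_on_diff W C Cp)+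
  have iF: "set_integrable lborel K (wed F b')" "(LINT x:K|lborel. wed F b' x) = 0"
    by (rule set_integral_wed_eq_0[OF W K CF _ C(4)]; simp add: F_def p0)+
  have iH: "set_integrable lborel K (wed H a)" "(LINT x:K|lborel. wed H a x) = 0"
    by (rule set_integral_wed_eq_0[OF W K CH _ C(1)]; simp add: H_def p0)+
  have st: "step_form \<phi> (\<eta>, j, x) = (?p' x - ?p x) * wed a' b' x - (a' x - a x) * wed ?p b' x + (b' x - b x) * wed ?p a x" for x
    by (simp add: step_form_def a_def b_def a'_def b'_def)
  show cst: "continuous_on K (\<lambda>x. step_form \<phi> (\<eta>, j, x))"
    unfolding st by (intro continuous_intros cont_K_wed cont_K_Ck[OF Cp] cont_K_Ck[OF C(1)] cont_K_Ck[OF C(2)]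
        cont_K_Ck[OF C(3)] cont_K_Ck[OF C(4)] C Cp)
  have c: "continuous_on K (\<lambda>x. ?p' x * wed a' b' x)" "continuous_on K (\<lambda>x. ?p x * wed a b x)"
    by (intro continuous_intros cont_K_wed C cont_K_Ck[OF Cp])+
  have key: "?p' x * wed a' b' x - ?p x * wed a b x = step_form \<phi> (\<eta>, j, x) + (wed F b' x - wed H a x)" if "x \<in> K" for x
  proof -
    have d: "?p differentiable (at x)" "a differentiable (at x)" "b differentiable (at x)" "a' differentiable (at x)"
      "b' differentiable (at x)" "(\<lambda>x. a' x - a x) differentiable (at x)" "(\<lambda>x. b' x - b x) differentiable (at x)"
      using C[of "Suc 0"] Cp[of "Suc 0" j] that K(2) by auto
    have w1: "wed F b' x = ?p x * (wed a' b' x - wed a b' x) + (a' x - a x) * wed ?p b' x"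
      unfolding F_def[abs_def] wed_mult_left[OF d(1,6)] by (simp add: wed_def pd_diff d algebra_simps)
    have w2: "wed H a x = ?p x * (wed b' a x - wed b a x) + (b' x - b x) * wed ?p a x"
      unfolding H_def[abs_def] wed_mult_left[OF d(1,7)] by (simp add: wed_def pd_diff d algebra_simps)
    show ?thesis unfolding st w1 w2 wed_swap[of a b'] wed_swap[of a b] by (simp add: algebra_simps)
  qed
  have "pairing \<phi> \<eta> (Suc j) - pairing \<phi> \<eta> j = (LINT x:K|lborel. ?p' x * wed a' b' x - ?p x * wed a b x)"
    unfolding pairing_def a_def[symmetric] b_def[symmetric] a'_def[symmetric] b'_def[symmetric]
    by (rule set_integral_diff(2)[symmetric]) (intro set_integrable_compact K(1) c)+
  also have "\<dots> = (LINT x:K|lborel. step_form \<phi> (\<eta>, j, x) + (wed F b' x - wed H a x))"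
    by (rule set_lebesgue_integral_cong) (use key K(1) in \<open>simp_all add: compact_imp_closed borel_closed\<close>)
  also have "\<dots> = (LINT x:K|lborel. step_form \<phi> (\<eta>, j, x)) + (LINT x:K|lborel. wed F b' x - wed H a x)"
    by (intro set_integral_add(2) set_integrable_compact K(1) cst set_integral_diff(1) iF iH)
  also have "(LINT x:K|lborel. wed F b' x - wed H a x) = 0"
    using set_integral_diff(2)[OF iF(1) iH(1)] iF(2) iH(2) by simp
  finally show "pairing \<phi> \<eta> (Suc j) - pairing \<phi> \<eta> j = (LINT x:K|lborel. step_form \<phi> (\<eta>, j, x))"
    by simp
qed

lemma cont_integrand_bound: "continuous_on UNIV \<eta> \<Longrightarrow> continuous_on S (\<lambda>x. integrand_bound (\<eta>, j, x))"
  unfolding integrand_bound_def O12_def A_def nosc_def fst_conv snd_conv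
  by (intro continuous_intros continuous_on_Osc continuous_on_osc) (auto intro: continuous_on_subset)

text \<open>Telescoping down to the scale \<open>j0\<close>. The order of quantifiers matters: the
  constant is chosen before \<open>\<eta>\<close> and \<open>N\<close>, which vary later with
  everything else fixed.\<close>

lemma pairing_le:
  assumes \<phi>: "\<phi> \<in> test_functions V"
    and supp: "\<And>j x. j \<ge> j0 \<Longrightarrow> x \<in> W - K \<Longrightarrow> proj (u j) x \<notin> closure {y. \<phi> y \<noteq> 0}"
  shows "\<exists>C\<ge>0. \<forall>\<eta> N. continuous_on UNIV \<eta> \<and> N \<ge> j0 \<longrightarrow>
    \<bar>pairing \<phi> \<eta> N\<bar> \<le> C * (\<Sum>j\<in>{j0..<Suc N}. LINT x:K|lborel. integrand_bound (\<eta>, j, x))"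
proof -
  obtain C where C: "C \<ge> 0" "\<And>z. z \<in> J \<Longrightarrow> \<bar>step_form \<phi> z\<bar> \<le> C * \<bar>integrand_bound z\<bar>"
    by (rule bndE[OF bnd_step_form[OF \<phi>]]) blast
  \<comment> \<open>The term left over at \<open>j0\<close> contains no increment: there the weight
    is bounded by \<open>2 ^ j * A\<close> instead of \<open>A\<close>, and the extra factor
    \<open>2 ^ j0\<close> is absorbed in the constant.\<close>
  have b0: "bnd J (\<lambda>z. \<psi> \<phi> (fst z) (fst (snd z)) (snd (snd z)) * wed (slope (u (fst (snd z))) 3 2) (slope (u (fst (snd z))) 1 3) (snd (snd z)))
     (\<lambda>z. 2 ^ fst (snd z) * A z * ((2 ^ fst (snd z) * O12 (snd z)) * (2 ^ fst (snd z) * O12 (snd z))))"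
    unfolding wed_def by (intro bnd_mult bnd_\<psi>[OF \<phi>] bnd_diff bnd_lift[OF bnd_pd_slope_12(1)])
  obtain C0 where C0: "C0 \<ge> 0" "\<And>z. z \<in> J \<Longrightarrow> \<bar>\<psi> \<phi> (fst z) (fst (snd z)) (snd (snd z)) * wed (slope (u (fst (snd z))) 3 2) (slope (u (fst (snd z))) 1 3) (snd (snd z))\<bar>
      \<le> C0 * \<bar>2 ^ fst (snd z) * A z * ((2 ^ fst (snd z) * O12 (snd z)) * (2 ^ fst (snd z) * O12 (snd z)))\<bar>"
    by (rule bndE[OF b0]) blast
  let ?C = "C + C0 * 2 ^ j0"
  have "\<bar>pairing \<phi> \<eta> N\<bar> \<le> ?C * (\<Sum>j\<in>{j0..<Suc N}. LINT x:K|lborel. integrand_bound (\<eta>, j, x))"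
    if \<eta>: "continuous_on UNIV \<eta>" and N: "N \<ge> j0" for \<eta> N
  proof -
    define h where "h j = (LINT x:K|lborel. integrand_bound (\<eta>, j, x))" for j
    have inJ: "(\<eta>, j, x) \<in> J" if "j \<ge> j0" "x \<in> K" for j x using that \<eta> by (simp add: J_def)
    have ib: "set_integrable lborel K (\<lambda>x. c * integrand_bound (\<eta>, j, x))" for j c
      by (intro set_integrable_compact K(1) continuous_intros cont_integrand_bound \<eta>)
    have h0: "h j \<ge> 0" if "j \<ge> j0" for j
      unfolding h_def set_lebesgue_integral_def
      using integrand_bound_nonneg[OF inJ[OF that]] by (intro integral_nonneg_AE) (auto simp: indicator_def)
    have step: "\<bar>pairing \<phi> \<eta> (Suc j) - pairing \<phi> \<eta> j\<bar> \<le> C * h j" if "j \<ge> j0" for j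
    proof -
      have ps: "continuous_on K (\<lambda>x. step_form \<phi> (\<eta>, j, x))"
        "pairing \<phi> \<eta> (Suc j) - pairing \<phi> \<eta> j = (LINT x:K|lborel. step_form \<phi> (\<eta>, j, x))"
        using pairing_step[OF \<phi> _ \<eta> that] supp by blast+
      have "\<bar>pairing \<phi> \<eta> (Suc j) - pairing \<phi> \<eta> j\<bar> \<le> (LINT x:K|lborel. norm (step_form \<phi> (\<eta>, j, x)))"
        unfolding ps(2) using set_integral_norm_bound[OF set_integrable_compact[OF K(1) ps(1)]] by simp
      also have "\<dots> \<le> (LINT x:K|lborel. C * integrand_bound (\<eta>, j, x))"
        using C(2)[OF inJ[OF that]] integrand_bound_nonneg[OF inJ[OF that]]
        by (intro set_integral_mono ib set_integrable_compact K(1) continuous_on_norm ps(1)) auto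
      finally show ?thesis by (simp add: h_def)
    qed
    have base: "\<bar>pairing \<phi> \<eta> j0\<bar> \<le> C0 * 2 ^ j0 * h j0"
    proof -
      have cb: "continuous_on K (\<lambda>x. \<psi> \<phi> \<eta> j0 x * wed (slope (u j0) 3 2) (slope (u j0) 1 3) x)"
        by (intro continuous_intros cont_K_wed cont_K_Ck[OF Ck_on_\<psi>[OF \<phi> \<eta>]] Ck_on_slope_u) auto
      have "\<bar>pairing \<phi> \<eta> j0\<bar> \<le> (LINT x:K|lborel. norm (\<psi> \<phi> \<eta> j0 x * wed (slope (u j0) 3 2) (slope (u j0) 1 3) x))"
        unfolding pairing_def using set_integral_norm_bound[OF set_integrable_compact[OF K(1) cb]] by simp
      also have "\<dots> \<le> (LINT x:K|lborel. (C0 * 2 ^ j0) * integrand_bound (\<eta>, j0, x))"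
      proof (intro set_integral_mono ib set_integrable_compact K(1) continuous_on_norm cb)
        fix x assume x: "x \<in> K"
        have e: "2 ^ j0 * A (\<eta>, j0, x) * ((2 ^ j0 * O12 (j0, x)) * (2 ^ j0 * O12 (j0, x))) = 2 ^ j0 * integrand_bound (\<eta>, j0, x)"
          by (simp add: integrand_bound_def power2_eq_square)
        have "\<bar>\<psi> \<phi> \<eta> j0 x * wed (slope (u j0) 3 2) (slope (u j0) 1 3) x\<bar> \<le> C0 * \<bar>2 ^ j0 * integrand_bound (\<eta>, j0, x)\<bar>"
          using C0(2)[OF inJ[OF order_refl x]] unfolding fst_conv snd_conv e .
        then show "norm (\<psi> \<phi> \<eta> j0 x * wed (slope (u j0) 3 2) (slope (u j0) 1 3) x) \<le> C0 * 2 ^ j0 * integrand_bound (\<eta>, j0, x)"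
          using integrand_bound_nonneg[OF inJ[OF order_refl x]] by (simp add: abs_mult)
      qed
      finally show ?thesis by (simp add: h_def)
    qed
    have "\<bar>pairing \<phi> \<eta> N\<bar> \<le> C0 * 2 ^ j0 * h j0 + C * (\<Sum>j\<in>{j0..<N}. h j)"
      using N
    proof (induction N rule: dec_induct)
      case base
      then show ?case using \<open>\<bar>pairing \<phi> \<eta> j0\<bar> \<le> C0 * 2 ^ j0 * h j0\<close> by simp
    next
      case (step n)
      then show ?case using \<open>\<And>j. j0 \<le> j \<Longrightarrow> \<bar>pairing \<phi> \<eta> (Suc j) - pairing \<phi> \<eta> j\<bar> \<le> C * h j\<close>[of n]
        by (simp add: distrib_left)
    qed
    \<comment> \<open>Summing below \<open>Suc N\<close> makes room for the term at
      \<open>j0\<close> even if \<open>N = j0\<close>.\<close>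
    also have "\<dots> \<le> C0 * 2 ^ j0 * (\<Sum>j\<in>{j0..<Suc N}. h j) + C * (\<Sum>j\<in>{j0..<Suc N}. h j)"
      using C0(1) C(1) N h0
      by (intro add_mono mult_left_mono member_le_sum sum_mono2) auto
    finally show ?thesis by (simp add: h_def distrib_right)
  qed
  then show ?thesis using C(1) C0(1) by (intro exI[of _ ?C]) auto
qed

text \<open>Six is the number of pairs of a coordinate direction and a component of the immersion;
  Jensen is applied to each.\<close>

lemma Osc_powr_le:
  assumes "q \<ge> 1"
  shows "Osc 1 t x powr q \<le> (6 powr q * cube_vol TYPE(2) powr (q - 1)) * Osc q t x"
proof -
  let ?f = "\<lambda>(i, a). osc 1 t (pd i (w a)) x"
  have "Osc 1 t x = (\<Sum>ia\<in>UNIV. ?f ia)"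
    unfolding Osc_def by (simp add: sum.cartesian_product flip: UNIV_Times_UNIV)
  then have "Osc 1 t x powr q \<le> real (card (UNIV :: (2 \<times> 3) set)) powr q * (\<Sum>ia\<in>UNIV. ?f ia powr q)"
    using powr_sum_le[of UNIV ?f q] assms osc_nonneg[OF cont_w(2), of 1] by (auto split: prod.splits)
  also have "\<dots> = 6 powr q * (\<Sum>ia\<in>UNIV. ?f ia powr q)" by (simp add: card_prod)
  also have "\<dots> \<le> 6 powr q * (\<Sum>(i, a)\<in>UNIV. cube_vol TYPE(2) powr (q - 1) * osc q t (pd i (w a)) x)"
    by (intro mult_left_mono sum_mono) (auto intro: osc_1_powr_le cont_w assms)
  also have "(\<Sum>(i, a)\<in>UNIV. cube_vol TYPE(2) powr (q - 1) * osc q t (pd i (w a)) x) = cube_vol TYPE(2) powr (q - 1) * Osc q t x"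
    unfolding Osc_def by (simp add: sum_distrib_left sum.cartesian_product split_def flip: UNIV_Times_UNIV)
  finally show ?thesis by (simp add: mult.assoc)
qed

lemma O12_powr_le:
  assumes q: "q \<ge> 1" and s: "s > 0"
  shows "((2 ^ j) powr s * O12 (j, x)) powr q \<le> 2 powr q * (6 powr q * cube_vol TYPE(2) powr (q - 1))
    * ((2 ^ j) powr (s * q) * Osc q (dyadic j) x + (2 ^ Suc j) powr (s * q) * Osc q (dyadic (Suc j)) x)"
proof -
  let ?V = "6 powr q * cube_vol TYPE(2) powr (q - 1)"
  have "O12 (j, x) powr q \<le> 2 powr q * (Osc 1 (dyadic j) x powr q + Osc 1 (dyadic (Suc j)) x powr q)"
    unfolding O12_def fst_conv snd_conv using q by (intro powr_add_le Osc_nonneg) auto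
  also have "\<dots> \<le> 2 powr q * (?V * Osc q (dyadic j) x + ?V * Osc q (dyadic (Suc j)) x)"
    by (intro mult_left_mono add_mono Osc_powr_le q) auto
  finally have o: "O12 (j, x) powr q \<le> 2 powr q * ?V * (Osc q (dyadic j) x + Osc q (dyadic (Suc j)) x)"
    by (simp add: algebra_simps)
  have "((2 ^ j) powr s * O12 (j, x)) powr q = (2 ^ j) powr (s * q) * O12 (j, x) powr q"
    using O12_nonneg[of "(j, x)"] by (simp add: powr_mult powr_powr)
  also have "\<dots> \<le> (2 ^ j) powr (s * q) * (2 powr q * ?V * (Osc q (dyadic j) x + Osc q (dyadic (Suc j)) x))"
    by (intro mult_left_mono o) auto
  also have "\<dots> = 2 powr q * ?V * ((2 ^ j) powr (s * q) * Osc q (dyadic j) x + (2 ^ j) powr (s * q) * Osc q (dyadic (Suc j)) x)"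
    by (simp add: algebra_simps)
  also have "\<dots> \<le> 2 powr q * ?V * ((2 ^ j) powr (s * q) * Osc q (dyadic j) x + (2 ^ Suc j) powr (s * q) * Osc q (dyadic (Suc j)) x)"
    using s q by (intro mult_left_mono add_mono mult_right_mono powr_mono2 Osc_nonneg order_refl) auto
  finally show ?thesis .
qed

text \<open>The two parts of \<open>A\<close> behave differently. The oscillation goes with the
  seminorm of order \<open>2 (1 - s)\<close>; the zeroth-order part gains \<open>2^-j\<close> and
  keeps the factor \<open>2^(j (1 - 2 s))\<close>, whose powers are summable in \<open>j\<close>
  since \<open>s > 1/2\<close>.\<close>

lemma A_powr_le:
  assumes q: "q \<ge> 1" and s: "1/2 < s" "s < 1" and \<eta>: "continuous_on UNIV \<eta>"
  shows "((2 ^ j) powr (2 * (1 - s)) * A (\<eta>, j, x)) powr q \<le> (2 powr q * 2 powr q * (cube_vol TYPE(2) powr (q - 1) + 1))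
    * ((2 ^ j) powr (2 * (1 - s) * q) * osc q (dyadic j) \<eta> x + (2 ^ Suc j) powr (2 * (1 - s) * q) * osc q (dyadic (Suc j)) \<eta> x
       + (2 powr ((1 - 2 * s) * q)) ^ j * \<bar>\<eta> x\<bar> powr q)"
proof -
  let ?s0 = "2 * (1 - s)"
  let ?V = "cube_vol TYPE(2) powr (q - 1)"
  let ?o = "\<lambda>r t. osc r t \<eta> x"
  let ?Y = "(2 ^ j) powr (?s0 * q) * ?o q (dyadic j) + (2 ^ Suc j) powr (?s0 * q) * ?o q (dyadic (Suc j))"
  let ?Z = "(2 powr ((1 - 2 * s) * q)) ^ j * \<bar>\<eta> x\<bar> powr q"
  have on: "?o r t \<ge> 0" if "r > 0" for r t by (rule osc_nonneg[OF \<eta> that])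
  have nn: "nosc (\<eta>, j, x) \<ge> 0" unfolding nosc_def using on[of 1] by simp
  have Y0: "?Y \<ge> 0" and Z0: "?Z \<ge> 0" using on[of q] q by (auto intro!: add_nonneg_nonneg mult_nonneg_nonneg)
  have n1: "nosc (\<eta>, j, x) powr q \<le> 2 powr q * (?V * (?o q (dyadic j) + ?o q (dyadic (Suc j))))"
  proof -
    have "nosc (\<eta>, j, x) powr q \<le> 2 powr q * (?o 1 (dyadic j) powr q + ?o 1 (dyadic (Suc j)) powr q)"
      unfolding nosc_def fst_conv snd_conv using q on[of 1] by (intro powr_add_le) auto
    also have "\<dots> \<le> 2 powr q * (?V * ?o q (dyadic j) + ?V * ?o q (dyadic (Suc j)))"
      by (intro mult_left_mono add_mono osc_1_powr_le \<eta> q) auto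
    finally show ?thesis by (simp add: distrib_left)
  qed
  have n2: "((2 ^ j) powr ?s0 * nosc (\<eta>, j, x)) powr q \<le> 2 powr q * (?V * ?Y)"
  proof -
    have "((2 ^ j) powr ?s0 * nosc (\<eta>, j, x)) powr q = (2 ^ j) powr (?s0 * q) * nosc (\<eta>, j, x) powr q"
      using nn by (simp add: powr_mult powr_powr)
    also have "\<dots> \<le> (2 ^ j) powr (?s0 * q) * (2 powr q * (?V * (?o q (dyadic j) + ?o q (dyadic (Suc j)))))"
      by (intro mult_left_mono n1) auto
    also have "\<dots> = 2 powr q * (?V * ((2 ^ j) powr (?s0 * q) * ?o q (dyadic j) + (2 ^ j) powr (?s0 * q) * ?o q (dyadic (Suc j))))"
      by (simp add: algebra_simps)
    also have "\<dots> \<le> 2 powr q * (?V * ?Y)"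
      using s q on[of q] by (intro mult_left_mono add_mono mult_right_mono powr_mono2 order_refl) auto
    finally show ?thesis .
  qed
  have n3: "((2 ^ j) powr ?s0 * (dyadic j * \<bar>\<eta> x\<bar>)) powr q = ?Z"
  proof -
    have "(2 ^ j) powr ?s0 * dyadic j = (2 ^ j) powr (?s0 - 1)"
      unfolding powr_diff dyadic_def by simp
    also have "\<dots> = 2 powr (real j * (?s0 - 1))" by (simp add: powr_powr flip: powr_realpow)
    finally have e: "(2 ^ j) powr ?s0 * dyadic j = 2 powr (real j * (1 - 2 * s))" by (simp add: algebra_simps)
    have "((2 ^ j) powr ?s0 * (dyadic j * \<bar>\<eta> x\<bar>)) powr q = (2 powr (real j * (1 - 2 * s))) powr q * \<bar>\<eta> x\<bar> powr q"
      unfolding mult.assoc[symmetric] e by (simp add: powr_mult)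
    also have "(2 powr (real j * (1 - 2 * s))) powr q = (2 powr ((1 - 2 * s) * q)) ^ j"
      by (simp add: powr_powr mult_ac flip: powr_realpow)
    finally show ?thesis .
  qed
  have "((2 ^ j) powr ?s0 * A (\<eta>, j, x)) powr q = ((2 ^ j) powr ?s0 * nosc (\<eta>, j, x) + (2 ^ j) powr ?s0 * (dyadic j * \<bar>\<eta> x\<bar>)) powr q"
    by (simp add: A_def distrib_left)
  also have "\<dots> \<le> 2 powr q * (((2 ^ j) powr ?s0 * nosc (\<eta>, j, x)) powr q + ((2 ^ j) powr ?s0 * (dyadic j * \<bar>\<eta> x\<bar>)) powr q)"
    using nn q dyadic_pos[of j] by (intro powr_add_le) auto
  also have "\<dots> \<le> 2 powr q * (2 powr q * (?V * ?Y) + ?Z)"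
    using n2 n3 by (intro mult_left_mono add_mono) auto
  also have "\<dots> \<le> 2 powr q * (2 powr q * (?V * ?Y) + 2 powr q * ?Z + 2 powr q * ?Y + 2 powr q * (?V * ?Z))"
  proof -
    have "1 * ?Z \<le> 2 powr q * ?Z" by (rule mult_right_mono[OF _ Z0]) (use q in \<open>simp add: ge_one_powr_ge_zero\<close>)
    then have "?Z \<le> 2 powr q * ?Z" by simp
    moreover have "2 powr q * ?Y \<ge> 0" "2 powr q * (?V * ?Z) \<ge> 0" using Y0 Z0 by auto
    ultimately show ?thesis by (intro mult_left_mono) (linarith, simp)
  qed
  also have "\<dots> = (2 powr q * 2 powr q * (?V + 1)) * (?Y + ?Z)" by (simp add: algebra_simps)
  finally show ?thesis .
qed

text \<open>Three integrations by parts per dyadic step leave two oscillations of the slopes and one of \<open>\<eta>\<close>.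
  In Young's inequality \<open>\<mu>\<close> is a free parameter: the norm \<open>S\<close> of the weight can be made small, the norm of the
  surface cannot.\<close>

theorem pairing_trilinear:
  fixes p s Bw :: real
  defines "p0 \<equiv> p / (p - 2)"
  assumes \<phi>: "\<phi> \<in> test_functions V"
    and supp: "\<And>j x. j \<ge> j0 \<Longrightarrow> x \<in> W - K \<Longrightarrow> proj (u j) x \<notin> closure {y. \<phi> y \<noteq> 0}"
    and p: "p > 2" and s: "1/2 < s" "s < 1"
    and Bw: "\<And>N. (\<Sum>j\<in>{j0..<N}. (2 ^ j) powr (s * p) * (LINT x:K|lborel. Osc p (dyadic j) x)) \<le> Bw"
  shows "\<exists>C\<ge>0. \<forall>\<eta> N \<mu> S. continuous_on UNIV \<eta> \<and> N \<ge> j0 \<and> \<mu> > 0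
      \<and> (\<forall>M. (\<Sum>j\<in>{j0..<M}. (2 ^ j) powr (2 * (1 - s) * p0) * (LINT x:K|lborel. osc p0 (dyadic j) \<eta> x)) \<le> S)
      \<and> (LINT x:K|lborel. \<bar>\<eta> x\<bar> powr p0) \<le> S
    \<longrightarrow> \<bar>pairing \<phi> \<eta> N\<bar> \<le> C * (\<mu> powr p + \<mu> powr (-2 * p0) * S)"
proof -
  have p0: "p0 \<ge> 1" using p by (simp add: p0_def field_simps)
  obtain C where C: "C \<ge> 0" "\<And>\<eta> N. continuous_on UNIV \<eta> \<Longrightarrow> N \<ge> j0 \<Longrightarrow>
      \<bar>pairing \<phi> \<eta> N\<bar> \<le> C * (\<Sum>j\<in>{j0..<Suc N}. LINT x:K|lborel. integrand_bound (\<eta>, j, x))"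
    using pairing_le[OF \<phi> supp] by blast
  define K1 where "K1 = 2 powr p * (6 powr p * cube_vol TYPE(2) powr (p - 1))"
  define K2 where "K2 = 2 powr p0 * 2 powr p0 * (cube_vol TYPE(2) powr (p0 - 1) + 1)"
  define r where "r = 2 powr ((1 - 2 * s) * p0)"
  have K12: "K1 \<ge> 0" "K2 \<ge> 0" unfolding K1_def K2_def by auto
  have "(1 - 2 * s) * p0 < 0" using s p0 by (intro mult_neg_pos) auto
  then have r: "0 \<le> r" "r < 1"
    using powr_less_mono[of "(1 - 2 * s) * p0" 0 2] by (simp_all add: r_def)
  let ?s0 = "2 * (1 - s)"
  let ?D = "\<bar>C * (K1 * (2 * Bw))\<bar> + C * (K2 * (2 + 1 / (1 - r)))"
  have D: "?D \<ge> 0" using C(1) K12 r by (intro add_nonneg_nonneg mult_nonneg_nonneg) auto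
  have "\<bar>pairing \<phi> \<eta> N\<bar> \<le> ?D * (\<mu> powr p + \<mu> powr (-2 * p0) * S)"
    if \<eta>: "continuous_on UNIV \<eta>" and N: "N \<ge> j0" and \<mu>: "\<mu> > 0"
      and S1: "\<And>M. (\<Sum>j\<in>{j0..<M}. (2 ^ j) powr (?s0 * p0) * (LINT x:K|lborel. osc p0 (dyadic j) \<eta> x)) \<le> S"
      and S2: "(LINT x:K|lborel. \<bar>\<eta> x\<bar> powr p0) \<le> S" for \<eta> N \<mu> S
  proof -
    define X where "X j x = (2 ^ j) powr (s * p) * Osc p (dyadic j) x" for j x
    define Y where "Y j x = (2 ^ j) powr (?s0 * p0) * osc p0 (dyadic j) \<eta> x" for j x
    define Z where "Z x = \<bar>\<eta> x\<bar> powr p0" for x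
    have cX: "continuous_on K (X j)" for j
      unfolding X_def[abs_def] using p by (intro continuous_intros continuous_on_Osc) auto
    have cY: "continuous_on K (Y j)" for j
      unfolding Y_def[abs_def] using p0 by (intro continuous_intros continuous_on_osc \<eta>) auto
    have cZ: "continuous_on K Z"
      unfolding Z_def[abs_def] using p0
      by (intro continuous_on_powr' continuous_intros continuous_on_subset[OF \<eta>]) auto
    have nn: "X j x \<ge> 0" "Y j x \<ge> 0" "Z x \<ge> 0" for j x
      using p p0 by (auto simp: X_def Y_def Z_def intro!: mult_nonneg_nonneg Osc_nonneg osc_nonneg \<eta>)
    define IX IY IZ where "IX j = (LINT x:K|lborel. X j x)" and "IY j = (LINT x:K|lborel. Y j x)"
      and "IZ = (LINT x:K|lborel. Z x)" for j
    have I0: "IX j \<ge> 0" "IY j \<ge> 0" "IZ \<ge> 0" for j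
      unfolding IX_def IY_def IZ_def set_lebesgue_integral_def
      using nn by (auto intro!: integral_nonneg_AE)
    let ?E = "\<lambda>j x. \<mu> powr p * (K1 * (X j x + X (Suc j) x)) + \<mu> powr (-2 * p0) * (K2 * (Y j x + Y (Suc j) x + r ^ j * Z x))"
    have pw: "integrand_bound (\<eta>, j, x) \<le> ?E j x" if "j \<ge> j0" "x \<in> K" for j x
    proof -
      have An: "A (\<eta>, j, x) \<ge> 0" using that \<eta> by (intro A_nonneg) (simp add: J_def)
      \<comment> \<open>\<open>s + s + 2 (1 - s) = 2\<close>: the factor \<open>4 ^ j\<close> is
        shared out exactly between the two slopes and the weight.\<close>
      have e1: "(2 ^ j :: real) powr s * (2 ^ j) powr s * (2 ^ j) powr ?s0 = (2 ^ j)\<^sup>2"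
      proof -
        have "(2 ^ j :: real) powr s * (2 ^ j) powr s * (2 ^ j) powr ?s0 = (2 ^ j) powr (s + s + ?s0)"
          by (simp only: powr_add)
        also have "s + s + ?s0 = 2" by simp
        finally show ?thesis by simp
      qed
      have "integrand_bound (\<eta>, j, x) = ((2 ^ j) powr s * O12 (j, x))\<^sup>2 * ((2 ^ j) powr ?s0 * A (\<eta>, j, x))"
        unfolding integrand_bound_def fst_conv snd_conv power_mult_distrib e1[symmetric]
        by (simp add: power2_eq_square mult_ac)
      also have "\<dots> \<le> \<mu> powr p * ((2 ^ j) powr s * O12 (j, x)) powr p + \<mu> powr (-2 * p0) * ((2 ^ j) powr ?s0 * A (\<eta>, j, x)) powr p0"
        unfolding p0_def by (intro young_weighted p \<mu> mult_nonneg_nonneg O12_nonneg An) auto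
      also have "\<dots> \<le> ?E j x"
        unfolding X_def Y_def Z_def K1_def K2_def r_def
        using p p0 s by (intro add_mono mult_left_mono O12_powr_le A_powr_le \<eta>) auto
      finally show ?thesis .
    qed
    have each: "(LINT x:K|lborel. integrand_bound (\<eta>, j, x))
        \<le> \<mu> powr p * (K1 * (IX j + IX (Suc j))) + \<mu> powr (-2 * p0) * (K2 * (IY j + IY (Suc j) + r ^ j * IZ))"
      if "j \<ge> j0" for j
    proof -
      have i: "set_integrable lborel K (X j)" "set_integrable lborel K (Y j)" "set_integrable lborel K Z" for j
        by (intro set_integrable_compact K(1) cX cY cZ)+
      have "(LINT x:K|lborel. integrand_bound (\<eta>, j, x)) \<le> (LINT x:K|lborel. ?E j x)"
        by (intro set_integral_mono set_integrable_compact K(1) continuous_intros cX cY cZ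
            cont_integrand_bound \<eta> pw that)
      also have "\<dots> = \<mu> powr p * (K1 * (IX j + IX (Suc j))) + \<mu> powr (-2 * p0) * (K2 * (IY j + IY (Suc j) + r ^ j * IZ))"
        unfolding IX_def IY_def IZ_def using i by (simp add: set_integral_add set_integrable_mult_right)
      finally show ?thesis .
    qed
    \<comment> \<open>Each scale occurs in two neighbouring steps, hence the factor 2.\<close>
    have sX: "(\<Sum>j\<in>{j0..<Suc N}. IX j + IX (Suc j)) \<le> 2 * Bw"
    proof -
      have b: "(\<Sum>j\<in>{j0..<M}. IX j) \<le> Bw" for M
        using Bw[of M] by (simp add: IX_def X_def)
      have "(\<Sum>j\<in>{j0..<Suc N}. IX (Suc j)) \<le> (\<Sum>j\<in>{j0..<Suc (Suc N)}. IX j)"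
        by (rule sum_atLeastLessThan_Suc_shift_le) (rule I0)
      then show ?thesis
        using b[of "Suc N"] b[of "Suc (Suc N)"] unfolding sum.distrib by linarith
    qed
    have sY: "(\<Sum>j\<in>{j0..<Suc N}. IY j + IY (Suc j) + r ^ j * IZ) \<le> (2 + 1 / (1 - r)) * S"
    proof -
      have b: "(\<Sum>j\<in>{j0..<M}. IY j) \<le> S" for M
        using S1[of M] by (simp add: IY_def Y_def)
      have "(\<Sum>j\<in>{j0..<Suc N}. IY (Suc j)) \<le> (\<Sum>j\<in>{j0..<Suc (Suc N)}. IY j)"
        by (rule sum_atLeastLessThan_Suc_shift_le) (rule I0)
      moreover have "(\<Sum>j\<in>{j0..<Suc N}. r ^ j * IZ) \<le> 1 / (1 - r) * S"
      proof -
        have "(\<Sum>j\<in>{j0..<Suc N}. r ^ j * IZ) = (\<Sum>j\<in>{j0..<Suc N}. r ^ j) * IZ" by (simp only: sum_distrib_right)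
        also have "\<dots> \<le> 1 / (1 - r) * S"
          using S2 I0(3) r by (intro mult_mono sum_geometric_le) (auto simp: IZ_def Z_def)
        finally show ?thesis .
      qed
      ultimately show ?thesis
        using b[of "Suc N"] b[of "Suc (Suc N)"] unfolding sum.distrib distrib_right by linarith
    qed
    have S0: "S \<ge> 0" using S2 I0(3) by (simp add: IZ_def Z_def)
    have "(\<Sum>j\<in>{j0..<Suc N}. LINT x:K|lborel. integrand_bound (\<eta>, j, x))
        \<le> (\<Sum>j\<in>{j0..<Suc N}. \<mu> powr p * (K1 * (IX j + IX (Suc j))) + \<mu> powr (-2 * p0) * (K2 * (IY j + IY (Suc j) + r ^ j * IZ)))"
      by (rule sum_mono) (rule each, simp)
    also have "\<dots> = \<mu> powr p * (K1 * (\<Sum>j\<in>{j0..<Suc N}. IX j + IX (Suc j)))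
        + \<mu> powr (-2 * p0) * (K2 * (\<Sum>j\<in>{j0..<Suc N}. IY j + IY (Suc j) + r ^ j * IZ))"
      by (subst sum.distrib) (simp only: sum_distrib_left)
    also have "\<dots> \<le> \<mu> powr p * (K1 * (2 * Bw)) + \<mu> powr (-2 * p0) * (K2 * ((2 + 1 / (1 - r)) * S))"
      by (intro add_mono mult_left_mono sX sY K12) auto
    finally have "C * (\<Sum>j\<in>{j0..<Suc N}. LINT x:K|lborel. integrand_bound (\<eta>, j, x))
        \<le> C * (\<mu> powr p * (K1 * (2 * Bw)) + \<mu> powr (-2 * p0) * (K2 * ((2 + 1 / (1 - r)) * S)))"
      by (rule mult_left_mono[OF _ C(1)])
    also have "\<dots> = (C * (K1 * (2 * Bw))) * \<mu> powr p + (C * (K2 * (2 + 1 / (1 - r)))) * (\<mu> powr (-2 * p0) * S)"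
      by (simp add: distrib_left mult_ac)
    also have "\<dots> \<le> ?D * \<mu> powr p + ?D * (\<mu> powr (-2 * p0) * S)"
      using S0 C(1) K12 r by (intro add_mono mult_right_mono) (auto intro!: add_increasing2 mult_nonneg_nonneg)
    finally show ?thesis
      using C(2)[OF \<eta> N] by (simp add: distrib_left)
  qed
  then show ?thesis using D by (intro exI[of _ ?D]) blast
qed

end

section \<open>Curvature in terms of Christoffel symbols of the first kind\<close>

lemma matrix_inv_2x2:
  fixes A :: "real^2^2"
  assumes "det A \<noteq> 0"
  shows "matrix_inv A $ 1 $ 1 = A $ 2 $ 2 / det A" "matrix_inv A $ 1 $ 2 = - A $ 1 $ 2 / det A"
    "matrix_inv A $ 2 $ 1 = - A $ 2 $ 1 / det A" "matrix_inv A $ 2 $ 2 = A $ 1 $ 1 / det A"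
proof -
  define X where "X = matrix_inv A"
  have inv: "invertible A" using assms by (simp add: invertible_det_nz)
  have "A ** X = mat 1 \<and> X ** A = mat 1"
    using inv unfolding X_def matrix_inv_def invertible_def by (rule someI_ex)
  then have "X ** A = mat 1" ..
  then have e: "(\<Sum>k\<in>UNIV. X $ i $ k * A $ k $ j) = (if i = j then 1 else 0)" for i j
    by (simp add: vec_eq_iff matrix_matrix_mult_def mat_def)
  define d where "d = det A"
  have d: "d = A $ 1 $ 1 * A $ 2 $ 2 - A $ 1 $ 2 * A $ 2 $ 1" by (simp add: d_def det_2)
  have d0: "d \<noteq> 0" using assms by (simp add: d_def)
  have r: "X $ i $ 1 * A $ 1 $ 1 + X $ i $ 2 * A $ 2 $ 1 = (if i = 1 then 1 else 0)"
    "X $ i $ 1 * A $ 1 $ 2 + X $ i $ 2 * A $ 2 $ 2 = (if i = 2 then 1 else 0)" for i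
    using e[of i 1] e[of i 2] by (simp_all add: sum_2)
  have s: "X $ i $ 1 * d = (if i = 1 then 1 else 0) * A $ 2 $ 2 - (if i = 2 then 1 else 0) * A $ 2 $ 1"
    "X $ i $ 2 * d = (if i = 2 then 1 else 0) * A $ 1 $ 1 - (if i = 1 then 1 else 0) * A $ 1 $ 2" for i
    unfolding d r[symmetric] by algebra+
  show "matrix_inv A $ 1 $ 1 = A $ 2 $ 2 / det A" "matrix_inv A $ 1 $ 2 = - A $ 1 $ 2 / det A"
    "matrix_inv A $ 2 $ 1 = - A $ 2 $ 1 / det A" "matrix_inv A $ 2 $ 2 = A $ 1 $ 1 / det A"
    using s[of 1] s[of 2] d0 unfolding X_def[symmetric] d_def[symmetric]
    by (simp_all add: field_simps)
qed

lemma riemannian_metric_det_pos: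
  assumes "riemannian_metric_on U g" "x \<in> U"
  shows "det (g x) > 0" "g x $ 2 $ 1 = g x $ 1 $ 2"
proof -
  have sym: "transpose (g x) = g x" and pos: "\<And>w. w \<noteq> 0 \<Longrightarrow> w \<bullet> (g x *v w) > 0"
    using assms by (auto simp: riemannian_metric_on_def)
  show s: "g x $ 2 $ 1 = g x $ 1 $ 2"
    using arg_cong[OF sym, of "\<lambda>A. A $ 1 $ 2"] by (simp add: transpose_def)
  have q: "(vector [a, b] :: real^2) \<bullet> (g x *v vector [a, b]) = a\<^sup>2 * g x $ 1 $ 1 + 2 * a * b * g x $ 1 $ 2 + b\<^sup>2 * g x $ 2 $ 2" for a b
    by (simp add: inner_vec_def matrix_vector_mult_def sum_2 s power2_eq_square algebra_simps)
  have nz: "(vector [a, b] :: real^2) \<noteq> 0" if "a \<noteq> 0 \<or> b \<noteq> 0" for a b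
    using that by (auto simp: vec_eq_iff forall_2)
  have p1: "g x $ 1 $ 1 > 0" using pos[OF nz[of 1 0]] by (simp add: q)
  \<comment> \<open>The vector \<open>(- g\<^sub>1\<^sub>2, g\<^sub>1\<^sub>1)\<close> turns the
    quadratic form into \<open>g\<^sub>1\<^sub>1 * det g\<close>.\<close>
  have "(g x $ 1 $ 2)\<^sup>2 * g x $ 1 $ 1 + 2 * (- (g x $ 1 $ 2)) * g x $ 1 $ 1 * g x $ 1 $ 2 + (g x $ 1 $ 1)\<^sup>2 * g x $ 2 $ 2 > 0"
    using pos[OF nz[of "- (g x $ 1 $ 2)" "g x $ 1 $ 1"]] p1 by (simp add: q)
  then have "g x $ 1 $ 1 * det (g x) > 0"
    by (simp add: det_2 s power2_eq_square algebra_simps)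
  then show "det (g x) > 0" using p1 by (simp add: zero_less_mult_iff)
qed

text \<open>Lowering the index of the curvature tensor trades derivatives of
  \<open>christoffel\<close>, which contain the inverse metric, for derivatives of
  \<open>christ\<close>; the correction is quadratic by metric compatibility. Multiplying by the
  determinant clears the inverse that remains in the quadratic terms.\<close>

lemma gauss_curvature_eq:
  assumes U: "open U" "x \<in> U" and g: "riemannian_metric_on U g"
  defines "G \<equiv> \<lambda>i k y. g y $ i $ k"
  shows "det_met (\<lambda>i k. G i k x) * (pd 1 (christ G 1 2 2) x - pd 2 (christ G 1 1 2) x)
      - quad (\<lambda>i k. G i k x) (\<lambda>k i j. christ G k i j x) = gauss_curvature g x * (det (g x))\<^sup>2"
proof -
  have Gk: "Ck_on k U (G i j)" for k i j
    unfolding G_def using g by (intro Ck_on_nth U(1)) (auto simp: riemannian_metric_on_def smooth_on_def)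
  have dG: "G i j differentiable (at y)" if "y \<in> U" for i j y
    using Gk[of "Suc 0" i j] that by simp
  have Cc: "Ck_on 1 U (christ G k i j)" for k i j
    unfolding christ_def[abs_def] One_nat_def
    by (intro Ck_on_mult Ck_on_add Ck_on_diff Ck_on_const U(1) Ck_on_pd Gk)
  have dc: "christ G k i j differentiable (at y)" if "y \<in> U" for k i j y
    using Cc[of k i j] that by simp
  have pos: "det (g y) > 0" and sym: "G 2 1 y = G 1 2 y" if "y \<in> U" for y
    using riemannian_metric_det_pos[OF g that] by (auto simp: G_def)
  have det: "det (g y) = G 1 1 y * G 2 2 y - G 1 2 y * G 1 2 y" if "y \<in> U" for y
    using sym[OF that] by (simp add: det_2 G_def)
  define d where "d y = G 1 1 y * G 2 2 y - G 1 2 y * G 1 2 y" for y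
  have d0: "d y \<noteq> 0" if "y \<in> U" for y using det[OF that] pos[OF that] by (simp add: d_def)
  have chf: "christoffel g k i j y = (\<Sum>l\<in>UNIV. matrix_inv (g y) $ k $ l * christ G l i j y)" for k i j y
    by (simp add: christoffel_def christ_def G_def sum_distrib_left)
  have ch: "christoffel g 1 i j y = (G 2 2 y * christ G 1 i j y - G 1 2 y * christ G 2 i j y) / d y"
    "christoffel g 2 i j y = (G 1 1 y * christ G 2 i j y - G 1 2 y * christ G 1 i j y) / d y" if "y \<in> U" for i j y
  proof -
    have "det (g y) \<noteq> 0" using pos[OF that] by simp
    note m = matrix_inv_2x2[OF this]
    have s: "g y $ 2 $ 1 = g y $ 1 $ 2" using sym[OF that] by (simp add: G_def)
    show "christoffel g 1 i j y = (G 2 2 y * christ G 1 i j y - G 1 2 y * christ G 2 i j y) / d y"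
      "christoffel g 2 i j y = (G 1 1 y * christ G 2 i j y - G 1 2 y * christ G 1 i j y) / d y"
      unfolding chf sum_2 m s det[OF that] d_def[symmetric] by (simp_all add: G_def diff_divide_distrib)
  qed
  have Cd: "Ck_on 1 U d" unfolding d_def[abs_def] by (intro Ck_on_diff Ck_on_mult U(1) Gk)
  have Cch: "Ck_on 1 U (christoffel g k i j)" for k i j
  proof -
    have q: "Ck_on 1 U (\<lambda>y. (G k k y * christ G m i j y - G 1 2 y * christ G n i j y) / d y)" for k m n
      by (rule Ck_on_divide[OF U(1) _ Cd d0]) (intro Ck_on_diff Ck_on_mult U(1) Gk Cc)
    have "Ck_on 1 U (\<lambda>y. (G 2 2 y * christ G 1 i j y - G 1 2 y * christ G 2 i j y) / d y)"
      "Ck_on 1 U (\<lambda>y. (G 1 1 y * christ G 2 i j y - G 1 2 y * christ G 1 i j y) / d y)"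
      by (rule q)+
    then have "Ck_on 1 U (christoffel g 1 i j)" "Ck_on 1 U (christoffel g 2 i j)"
      using Ck_on_cong[OF U(1), of "christoffel g 1 i j", OF ch(1)] Ck_on_cong[OF U(1), of "christoffel g 2 i j", OF ch(2)] by blast+
    then show ?thesis using exhaust_2[of k] by auto
  qed
  have dch: "christoffel g k i j differentiable (at x)" for k i j using Cch[of k i j] U(2) by simp
  have lower: "(\<Sum>l\<in>UNIV. G k l y * christoffel g l i j y) = christ G k i j y" if "y \<in> U" for k i j y
  proof -
    have "k = 1 \<or> k = 2" using exhaust_2 by blast
    then show ?thesis
      using d0[OF that] sym[OF that] unfolding sum_2 ch[OF that]
      by (auto simp: field_simps) (simp_all add: d_def algebra_simps)
  qed
  have dlower: "(\<Sum>l\<in>UNIV. G 1 l x * pd m (christoffel g l i j) x)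
      = pd m (christ G 1 i j) x - (\<Sum>l\<in>UNIV. pd m (G 1 l) x * christoffel g l i j x)" for m i j
  proof -
    have "pd m (christ G 1 i j) x = pd m (\<lambda>y. \<Sum>l\<in>UNIV. G 1 l y * christoffel g l i j y) x"
      by (rule pd_cong_open[OF U]) (rule lower[symmetric])
    then show ?thesis
      by (simp add: pd_sum pd_mult dG[OF U(2)] dch sum.distrib)
  qed
  have dsym: "pd m (G 2 1) x = pd m (G 1 2) x" for m
    by (rule pd_cong_open[OF U]) (rule sym)
  \<comment> \<open>Metric compatibility: each derivative of the metric is a sum of two symbols of
    the first kind.\<close>
  have dg: "pd 1 (G 1 l) x = christ G 1 1 l x + christ G l 1 1 x" "pd 2 (G 1 l) x = christ G 1 2 l x + christ G l 1 2 x" for l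
    using exhaust_2[of l] dsym by (auto simp: christ_def field_simps)
  let ?c = "\<lambda>k i j. christ G k i j x"
  let ?C = "\<lambda>k i j. christoffel g k i j x"
  have c21: "?c k 2 1 = ?c k 1 2" for k
    using dsym by (simp add: christ_def add.commute)
  have "(\<Sum>l\<in>UNIV. G 1 l x * riemann g l 1 2 2 x)
      = (\<Sum>l\<in>UNIV. G 1 l x * pd 1 (christoffel g l 2 2) x) - (\<Sum>l\<in>UNIV. G 1 l x * pd 2 (christoffel g l 1 2) x)
        + ((\<Sum>l\<in>UNIV. G 1 l x * ?C l 1 1) * ?C 1 2 2 + (\<Sum>l\<in>UNIV. G 1 l x * ?C l 1 2) * ?C 2 2 2)
        - ((\<Sum>l\<in>UNIV. G 1 l x * ?C l 2 1) * ?C 1 1 2 + (\<Sum>l\<in>UNIV. G 1 l x * ?C l 2 2) * ?C 2 1 2)"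
    unfolding riemann_def sum_2 by (simp add: algebra_simps)
  also have "\<dots> = pd 1 (christ G 1 2 2) x - pd 2 (christ G 1 1 2) x
      - (?c 1 1 1 * ?C 1 2 2 + ?c 2 1 1 * ?C 2 2 2) + (?c 1 1 2 * ?C 1 1 2 + ?c 2 1 2 * ?C 2 1 2)"
    unfolding dlower lower[OF U(2)] dg sum_2 by (simp add: c21 algebra_simps)
  finally have R: "(\<Sum>l\<in>UNIV. G 1 l x * riemann g l 1 2 2 x) = pd 1 (christ G 1 2 2) x - pd 2 (christ G 1 1 2) x
      - (?c 1 1 1 * ?C 1 2 2 + ?c 2 1 1 * ?C 2 2 2) + (?c 1 1 2 * ?C 1 1 2 + ?c 2 1 2 * ?C 2 1 2)" .
  have "gauss_curvature g x * (det (g x))\<^sup>2 = d x * (\<Sum>l\<in>UNIV. G 1 l x * riemann g l 1 2 2 x)"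
    using d0[OF U(2)] unfolding gauss_curvature_def det[OF U(2), folded d_def]
    by (simp add: G_def power2_eq_square)
  also have "\<dots> = d x * (pd 1 (christ G 1 2 2) x - pd 2 (christ G 1 1 2) x)
      - (?c 1 1 1 * (d x * ?C 1 2 2) + ?c 2 1 1 * (d x * ?C 2 2 2)) + (?c 1 1 2 * (d x * ?C 1 1 2) + ?c 2 1 2 * (d x * ?C 2 1 2))"
    unfolding R by (simp add: algebra_simps)
  also have "\<dots> = d x * (pd 1 (christ G 1 2 2) x - pd 2 (christ G 1 1 2) x)
      - (?c 1 1 1 * (G 2 2 x * ?c 1 2 2 - G 1 2 x * ?c 2 2 2) + ?c 2 1 1 * (G 1 1 x * ?c 2 2 2 - G 1 2 x * ?c 1 2 2))
      + (?c 1 1 2 * (G 2 2 x * ?c 1 1 2 - G 1 2 x * ?c 2 1 2) + ?c 2 1 2 * (G 1 1 x * ?c 2 1 2 - G 1 2 x * ?c 1 1 2))"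
    using d0[OF U(2)] by (simp add: ch[OF U(2)])
  also have "\<dots> = det_met (\<lambda>i k. G i k x) * (pd 1 (christ G 1 2 2) x - pd 2 (christ G 1 1 2) x)
      - quad (\<lambda>i k. G i k x) (\<lambda>k i j. christ G k i j x)"
    unfolding det_met_def quad_def d_def by (simp add: power2_eq_square algebra_simps)
  finally show ?thesis by simp
qed

lemma christ_cong_open:
  assumes "open V" "x \<in> V" "\<And>i k y. y \<in> V \<Longrightarrow> G i k y = G' i k y"
  shows "christ G k i j x = christ G' k i j x" "pd m (christ G k i j) x = pd m (christ G' k i j) x"
proof -
  have e: "pd m (G i k) y = pd m (G' i k) y" if "y \<in> V" for m i k y
    by (rule pd_cong_open[OF assms(1) that]) (rule assms(3))
  then have "christ G k i j y = christ G' k i j y" if "y \<in> V" for y using that by (simp add: christ_def)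
  then show "christ G k i j x = christ G' k i j x" "pd m (christ G k i j) x = pd m (christ G' k i j) x"
    using assms(2) by (auto intro: pd_cong_open[OF assms(1,2)])
qed

section \<open>Change of variables\<close>

text \<open>Besides changing variables this passes from Lebesgue integrals over an open set, in
  which distributions are expressed, to Borel integrals over a compact set, in which the estimates
  are carried out.\<close>

lemma set_integral_C1_diffeo:
  fixes F :: "real^2 \<Rightarrow> real"
  assumes \<Psi>: "C1_diffeo U U' \<Psi> \<Phi>" and L: "compact L" "L \<subseteq> U'" and F: "continuous_on U' F" "\<And>y. y \<in> U' - L \<Longrightarrow> F y = 0"
    and K: "compact K" "\<Phi> ` L \<subseteq> K" "K \<subseteq> U"
  shows "set_integrable lebesgue U' F"
    "(LINT y:U'|lebesgue. F y) = (LINT x:K|lborel. F (\<Psi> x) * \<bar>wed (\<lambda>x. \<Psi> x $ 1) (\<lambda>x. \<Psi> x $ 2) x\<bar>)"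
proof -
  let ?D = "wed (\<lambda>x. \<Psi> x $ 1) (\<lambda>x. \<Psi> x $ 2)"
  have U: "open U" "open U'" and hom: "homeomorphism U U' \<Psi> \<Phi>" and C: "Ck_on 1 U \<Psi>"
    using \<Psi> by (auto simp: C1_diffeo_def)
  have sup: "set_integrable lebesgue T H" "(LINT y:T|lebesgue. H y) = (LINT y:C|lborel. H y)"
    if "compact C" "C \<subseteq> T" "continuous_on T H" "\<And>y. y \<in> T - C \<Longrightarrow> H y = 0" for T C and H :: "real^2 \<Rightarrow> real"
  proof -
    have cC: "continuous_on C H" using that continuous_on_subset by blast
    have e: "(\<lambda>y. indicator T y *\<^sub>R H y) = (\<lambda>y. indicator C y *\<^sub>R H y)"
      using that(2,4) by (fastforce simp: fun_eq_iff indicator_def)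
    show "set_integrable lebesgue T H"
      using set_integral_lebesgue_eq(1)[OF that(1) cC] unfolding set_integrable_def e .
    show "(LINT y:T|lebesgue. H y) = (LINT y:C|lborel. H y)"
      using set_integral_lebesgue_eq(2)[OF that(1) cC] unfolding set_lebesgue_integral_def e .
  qed
  show iF: "set_integrable lebesgue U' F" by (rule sup(1)[OF L F])
  have d\<Psi>: "(\<Psi> has_derivative frechet_derivative \<Psi> (at x)) (at x within U)" if "x \<in> U" for x
  proof -
    have "\<Psi> differentiable (at x)" using C that by simp
    then show ?thesis by (simp add: frechet_derivative_works has_derivative_at_withinI)
  qed
  have detD: "det (matrix (frechet_derivative \<Psi> (at x))) = ?D x" if "x \<in> U" for x
  proof -
    have "\<Psi> differentiable (at x)" using C that by simp
    then show ?thesis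
      by (simp add: det_2 matrix_def wed_def pd_nth) (simp add: pd_def mult.commute)
  qed
  have inj: "inj_on \<Psi> U" and im: "\<Psi> ` U = U'"
    using hom by (auto simp: homeomorphism_def inj_on_def) metis
  define H where "H x = \<bar>?D x\<bar> * F (\<Psi> x)" for x
  have cD: "continuous_on U ?D"
    using Ck_on_wed[OF U(1), of 0] Ck_on_nth[OF U(1) C] by simp
  have cH: "continuous_on U H"
    unfolding H_def[abs_def] using hom
    by (intro continuous_intros cD continuous_on_compose2[OF F(1)]) (auto simp: homeomorphism_def)
  have H0: "H x = 0" if "x \<in> U - K" for x
  proof -
    have "\<Psi> x \<notin> L"
    proof
      assume "\<Psi> x \<in> L"
      then have "\<Phi> (\<Psi> x) \<in> K" using K(2) by auto
      then show False using that hom by (simp add: homeomorphism_def)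
    qed
    moreover have "\<Psi> x \<in> U'" using im that by auto
    ultimately show ?thesis using F(2) by (simp add: H_def)
  qed
  have iH: "set_integrable lebesgue U H" by (rule sup(1)[OF K(1,3) cH H0])
  \<comment> \<open>The change of variables theorem concerns maps into a Cartesian space, so
    \<open>F\<close> is viewed as a map into \<open>real^1\<close>.\<close>
  have lift: "(\<lambda>x. \<bar>det (matrix (frechet_derivative \<Psi> (at x)))\<bar> *\<^sub>R (vec (F (\<Psi> x)) :: real^1)) absolutely_integrable_on U
      \<and> integral U (\<lambda>x. \<bar>det (matrix (frechet_derivative \<Psi> (at x)))\<bar> *\<^sub>R (vec (F (\<Psi> x)) :: real^1)) = vec (integral U' F)
    \<longleftrightarrow> (\<lambda>y. vec (F y) :: real^1) absolutely_integrable_on (\<Psi> ` U) \<and> integral (\<Psi> ` U) (\<lambda>y. vec (F y) :: real^1) = vec (integral U' F)"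
    using has_absolute_integral_change_of_variables[of U \<Psi> "\<lambda>x. frechet_derivative \<Psi> (at x)" "\<lambda>y. vec (F y) :: real^1", OF _ d\<Psi> inj]
      U(1) by simp
  have bl: "bounded_linear (vec :: real \<Rightarrow> real^1)"
    by (rule linear_conv_bounded_linear[THEN iffD1, OF linear_vec])
  have v: "(\<lambda>y. vec (F y) :: real^1) absolutely_integrable_on U'" "integral U' (\<lambda>y. vec (F y) :: real^1) = vec (integral U' F)"
    using absolutely_integrable_linear[OF iF bl] integral_linear[OF set_lebesgue_integral_eq_integral(1)[OF iF] bl]
    by (simp_all add: o_def)
  have "integral U (\<lambda>x. \<bar>det (matrix (frechet_derivative \<Psi> (at x)))\<bar> *\<^sub>R (vec (F (\<Psi> x)) :: real^1)) = vec (integral U' F)"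
    using lift v by (simp add: im)
  also have "integral U (\<lambda>x. \<bar>det (matrix (frechet_derivative \<Psi> (at x)))\<bar> *\<^sub>R (vec (F (\<Psi> x)) :: real^1))
      = integral U (\<lambda>x. vec (H x))"
    by (rule integral_cong) (simp add: detD H_def vec_eq_iff)
  also have "\<dots> = vec (integral U H)"
    using integral_linear[OF set_lebesgue_integral_eq_integral(1)[OF iH] bl] by (simp add: o_def)
  finally have "integral U H = integral U' F" by (simp add: vec_eq_iff)
  then have "(LINT y:U'|lebesgue. F y) = (LINT x:U|lebesgue. H x)"
    using set_lebesgue_integral_eq_integral(2)[OF iF] set_lebesgue_integral_eq_integral(2)[OF iH] by simp
  also have "\<dots> = (LINT x:K|lborel. H x)" by (rule sup(2)[OF K(1,3) cH H0])
  finally show "(LINT y:U'|lebesgue. F y) = (LINT x:K|lborel. F (\<Psi> x) * \<bar>?D x\<bar>)"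
    by (simp add: H_def mult.commute)
qed

section \<open>Removing a set of capacity zero\<close>

text \<open>Supplies the smallness at the endpoint: a bound on the dyadic sums gives no rate, but it
  forces their terms to tend to 0.\<close>

lemma tendsto_0_of_bounded_sums:
  fixes f :: "nat \<Rightarrow> real"
  assumes "\<And>j. f j \<ge> 0" "\<And>N. (\<Sum>j\<in>{j0..<N}. f j) \<le> B"
  shows "f \<longlonglongrightarrow> 0"
proof -
  have "summable (\<lambda>j. f (j + j0))"
  proof (rule summableI_nonneg_bounded)
    fix n
    have "(\<Sum>j<n. f (j + j0)) = (\<Sum>j\<in>{j0..<n + j0}. f j)"
      using sum.shift_bounds_nat_ivl[of f 0 j0 n] by (simp add: lessThan_atLeast0)
    then show "(\<Sum>j<n. f (j + j0)) \<le> B" using assms(2)[of "n + j0"] by simp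
  qed (rule assms(1))
  then have "(\<lambda>j. f (j + j0)) \<longlonglongrightarrow> 0" by (rule summable_LIMSEQ_zero)
  then show ?thesis by (rule LIMSEQ_offset)
qed

lemma (in mollified_graph) Osc_dyadic_bounded:
  assumes q: "q \<ge> 1" and s: "s > 0" and V: "V \<in> sets borel"
    and KV: "\<And>x y j. x \<in> K \<Longrightarrow> y \<in> unit_cube \<Longrightarrow> j \<ge> j0 \<Longrightarrow> x - dyadic j *\<^sub>R y \<in> V" and KV0: "K \<subseteq> V"
    and fin: "\<And>i a. gagliardo_pow s q V (pd i (w a)) < \<infinity>"
  obtains Bw where "\<And>N. (\<Sum>j\<in>{j0..<N}. (2 ^ j) powr (s * q) * (LINT x:K|lborel. Osc q (dyadic j) x)) \<le> Bw"
proof -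
  let ?b = "\<lambda>i a. 2 * real CARD(2) powr (real CARD(2) + s * q) * enn2real (gagliardo_pow s q V (pd i (w a)))"
  have i: "set_integrable lborel K (osc q t (pd i (w a)))" for t i a
    using q by (intro set_integrable_compact K(1) continuous_on_osc cont_w) auto
  have e: "(LINT x:K|lborel. Osc q t x) = (\<Sum>i\<in>UNIV. \<Sum>a\<in>UNIV. LINT x:K|lborel. osc q t (pd i (w a)) x)" for t
  proof -
    have "(LINT x:K|lborel. Osc q t x) = (\<Sum>i\<in>UNIV. LINT x:K|lborel. (\<Sum>a\<in>UNIV. osc q t (pd i (w a)) x))"
      unfolding Osc_def sum_2 sum_3 using i by (intro set_integral_add) auto
    also have "\<dots> = (\<Sum>i\<in>UNIV. \<Sum>a\<in>UNIV. LINT x:K|lborel. osc q t (pd i (w a)) x)"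
      unfolding sum_3 using i by (simp add: set_integral_add)
    finally show ?thesis .
  qed
  have "(\<Sum>j\<in>{j0..<N}. (2 ^ j) powr (s * q) * (LINT x:K|lborel. Osc q (dyadic j) x)) \<le> (\<Sum>i\<in>UNIV. \<Sum>a\<in>UNIV. ?b i a)" for N
  proof -
    have "(\<Sum>j\<in>{j0..<N}. (2 ^ j) powr (s * q) * (LINT x:K|lborel. Osc q (dyadic j) x))
        = (\<Sum>j\<in>{j0..<N}. \<Sum>i\<in>UNIV. \<Sum>a\<in>UNIV. (2 ^ j) powr (s * q) * (LINT x:K|lborel. osc q (dyadic j) (pd i (w a)) x))"
      unfolding e by (simp add: sum_distrib_left)
    also have "\<dots> = (\<Sum>i\<in>UNIV. \<Sum>a\<in>UNIV. \<Sum>j\<in>{j0..<N}. (2 ^ j) powr (s * q) * (LINT x:K|lborel. osc q (dyadic j) (pd i (w a)) x))"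
      by (subst sum.swap, rule sum.cong[OF refl], rule sum.swap)
    also have "\<dots> \<le> (\<Sum>i\<in>UNIV. \<Sum>a\<in>UNIV. ?b i a)"
      using KV unfolding dyadic_def
      by (intro sum_mono osc_dyadic_sum_le cont_w q s K(1) V KV0 fin) auto
    finally show ?thesis .
  qed
  then show ?thesis using that by blast
qed

lemma eventually_dyadic_less:
  assumes "d > 0"
  obtains j0 where "\<And>j. j \<ge> j0 \<Longrightarrow> dyadic j < d"
  using order_tendstoD(2)[OF dyadic_tendsto_0 assms] by (auto simp: eventually_sequentially)

lemma dyadic_shift_mem:
  assumes "compact C" "open V" "C \<subseteq> V"
  obtains j0 where "\<And>x y j. x \<in> C \<Longrightarrow> y \<in> (unit_cube :: (real^2) set) \<Longrightarrow> j \<ge> j0 \<Longrightarrow> x - dyadic j *\<^sub>R y \<in> V"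
proof -
  obtain e where e: "e > 0" "(\<Union>x\<in>C. ball x e) \<subseteq> V"
    using compact_subset_open_imp_ball_epsilon_subset[OF assms] by blast
  obtain j0 where j0: "\<And>j. j \<ge> j0 \<Longrightarrow> dyadic j < e / 2"
    using eventually_dyadic_less[of "e / 2"] e(1) by auto
  have "x - dyadic j *\<^sub>R y \<in> V" if "x \<in> C" "y \<in> unit_cube" "j \<ge> j0" for x y :: "real^2" and j
  proof -
    have "dist x (x - dyadic j *\<^sub>R y) \<le> dyadic j * 2"
      using mult_left_mono[OF unit_cube_norm_le[OF that(2)], of "dyadic j"] dyadic_pos[of j] by (simp add: dist_norm)
    also have "\<dots> < e" using j0[OF that(3)] by simp
    finally have "x - dyadic j *\<^sub>R y \<in> ball x e" by simp
    then show ?thesis using e(2) that(1) by blast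
  qed
  with that show ?thesis by blast
qed

text \<open>The Jacobian is a polynomial in first derivatives, and these converge uniformly on
  \<open>C\<close>; half of its minimal absolute value survives.\<close>

lemma wed_reg_nondegenerate:
  fixes w :: "3 \<Rightarrow> real^2 \<Rightarrow> real"
  assumes w: "\<And>a. Ck_on 1 UNIV (w a)" and B: "\<And>a i x. \<bar>pd i (w a) x\<bar> \<le> B"
    and C: "compact C" and nz: "\<And>x. x \<in> C \<Longrightarrow> wed (w 1) (w 2) x \<noteq> 0"
  obtains c j0 where "c > 0" "\<And>j x. j \<ge> j0 \<Longrightarrow> x \<in> C \<Longrightarrow> c \<le> \<bar>wed (reg (dyadic j) (w 1)) (reg (dyadic j) (w 2)) x\<bar>"
    "\<And>x. x \<in> C \<Longrightarrow> c \<le> \<bar>wed (w 1) (w 2) x\<bar>"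
proof (cases "C = {}")
  case True
  then show ?thesis by (intro that[of 1 0]) auto
next
  case False
  have cw: "continuous_on UNIV (pd i (w a))" for i a using w[of a] by simp
  have "continuous_on C (\<lambda>x. \<bar>wed (w 1) (w 2) x\<bar>)"
    unfolding wed_def by (intro continuous_intros continuous_on_subset[OF cw]) auto
  then obtain x0 where x0: "x0 \<in> C" "\<And>x. x \<in> C \<Longrightarrow> \<bar>wed (w 1) (w 2) x0\<bar> \<le> \<bar>wed (w 1) (w 2) x\<bar>"
    using continuous_attains_inf[OF C False] by blast
  define m where "m = \<bar>wed (w 1) (w 2) x0\<bar>"
  have m: "m > 0" using nz[OF x0(1)] by (simp add: m_def)
  have B0: "B \<ge> 0" using order_trans[OF abs_ge_zero B] .
  \<comment> \<open>Two products of derivatives, each off by at most \<open>2 * (B * e)\<close>,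
    change the Jacobian by at most \<open>4 * (B * e)\<close>, which is at most
    \<open>m / 2\<close>; writing \<open>B + 1\<close> keeps the denominator positive.\<close>
  define e where "e = m / (8 * (B + 1))"
  have e: "e > 0" using m B0 by (simp add: e_def)
  have "\<exists>d>0. \<forall>t x. 0 < t \<and> t < d \<and> x \<in> C \<longrightarrow> \<bar>reg t (pd i (w a)) x - pd i (w a) x\<bar> \<le> e" for i a
    by (rule reg_uniformly_close[OF cw C e])
  then obtain d where d: "\<And>i a. d i a > 0"
    "\<And>i a t x. 0 < t \<Longrightarrow> t < d i a \<Longrightarrow> x \<in> C \<Longrightarrow> \<bar>reg t (pd i (w a)) x - pd i (w a) x\<bar> \<le> e"
    by metis
  define d0 where "d0 = Min (range (\<lambda>(i, a). d i a))"
  have d0: "d0 > 0" unfolding d0_def using d(1) by (subst Min_gr_iff) auto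
  have d0_le: "d0 \<le> d i a" for i a
    unfolding d0_def by (rule Min_le) (auto intro: image_eqI[of _ _ "(i, a)"])
  obtain j0 where j0: "\<And>j. j \<ge> j0 \<Longrightarrow> dyadic j < d0" using eventually_dyadic_less[OF d0] by blast
  have main: "m / 2 \<le> \<bar>wed (reg (dyadic j) (w 1)) (reg (dyadic j) (w 2)) x\<bar>" if "j \<ge> j0" "x \<in> C" for j x
  proof -
    let ?r = "\<lambda>i a. reg (dyadic j) (pd i (w a)) x"
    let ?p = "\<lambda>i a. pd i (w a) x"
    have close: "\<bar>?r i a - ?p i a\<bar> \<le> e" for i a
      using d(2)[OF dyadic_pos less_le_trans[OF j0[OF that(1)] d0_le] that(2)] .
    have rB: "\<bar>?r i a\<bar> \<le> B" for i a by (rule reg_abs_le[OF cw B])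
    have prod: "\<bar>?r i a * ?r k b - ?p i a * ?p k b\<bar> \<le> 2 * (B * e)" for i a k b
    proof -
      have eq: "?r i a * ?r k b - ?p i a * ?p k b = (?r i a - ?p i a) * ?r k b + ?p i a * (?r k b - ?p k b)"
        by (simp add: algebra_simps)
      have "\<bar>?r i a - ?p i a\<bar> * \<bar>?r k b\<bar> \<le> e * B"
        using close[of i a] rB[of k b] e by (intro mult_mono) auto
      moreover have "\<bar>?p i a\<bar> * \<bar>?r k b - ?p k b\<bar> \<le> B * e"
        using close[of k b] B[of i a x] B0 by (intro mult_mono) auto
      ultimately show ?thesis
        unfolding eq using abs_triangle_ineq[of "(?r i a - ?p i a) * ?r k b" "?p i a * (?r k b - ?p k b)"]
        by (simp add: abs_mult mult.commute)
    qed
    have "wed (reg (dyadic j) (w 1)) (reg (dyadic j) (w 2)) x = ?r 1 1 * ?r 2 2 - ?r 2 1 * ?r 1 2"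
      unfolding wed_def by (simp add: pd_mol[OF continuous_on_rho(1) w])
    then have "\<bar>wed (reg (dyadic j) (w 1)) (reg (dyadic j) (w 2)) x - wed (w 1) (w 2) x\<bar> \<le> 4 * (B * e)"
      using prod[of 1 1 2 2] prod[of 2 1 1 2] by (simp add: wed_def)
    moreover have "4 * (B * e) \<le> m / 2"
    proof -
      have "4 * (B * e) \<le> 4 * ((B + 1) * e)" using e by simp
      also have "\<dots> = m / 2" using B0 by (simp add: e_def field_simps)
      finally show ?thesis .
    qed
    moreover have "m \<le> \<bar>wed (w 1) (w 2) x\<bar>" unfolding m_def by (rule x0(2)[OF that(2)])
    ultimately show ?thesis by linarith
  qed
  have "m / 2 \<le> \<bar>wed (w 1) (w 2) x\<bar>" if "x \<in> C" for x
    using x0(2)[OF that] m by (simp add: m_def)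
  with main m show ?thesis by (intro that[of "m / 2" j0]) auto
qed

lemma C1_compact_support_bounded:
  fixes F :: "real^'n::finite \<Rightarrow> real"
  assumes F: "Ck_on 1 UNIV F" and K: "compact K" "\<And>x. x \<notin> K \<Longrightarrow> F x = 0"
  obtains M where "\<And>x. \<bar>F x\<bar> \<le> M" "\<And>i x. \<bar>pd i F x\<bar> \<le> M"
proof -
  have bd: "\<exists>C. \<forall>x. \<bar>H x\<bar> \<le> C" if "continuous_on UNIV H" "\<And>x. x \<notin> K \<Longrightarrow> H x = 0" for H :: "real^'n \<Rightarrow> real"
  proof -
    have "bounded (H ` K)"
      using that(1) K(1) by (intro compact_imp_bounded compact_continuous_image) (auto intro: continuous_on_subset)
    then obtain C where "\<And>x. x \<in> K \<Longrightarrow> \<bar>H x\<bar> \<le> C" by (auto simp: bounded_iff)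
    then have "\<bar>H x\<bar> \<le> max C 0" for x using that(2)[of x] by (cases "x \<in> K") (auto simp: le_max_iff_disj)
    then show ?thesis by blast
  qed
  have pd0: "pd i F x = 0" if "x \<notin> K" for i x
  proof -
    have "pd i F x = pd i (\<lambda>_. 0) x"
      by (rule pd_cong_open[of "- K"]) (use that K in \<open>auto simp: compact_imp_closed open_Compl\<close>)
    then show ?thesis by simp
  qed
  obtain C0 where C0: "\<And>x. \<bar>F x\<bar> \<le> C0" using bd[OF Ck_on_imp_continuous[OF F] K(2)] by blast
  have "\<exists>C. \<forall>x. \<bar>pd i F x\<bar> \<le> C" for i using F by (intro bd pd0) auto
  then obtain C1 where C1: "\<And>i x. \<bar>pd i F x\<bar> \<le> C1 i" by metis
  define M where "M = max C0 (Max (range C1))"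
  have "C1 i \<le> M" for i unfolding M_def by (rule max.coboundedI2) (rule Max_ge, auto)
  with C1 have "\<bar>pd i F x\<bar> \<le> M" for i x using order_trans by blast
  moreover have "\<bar>F x\<bar> \<le> M" for x using C0[of x] by (simp add: M_def)
  ultimately show ?thesis using that by blast
qed

lemma Lp_norm_pow_cmult:
  assumes h: "continuous_on UNIV h" and le: "\<And>x. \<bar>\<eta> x\<bar> \<le> C * \<bar>h x\<bar>" and C: "C \<ge> 0" and q: "q > 0"
  shows "(\<integral>\<^sup>+x. ennreal (\<bar>\<eta> x\<bar> powr q) \<partial>lborel) \<le> ennreal (C powr q) * Lp_norm_pow q UNIV (h :: real^'n::finite \<Rightarrow> real)"
proof -
  have [measurable]: "h \<in> borel_measurable borel" using h by (rule borel_measurable_continuous_onI)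
  have "(\<integral>\<^sup>+x. ennreal (\<bar>\<eta> x\<bar> powr q) \<partial>lborel) \<le> (\<integral>\<^sup>+x. ennreal (C powr q) * ennreal (\<bar>h x\<bar> powr q) \<partial>lborel)"
  proof (rule nn_integral_mono)
    fix x
    have "\<bar>\<eta> x\<bar> powr q \<le> C powr q * \<bar>h x\<bar> powr q"
      using powr_mono2[OF less_imp_le[OF q] abs_ge_zero le[of x]] C by (simp add: powr_mult)
    then show "ennreal (\<bar>\<eta> x\<bar> powr q) \<le> ennreal (C powr q) * ennreal (\<bar>h x\<bar> powr q)"
      by (simp add: ennreal_leI flip: ennreal_mult')
  qed
  also have "\<dots> = ennreal (C powr q) * (\<integral>\<^sup>+x. ennreal (\<bar>h x\<bar> powr q) \<partial>lborel)"
    by (rule nn_integral_cmult) measurable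
  finally show ?thesis by (simp add: Lp_norm_pow_def nn_integral_completion)
qed

lemma gagliardo_pow_cmult:
  assumes h: "continuous_on UNIV h" and le: "\<And>x y. \<bar>\<eta> x - \<eta> y\<bar> \<le> C * \<bar>h x - h y\<bar>" and C: "C \<ge> 0" and q: "q > 0"
  shows "gagliardo_pow s q UNIV \<eta> \<le> ennreal (C powr q) * gagliardo_pow s q UNIV (h :: real^'n::finite \<Rightarrow> real)"
proof -
  have [measurable]: "h \<in> borel_measurable borel" using h by (rule borel_measurable_continuous_onI)
  let ?k = "\<lambda>f x y. ennreal (norm (f x - f y) powr q / norm (x - y) powr (real CARD('n) + s * q))"
  have pw: "?k \<eta> x y \<le> ennreal (C powr q) * ?k h x y" for x y
  proof -
    have "\<bar>\<eta> x - \<eta> y\<bar> powr q \<le> C powr q * \<bar>h x - h y\<bar> powr q"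
      using powr_mono2[OF less_imp_le[OF q] abs_ge_zero le[of x y]] C by (simp add: powr_mult)
    then have "\<bar>\<eta> x - \<eta> y\<bar> powr q / norm (x - y) powr (real CARD('n) + s * q)
        \<le> C powr q * (\<bar>h x - h y\<bar> powr q / norm (x - y) powr (real CARD('n) + s * q))"
      using divide_right_mono[of _ _ "norm (x - y) powr (real CARD('n) + s * q)"] by fastforce
    then show ?thesis by (simp add: ennreal_leI flip: ennreal_mult')
  qed
  have "gagliardo_pow s q UNIV \<eta> = (\<integral>\<^sup>+x. (\<integral>\<^sup>+y. ?k \<eta> x y \<partial>lborel) \<partial>lborel)"
    by (simp add: gagliardo_pow_lborel)
  also have "\<dots> \<le> (\<integral>\<^sup>+x. (\<integral>\<^sup>+y. ennreal (C powr q) * ?k h x y \<partial>lborel) \<partial>lborel)"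
    by (intro nn_integral_mono pw)
  also have "\<dots> = (\<integral>\<^sup>+x. ennreal (C powr q) * (\<integral>\<^sup>+y. ?k h x y \<partial>lborel) \<partial>lborel)"
    by (intro nn_integral_cong nn_integral_cmult) measurable
  also have "\<dots> = ennreal (C powr q) * (\<integral>\<^sup>+x. (\<integral>\<^sup>+y. ?k h x y \<partial>lborel) \<partial>lborel)"
    by (rule nn_integral_cmult) measurable
  finally show ?thesis by (simp add: gagliardo_pow_lborel)
qed

text \<open>A competitor for the capacity is at least 1 on \<open>S\<close> itself, but a weight
  equal to 1 near \<open>S\<close> is wanted. Doubling and truncating to \<open>[0, 1]\<close> makes
  it 1 wherever \<open>h > 1/2\<close>; as this at most doubles increments, the \<open>q\<close>-th
  powers of the norms grow by at most \<open>2 powr q\<close>, whence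
  \<open>\<epsilon>\<close>.\<close>

lemma capacity_zero_weight:
  fixes S :: "(real^'n::finite) set"
  assumes cap: "Cap \<sigma> q S = 0" and \<delta>: "\<delta> > 0" and q: "q > 0"
  obtains \<eta> N L where "continuous_on UNIV \<eta>" "open N" "S \<subseteq> N" "\<And>x. x \<in> N \<Longrightarrow> \<eta> x = (1 :: real)"
    "\<And>x y. \<bar>\<eta> (x - y) - \<eta> x\<bar> \<le> L * norm y" "\<And>x. \<bar>\<eta> x\<bar> \<le> 1"
    "gagliardo_pow \<sigma> q UNIV \<eta> \<le> ennreal \<delta>" "(\<integral>\<^sup>+x. ennreal (\<bar>\<eta> x\<bar> powr q) \<partial>lborel) \<le> ennreal \<delta>"
proof -
  define \<epsilon> where "\<epsilon> = \<delta> / 2 powr q"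
  have \<epsilon>: "\<epsilon> > 0" using \<delta> by (simp add: \<epsilon>_def)
  have "Cap \<sigma> q S < ennreal \<epsilon>" using cap \<epsilon> by simp
  then obtain h where h: "h \<in> test_functions UNIV" "\<And>x. x \<in> S \<Longrightarrow> h x \<ge> 1"
    "Lp_norm_pow q UNIV h + gagliardo_pow \<sigma> q UNIV h < ennreal \<epsilon>"
    unfolding Cap_def INF_less_iff by auto
  have C1: "Ck_on 1 UNIV h" by (rule test_functionsD(1)[OF h(1)])
  have ch: "continuous_on UNIV h" by (rule Ck_on_imp_continuous[OF C1])
  obtain M where M: "\<And>x. \<bar>h x\<bar> \<le> M" "\<And>i x. \<bar>pd i h x\<bar> \<le> M"
    using C1_compact_support_bounded[OF C1 test_functionsD(2)[OF h(1)] test_functionsD(4)[OF h(1)]] by blast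
  define \<eta> where "\<eta> x = min 1 (max 0 (2 * h x))" for x
  have diff: "\<bar>\<eta> x - \<eta> y\<bar> \<le> 2 * \<bar>h x - h y\<bar>" for x y
    unfolding \<eta>_def by (auto simp: min_def max_def abs_if)
  have Lip: "\<bar>\<eta> (x - y) - \<eta> x\<bar> \<le> (2 * (CARD('n) * M)) * norm y" for x y
    using diff[of "x - y" x] Lipschitz_of_bounded_pd[OF C1 M(2), of x y] by simp
  have small: "Lp_norm_pow q UNIV h \<le> ennreal \<epsilon>" "gagliardo_pow \<sigma> q UNIV h \<le> ennreal \<epsilon>"
    by (rule order_trans[OF _ less_imp_le[OF h(3)]], simp add: add_increasing2 add_increasing)+
  have \<epsilon>\<delta>: "ennreal (2 powr q) * ennreal \<epsilon> = ennreal \<delta>"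
    by (simp add: \<epsilon>_def flip: ennreal_mult')
  show ?thesis
  proof (rule that[of \<eta> "{x. h x > 1/2}" "2 * (CARD('n) * M)"])
    show "continuous_on UNIV \<eta>" unfolding \<eta>_def[abs_def] by (intro continuous_intros ch)
    show "open {x. h x > 1/2}" by (intro open_Collect_less continuous_intros ch)
    show "S \<subseteq> {x. h x > 1/2}" using h(2) by fastforce
    show "\<eta> x = 1" if "x \<in> {x. h x > 1/2}" for x using that by (simp add: \<eta>_def)
    show "\<bar>\<eta> x\<bar> \<le> 1" for x by (simp add: \<eta>_def)
    have "gagliardo_pow \<sigma> q UNIV \<eta> \<le> ennreal (2 powr q) * gagliardo_pow \<sigma> q UNIV h"
      using diff q by (intro gagliardo_pow_cmult ch) auto
    also have "\<dots> \<le> ennreal (2 powr q) * ennreal \<epsilon>" by (rule mult_left_mono[OF small(2)]) simp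
    finally show "gagliardo_pow \<sigma> q UNIV \<eta> \<le> ennreal \<delta>" unfolding \<epsilon>\<delta> .
    have "\<bar>\<eta> x\<bar> \<le> 2 * \<bar>h x\<bar>" for x by (auto simp: \<eta>_def min_def max_def)
    then have "(\<integral>\<^sup>+x. ennreal (\<bar>\<eta> x\<bar> powr q) \<partial>lborel) \<le> ennreal (2 powr q) * Lp_norm_pow q UNIV h"
      using q by (intro Lp_norm_pow_cmult ch) auto
    also have "\<dots> \<le> ennreal (2 powr q) * ennreal \<epsilon>" by (rule mult_left_mono[OF small(1)]) simp
    finally show "(\<integral>\<^sup>+x. ennreal (\<bar>\<eta> x\<bar> powr q) \<partial>lborel) \<le> ennreal \<delta>" unfolding \<epsilon>\<delta> .
  qed (rule Lip)
qed

context mollified_graph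
begin

text \<open>No smallness of \<open>L\<close> is asked for: \<open>\<eta>\<close> is fixed while the
  scale varies, so a gradient bound of order \<open>L\<close> is a constant in the sense of
  \<open>bnd\<close>.\<close>

lemma tame_one_minus_reg_mult_\<theta>:
  assumes \<phi>: "\<phi> \<in> test_functions V" and \<eta>: "continuous_on UNIV \<eta>" and L: "\<And>x y. \<bar>\<eta> (x - y) - \<eta> x\<bar> \<le> L * norm y"
    and \<eta>1: "\<And>x. \<bar>\<eta> x\<bar> \<le> 1"
  shows "tame (\<lambda>j x. (1 - reg (dyadic j) \<eta> x) * \<theta> \<phi> j x)"
proof (rule tame_mult)
  have pos: "z \<in> I \<Longrightarrow> (1 :: real) \<le> 1 + 2 ^ fst z * O1 z" for z by (simp add: O1_nonneg)
  show "tame (\<theta> \<phi>)"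
    unfolding tame_def
    by (intro conjI allI impI Ck_on_\<theta>[OF \<phi>] bnd_\<theta>[OF \<phi>] bnd_le[OF bnd_pd_\<theta>[OF \<phi>] _ pos]) auto
  have L0: "L \<ge> 0" using order_trans[OF abs_ge_zero L[of _ "axis 1 1"]] by simp
  let ?R = "rho_bound TYPE(2)" and ?V = "cube_vol TYPE(2)"
  have pdb: "\<bar>pd k (reg (dyadic j) \<eta>) x\<bar> \<le> ?R * (?V * (L * 2))" for j k x
  proof -
    have "\<bar>\<eta> (x - dyadic j *\<^sub>R y) - \<eta> x\<bar> \<le> L * 2 * dyadic j" if "y \<in> unit_cube" for y
    proof -
      have "\<bar>\<eta> (x - dyadic j *\<^sub>R y) - \<eta> x\<bar> \<le> L * norm (dyadic j *\<^sub>R y)" by (rule L)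
      also have "\<dots> \<le> L * (dyadic j * 2)"
        using unit_cube_norm_le[OF that] dyadic_pos[of j] L0 by (intro mult_left_mono) auto
      finally show ?thesis by (simp add: mult_ac)
    qed
    then have o: "osc 1 (dyadic j) \<eta> x \<le> ?V * (L * 2 * dyadic j)" by (rule osc_le[OF \<eta>])
    have "\<bar>pd k (reg (dyadic j) \<eta>) x\<bar> \<le> ?R / dyadic j * osc 1 (dyadic j) \<eta> x"
      by (rule pd_reg_le[OF \<eta> dyadic_pos])
    also have "\<dots> \<le> ?R / dyadic j * (?V * (L * 2 * dyadic j))"
      using rho_bound(1)[where 'n=2] dyadic_pos[of j] by (intro mult_left_mono o) auto
    also have "\<dots> = ?R * (?V * (L * 2))" using dyadic_pos[of j] by simp
    finally show ?thesis .
  qed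
  have d: "reg (dyadic j) \<eta> differentiable (at x)" for j x
    using Ck_on_reg[OF \<eta> dyadic_pos, of "Suc 0" j] by simp
  have pde: "pd k (\<lambda>x. 1 - reg (dyadic j) \<eta> x) x = - pd k (reg (dyadic j) \<eta>) x" for j k x
    by (simp add: pd_diff d)
  show "tame (\<lambda>j x. 1 - reg (dyadic j) \<eta> x)"
    unfolding tame_def
  proof (intro conjI allI impI)
    show "Ck_on 1 W (\<lambda>x. 1 - reg (dyadic j) \<eta> x)" for j
      by (intro Ck_on_diff W Ck_on_const Ck_on_subset[OF Ck_on_reg[OF \<eta> dyadic_pos] subset_UNIV])
    have "\<bar>reg (dyadic j) \<eta> x\<bar> \<le> 1" for j x by (rule reg_abs_le[OF \<eta> \<eta>1])
    then have "bnd I (\<lambda>z. reg (dyadic (fst z)) \<eta> (snd z)) (\<lambda>_. 1)" by (intro bndI[of _ _ 1]) simp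
    then show "bnd I (\<lambda>z. 1 - reg (dyadic (fst z)) \<eta> (snd z)) (\<lambda>_. 1)" by (intro bnd_diff bnd_const)
    fix k
    have "bnd I (\<lambda>z. pd k (\<lambda>x. 1 - reg (dyadic (fst z)) \<eta> x) (snd z)) (\<lambda>_. 1)"
      unfolding pde using pdb by (intro bndI[of _ _ "?R * (?V * (L * 2))"]) simp
    then show "bnd I (\<lambda>z. pd k (\<lambda>x. 1 - reg (dyadic (fst z)) \<eta> x) (snd z)) (\<lambda>z. 1 + 2 ^ fst z * O1 z)"
      by (rule bnd_le) (simp_all add: O1_nonneg)
  qed
qed

end

lemma set_integral_le_of_nn_integral:
  fixes f :: "'a::euclidean_space \<Rightarrow> real"
  assumes K: "compact K" and f: "continuous_on K f" and nonneg: "\<And>x. f x \<ge> 0"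
    and le: "(\<integral>\<^sup>+x. ennreal (f x) \<partial>lborel) \<le> ennreal d" and d: "d \<ge> 0"
  shows "(LINT x:K|lborel. f x) \<le> d"
proof -
  have "ennreal (LINT x:K|lborel. f x) = (\<integral>\<^sup>+x. ennreal (indicator K x * f x) \<partial>lborel)"
    by (rule nn_integral_compact_eq[OF K f nonneg, symmetric])
  also have "\<dots> \<le> (\<integral>\<^sup>+x. ennreal (f x) \<partial>lborel)"
    by (intro nn_integral_mono ennreal_leI) (simp add: indicator_def nonneg)
  also note le
  finally show ?thesis using d by (simp add: ennreal_le_iff)
qed

lemma reg_eq_const:
  fixes \<eta> :: "real^'n::finite \<Rightarrow> real"
  assumes "continuous_on UNIV \<eta>" "\<And>y. y \<in> unit_cube \<Longrightarrow> \<eta> (x - t *\<^sub>R y) = \<eta> x"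
  shows "reg t \<eta> x = \<eta> x"
proof -
  have "osc 1 t \<eta> x \<le> cube_vol TYPE('n) * 0" using assms by (intro osc_le) auto
  moreover have "osc 1 t \<eta> x \<ge> 0" by (rule osc_nonneg[OF assms(1)]) simp
  ultimately show ?thesis using reg_minus_le[OF assms(1), of t x] by simp
qed

text \<open>Choose first \<open>\<mu>\<close> with \<open>\<mu> powr p = e\<close> and then
  \<open>\<delta>\<close> so that the second term is \<open>e\<close> as well; \<open>C\<close>
  involves neither.\<close>

lemma eq_0_of_abs_le_powr:
  fixes X C p q :: real
  assumes p: "p > 0" and le: "\<And>\<mu> \<delta>. \<mu> > 0 \<Longrightarrow> \<delta> > 0 \<Longrightarrow> \<bar>X\<bar> \<le> C * (\<mu> powr p + \<mu> powr (- q) * \<delta>)"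
  shows "X = 0"
proof -
  have "\<bar>X\<bar> \<le> 2 * C * e" if e: "e > 0" for e
  proof -
    define \<mu> where "\<mu> = e powr (1 / p)"
    have \<mu>: "\<mu> > 0" "\<mu> powr p = e" using e p by (simp_all add: \<mu>_def powr_powr)
    have "\<mu> powr (- q) * (\<mu> powr q * e) = e" using \<mu>(1) by (simp flip: powr_add mult.assoc)
    then show ?thesis using le[OF \<mu>(1), of "\<mu> powr q * e"] \<mu> e by (simp add: mult_ac)
  qed
  note * = this
  have "((\<lambda>e. 2 * C * e) \<longlongrightarrow> 2 * C * 0) (at_right 0)" by (intro tendsto_intros)
  then have "\<bar>X\<bar> \<le> 2 * C * 0"
    by (rule tendsto_lowerbound) (use * in \<open>auto simp: eventually_at_right_less intro!: eventually_at_rightI[of 0 1]\<close>)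
  then show ?thesis by simp
qed

section \<open>Splitting the test function around the exceptional set\<close>

context mollified_graph
begin

text \<open>The part of the test function with \<open>1 - \<eta>\<close> lives on a compact set off
  \<open>S\<close>, where \<open>gauss_limit\<close> applies; the part with \<open>\<eta>\<close> is
  bounded uniformly in the scale by \<open>pairing_trilinear\<close>, and on the curvature side it
  is small because \<open>\<eta>\<close> is small in \<open>L^{p0}\<close>. The difference
  \<open>X\<close> of the two sides does not depend on \<open>\<eta>\<close>, so it
  vanishes.\<close>

lemma hess_form_integral_eq:
  fixes S :: "(real^2) set" and p s Bw L :: real
  defines "p0 \<equiv> p / (p - 2)" and "s0 \<equiv> 2 * (1 - s)"
  assumes \<phi>: "\<phi> \<in> test_functions V"
    and supp: "\<And>j x. j \<ge> j0 \<Longrightarrow> x \<in> W - K \<Longrightarrow> proj (u j) x \<notin> closure {y. \<phi> y \<noteq> 0}"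
    and p: "p > 2" and s: "1/2 < s" "s < 1"
    and Bw: "\<And>N. (\<Sum>j\<in>{j0..<N}. (2 ^ j) powr (s * p) * (LINT x:K|lborel. Osc p (dyadic j) x)) \<le> Bw"
    and G: "\<And>i k. Ck_on 2 UNIV (G i k)" "\<And>m l i k x. \<bar>pd m (pd l (G i k)) x\<bar> \<le> L"
    and near: "\<And>j x y. j \<ge> j0 \<Longrightarrow> x \<in> W \<Longrightarrow> y \<in> unit_cube \<Longrightarrow> x - dyadic j *\<^sub>R y \<in> V1"
    and metric: "\<And>x i k. x \<in> V1 \<Longrightarrow> met w i k x = G i k x"
    and S: "compact S" and cap: "Cap s0 p0 S = 0"
    and gag: "\<And>C. compact C \<Longrightarrow> C \<subseteq> K - S \<Longrightarrow> (\<lambda>j. (2 ^ j)\<^sup>2 * (LINT x:C|lborel. Osc 3 (dyadic j) x)) \<longlonglongrightarrow> 0"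
  shows "(LINT x:K|lborel. hess_form \<phi> w x) = (LINT x:K|lborel. \<phi> (proj w x) * gauss_density w G x)"
proof -
  have p0: "p0 > 0" "p0 \<ge> 1" using p by (simp_all add: p0_def field_simps)
  \<comment> \<open>An empty compact set makes the convergence hypothesis trivial; this instance
    supplies the continuity of \<open>gauss_density w G\<close> on all of \<open>W\<close>,
    including points of \<open>S\<close>.\<close>
  interpret M0: mollified_metric w W "{}" c B j0 G L V1
    by unfold_locales (use w w_le pd_w_le W c nd_u nd_w G near metric in \<open>auto simp: set_lebesgue_integral_def\<close>)
  let ?gd = "gauss_density w G"
  have cgd: "continuous_on K ?gd" by (rule continuous_on_subset[OF M0.cont_gauss_density K(2)])
  have c\<phi>: "continuous_on UNIV \<phi>" by (rule Ck_on_imp_continuous[OF test_functionsD(1)[OF \<phi>]])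
  have c\<phi>p: "continuous_on T (\<lambda>x. \<phi> (proj w x))" for T
    by (rule continuous_on_compose2[OF c\<phi> cont_proj(2)]) simp
  define F where "F x = \<phi> (proj w x) * ?gd x" for x
  have cF: "continuous_on K F" unfolding F_def[abs_def] by (intro continuous_intros c\<phi>p cgd)
  have "bounded (F ` K)" by (intro compact_imp_bounded compact_continuous_image cF K)
  then obtain M' where M': "\<And>x. x \<in> K \<Longrightarrow> \<bar>F x\<bar> \<le> M'" by (auto simp: bounded_iff)
  define M where "M = \<bar>M'\<bar>"
  have M: "M \<ge> 0" "\<And>x. x \<in> K \<Longrightarrow> \<bar>F x\<bar> \<le> M" using M' unfolding M_def by force+
  obtain C where C: "C \<ge> 0" and Cle: "\<And>\<eta> N \<mu> S. continuous_on UNIV \<eta> \<Longrightarrow> N \<ge> j0 \<Longrightarrow> \<mu> > 0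
      \<Longrightarrow> (\<And>M. (\<Sum>j\<in>{j0..<M}. (2 ^ j) powr (2 * (1 - s) * p0) * (LINT x:K|lborel. osc p0 (dyadic j) \<eta> x)) \<le> S)
      \<Longrightarrow> (LINT x:K|lborel. \<bar>\<eta> x\<bar> powr p0) \<le> S
      \<Longrightarrow> \<bar>pairing \<phi> \<eta> N\<bar> \<le> C * (\<mu> powr p + \<mu> powr (-2 * p0) * S)"
    using pairing_trilinear[OF \<phi> supp p s Bw] unfolding p0_def by blast
  define H where "H = (LINT x:K|lborel. hess_form \<phi> w x)"
  \<comment> \<open>At least 1, so that \<open>c1 * \<delta>\<close> bounds both the dyadic sums of
    the seminorm and the integral of \<open>\<bar>\<eta> x\<bar> powr p0\<close>.\<close>
  define c1 where "c1 = max 1 (2 * real CARD(2) powr (real CARD(2) + s0 * p0))"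
  define k where "k = (LINT x:K|lborel. (1::real))"
  have k0: "k \<ge> 0" unfolding k_def set_lebesgue_integral_def by (auto intro!: integral_nonneg_AE)
  define X where "X = H - (LINT x:K|lborel. F x)"
  have "\<bar>X\<bar> \<le> (C * c1 + M * (k + 1)) * (\<mu> powr p + \<mu> powr (- (2 * p0)) * \<delta>)" if \<mu>: "\<mu> > 0" and \<delta>: "\<delta> > 0" for \<mu> \<delta>
  proof -
    obtain \<eta> N L' where \<eta>: "continuous_on UNIV \<eta>" and N: "open N" "S \<subseteq> N" "\<And>x. x \<in> N \<Longrightarrow> \<eta> x = (1 :: real)"
      and L': "\<And>x y. \<bar>\<eta> (x - y) - \<eta> x\<bar> \<le> L' * norm y" and \<eta>1: "\<And>x. \<bar>\<eta> x\<bar> \<le> 1"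
      and sm: "gagliardo_pow s0 p0 UNIV \<eta> \<le> ennreal \<delta>" "(\<integral>\<^sup>+x. ennreal (\<bar>\<eta> x\<bar> powr p0) \<partial>lborel) \<le> ennreal \<delta>"
      using capacity_zero_weight[OF cap \<delta> p0(1)] by metis
    have c\<eta>: "continuous_on T \<eta>" for T by (rule continuous_on_subset[OF \<eta>]) simp
    have c\<eta>p: "continuous_on K (\<lambda>x. \<bar>\<eta> x\<bar> powr p0)"
      using p0 by (intro continuous_on_powr' continuous_intros c\<eta>) auto
    have S2: "(LINT x:K|lborel. \<bar>\<eta> x\<bar> powr p0) \<le> \<delta>"
      using \<delta> by (intro set_integral_le_of_nn_integral K c\<eta>p sm) auto
    have S1: "(\<Sum>j\<in>{j0..<M}. (2 ^ j) powr (2 * (1 - s) * p0) * (LINT x:K|lborel. osc p0 (dyadic j) \<eta> x)) \<le> c1 * \<delta>" for M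
    proof -
      have "(\<Sum>j\<in>{j0..<M}. (2 ^ j) powr (s0 * p0) * (LINT x:K|lborel. osc p0 (1 / 2 ^ j) \<eta> x))
          \<le> 2 * real CARD(2) powr (real CARD(2) + s0 * p0) * enn2real (gagliardo_pow s0 p0 UNIV \<eta>)"
        using s sm(1) by (intro osc_dyadic_sum_le \<eta> p0 K) (auto simp: s0_def intro: le_less_trans)
      also have "\<dots> \<le> c1 * \<delta>"
        using enn2real_mono[OF sm(1)] \<delta> by (intro mult_mono) (auto simp: c1_def)
      finally show ?thesis by (simp add: dyadic_def s0_def)
    qed
    have S2': "(LINT x:K|lborel. \<bar>\<eta> x\<bar> powr p0) \<le> c1 * \<delta>"
    proof (rule order_trans[OF S2])
      have "1 * \<delta> \<le> c1 * \<delta>" using \<delta> by (intro mult_right_mono) (auto simp: c1_def)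
      then show "\<delta> \<le> c1 * \<delta>" by simp
    qed
    obtain e where e: "e > 0" "(\<Union>x\<in>S. ball x e) \<subseteq> N"
      using compact_subset_open_imp_ball_epsilon_subset[OF S N(1,2)] by blast
    \<comment> \<open>Half the radius leaves room for mollification: at scales below
      \<open>e / 4\<close> the shifts are shorter than \<open>e / 2\<close>, so at points of
      \<open>N'\<close> only values of \<open>\<eta>\<close> equal to 1 are averaged.\<close>
    define N' where "N' = (\<Union>x\<in>S. ball x (e / 2))"
    have N': "open N'" "S \<subseteq> N'" using e(1) by (auto simp: N'_def)
    define K1 where "K1 = K - N'"
    have K1: "compact K1" "K1 \<subseteq> K - S" unfolding K1_def using K(1) N' by (auto intro: compact_diff)
    obtain j1 where j1: "\<And>j. j \<ge> j1 \<Longrightarrow> dyadic j < e / 4"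
      using eventually_dyadic_less[of "e / 4"] e(1) by auto
    define j2 where "j2 = max j0 j1"
    \<comment> \<open>The same mollified maps on \<open>W - S\<close>, with \<open>K1\<close> in
      place of \<open>K\<close>; as \<open>K1\<close> is compact and avoids \<open>S\<close>, the
      hypothesis \<open>gag\<close> is available for it.\<close>
    interpret M1: mollified_metric w "W - S" K1 c B j2 G L V1
      by unfold_locales
        (use w w_le pd_w_le W c nd_u nd_w G near metric K1 K(2) S gag[OF K1] in
          \<open>auto simp: j2_def intro: open_Diff compact_imp_closed\<close>)
    define \<psi>1 where "\<psi>1 j x = (1 - reg (dyadic j) \<eta> x) * \<theta> \<phi> j x" for j x
    have one: "reg (dyadic j) \<eta> x = 1" "\<eta> x = 1" if "j \<ge> j2" "x \<in> N'" for j x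
    proof -
      obtain z where z: "z \<in> S" "dist z x < e / 2" using \<open>x \<in> N'\<close> by (auto simp: N'_def)
      have inN: "x - dyadic j *\<^sub>R y \<in> N" if y: "y \<in> unit_cube" for y
      proof -
        have "dist x (x - dyadic j *\<^sub>R y) \<le> dyadic j * 2"
          using mult_left_mono[OF unit_cube_norm_le[OF y], of "dyadic j"] dyadic_pos[of j] by (simp add: dist_norm)
        moreover have "dyadic j < e / 4" using j1 \<open>j \<ge> j2\<close> by (simp add: j2_def)
        ultimately have "dist z (x - dyadic j *\<^sub>R y) < e"
          using dist_triangle[of z "x - dyadic j *\<^sub>R y" x] z(2) by linarith
        then show ?thesis using e(2) z(1) by (auto simp: subset_iff)
      qed
      have "dist z x < e" using z(2) e(1) by linarith
      then have "x \<in> N" using e(2) z(1) by (auto simp: subset_iff)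
      then show "\<eta> x = 1" by (rule N(3))
      with reg_eq_const[OF \<eta>, of x "dyadic j"] inN N(3) show "reg (dyadic j) \<eta> x = 1" by simp
    qed
    have van: "\<psi>1 j x = 0" if "j \<ge> j2" "x \<in> W - K1" for j x
    proof (cases "x \<in> K")
      case True
      then have "x \<in> N'" using that(2) by (simp add: K1_def)
      then show ?thesis using one[OF that(1)] by (simp add: \<psi>1_def)
    next
      case False
      have "proj (u j) x \<notin> closure {y. \<phi> y \<noteq> 0}" using that False by (intro supp) (auto simp: j2_def)
      then have "\<phi> (proj (u j) x) = 0" by (rule test_functionsD(4)[OF \<phi>])
      then show ?thesis by (simp add: \<psi>1_def \<theta>_def)
    qed
    let ?wed = "\<lambda>j x. wed (slope (u j) 3 2) (slope (u j) 1 3) x"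
    have lim1: "(\<lambda>j. LINT x:K1|lborel. \<psi>1 j x * ?wed j x)
        \<longlonglongrightarrow> (LINT x:K1|lborel. ((1 - \<eta> x) * \<phi> (proj w x)) * ?gd x)"
    proof (rule M1.gauss_limit)
      show "M1.tame \<psi>1"
        unfolding \<psi>1_def[abs_def] by (rule M1.tame_one_minus_reg_mult_\<theta>[OF \<phi> \<eta> L' \<eta>1])
      show "\<psi>1 j x = 0" if "j \<ge> j2" "x \<in> W - S - K1" for j x using that by (intro van) auto
      show "continuous_on K1 (\<lambda>x. (1 - \<eta> x) * \<phi> (proj w x))" by (intro continuous_intros c\<eta> c\<phi>p)
      fix x
      have "isCont \<phi> (proj w x)" using c\<phi> by (simp add: continuous_on_eq_continuous_at)
      then show "(\<lambda>j. \<psi>1 j x) \<longlonglongrightarrow> (1 - \<eta> x) * \<phi> (proj w x)"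
        unfolding \<psi>1_def \<theta>_def
        by (intro tendsto_intros reg_tendsto \<eta> dyadic_pos dyadic_tendsto_0 isCont_tendsto_compose[OF _ proj_tendsto])
    qed
    have e1: "(LINT x:K1|lborel. \<psi>1 j x * ?wed j x) = (LINT x:K|lborel. \<psi>1 j x * ?wed j x)" if "j \<ge> j2" for j
      by (rule set_integral_eq_subset[symmetric]) (use K1(2) K(2) van[OF that] in auto)
    have e2: "(LINT x:K1|lborel. ((1 - \<eta> x) * \<phi> (proj w x)) * ?gd x) = (LINT x:K|lborel. (1 - \<eta> x) * F x)"
    proof -
      have "(LINT x:K|lborel. (1 - \<eta> x) * F x) = (LINT x:K1|lborel. (1 - \<eta> x) * F x)"
        by (rule set_integral_eq_subset) (use one(2)[OF order_refl] in \<open>auto simp: K1_def\<close>)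
      then show ?thesis by (simp add: F_def mult.assoc)
    qed
    have split: "(LINT x:K|lborel. \<phi> (proj (u j) x) * ?wed j x) = pairing \<phi> \<eta> j + (LINT x:K|lborel. \<psi>1 j x * ?wed j x)"
      if "j \<ge> j2" for j
    proof -
      have j: "j \<ge> j0" using that by (simp add: j2_def)
      have cw: "continuous_on K (?wed j)" by (rule cont_K_wed[OF Ck_on_slope_u[OF j] Ck_on_slope_u[OF j]])
      have c\<theta>: "continuous_on K (\<theta> \<phi> j)" by (rule Ck_on_imp_continuous[OF Ck_on_\<theta>[OF \<phi>]])
      have cr: "continuous_on K (reg (dyadic j) \<eta>)"
        by (rule continuous_on_subset[OF Ck_on_imp_continuous[OF Ck_on_reg[OF \<eta> dyadic_pos]] subset_UNIV])
      have i: "set_integrable lborel K (\<lambda>x. \<psi> \<phi> \<eta> j x * ?wed j x)" "set_integrable lborel K (\<lambda>x. \<psi>1 j x * ?wed j x)"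
        unfolding \<psi>_def \<psi>1_def by (intro set_integrable_compact K continuous_intros cw c\<theta> cr)+
      show ?thesis
        unfolding pairing_def set_integral_add(2)[OF i, symmetric]
        by (intro arg_cong[of _ _ "\<lambda>f. set_lebesgue_integral lborel K f"] ext) (simp add: \<psi>_def \<psi>1_def \<theta>_def algebra_simps)
    qed
    let ?Y = "H - (LINT x:K|lborel. (1 - \<eta> x) * F x)"
    \<comment> \<open>The pairings converge as the difference of two convergent sequences, and their
      limit inherits the bound that is uniform in \<open>j\<close>.\<close>
    have "(\<lambda>j. (LINT x:K|lborel. \<phi> (proj (u j) x) * ?wed j x) - (LINT x:K1|lborel. \<psi>1 j x * ?wed j x)) \<longlonglongrightarrow> ?Y"
      unfolding H_def e2[symmetric] by (intro tendsto_diff lim1 hess_form_integral_tendsto[OF \<phi> supp])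
    then have "(\<lambda>j. pairing \<phi> \<eta> j) \<longlonglongrightarrow> ?Y"
      by (rule Lim_transform_eventually) (use e1 split in \<open>auto simp: eventually_sequentially intro!: exI[of _ j2]\<close>)
    then have "(\<lambda>j. \<bar>pairing \<phi> \<eta> j\<bar>) \<longlonglongrightarrow> \<bar>?Y\<bar>" by (rule tendsto_rabs)
    then have Y: "\<bar>?Y\<bar> \<le> C * (\<mu> powr p + \<mu> powr (-2 * p0) * (c1 * \<delta>))"
      by (rule LIMSEQ_le_const2) (use Cle[OF \<eta> _ \<mu> S1 S2'] in blast)
    have i: "set_integrable lborel K F" "set_integrable lborel K (\<lambda>x. \<eta> x * F x)"
      "set_integrable lborel K (\<lambda>x. M * (\<mu> powr p * 1 + \<mu> powr (-2 * p0) * \<bar>\<eta> x\<bar> powr p0))"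
      "set_integrable lborel K (\<lambda>x. \<mu> powr p * 1)" "set_integrable lborel K (\<lambda>x. \<mu> powr (-2 * p0) * \<bar>\<eta> x\<bar> powr p0)"
      by (intro set_integrable_compact K continuous_intros c\<eta> cF c\<eta>p)+
    have Xeq: "X = ?Y - (LINT x:K|lborel. \<eta> x * F x)"
      using set_integral_diff(2)[OF i(1,2)] by (simp add: X_def left_diff_distrib)
    have "\<bar>LINT x:K|lborel. \<eta> x * F x\<bar> \<le> (LINT x:K|lborel. \<bar>\<eta> x * F x\<bar>)"
      using set_integral_norm_bound[OF i(2)] by simp
    also have "\<dots> \<le> (LINT x:K|lborel. M * (\<mu> powr p * 1 + \<mu> powr (-2 * p0) * \<bar>\<eta> x\<bar> powr p0))"
    proof (rule set_integral_mono)
      show "set_integrable lborel K (\<lambda>x. \<bar>\<eta> x * F x\<bar>)" using set_integrable_abs[OF i(2)] .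
      show "set_integrable lborel K (\<lambda>x. M * (\<mu> powr p * 1 + \<mu> powr (-2 * p0) * \<bar>\<eta> x\<bar> powr p0))" by (rule i(3))
      fix x assume x: "x \<in> K"
      have "\<bar>F x\<bar> * \<bar>\<eta> x\<bar> \<le> M * \<bar>\<eta> x\<bar>" using M(2)[OF x] by (intro mult_right_mono) auto
      \<comment> \<open>Young's inequality with \<open>x = 1\<close> brings the weight itself into
        the form of the trilinear bound.\<close>
      also have "\<dots> \<le> M * (\<mu> powr p * 1 + \<mu> powr (-2 * p0) * \<bar>\<eta> x\<bar> powr p0)"
        using young_weighted[of 1 "\<bar>\<eta> x\<bar>" p \<mu>] p \<mu> unfolding p0_def by (intro mult_left_mono M(1)) simp
      finally show "\<bar>\<eta> x * F x\<bar> \<le> M * (\<mu> powr p * 1 + \<mu> powr (-2 * p0) * \<bar>\<eta> x\<bar> powr p0)"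
        by (simp add: abs_mult mult.commute)
    qed
    also have "\<dots> = M * (\<mu> powr p * k + \<mu> powr (-2 * p0) * (LINT x:K|lborel. \<bar>\<eta> x\<bar> powr p0))"
      unfolding set_integral_mult_right set_integral_add(2)[OF i(4,5)] k_def ..
    also have "\<dots> \<le> M * (\<mu> powr p * k + \<mu> powr (-2 * p0) * \<delta>)"
      by (intro mult_left_mono add_left_mono S2 M(1)) simp
    finally have Z: "\<bar>LINT x:K|lborel. \<eta> x * F x\<bar> \<le> M * (\<mu> powr p * k + \<mu> powr (-2 * p0) * \<delta>)" .
    define P Q where "P = \<mu> powr p" and "Q = \<mu> powr (-2 * p0) * \<delta>"
    have PQ: "P \<ge> 0" "Q \<ge> 0" using \<delta> by (auto simp: P_def Q_def)
    have c1: "c1 \<ge> 1" by (simp add: c1_def)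
    have "\<bar>X\<bar> \<le> C * (P + c1 * Q) + M * (P * k + Q)"
      unfolding Xeq using Y Z abs_triangle_ineq4[of ?Y "LINT x:K|lborel. \<eta> x * F x"]
      by (simp add: P_def Q_def mult_ac)
    also have "\<dots> \<le> C * (c1 * P + c1 * Q) + M * ((k + 1) * P + (k + 1) * Q)"
    proof -
      have "P \<le> c1 * P" using mult_right_mono[OF c1 PQ(1)] by simp
      then have "C * (P + c1 * Q) \<le> C * (c1 * P + c1 * Q)" by (intro mult_left_mono C) simp
      moreover have "P * k + Q \<le> (k + 1) * P + (k + 1) * Q"
        using PQ mult_nonneg_nonneg[OF k0 PQ(2)] by (simp add: algebra_simps)
      then have "M * (P * k + Q) \<le> M * ((k + 1) * P + (k + 1) * Q)" by (intro mult_left_mono M(1))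
      ultimately show ?thesis by (rule add_mono)
    qed
    also have "\<dots> = (C * c1 + M * (k + 1)) * (P + Q)" by (simp add: algebra_simps)
    finally show ?thesis by (simp add: P_def Q_def)
  qed
  then have "X = 0" by (rule eq_0_of_abs_le_powr[OF less_trans[OF zero_less_numeral p]])
  then show ?thesis by (simp add: X_def H_def F_def)
qed

end

section \<open>The Gauss equation\<close>

lemma finite_uniform_bound:
  fixes F :: "'i::finite \<Rightarrow> 'x \<Rightarrow> real"
  assumes "\<And>i. \<exists>C. \<forall>x. \<bar>F i x\<bar> \<le> C"
  shows "\<exists>C. \<forall>i x. \<bar>F i x\<bar> \<le> C"
proof -
  obtain C where C: "\<And>i x. \<bar>F i x\<bar> \<le> C i" using assms by metis
  have "\<bar>F i x\<bar> \<le> Max (range C)" for i x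
    by (rule order_trans[OF C Max_ge]) auto
  then show ?thesis by blast
qed

text \<open>On a connected set the Jacobian has one sign; this lets the absolute value in the change
  of variables become the signed coefficient of a two-form.\<close>

lemma continuous_nonzero_constant_sign:
  fixes F :: "'a::topological_space \<Rightarrow> real"
  assumes "connected U" "continuous_on U F" "\<And>x. x \<in> U \<Longrightarrow> F x \<noteq> 0"
  obtains \<sigma> where "\<And>x. x \<in> U \<Longrightarrow> \<bar>F x\<bar> = \<sigma> * F x"
proof (cases "\<exists>x\<in>U. F x > 0")
  case True
  then obtain x where x: "x \<in> U" "F x > 0" by blast
  have "F y > 0" if "y \<in> U" for y
  proof (rule ccontr)
    assume "\<not> F y > 0"
    moreover have "connected (F ` U)" by (rule connected_continuous_image[OF assms(2,1)])
    ultimately have "0 \<in> F ` U"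
      using connectedD_interval[of "F ` U" "F y" "F x" 0] that x by auto
    then show False using assms(3) by auto
  qed
  then show ?thesis by (intro that[of 1]) (simp add: abs_of_pos)
next
  case False
  then show ?thesis by (intro that[of "-1"]) (force simp: abs_if)
qed

section \<open>The given surface as a graph, seen in the coordinates of \<open>U\<close>\<close>

locale isometric_graph =
  fixes U U' :: "(real^2) set" and g :: "real^2 \<Rightarrow> real^2^2" and u :: "real^2 \<Rightarrow> real^3"
    and \<Psi> \<Phi> :: "real^2 \<Rightarrow> real^2" and v f :: "real^2 \<Rightarrow> real"
  assumes U: "open U" "connected U" and g: "riemannian_metric_on U g"
    and iso: "isometric_embedding U g u"
    and u_eq: "x \<in> U \<Longrightarrow> u x = vector [\<Psi> x $ 1, \<Psi> x $ 2, v x]"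
    and \<Psi>: "C1_diffeo U U' \<Psi> \<Phi>" and f: "y \<in> U' \<Longrightarrow> f y = v (\<Phi> y)"
begin

definition uc :: "3 \<Rightarrow> real^2 \<Rightarrow> real" where
  "uc a x = u x $ a"

abbreviation D :: "real^2 \<Rightarrow> real" where
  "D \<equiv> wed (uc 1) (uc 2)"

lemma Ck_u: "Ck_on 1 U u" using iso by (simp add: isometric_embedding_def)

lemma Ck_uc: "Ck_on 1 U (uc a)"
  unfolding uc_def[abs_def] by (rule Ck_on_nth[OF U(1) Ck_u])

lemma U': "open U'" and Ck_\<Phi>: "Ck_on 1 U' \<Phi>" and Ck_\<Psi>: "Ck_on 1 U \<Psi>"
  and \<Phi>_\<Psi>: "x \<in> U \<Longrightarrow> \<Phi> (\<Psi> x) = x" and \<Psi>_\<Phi>: "y \<in> U' \<Longrightarrow> \<Psi> (\<Phi> y) = y"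
  and \<Psi>_mem: "x \<in> U \<Longrightarrow> \<Psi> x \<in> U'" and \<Phi>_mem: "y \<in> U' \<Longrightarrow> \<Phi> y \<in> U"
  using \<Psi> by (auto simp: C1_diffeo_def homeomorphism_def)

lemma uc_\<Psi>: "x \<in> U \<Longrightarrow> uc 1 x = \<Psi> x $ 1" "x \<in> U \<Longrightarrow> uc 2 x = \<Psi> x $ 2" "x \<in> U \<Longrightarrow> uc 3 x = v x"
  by (simp_all add: uc_def u_eq)

lemma \<Psi>_eq: "x \<in> U \<Longrightarrow> \<Psi> x = vector [uc 1 x, uc 2 x]"
  by (simp add: uc_\<Psi> vec_eq_iff forall_2)

lemma uc_diff: "x \<in> U \<Longrightarrow> uc a differentiable (at x)" and cont_pd_uc: "continuous_on U (pd i (uc a))"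
  using Ck_uc[of a] by simp_all

lemma D_eq: "x \<in> U \<Longrightarrow> wed (\<lambda>x. \<Psi> x $ 1) (\<lambda>x. \<Psi> x $ 2) x = D x"
  using pd_cong_open[OF U(1), of x "\<lambda>x. \<Psi> x $ 1" "uc 1"] pd_cong_open[OF U(1), of x "\<lambda>x. \<Psi> x $ 2" "uc 2"]
  by (simp add: wed_def uc_\<Psi>)

text \<open>By the chain rule for \<open>\<Phi> \<circ> \<Psi> = id\<close>, the Jacobian of
  \<open>\<Phi>\<close> times \<open>D\<close> is 1.\<close>

lemma D_nz:
  assumes x: "x \<in> U"
  shows "D x \<noteq> 0"
proof -
  have d: "(\<lambda>y. \<Phi> y $ k) differentiable (at (vector [uc 1 x, uc 2 x]))" for k
    using Ck_\<Phi> \<Psi>_mem[OF x] unfolding \<Psi>_eq[OF x] by (intro differentiable_nth) simp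
  define q where "q i k = pd i (\<lambda>y. \<Phi> y $ k) (\<Psi> x)" for i k
  have e: "axis i 1 $ k = q 1 k * pd i (uc 1) x + q 2 k * pd i (uc 2) x" for i k
  proof -
    have "pd i (\<lambda>x :: real^2. x $ k) x = axis i 1 $ k"
      by (rule pd_eqI) (rule bounded_linear.has_derivative[OF bounded_linear_vec_nth has_derivative_ident])
    moreover have "pd i (\<lambda>x. x $ k) x = pd i (\<lambda>x. \<Phi> (vector [uc 1 x, uc 2 x]) $ k) x"
      by (rule pd_cong_open[OF U(1) x]) (simp add: \<Phi>_\<Psi> flip: \<Psi>_eq)
    moreover have "\<dots> = pd 1 (\<lambda>y. \<Phi> y $ k) (\<Psi> x) * pd i (uc 1) x + pd 2 (\<lambda>y. \<Phi> y $ k) (\<Psi> x) * pd i (uc 2) x"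
      unfolding \<Psi>_eq[OF x] by (rule pd_comp_vec2[OF uc_diff[OF x] uc_diff[OF x] d])
    ultimately show ?thesis by (simp add: q_def)
  qed
  have "D x * (q 1 1 * q 2 2 - q 2 1 * q 1 2)
      = (q 1 1 * pd 1 (uc 1) x + q 2 1 * pd 1 (uc 2) x) * (q 1 2 * pd 2 (uc 1) x + q 2 2 * pd 2 (uc 2) x)
      - (q 1 1 * pd 2 (uc 1) x + q 2 1 * pd 2 (uc 2) x) * (q 1 2 * pd 1 (uc 1) x + q 2 2 * pd 1 (uc 2) x)"
    unfolding wed_def by (simp add: algebra_simps)
  then have "D x * (q 1 1 * q 2 2 - q 2 1 * q 1 2) = 1"
    by (simp add: axis_def flip: e)
  then show ?thesis by auto
qed

lemma f_diff:
  assumes y: "y \<in> U'"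
  shows "f differentiable (at y)"
proof -
  have "(uc 3 \<circ> \<Phi>) differentiable (at y)"
    using Ck_\<Phi> y \<Phi>_mem[OF y] by (intro differentiable_chain_at uc_diff) auto
  moreover have "f z = (uc 3 \<circ> \<Phi>) z" if "z \<in> U'" for z using that by (simp add: f uc_\<Psi> \<Phi>_mem)
  ultimately show ?thesis using differentiable_cong_open[OF U' y, of f "uc 3 \<circ> \<Phi>"] by blast
qed

text \<open>The chain rule for \<open>uc 3 = f(uc 1, uc 2)\<close>, solved by Cramer's rule.\<close>

lemma slope_uc:
  assumes x: "x \<in> U"
  shows "slope uc 3 2 x = pd 1 f (\<Psi> x)" "slope uc 1 3 x = pd 2 f (\<Psi> x)"
proof -
  have "pd i (uc 3) x = pd 1 f (\<Psi> x) * pd i (uc 1) x + pd 2 f (\<Psi> x) * pd i (uc 2) x" for i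
  proof -
    have "pd i (uc 3) x = pd i (\<lambda>x. f (vector [uc 1 x, uc 2 x])) x"
      by (rule pd_cong_open[OF U(1) x]) (simp add: \<Phi>_\<Psi> f \<Psi>_mem uc_\<Psi>(3) flip: \<Psi>_eq)
    moreover have "\<dots> = pd 1 f (\<Psi> x) * pd i (uc 1) x + pd 2 f (\<Psi> x) * pd i (uc 2) x"
      using f_diff[OF \<Psi>_mem[OF x]] unfolding \<Psi>_eq[OF x] by (rule pd_comp_vec2[OF uc_diff[OF x] uc_diff[OF x]])
    ultimately show ?thesis by simp
  qed
  then show "slope uc 3 2 x = pd 1 f (\<Psi> x)" "slope uc 1 3 x = pd 2 f (\<Psi> x)"
    using D_nz[OF x] unfolding slope_def wed_def by (simp_all add: divide_eq_eq algebra_simps)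
qed

lemma cont_D: "continuous_on U D"
  unfolding wed_def[abs_def] by (intro continuous_intros cont_pd_uc)

lemma cont_pd_f: "continuous_on U' (pd 1 f)" "continuous_on U' (pd 2 f)"
proof -
  have s: "continuous_on U (slope uc a b)" for a b
    unfolding slope_def[abs_def] using D_nz
    by (intro continuous_intros cont_D) (auto simp: wed_def[abs_def] intro!: continuous_intros cont_pd_uc)
  have \<Phi>c: "continuous_on U' \<Phi>" by (rule Ck_on_imp_continuous[OF Ck_\<Phi>])
  have c: "continuous_on U' (\<lambda>y. slope uc a b (\<Phi> y))" for a b
    by (rule continuous_on_compose2[OF s \<Phi>c]) (auto simp: \<Phi>_mem)
  show "continuous_on U' (pd 1 f)"
    by (rule continuous_on_eq[OF c[of 3 2]]) (simp add: slope_uc \<Phi>_mem \<Psi>_\<Phi>)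
  show "continuous_on U' (pd 2 f)"
    by (rule continuous_on_eq[OF c[of 1 3]]) (simp add: slope_uc \<Phi>_mem \<Psi>_\<Phi>)
qed

lemma norm_grad_f: "(norm (grad f y))\<^sup>2 = (pd 1 f y)\<^sup>2 + (pd 2 f y)\<^sup>2"
  unfolding power2_norm_eq_inner by (simp add: inner_vec_def sum_2 grad_def power2_eq_square)

abbreviation gc :: "2 \<Rightarrow> 2 \<Rightarrow> real^2 \<Rightarrow> real" where
  "gc \<equiv> \<lambda>i k y. g y $ i $ k"

lemma Ck_gc: "Ck_on k U (gc i l)"
  using g by (auto simp: riemannian_metric_on_def smooth_on_def intro!: Ck_on_nth[OF U(1)])

lemma met_uc: "x \<in> U \<Longrightarrow> met uc i k x = gc i k x"
proof -
  assume x: "x \<in> U"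
  have "u differentiable (at x)" using Ck_u x by simp
  then have "pd i (uc a) x = pd i u x $ a" for i a
    unfolding uc_def[abs_def] by (rule pd_nth)
  then have "met uc i k x = pd i u x \<bullet> pd k u x" by (simp add: met_def inner_vec_def)
  then show ?thesis using iso x by (simp add: isometric_embedding_def)
qed

text \<open>The determinant of the metric is the sum of the squares of the 2 by 2 minors of
  \<open>Du\<close>; one of them is \<open>D\<close>, and the other two are \<open>D\<close> times a
  slope up to sign.\<close>

lemma det_g: "x \<in> U \<Longrightarrow> det (g x) = (D x)\<^sup>2 * (1 + (norm (grad f (\<Psi> x)))\<^sup>2)"
proof -
  assume x: "x \<in> U"
  have "det (g x) = det_met (\<lambda>i k. met uc i k x)"
    using riemannian_metric_det_pos(2)[OF g x] by (simp add: met_uc[OF x] det_met_def det_2 power2_eq_square)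
  also have "\<dots> = (wed (uc 2) (uc 3) x)\<^sup>2 + (wed (uc 3) (uc 1) x)\<^sup>2 + (D x)\<^sup>2" by (rule det_met_eq)
  finally have *: "det (g x) = (wed (uc 2) (uc 3) x)\<^sup>2 + (wed (uc 3) (uc 1) x)\<^sup>2 + (D x)\<^sup>2" .
  have "wed (uc 2) (uc 3) x = - D x * pd 1 f (\<Psi> x)" "wed (uc 3) (uc 1) x = - D x * pd 2 f (\<Psi> x)"
    using slope_uc[OF x] D_nz[OF x] wed_swap[of "uc 2" "uc 3" x] wed_swap[of "uc 3" "uc 1" x]
    by (auto simp: slope_def divide_eq_eq)
  then show ?thesis unfolding * norm_grad_f by (simp add: power_mult_distrib algebra_simps)
qed

text \<open>After squaring \<open>det_g\<close> and dividing by \<open>D^3\<close> a single factor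
  \<open>D\<close> remains: the signed Jacobian that the change of variables to \<open>U'\<close>
  consumes.\<close>

lemma gauss_density_uc:
  assumes x: "x \<in> U"
  shows "gauss_density uc gc x = gauss_curvature g x * (1 + (norm (grad f (\<Psi> x)))\<^sup>2)\<^sup>2 * D x"
proof -
  have "gauss_density uc gc x = gauss_curvature g x * (det (g x))\<^sup>2 / D x ^ 3"
    using gauss_curvature_eq[OF U(1) x g] by (simp add: gauss_density_def met_uc[OF x])
  then show ?thesis
    using D_nz[OF x] unfolding det_g[OF x] by (simp add: divide_simps power_mult_distrib) (simp add: eval_nat_numeral)
qed

text \<open>Continuity is read off from the formula in symbols of the first kind, where the only
  division is by a power of \<open>det g\<close>.\<close>

lemma cont_gauss_curvature: "continuous_on U (gauss_curvature g)"
proof -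
  have cg: "continuous_on U (gc i k)" for i k by (rule Ck_on_imp_continuous[OF Ck_gc])
  have C1: "Ck_on 1 U (christ gc k i j)" for k i j
    unfolding christ_def[abs_def]
    by (intro Ck_on_mult Ck_on_add Ck_on_diff Ck_on_const U(1) Ck_on_pd[of 1] Ck_gc)
  have c: "continuous_on U (christ gc k i j)" "continuous_on U (pd m (christ gc k i j))" for m k i j
    using C1[of k i j] Ck_on_imp_continuous[OF C1[of k i j]] by simp_all
  define N where "N x = det_met (\<lambda>i k. gc i k x) * (pd 1 (christ gc 1 2 2) x - pd 2 (christ gc 1 1 2) x)
      - quad (\<lambda>i k. gc i k x) (\<lambda>k i j. christ gc k i j x)" for x
  define d where "d x = gc 1 1 x * gc 2 2 x - gc 1 2 x * gc 2 1 x" for x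
  have d: "det (g x) = d x" for x by (simp add: det_2 d_def)
  have nz: "d x \<noteq> 0" if "x \<in> U" for x
    using riemannian_metric_det_pos(1)[OF g that] unfolding d by simp
  have "continuous_on U N"
    unfolding N_def[abs_def] det_met_def quad_def
    by (intro continuous_on_add continuous_on_diff continuous_on_mult continuous_on_power continuous_on_const c cg)
  moreover have "continuous_on U d"
    unfolding d_def[abs_def] by (intro continuous_intros cg)
  ultimately have cq: "continuous_on U (\<lambda>x. N x / (d x)\<^sup>2)"
    by (intro continuous_intros) (simp_all add: nz)
  have "gauss_curvature g x = N x / (d x)\<^sup>2" if "x \<in> U" for x
    using gauss_curvature_eq[OF U(1) that g] nz[OF that] unfolding N_def[symmetric] d by simp
  then show ?thesis by (intro continuous_on_eq[OF cq]) simp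
qed

end

lemma open_cutoff_region:
  fixes K :: "(real^'n::finite) set"
  assumes "compact K" "open U" "K \<subseteq> U"
  obtains V K' where "open V" "K \<subseteq> V" "V \<subseteq> K'" "compact K'" "K' \<subseteq> U"
  using smooth_cutoff[OF assms] by metis

lemma closure_subset_compact: "V \<subseteq> K \<Longrightarrow> compact K \<Longrightarrow> closure V \<subseteq> K \<and> compact (closure V)"
  for V K :: "'a::t2_space set"
  using closure_minimal[of V K] compact_Int_closed[of K "closure V"] by (auto simp: compact_imp_closed Int_absorb1)

section \<open>Localisation and proof of the Gauss equation\<close>

context isometric_graph
begin

text \<open>The nested sets are \<open>K0 \<subseteq> V3 \<subseteq> K3 \<subseteq> V2 \<subseteq>
  K2 \<subseteq> V1 \<subseteq> K1 \<subseteq> U\<close>, where \<open>K0\<close> is the pulled back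
  support. The cutoff lives in \<open>K1\<close> and changes nothing on \<open>V1\<close>, the
  uniform estimates are made on \<open>K2\<close>, and \<open>V2\<close>, \<open>K3\<close> become
  \<open>W\<close>, \<open>K\<close> of the locale.\<close>

lemma hess_form_integral_pullback:
  fixes S :: "(real^2) set" and s p :: real
  assumes s: "1/2 < s" "s < 1" and p: "p \<ge> 2 / s" and reg: "in_W1sp_loc s p U u"
    and S: "compact S" "S \<subseteq> U" "Cap (2 * (1 - s)) (p / (p - 2)) S = 0"
    and reg3: "in_W1sp_loc (2/3) 3 (U - S) u" and \<phi>: "\<phi> \<in> test_functions U'"
  obtains K where "compact K" "\<Phi> ` closure {y. \<phi> y \<noteq> 0} \<subseteq> K" "K \<subseteq> U"
    "(LINT x:K|lborel. hess_form \<phi> uc x)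
      = (LINT x:K|lborel. \<phi> (\<Psi> x) * (gauss_curvature g x * (1 + (norm (grad f (\<Psi> x)))\<^sup>2)\<^sup>2 * D x))"
proof -
  \<comment> \<open>As \<open>s < 1\<close>, the bound \<open>p \<ge> 2 / s\<close> gives
    \<open>p > 2\<close>, so that \<open>p / (p - 2)\<close> is positive and conjugate to
    \<open>p / 2\<close>.\<close>
  have "2 < 2 / s" using s by (simp add: field_simps)
  then have p2: "p > 2" using p by linarith
  define L where "L = closure {y. \<phi> y \<noteq> 0}"
  have L: "compact L" "L \<subseteq> U'" using test_functionsD(2,3)[OF \<phi>] by (simp_all add: L_def)
  define K0 where "K0 = \<Phi> ` L"
  have K0: "compact K0" "K0 \<subseteq> U"
    unfolding K0_def using L \<Phi>_mem
    by (auto intro!: compact_continuous_image continuous_on_subset[OF Ck_on_imp_continuous[OF Ck_\<Phi>]])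
  obtain \<zeta> V1 K1 where \<zeta>: "\<And>k. Ck_on k UNIV \<zeta>" and V1: "open V1" "K0 \<subseteq> V1" "V1 \<subseteq> K1" and K1: "compact K1" "K1 \<subseteq> U"
    and \<zeta>1: "\<And>x. x \<in> V1 \<Longrightarrow> \<zeta> x = 1" and \<zeta>0: "\<And>x. x \<notin> K1 \<Longrightarrow> \<zeta> x = (0 :: real)"
    using smooth_cutoff[OF K0(1) U(1) K0(2)] by blast
  obtain V2 K2 where V2: "open V2" "K0 \<subseteq> V2" "V2 \<subseteq> K2" and K2: "compact K2" "K2 \<subseteq> V1"
    using open_cutoff_region[OF K0(1) V1(1,2)] by blast
  obtain V3 K3 where V3: "open V3" "K0 \<subseteq> V3" "V3 \<subseteq> K3" and K3: "compact K3" "K3 \<subseteq> V2"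
    using open_cutoff_region[OF K0(1) V2(1,2)] by blast
  have V1U: "V1 \<subseteq> U" using V1 K1 by blast
  have K2U: "K2 \<subseteq> U" and K3U: "K3 \<subseteq> U" and K3V1: "K3 \<subseteq> V1" using K2 K3 V2 V1U by blast+
  define w where "w a x = \<zeta> x * uc a x" for a x
  define G where "G i k x = \<zeta> x * gc i k x" for i k x
  have w1: "Ck_on 1 UNIV (w a)" for a
    unfolding w_def[abs_def] by (rule Ck_on_cutoff[OF \<zeta> U(1) K1 \<zeta>0 Ck_uc])
  have Gk: "Ck_on n UNIV (G i k)" for n i k
    unfolding G_def[abs_def] by (rule Ck_on_cutoff[OF \<zeta> U(1) K1 \<zeta>0 Ck_gc])
  have w0: "w a x = 0" and G0: "G i k x = 0" if "x \<notin> K1" for a i k x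
    using \<zeta>0[OF that] by (simp_all add: w_def G_def)
  have w_V1: "w a x = uc a x" and G_V1: "G i k x = gc i k x" if "x \<in> V1" for a i k x
    using \<zeta>1[OF that] by (simp_all add: w_def G_def)
  have pd_w: "pd i (w a) x = pd i (uc a) x" if "x \<in> V1" for i a x
    by (rule pd_cong_open[OF V1(1) that w_V1])
  have wed_w: "wed (w a) (w b) x = wed (uc a) (uc b) x" if "x \<in> V1" for a b x
    by (simp add: wed_def pd_w[OF that])
  have proj_w: "proj w x = \<Psi> x" if "x \<in> V1" for x
    using V1U that by (simp add: proj_def w_V1[OF that] \<Psi>_eq subset_iff)
  obtain B0 where B0: "\<And>a x. \<bar>w a x\<bar> \<le> B0"
    using finite_uniform_bound[of w] C1_compact_support_bounded[OF w1 K1(1) w0] by metis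
  have "\<exists>C. \<forall>x. \<bar>pd i (w a) x\<bar> \<le> C" for i a
    using C1_compact_support_bounded[OF w1 K1(1) w0] by metis
  then obtain B1 where B1: "\<And>z x. \<bar>(case z of (i, a) \<Rightarrow> pd i (w a)) x\<bar> \<le> B1"
    using finite_uniform_bound[of "\<lambda>z. case z of (i, a) \<Rightarrow> pd i (w a)"] by fastforce
  define B where "B = max B0 B1"
  have wB: "\<bar>w a x\<bar> \<le> B" "\<bar>pd i (w a) x\<bar> \<le> B" for a i x
    using B0[of a x] B1[of "(i, a)" x] by (simp_all add: B_def)
  have pdG0: "pd l (G i k) x = 0" if "x \<notin> K1" for l i k x
  proof -
    have "pd l (G i k) x = pd l (\<lambda>_. 0) x"
      by (rule pd_cong_open[of "- K1"]) (use that G0 K1(1) in \<open>auto simp: compact_imp_closed open_Compl\<close>)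
    then show ?thesis by simp
  qed
  have bd: "\<exists>C. \<forall>x. \<bar>pd m (pd l (G i k)) x\<bar> \<le> C" for m l i k
  proof -
    have "Ck_on 1 UNIV (pd l (G i k))" by (rule Ck_on_pd[OF Gk])
    then show ?thesis by (rule C1_compact_support_bounded[OF _ K1(1) pdG0]) blast+
  qed
  have "\<exists>C. \<forall>z x. \<bar>(case z of (m, l, i, k) \<Rightarrow> pd m (pd l (G i k))) x\<bar> \<le> C"
  proof (rule finite_uniform_bound)
    fix z :: "2 \<times> 2 \<times> 2 \<times> 2"
    show "\<exists>C. \<forall>x. \<bar>(case z of (m, l, i, k) \<Rightarrow> pd m (pd l (G i k))) x\<bar> \<le> C"
      using bd by (cases z) simp
  qed
  then obtain B2 where B2: "\<And>z x. \<bar>(case z of (m, l, i, k) \<Rightarrow> pd m (pd l (G i k))) x\<bar> \<le> B2"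
    by blast
  have GB: "\<bar>pd m (pd l (G i k)) x\<bar> \<le> B2" for m l i k x using B2[of "(m, l, i, k)" x] by simp
  have nzD: "wed (w 1) (w 2) x \<noteq> 0" if "x \<in> K2" for x
  proof -
    have "x \<in> V1" "x \<in> U" using that K2 K2U by auto
    then show ?thesis by (simp add: wed_w D_nz)
  qed
  obtain c ja where c: "c > 0" "\<And>j x. j \<ge> ja \<Longrightarrow> x \<in> K2 \<Longrightarrow> c \<le> \<bar>wed (reg (dyadic j) (w 1)) (reg (dyadic j) (w 2)) x\<bar>"
    "\<And>x. x \<in> K2 \<Longrightarrow> c \<le> \<bar>wed (w 1) (w 2) x\<bar>"
    using wed_reg_nondegenerate[OF w1 wB(2) K2(1) nzD] by blast
  have cw: "continuous_on UNIV (w a)" for a by (rule Ck_on_imp_continuous[OF w1])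
  have cproj: "continuous_on T (proj w)" for T
    unfolding proj_def[abs_def] by (intro continuous_on_vec2 continuous_on_subset[OF cw]) auto
  \<comment> \<open>Outside \<open>V3\<close> the projection stays at a distance of at least some
    \<open>d > 0\<close> from the support of \<open>\<phi>\<close>. Mollification moves it by less
    than \<open>d\<close>, so \<open>\<phi>\<close> composed with each mollified projection vanishes
    on \<open>V2 - K3\<close>.\<close>
  have "proj w ` (K2 - V3) \<inter> L = {}"
  proof -
    have "\<Psi> x \<notin> L" if "x \<in> K2 - V3" for x
    proof
      assume "\<Psi> x \<in> L"
      then have "\<Phi> (\<Psi> x) \<in> K0" by (simp add: K0_def)
      then show False using that V3(2) K2U by (auto simp: \<Phi>_\<Psi> subset_iff)
    qed
    then show ?thesis using K2(2) by (auto simp: proj_w subset_iff)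
  qed
  moreover have "compact (proj w ` (K2 - V3))"
    by (intro compact_continuous_image cproj compact_diff K2 V3)
  ultimately obtain d where d: "d > 0" "\<And>a b. a \<in> proj w ` (K2 - V3) \<Longrightarrow> b \<in> L \<Longrightarrow> d \<le> dist a b"
    using separate_compact_closed[of "proj w ` (K2 - V3)" L] compact_imp_closed[OF L(1)] by blast
  \<comment> \<open>Two coordinates, each off by at most \<open>d / 4\<close>, displace the
    projection by at most \<open>d / 2\<close>.\<close>
  have "\<exists>e>0. \<forall>t x. 0 < t \<and> t < e \<and> x \<in> K2 \<longrightarrow> \<bar>reg t (w a) x - w a x\<bar> \<le> d / 4" for a
    using d(1) by (intro reg_uniformly_close[OF cw K2(1)]) simp
  then obtain e where e: "\<And>a. e a > 0"
    "\<And>a t x. 0 < t \<Longrightarrow> t < e a \<Longrightarrow> x \<in> K2 \<Longrightarrow> \<bar>reg t (w a) x - w a x\<bar> \<le> d / 4"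
    by metis
  obtain jb where jb: "\<And>j. j \<ge> jb \<Longrightarrow> dyadic j < min (e 1) (e 2)"
    using eventually_dyadic_less[of "min (e 1) (e 2)"] e(1) by auto
  obtain jc where jc: "\<And>x y j. x \<in> K2 \<Longrightarrow> y \<in> (unit_cube :: (real^2) set) \<Longrightarrow> j \<ge> jc \<Longrightarrow> x - dyadic j *\<^sub>R y \<in> V1"
    using dyadic_shift_mem[OF K2(1) V1(1) K2(2)] by blast
  define j0 where "j0 = max ja (max jb jc)"
  interpret M: mollified_graph w V2 K3 c B j0
    by unfold_locales (use w1 wB V2 K3 c in \<open>auto simp: j0_def subset_iff\<close>)
  have near: "x - dyadic j *\<^sub>R y \<in> V1" if "j \<ge> j0" "x \<in> V2" "y \<in> unit_cube" for j x y
    using jc[of x y j] that V2(3) by (auto simp: j0_def)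
  have supp: "proj (M.u j) x \<notin> closure {y. \<phi> y \<noteq> 0}" if j: "j \<ge> j0" and x: "x \<in> V2 - K3" for j x
  proof
    assume "proj (M.u j) x \<in> closure {y. \<phi> y \<noteq> 0}"
    then have inL: "proj (M.u j) x \<in> L" by (simp add: L_def)
    have xK2: "x \<in> K2" "x \<in> K2 - V3" using x V2(3) V3(3) by auto
    have "\<bar>M.u j a x - w a x\<bar> \<le> d / 4" if "a = 1 \<or> a = 2" for a
      unfolding M.u_def using that j jb[of j] by (intro e(2) dyadic_pos xK2) (auto simp: j0_def)
    then have c12: "\<bar>M.u j 1 x - w 1 x\<bar> \<le> d / 4" "\<bar>M.u j 2 x - w 2 x\<bar> \<le> d / 4" by auto
    have "dist (proj w x) (proj (M.u j) x) \<le> (\<Sum>i\<in>UNIV. \<bar>(proj w x - proj (M.u j) x) $ i\<bar>)"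
      unfolding dist_norm by (rule norm_le_l1_cart)
    also have "\<dots> = \<bar>w 1 x - M.u j 1 x\<bar> + \<bar>w 2 x - M.u j 2 x\<bar>" by (simp add: sum_2 proj_def)
    finally have "dist (proj w x) (proj (M.u j) x) < d" using c12 d(1) by linarith
    moreover have "d \<le> dist (proj w x) (proj (M.u j) x)" using d(2)[OF _ inL] xK2(2) by blast
    ultimately show False by simp
  qed
  have gag_fin: "gagliardo_pow \<sigma> q V (pd i (w a)) < \<infinity>"
    if "in_W1sp \<sigma> q V u" "open V" "V \<subseteq> V1" "q \<ge> 1" for \<sigma> q V i a
  proof -
    have "V \<subseteq> U" using that V1U by blast
    have bd: "bounded V" using bounded_subset[OF compact_imp_bounded[OF K1(1)]] that V1(3) by blast
    have "gagliardo_pow \<sigma> q V (\<lambda>x. pd i (uc a) x) < \<infinity>"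
      unfolding uc_def[abs_def]
      by (rule in_W1sp_gagliardo_pd[OF that(1,2) bd Ck_on_subset[OF Ck_u \<open>V \<subseteq> U\<close>] that(4)])
    moreover have "gagliardo_pow \<sigma> q V (pd i (w a)) = gagliardo_pow \<sigma> q V (\<lambda>x. pd i (uc a) x)"
      by (rule gagliardo_pow_cong) (use that(3) in \<open>auto simp: pd_w\<close>)
    ultimately show ?thesis by simp
  qed
  have "in_W1sp s p V1 u"
    using reg V1(1) closure_subset_compact[OF V1(3) K1(1)] K1(2) unfolding in_W1sp_loc_def by blast
  then have fin: "gagliardo_pow s p V1 (pd i (w a)) < \<infinity>" for i a
    using p2 V1(1) by (intro gag_fin) auto
  obtain Bw where Bw: "\<And>N. (\<Sum>j\<in>{j0..<N}. (2 ^ j) powr (s * p) * (LINT x:K3|lborel. M.Osc p (dyadic j) x)) \<le> Bw"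
  proof (rule M.Osc_dyadic_bounded[of p s V1])
    show "x - dyadic j *\<^sub>R y \<in> V1" if "x \<in> K3" "y \<in> unit_cube" "j \<ge> j0" for x y j
      using near that K3(2) by blast
  qed (use p2 s V1(1) K3V1 fin in auto)
  have gag: "(\<lambda>j. (2 ^ j)\<^sup>2 * (LINT x:C|lborel. M.Osc 3 (dyadic j) x)) \<longlonglongrightarrow> 0" if C: "compact C" "C \<subseteq> K3 - S" for C
  proof -
    have "C \<subseteq> V1 - S" using C(2) K3V1 by blast
    then obtain V4 K4 where V4: "open V4" "C \<subseteq> V4" "V4 \<subseteq> K4" and K4: "compact K4" "K4 \<subseteq> V1 - S"
      using open_cutoff_region[OF C(1), of "V1 - S"] open_Diff[OF V1(1) compact_imp_closed[OF S(1)]] by blast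
    have "in_W1sp (2/3) 3 V4 u"
      using reg3 V4(1) closure_subset_compact[OF V4(3) K4(1)] K4(2) V1U unfolding in_W1sp_loc_def by blast
    then have fin3: "gagliardo_pow (2/3) 3 V4 (pd i (w a)) < \<infinity>" for i a
      using V4 K4 by (intro gag_fin) auto
    obtain jd where jd: "\<And>x y j. x \<in> C \<Longrightarrow> y \<in> (unit_cube :: (real^2) set) \<Longrightarrow> j \<ge> jd \<Longrightarrow> x - dyadic j *\<^sub>R y \<in> V4"
      using dyadic_shift_mem[OF C(1) V4(1,2)] by blast
    \<comment> \<open>The same mollified maps from a later scale on, at which the shifted points of
      \<open>C\<close> lie in \<open>V4\<close>; the later start does not affect the limit.\<close>
    interpret M4: mollified_graph w V2 C c B "max j0 jd"
      by unfold_locales (use M.w M.w_le M.pd_w_le M.W M.c M.nd_u M.nd_w C K3(2) in auto)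
    obtain B4 where B4: "\<And>N. (\<Sum>j\<in>{max j0 jd..<N}. (2 ^ j) powr (2/3 * 3) * (LINT x:C|lborel. M4.Osc 3 (dyadic j) x)) \<le> B4"
    proof (rule M4.Osc_dyadic_bounded[of 3 "2/3" V4])
      show "x - dyadic j *\<^sub>R y \<in> V4" if "x \<in> C" "y \<in> unit_cube" "j \<ge> max j0 jd" for x y j
        using jd that by auto
    qed (use V4 fin3 in auto)
    have pw: "(2 ^ j :: real) powr (2/3 * 3) = (2 ^ j)\<^sup>2" for j by simp
    have nn: "(LINT x:C|lborel. M.Osc 3 (dyadic j) x) \<ge> 0" for j
      unfolding set_lebesgue_integral_def by (intro integral_nonneg_AE AE_I2) (simp add: M.Osc_nonneg)
    show ?thesis
      by (rule tendsto_0_of_bounded_sums[of _ "max j0 jd" B4]) (use B4 nn in \<open>auto simp: pw\<close>)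
  qed
  have met_w: "met w i k x = G i k x" if "x \<in> V1" for x i k
    using that V1U met_uc[of x i k] by (auto simp: met_def pd_w G_V1)
  have main: "(LINT x:K3|lborel. hess_form \<phi> w x) = (LINT x:K3|lborel. \<phi> (proj w x) * gauss_density w G x)"
    by (rule M.hess_form_integral_eq[OF \<phi> supp p2 s Bw Gk GB near met_w S(1,3) gag])
  have slope_w: "slope w a b x = slope uc a b x" if "x \<in> V1" for a b x
    by (simp add: slope_def wed_w[OF that])
  have projs: "proj w x = proj uc x" if "x \<in> V1" for x by (simp add: proj_def w_V1[OF that])
  have h: "hess_form \<phi> w x = hess_form \<phi> uc x" if "x \<in> V1" for x
    unfolding hess_form_def slope_w[OF that] projs[OF that] wed_w[OF that] ..
  have gd: "gauss_density w G x = gauss_curvature g x * (1 + (norm (grad f (\<Psi> x)))\<^sup>2)\<^sup>2 * D x" if x: "x \<in> V1" for x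
  proof -
    have "christ G k i j x = christ gc k i j x" "pd m (christ G k i j) x = pd m (christ gc k i j) x" for k i j m
      by (rule christ_cong_open[of V1 x G gc, OF V1(1) x], simp add: G_V1)+
    then have "gauss_density w G x = gauss_density uc gc x"
      by (simp add: gauss_density_def wed_w[OF x] met_def pd_w[OF x])
    then show ?thesis using gauss_density_uc V1U x by auto
  qed
  show ?thesis
  proof (rule that)
    show "compact K3" "K3 \<subseteq> U" by (rule K3(1), rule K3U)
    show "\<Phi> ` closure {y. \<phi> y \<noteq> 0} \<subseteq> K3" using V3 unfolding K0_def L_def by blast
    have m: "K3 \<in> sets lborel" using borel_compact[OF K3(1)] by simp
    have "(LINT x:K3|lborel. hess_form \<phi> uc x) = (LINT x:K3|lborel. hess_form \<phi> w x)"
      by (rule set_lebesgue_integral_cong[OF m]) (use h K3V1 in auto)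
    also note main
    also have "(LINT x:K3|lborel. \<phi> (proj w x) * gauss_density w G x)
      = (LINT x:K3|lborel. \<phi> (\<Psi> x) * (gauss_curvature g x * (1 + (norm (grad f (\<Psi> x)))\<^sup>2)\<^sup>2 * D x))"
      by (rule set_lebesgue_integral_cong[OF m]) (use gd proj_w K3V1 in auto)
    finally show "(LINT x:K3|lborel. hess_form \<phi> uc x)
      = (LINT x:K3|lborel. \<phi> (\<Psi> x) * (gauss_curvature g x * (1 + (norm (grad f (\<Psi> x)))\<^sup>2)\<^sup>2 * D x))" .
  qed
qed

text \<open>Both distributions are pulled back to \<open>U\<close> by \<open>\<Psi>\<close>. The
  constant sign \<open>\<sigma>\<close> of the Jacobian comes out of both integrals, and what
  remains is the identity of integrals over \<open>K\<close>.\<close>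

theorem gauss_equation:
  fixes S :: "(real^2) set" and s p :: real
  assumes s: "1/2 < s" "s < 1" and p: "p \<ge> 2 / s" and reg: "in_W1sp_loc s p U u"
    and S: "compact S" "S \<subseteq> U" "Cap (2 * (1 - s)) (p / (p - 2)) S = 0"
    and reg3: "in_W1sp_loc (2/3) 3 (U - S) u"
  shows "distr_eq U' (Det_D2 U' f) (distr_of U' (\<lambda>y. gauss_curvature g (\<Phi> y) * (1 + (norm (grad f y))\<^sup>2)\<^sup>2))"
  unfolding distr_eq_def
proof
  fix \<phi> assume \<phi>: "\<phi> \<in> test_functions U'"
  let ?L = "closure {y. \<phi> y \<noteq> 0}"
  have L: "compact ?L" "?L \<subseteq> U'" by (rule test_functionsD(2,3)[OF \<phi>])+
  obtain K where K: "compact K" "\<Phi> ` ?L \<subseteq> K" "K \<subseteq> U"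
    and eq: "(LINT x:K|lborel. hess_form \<phi> uc x)
      = (LINT x:K|lborel. \<phi> (\<Psi> x) * (gauss_curvature g x * (1 + (norm (grad f (\<Psi> x)))\<^sup>2)\<^sup>2 * D x))"
    using hess_form_integral_pullback[OF s p reg S reg3 \<phi>] by blast
  obtain \<sigma> where \<sigma>: "\<And>x. x \<in> U \<Longrightarrow> \<bar>D x\<bar> = \<sigma> * D x"
    using continuous_nonzero_constant_sign[OF U(2) cont_D D_nz] by blast
  have m: "K \<in> sets lborel" using borel_compact[OF K(1)] by simp
  note chg = set_integral_C1_diffeo[OF \<Psi> L _ _ K]
  have sub: "(LINT x:K|lborel. F (\<Psi> x) * \<bar>wed (\<lambda>x. \<Psi> x $ 1) (\<lambda>x. \<Psi> x $ 2) x\<bar>) = \<sigma> * (LINT x:K|lborel. H x)"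
    if "\<And>x. x \<in> U \<Longrightarrow> H x = F (\<Psi> x) * D x" for F H
  proof -
    have "(LINT x:K|lborel. F (\<Psi> x) * \<bar>wed (\<lambda>x. \<Psi> x $ 1) (\<lambda>x. \<Psi> x $ 2) x\<bar>) = (LINT x:K|lborel. \<sigma> * H x)"
      by (rule set_lebesgue_integral_cong[OF m]) (use K(3) D_eq \<sigma> that in \<open>auto simp: subset_iff\<close>)
    then show ?thesis by simp
  qed
  have \<phi>2: "continuous_on T (pd i (pd k \<phi>))" for T i k
  proof -
    have "continuous_on UNIV (pd i (pd k \<phi>))" using test_functionsD(1)[OF \<phi>, of "Suc (Suc 0)"] by simp
    then show ?thesis by (rule continuous_on_subset) simp
  qed
  have \<phi>0: "\<phi> y = 0" "pd i (pd k \<phi>) y = 0" if "y \<in> U' - ?L" for y i k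
  proof -
    show "\<phi> y = 0" using that by (intro test_functionsD(4)[OF \<phi>]) simp
    have "pd i (pd k \<phi>) y = pd i (\<lambda>_. 0) y"
      by (rule pd_cong_open[of "- ?L"]) (use that test_functionsD(5)[OF \<phi>] in auto)
    then show "pd i (pd k \<phi>) y = 0" by simp
  qed
  \<comment> \<open>\<open>distr_pd 2 (distr_pd 1 T)\<close> evaluates \<open>T\<close> at
    \<open>pd 1 (pd 2 \<phi>)\<close>, the two signs cancelling; this fixes the order of the
    derivatives in \<open>F1\<close>.\<close>
  define F1 F2 F3 where "F1 y = pd 1 f y * pd 2 f y * pd 1 (pd 2 \<phi>) y"
    and "F2 y = (pd 1 f y)\<^sup>2 * pd 2 (pd 2 \<phi>) y" and "F3 y = (pd 2 f y)\<^sup>2 * pd 1 (pd 1 \<phi>) y" for y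
  define H where "H y = F1 y - 1/2 * F2 y - 1/2 * F3 y" for y
  define R where "R y = gauss_curvature g (\<Phi> y) * (1 + (norm (grad f y))\<^sup>2)\<^sup>2 * \<phi> y" for y
  have cF: "continuous_on U' F1" "continuous_on U' F2" "continuous_on U' F3"
    unfolding F1_def[abs_def] F2_def[abs_def] F3_def[abs_def]
    by (intro continuous_on_mult continuous_on_power cont_pd_f \<phi>2)+
  have cH: "continuous_on U' H" unfolding H_def[abs_def] by (intro continuous_intros cF)
  have F0: "F1 y = 0" "F2 y = 0" "F3 y = 0" "H y = 0" "R y = 0" if "y \<in> U' - ?L" for y
    using \<phi>0[OF that] by (simp_all add: F1_def F2_def F3_def H_def R_def)
  have cR: "continuous_on U' R"
  proof -
    have "continuous_on U' (\<lambda>y. gauss_curvature g (\<Phi> y))"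
      by (rule continuous_on_compose2[OF cont_gauss_curvature Ck_on_imp_continuous[OF Ck_\<Phi>]]) (auto simp: \<Phi>_mem)
    then show ?thesis
      unfolding R_def[abs_def] norm_grad_f
      by (intro continuous_on_mult continuous_on_power continuous_on_add continuous_on_const cont_pd_f
          Ck_on_imp_continuous[OF Ck_on_subset[OF test_functionsD(1)[OF \<phi>] subset_UNIV]])
  qed
  have i: "set_integrable lebesgue U' F1" "set_integrable lebesgue U' F2" "set_integrable lebesgue U' F3"
    by (rule chg(1)[OF cF(1) F0(1)], assumption, rule chg(1)[OF cF(2) F0(2)], assumption,
        rule chg(1)[OF cF(3) F0(3)], assumption)
  have chgH: "(LINT y:U'|lebesgue. H y) = (LINT x:K|lborel. H (\<Psi> x) * \<bar>wed (\<lambda>x. \<Psi> x $ 1) (\<lambda>x. \<Psi> x $ 2) x\<bar>)"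
    by (rule chg(2)[OF cH F0(4)])
  have chgR: "(LINT y:U'|lebesgue. R y) = (LINT x:K|lborel. R (\<Psi> x) * \<bar>wed (\<lambda>x. \<Psi> x $ 1) (\<lambda>x. \<Psi> x $ 2) x\<bar>)"
    by (rule chg(2)[OF cR F0(5)])
  have "Det_D2 U' f \<phi> = (LINT y:U'|lebesgue. F1 y) - 1/2 * (LINT y:U'|lebesgue. F2 y) - 1/2 * (LINT y:U'|lebesgue. F3 y)"
    by (simp add: Det_D2_def distr_pd_def distr_of_def F1_def F2_def F3_def)
  also have "\<dots> = (LINT y:U'|lebesgue. H y)"
    unfolding H_def using i by (simp add: set_integral_diff)
  also have "\<dots> = \<sigma> * (LINT x:K|lborel. hess_form \<phi> uc x)"
    unfolding chgH
  proof (rule sub[of "hess_form \<phi> uc" H])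
    fix x assume x: "x \<in> U"
    show "hess_form \<phi> uc x = H (\<Psi> x) * D x"
      unfolding hess_form_def slope_uc[OF x] proj_def \<Psi>_eq[OF x, symmetric] by (simp add: H_def F1_def F2_def F3_def mult_ac)
  qed
  also have "\<dots> = (LINT y:U'|lebesgue. R y)"
    unfolding eq chgR
    by (rule sub[symmetric]) (simp add: R_def \<Phi>_\<Psi> mult_ac)
  also have "\<dots> = distr_of U' (\<lambda>y. gauss_curvature g (\<Phi> y) * (1 + (norm (grad f y))\<^sup>2)\<^sup>2) \<phi>"
    by (simp add: distr_of_def R_def)
  finally show "Det_D2 U' f \<phi> = distr_of U' (\<lambda>y. gauss_curvature g (\<Phi> y) * (1 + (norm (grad f y))\<^sup>2)\<^sup>2) \<phi>" .
qed

end

theorem theorem1p5: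
  fixes U U' S :: "(real^2) set"
    and g :: "real^2 \<Rightarrow> real^2^2"
    and u :: "real^2 \<Rightarrow> real^3"
    and \<Psi> \<Phi> :: "real^2 \<Rightarrow> real^2"
    and v f :: "real^2 \<Rightarrow> real"
    and s p s0 p0 :: real
  assumes "open U" and "connected U" and "U \<noteq> {}"
    and "riemannian_metric_on U g"
    and "1/2 < s" and "s < 1" and "p \<ge> 2 / s"
    and "Ck_on 1 U u" and "in_W1sp_loc s p U u"
    and "isometric_embedding U g u"
    and "\<forall>x\<in>U. u x = vector [\<Psi> x $ 1, \<Psi> x $ 2, v x]"
    and "C1_diffeo U U' \<Psi> \<Phi>"
    and "\<forall>y\<in>U'. f y = v (\<Phi> y)"
    and "u ` U = graph_over U' f"
    and "s0 = 2 * (1 - s)" and "p0 = p / (p - 2)"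
    and "compact S" and "S \<subseteq> U" and "Cap s0 p0 S = 0"
    and "in_W1sp_loc (2/3) 3 (U - S) u"
  shows "distr_eq U' (Det_D2 U' f)
           (distr_of U' (\<lambda>y. gauss_curvature g (\<Phi> y) * (1 + (norm (grad f y))^2)^2))"
proof -
  interpret isometric_graph U U' g u \<Psi> \<Phi> v f
    by unfold_locales (use assms in auto)
  show ?thesis
    using assms by (intro gauss_equation[of s p S]) auto
qed

end
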